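(* For every integer $r\ge1$ and every positive integer $k$ with $r\le2k$, the coefficient of $z^r$ in $\sum_{r'>0}(\mathcal{M})(2k,r')\frac{(\mathfrak{i}z)^{r'}}{r'!}$ equals the coefficient of $z^r$ in $$\frac{G(k+1)^2}{G(2k+1)}\sum_\lambda\tilde s^{(2k)}_\lambda\,s_\lambda\left([1^k]\right)z^{|\lambda|},$$ the sum being over all partitions $\lambda$.
   Context: $\mathfrak{i}^2=-1$; $G$ is the Barnes $G$-function; $s_\lambda([1^k])$ is the Schur polynomial at $k$ variables equal to $1$. For an integer $m\ge0$, $\tilde h^{(R)}_m=\frac{(R-1)!}{(R+m-1)!\,m!}$, $\tilde h^{(R)}_m=0$ for $m<0$, and $\tilde s^{(R)}_\lambda=\left|\tilde h^{(R-j+1)}_{\lambda_i-i+j}\right|_{l(\lambda)\times l(\lambda)}$. For an $N\times N$ unitary $U$ with eigenvalues $e^{\mathfrak{i}\theta_j}$, $Z_U(\theta)=\prod_{j=1}^N(1-e^{\mathfrak{i}(\theta_j-\theta)})$; for $2k-r>-1$, $(\mathcal{M})_N(2k,r)=\int_{\mathrm{U}(N)}|Z_U(0)|^{2k}(Z_U'(0)/Z_U(0))^r dU$ (Haar probability) and $(\mathcal{M})(2k,r)=\lim_{N\to\infty}(\mathcal{M})_N(2k,r)/N^{k^2+r}$. *)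

theory Defs
  imports "HOL-Analysis.Analysis" "HOL-Computational_Algebra.Polynomial"
          "HOL-Computational_Algebra.Formal_Power_Series" "HOL-Library.FuncSet"
begin

section \<open>Square matrices of size N, represented as nat => nat => 'a (zero outside N x N)\<close>

definition mdet :: "nat \<Rightarrow> (nat \<Rightarrow> nat \<Rightarrow> 'a::comm_ring_1) \<Rightarrow> 'a" where
  "mdet N A = (\<Sum>p | p permutes {..<N}. of_int (sign p) * (\<Prod>i<N. A i (p i)))"

definition mmul :: "nat \<Rightarrow> (nat \<Rightarrow> nat \<Rightarrow> complex) \<Rightarrow> (nat \<Rightarrow> nat \<Rightarrow> complex) \<Rightarrow> (nat \<Rightarrow> nat \<Rightarrow> complex)" where
  "mmul N A B = (\<lambda>i j. if i < N \<and> j < N then (\<Sum>l<N. A i l * B l j) else 0)"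

definition unitary_group :: "nat \<Rightarrow> (nat \<Rightarrow> nat \<Rightarrow> complex) set" where
  "unitary_group N = {A. (\<forall>i j. (N \<le> i \<or> N \<le> j) \<longrightarrow> A i j = 0) \<and>
      (\<forall>i<N. \<forall>j<N. (\<Sum>l<N. cnj (A l i) * A l j) = (if i = j then 1 else 0))}"

definition haar :: "nat \<Rightarrow> (nat \<Rightarrow> nat \<Rightarrow> complex) measure" where
  "haar N = (THE M. space M = unitary_group N \<and>
      sets M = sets (restrict_space borel (unitary_group N)) \<and>
      emeasure M (space M) = 1 \<and>
      (\<forall>V\<in>unitary_group N. \<forall>A\<in>sets M. emeasure M (mmul N V ` A) = emeasure M A))"

definition charpoly :: "nat \<Rightarrow> (nat \<Rightarrow> nat \<Rightarrow> complex) \<Rightarrow> complex poly" where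
  "charpoly N U = mdet N (\<lambda>i j. if i = j then [:- U i j, 1:] else [:- U i j:])"

definition eigenvalues :: "nat \<Rightarrow> (nat \<Rightarrow> nat \<Rightarrow> complex) \<Rightarrow> complex multiset" where
  "eigenvalues N U = proots (charpoly N U)"

definition ZU :: "nat \<Rightarrow> (nat \<Rightarrow> nat \<Rightarrow> complex) \<Rightarrow> real \<Rightarrow> complex" where
  "ZU N U \<theta> = prod_mset (image_mset (\<lambda>e. 1 - e * exp (- \<i> * complex_of_real \<theta>)) (eigenvalues N U))"

definition MN :: "nat \<Rightarrow> nat \<Rightarrow> nat \<Rightarrow> complex" where
  "MN N k r = integral\<^sup>L (haar N)
      (\<lambda>U. complex_of_real (cmod (ZU N U 0) ^ (2 * k)) *
           (vector_derivative (ZU N U) (at 0) / ZU N U 0) ^ r)"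

definition Mlim :: "nat \<Rightarrow> nat \<Rightarrow> complex" where
  "Mlim k r = lim (\<lambda>N. MN N k r / of_nat N ^ (k^2 + r))"

definition partitions :: "nat \<Rightarrow> nat list set" where
  "partitions n = {lam. sorted_wrt (\<ge>) lam \<and> (\<forall>x\<in>set lam. 0 < x) \<and> sum_list lam = n}"

definition young_cells :: "nat list \<Rightarrow> (nat \<times> nat) set" where
  "young_cells lam = {(i, j). i < length lam \<and> j < lam ! i}"

definition ssyt :: "nat list \<Rightarrow> nat \<Rightarrow> ((nat \<times> nat) \<Rightarrow> nat) set" where
  "ssyt lam k = {T \<in> young_cells lam \<rightarrow>\<^sub>E {..<k}.
      (\<forall>i j. (i, Suc j) \<in> young_cells lam \<longrightarrow> T (i, j) \<le> T (i, Suc j)) \<and>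
      (\<forall>i j. (Suc i, j) \<in> young_cells lam \<longrightarrow> T (i, j) < T (Suc i, j))}"

definition schur :: "nat list \<Rightarrow> nat \<Rightarrow> (nat \<Rightarrow> complex) \<Rightarrow> complex" where
  "schur lam k x = (\<Sum>T\<in>ssyt lam k. \<Prod>c\<in>young_cells lam. x (T c))"

text \<open>tilde h^{(R)}_m (used only for R >= 1)\<close>
definition htil :: "int \<Rightarrow> int \<Rightarrow> complex" where
  "htil R m = (if m < 0 then 0 else
      fact (nat (R - 1)) / (fact (nat (R + m - 1)) * fact (nat m)))"

text \<open>tilde s^{(R)}_lam = det [htil^{(R-j+1)}_{lam_i - i + j}], 1-based i,j; here 0-based.\<close>
definition stil :: "int \<Rightarrow> nat list \<Rightarrow> complex" where
  "stil R lam = mdet (length lam)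
      (\<lambda>i j. htil (R - int j) (int (lam ! i) - int i + int j))"

text \<open>Barnes G-function at positive integers: G(1) = 1, G(n+1) = (n-1)! G(n),
  i.e. G(n) = prod_{j=0}^{n-2} j!.\<close>
definition barnesG :: "nat \<Rightarrow> complex" where
  "barnesG n = (\<Prod>j<n - 1. fact j)"

end

theory Submission
  imports Defs "Jordan_Normal_Form.Char_Poly"
begin

text \<open>
  Up to elementary factors, the moments are read off at \<open>x = (-1, \<dots>, -1)\<close> from the generating
  function \<open>F(x) = E[cnj (det U) ^ k \<Prod>\<^sub>j det (1 + x\<^sub>j U)]\<close> in \<open>2k\<close> variables. Replacing \<open>U\<close> by
  \<open>(1 + w v v\<^sup>*) U\<close> does not change the integral, and the terms of second order in \<open>w\<close>, averaged
  over \<open>v\<close>, give a second order differential equation for \<open>F\<close>. It says that all exponents \<open>q\<close>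
  occurring in the product of \<open>F\<close> with the Vandermonde determinant have the same sum and the same
  sum of squares. The exponents \<open>0, \<dots>, k - 1, N + k, \<dots>, N + 2k - 1\<close> of the top term are the
  only ones attaining this (maximal) sum of squares, so the product is a single alternant and \<open>F\<close> is a Schur
  function of rectangular shape, for which the Jacobi-Trudi identity gives a \<open>k\<close> by \<open>k\<close>
  determinant. Its derivatives at the point above are binomial determinants, whose limits for
  \<open>N \<rightarrow> \<infinity>\<close> are sums over compositions. On the other side, the Schur functions at
  \<open>[1\<^sup>k]\<close> and the modified Schur functions are determinants in the shifted parts
  \<open>\<lambda>\<^sub>i + k - i\<close>; expanding both and dropping the ordering of the parts yields the same sum.
\<close>

text \<open>On the unitary group \<open>cnj (det (1 - U))\<close> equals
  \<open>cnj (det U) * det (1 - U)\<close> up to sign. Hence the integrand becomes, up to a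
  constant, \<open>cnj (det U) ^ k\<close> times a product of \<open>r\<close> derivatives and
  \<open>2k - r\<close> values of \<open>det (1 + xU)\<close> at \<open>x = -1\<close>; this is why
  there are \<open>2k\<close> variables, and r \<le> 2k keeps the exponents nonnegative. Eigenvalue
  densities never enter. The equation for F closes because the trace of a product of two resolvents
  reduces to single traces; multiplying by the Vandermonde determinant then absorbs the singular
  first order terms and leaves an operator that is diagonal on monomials. \<open>haar\<close> is a
  definite description, so existence and uniqueness of the invariant measure have to be proved
  before any integral can be evaluated. The obstacle in the limit is cancellation: single terms of
  the binomial determinants have order \<open>N ^ (2k^2 - k + r)\<close>, their sum only
  \<open>N ^ (k^2 + r)\<close>. The cancellation is therefore carried out exactly at finite
  \<open>N\<close>, by symmetrising over the rows and trading shifts of the upper binomial index for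
  shifts of the lower one.\<close>

definition uid :: "nat \<Rightarrow> nat \<Rightarrow> nat \<Rightarrow> complex" where
  "uid N = (\<lambda>i j. if i < N \<and> j < N \<and> i = j then 1 else 0)"

definition uadj :: "nat \<Rightarrow> (nat \<Rightarrow> nat \<Rightarrow> complex) \<Rightarrow> nat \<Rightarrow> nat \<Rightarrow> complex" where
  "uadj N A = (\<lambda>i j. if i < N \<and> j < N then cnj (A j i) else 0)"

text \<open>Passes from matrices given as functions to the type \<open>'a mat\<close>, where
  determinants of products and of block matrices are available.\<close>

definition fmat :: "nat \<Rightarrow> (nat \<Rightarrow> nat \<Rightarrow> 'a) \<Rightarrow> 'a mat" where
  "fmat N A = mat N N (\<lambda>(i, j). A i j)"

lemma fmat_carrier [simp]: "fmat N A \<in> carrier_mat N N"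
  by (simp add: fmat_def)

lemma dim_fmat [simp]: "dim_row (fmat N A) = N" "dim_col (fmat N A) = N"
  by (simp_all add: fmat_def)

lemma fmat_index [simp]: "i < N \<Longrightarrow> j < N \<Longrightarrow> fmat N A $$ (i, j) = A i j"
  by (simp add: fmat_def)

lemma fmat_mmul: "fmat N (mmul N A B) = fmat N A * fmat N B"
  by (rule eq_matI) (auto simp: mmul_def scalar_prod_def atLeast0LessThan)

lemma fmat_uid: "fmat N (uid N) = 1\<^sub>m N"
  by (rule eq_matI) (auto simp: uid_def)

lemma mdet_eq_det: "mdet N A = Determinant.det (fmat N A)"
proof -
  have "(\<Prod>i<N. A i (p i)) = (\<Prod>i<N. fmat N A $$ (i, p i))" if "p permutes {..<N}" for p
    using that by (intro prod.cong) (auto simp: permutes_in_image[of p "{..<N}", unfolded lessThan_iff])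
  then show ?thesis
    unfolding mdet_def Determinant.det_def by (auto simp: atLeast0LessThan intro!: sum.cong)
qed

lemma fun_eq_fmatI:
  assumes "\<And>i j. N \<le> i \<or> N \<le> j \<Longrightarrow> A i j = 0" "\<And>i j. N \<le> i \<or> N \<le> j \<Longrightarrow> B i j = 0"
    and "fmat N A = fmat N B"
  shows "A = B"
proof (intro ext)
  fix i j
  show "A i j = B i j"
  proof (cases "i < N \<and> j < N")
    case True
    then have "fmat N A $$ (i,j) = fmat N B $$ (i,j)" using assms(3) by simp
    with True show ?thesis by simp
  next
    case False
    then show ?thesis using assms(1,2)[of i j] by (auto simp: not_less)
  qed
qed

section \<open>Matrix algebra of the unitary group\<close>

lemma unitary_group_iff:
  "A \<in> unitary_group N \<longleftrightarrow> (\<forall>i j. (N \<le> i \<or> N \<le> j) \<longrightarrow> A i j = 0) \<and> mmul N (uadj N A) A = uid N"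
proof -
  have "mmul N (uadj N A) A = uid N \<longleftrightarrow>
     (\<forall>i<N. \<forall>j<N. (\<Sum>l<N. cnj (A l i) * A l j) = (if i = j then 1 else 0))"
    (is "?a \<longleftrightarrow> ?b")
  proof
    assume a: ?a
    show ?b
    proof (intro allI impI)
      fix i j assume "i < N" "j < N"
      with fun_cong[OF fun_cong[OF a, of i], of j]
      show "(\<Sum>l<N. cnj (A l i) * A l j) = (if i = j then 1 else 0)"
        by (simp add: mmul_def uadj_def uid_def)
    qed
  next
    assume ?b
    then show ?a by (auto simp: mmul_def uadj_def uid_def fun_eq_iff)
  qed
  then show ?thesis by (auto simp: unitary_group_def)
qed

lemma unitary_group_zero: "A \<in> unitary_group N \<Longrightarrow> N \<le> i \<or> N \<le> j \<Longrightarrow> A i j = 0"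
  unfolding unitary_group_iff by blast

lemma mmul_uadj_left: "A \<in> unitary_group N \<Longrightarrow> mmul N (uadj N A) A = uid N"
  by (simp add: unitary_group_iff)

text \<open>\<open>unitary_group\<close> only speaks of orthonormal columns. A left inverse of a
  square matrix is also a right inverse, which gives orthonormal rows and thereby inverses inside
  the group.\<close>

lemma mmul_uadj_right:
  assumes "A \<in> unitary_group N"
  shows "mmul N A (uadj N A) = uid N"
proof (rule fun_eq_fmatI[of N])
  have "fmat N (uadj N A) * fmat N A = 1\<^sub>m N"
    using mmul_uadj_left[OF assms] fmat_mmul fmat_uid by metis
  then have "fmat N A * fmat N (uadj N A) = 1\<^sub>m N"
    by (rule mat_mult_left_right_inverse[rotated 2]) auto
  then show "fmat N (mmul N A (uadj N A)) = fmat N (uid N)"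
    by (simp add: fmat_mmul fmat_uid)
qed (auto simp: mmul_def uid_def)

lemma mmul_assoc: "mmul N (mmul N A B) C = mmul N A (mmul N B C)"
proof (rule fun_eq_fmatI[of N])
  show "fmat N (mmul N (mmul N A B) C) = fmat N (mmul N A (mmul N B C))"
    unfolding fmat_mmul by (rule assoc_mult_mat) auto
qed (auto simp: mmul_def)

lemma mmul_uid_left:
  assumes "\<And>i j. N \<le> i \<or> N \<le> j \<Longrightarrow> A i j = 0"
  shows "mmul N (uid N) A = A"
proof (rule fun_eq_fmatI[of N])
  show "fmat N (mmul N (uid N) A) = fmat N A"
    unfolding fmat_mmul fmat_uid by simp
qed (use assms in \<open>auto simp: mmul_def\<close>)

lemma uadj_uadj: "(\<And>i j. N \<le> i \<or> N \<le> j \<Longrightarrow> A i j = 0) \<Longrightarrow> uadj N (uadj N A) = A"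
  by (intro ext) (simp add: uadj_def not_less)

lemma mmul_uid_left_unitary: "U \<in> unitary_group N \<Longrightarrow> mmul N (uid N) U = U"
  by (rule mmul_uid_left) (rule unitary_group_zero)

lemma uadj_uadj_unitary: "U \<in> unitary_group N \<Longrightarrow> uadj N (uadj N U) = U"
  by (rule uadj_uadj) (rule unitary_group_zero)

lemma uadj_mmul: "uadj N (mmul N A B) = mmul N (uadj N B) (uadj N A)"
  unfolding uadj_def mmul_def by (intro ext) (auto intro!: sum.cong)

lemma uadj_unitary: "A \<in> unitary_group N \<Longrightarrow> uadj N A \<in> unitary_group N"
  unfolding unitary_group_iff[of "uadj N A"] uadj_uadj_unitary
  by (simp add: mmul_uadj_right) (simp add: uadj_def)

lemma uid_unitary: "uid N \<in> unitary_group N"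
proof -
  have "mmul N (uadj N (uid N)) (uid N) = uid N"
  proof (rule fun_eq_fmatI[of N])
    have "uadj N (uid N) = uid N" by (intro ext) (simp add: uadj_def uid_def)
    then show "fmat N (mmul N (uadj N (uid N)) (uid N)) = fmat N (uid N)"
      by (simp add: fmat_mmul fmat_uid)
  qed (auto simp: mmul_def uid_def)
  then show ?thesis by (auto simp: unitary_group_iff uid_def)
qed

lemma mmul_unitary:
  assumes "A \<in> unitary_group N" "B \<in> unitary_group N"
  shows "mmul N A B \<in> unitary_group N"
proof -
  have "mmul N (uadj N (mmul N A B)) (mmul N A B) = mmul N (uadj N B) (mmul N (mmul N (uadj N A) A) B)"
    by (simp add: uadj_mmul mmul_assoc)
  also have "\<dots> = uid N"
    unfolding mmul_uadj_left[OF assms(1)] mmul_uid_left_unitary[OF assms(2)]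
    by (rule mmul_uadj_left[OF assms(2)])
  finally show ?thesis by (auto simp: unitary_group_iff mmul_def)
qed

lemma mmul_uadj_cancel:
  assumes "V \<in> unitary_group N" "U \<in> unitary_group N"
  shows "mmul N (uadj N V) (mmul N V U) = U" "mmul N V (mmul N (uadj N V) U) = U"
  unfolding mmul_assoc[symmetric] mmul_uadj_left[OF assms(1)] mmul_uadj_right[OF assms(1)]
  by (rule mmul_uid_left_unitary[OF assms(2)])+

lemma mmul_image_iff:
  assumes "V \<in> unitary_group N" "A \<subseteq> unitary_group N" "U \<in> unitary_group N"
  shows "U \<in> mmul N V ` A \<longleftrightarrow> mmul N (uadj N V) U \<in> A"
proof
  assume "U \<in> mmul N V ` A"
  then show "mmul N (uadj N V) U \<in> A" using assms mmul_uadj_cancel(1)[OF assms(1)] by auto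
next
  assume "mmul N (uadj N V) U \<in> A"
  then show "U \<in> mmul N V ` A" using mmul_uadj_cancel(2)[OF assms(1,3)] by (metis image_eqI)
qed

lemma mmul_image_subset:
  assumes "V \<in> unitary_group N" "A \<subseteq> unitary_group N"
  shows "mmul N V ` A \<subseteq> unitary_group N"
  using mmul_unitary[OF assms(1)] assms(2) by auto

lemma unitary_entry_le:
  assumes "U \<in> unitary_group N"
  shows "cmod (U i j) \<le> 1"
proof (cases "i < N \<and> j < N")
  case True
  with assms have "(\<Sum>l<N. cnj (U l j) * U l j) = 1" by (auto simp: unitary_group_def)
  then have "(\<Sum>l<N. complex_of_real ((cmod (U l j))\<^sup>2)) = 1"
    by (simp only: complex_norm_square mult.commute)
  then have "(\<Sum>l<N. (cmod (U l j))\<^sup>2) = 1"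
    by (metis of_real_eq_1_iff of_real_sum)
  moreover have "(cmod (U i j))\<^sup>2 \<le> (\<Sum>l<N. (cmod (U l j))\<^sup>2)"
    using True by (intro member_le_sum) auto
  ultimately show ?thesis by (simp add: abs_square_le_1 power_le_one_iff)
next
  case False
  then show ?thesis using unitary_group_zero[OF assms, of i j] by (auto simp: not_less)
qed

subsection \<open>Uniqueness of the invariant measure\<close>

abbreviation uborel :: "nat \<Rightarrow> (nat \<Rightarrow> nat \<Rightarrow> complex) measure" where
  "uborel N \<equiv> restrict_space borel (unitary_group N)"

lemma space_uborel [simp]: "space (uborel N) = unitary_group N"
  by (simp add: space_restrict_space)

text \<open>The Borel sets of a countable product are generated by the coordinates, so measurability
  can be checked entry by entry.\<close>

lemma measurable_uborelI:
  assumes "\<And>i j. (\<lambda>x. f x i j) \<in> borel_measurable M"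
    and "\<And>x. x \<in> space M \<Longrightarrow> f x \<in> unitary_group N"
  shows "f \<in> measurable M (uborel N)"
proof (rule measurable_restrict_space2)
  show "f \<in> borel_measurable M"
    by (intro measurable_coordinatewise_then_product assms(1))
qed (use assms(2) in auto)

lemma measurable_entry [measurable]: "(\<lambda>x::nat\<Rightarrow>nat\<Rightarrow>complex. x i j) \<in> borel_measurable borel"
proof -
  have "continuous_on UNIV (\<lambda>x::nat\<Rightarrow>nat\<Rightarrow>complex. x i j)"
    by (rule continuous_on_product_then_coordinatewise[OF continuous_on_product_then_coordinatewise[OF continuous_on_id]])
  then show ?thesis by (rule borel_measurable_continuous_onI)
qed

lemma measurable_uborel_entry: "(\<lambda>x. x i j) \<in> borel_measurable (uborel N)"
  by (rule measurable_restrict_space1) simp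

lemma measurable_mmul:
  assumes f: "f \<in> measurable M (uborel N)" and g: "g \<in> measurable M (uborel N)"
  shows "(\<lambda>x. mmul N (f x) (g x)) \<in> measurable M (uborel N)"
proof (rule measurable_uborelI)
  have [measurable]: "(\<lambda>x. f x i j) \<in> borel_measurable M" "(\<lambda>x. g x i j) \<in> borel_measurable M" for i j
    using measurable_compose[OF f measurable_uborel_entry] measurable_compose[OF g measurable_uborel_entry] by auto
  show "(\<lambda>x. mmul N (f x) (g x) i j) \<in> borel_measurable M" for i j
    by (cases "i < N \<and> j < N") (simp_all add: mmul_def)
  show "mmul N (f x) (g x) \<in> unitary_group N" if "x \<in> space M" for x
    using measurable_space[OF f that] measurable_space[OF g that] by (simp add: mmul_unitary)
qed

lemma measurable_uadj:
  assumes f: "f \<in> measurable M (uborel N)"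
  shows "(\<lambda>x. uadj N (f x)) \<in> measurable M (uborel N)"
proof (rule measurable_uborelI)
  have [measurable]: "(\<lambda>x. f x i j) \<in> borel_measurable M" for i j
    using measurable_compose[OF f measurable_uborel_entry] by auto
  show "(\<lambda>x. uadj N (f x) i j) \<in> borel_measurable M" for i j
  proof (cases "i < N \<and> j < N")
    case True
    have "(\<lambda>x. cnj (f x j i)) \<in> borel_measurable M"
      by (rule measurable_compose[of _ _ borel, OF _ borel_measurable_continuous_onI])
        (auto intro!: continuous_intros)
    with True show ?thesis by (simp add: uadj_def)
  qed (auto simp: uadj_def)
  show "uadj N (f x) \<in> unitary_group N" if "x \<in> space M" for x
    using measurable_space[OF f that] by (simp add: uadj_unitary)
qed

text \<open>The condition under the \<open>THE\<close> in \<open>haar\<close>, named so that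
  existence and uniqueness can be stated separately.\<close>

definition is_haar :: "nat \<Rightarrow> (nat \<Rightarrow> nat \<Rightarrow> complex) measure \<Rightarrow> bool" where
  "is_haar N M \<longleftrightarrow> space M = unitary_group N \<and>
      sets M = sets (restrict_space borel (unitary_group N)) \<and>
      emeasure M (space M) = 1 \<and>
      (\<forall>V\<in>unitary_group N. \<forall>A\<in>sets M. emeasure M (mmul N V ` A) = emeasure M A)"

text \<open>The double integral of the indicator of \<open>A\<close> at \<open>x^-1 y\<close>, with
  \<open>x\<close> distributed by \<open>M'\<close> and \<open>y\<close> by \<open>M\<close>, is
  computed in both orders. For fixed \<open>x\<close> left invariance of \<open>M\<close> gives
  \<open>M A\<close>; for fixed \<open>y\<close> left invariance of \<open>M'\<close> gives the
  \<open>M'\<close>-measure of the inverses of \<open>A\<close>.\<close>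

lemma is_haar_inverse:
  assumes M: "is_haar N M" and M': "is_haar N M'" and A: "A \<in> sets (uborel N)"
  shows "emeasure M A = emeasure M' {U \<in> unitary_group N. uadj N U \<in> A}"
proof -
  have [simp]: "space M = unitary_group N" "space M' = unitary_group N"
    and sets [measurable_cong]: "sets M = sets (uborel N)" "sets M' = sets (uborel N)"
    using M M' by (auto simp: is_haar_def)
  interpret M: finite_measure M using M by (intro finite_measureI) (auto simp: is_haar_def)
  interpret M': finite_measure M' using M' by (intro finite_measureI) (auto simp: is_haar_def)
  interpret P: pair_sigma_finite M' M ..
  note A[measurable]
  have [measurable]: "(\<lambda>p. mmul N (uadj N (fst p)) (snd p)) \<in> measurable (M' \<Otimes>\<^sub>M M) (uborel N)"
    by (intro measurable_mmul measurable_uadj) measurable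
  have As: "A \<subseteq> unitary_group N" using sets.sets_into_space[OF A] by simp
  define B where "B = {U \<in> unitary_group N. uadj N U \<in> A}"
  have "B = (\<lambda>U. uadj N U) -` A \<inter> space (uborel N)" by (auto simp: B_def)
  then have B: "B \<in> sets (uborel N)"
    using measurable_sets[OF measurable_uadj[OF measurable_ident] A] by simp
  have Bs: "B \<subseteq> unitary_group N" by (auto simp: B_def)
  have inner1: "(\<integral>\<^sup>+ y. indicator A (mmul N (uadj N x) y) \<partial>M) = emeasure M A" if x: "x \<in> unitary_group N" for x
  proof -
    have "(\<integral>\<^sup>+ y. indicator A (mmul N (uadj N x) y) \<partial>M) = (\<integral>\<^sup>+ y. indicator (mmul N x ` A) y \<partial>M)"
      using mmul_image_iff[OF x As] by (intro nn_integral_cong) (auto simp: indicator_def)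
    also have "\<dots> = emeasure M (mmul N x ` A)"
    proof (rule nn_integral_indicator)
      \<comment> \<open>Invariance is formulated with images; written as a preimage under the
        inverse translation, the image is seen to be measurable.\<close>
      have "mmul N x ` A = (\<lambda>y. mmul N (uadj N x) y) -` A \<inter> space M"
        using mmul_image_iff[OF x As] mmul_image_subset[OF x As] by auto
      moreover have "(\<lambda>y. mmul N (uadj N x) y) \<in> measurable M (uborel N)"
        using x uadj_unitary[OF x] by (intro measurable_mmul) (auto simp: sets)
      ultimately show "mmul N x ` A \<in> sets M" using measurable_sets A by metis
    qed
    also have "\<dots> = emeasure M A" using M x A sets by (auto simp: is_haar_def)
    finally show ?thesis .
  qed
  have inner2: "(\<integral>\<^sup>+ x. indicator A (mmul N (uadj N x) y) \<partial>M') = emeasure M' B" if y: "y \<in> unitary_group N" for y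
  proof -
    have "(\<integral>\<^sup>+ x. indicator A (mmul N (uadj N x) y) \<partial>M') = (\<integral>\<^sup>+ x. indicator (mmul N y ` B) x \<partial>M')"
    proof (intro nn_integral_cong)
      fix x assume "x \<in> space M'"
      then have x: "x \<in> unitary_group N" by simp
      have "uadj N (mmul N (uadj N y) x) = mmul N (uadj N x) y"
        unfolding uadj_mmul uadj_uadj_unitary[OF y] ..
      moreover have "mmul N (uadj N y) x \<in> unitary_group N" by (intro mmul_unitary uadj_unitary x y)
      ultimately have "mmul N (uadj N y) x \<in> B \<longleftrightarrow> mmul N (uadj N x) y \<in> A" by (auto simp: B_def)
      then show "indicator A (mmul N (uadj N x) y) = (indicator (mmul N y ` B) x :: ennreal)"
        using mmul_image_iff[OF y Bs x] by (auto simp: indicator_def)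
    qed
    also have "\<dots> = emeasure M' (mmul N y ` B)"
    proof (rule nn_integral_indicator)
      have "mmul N y ` B = (\<lambda>x. mmul N (uadj N y) x) -` B \<inter> space M'"
        using mmul_image_iff[OF y Bs] mmul_image_subset[OF y Bs] by auto
      moreover have "(\<lambda>x. mmul N (uadj N y) x) \<in> measurable M' (uborel N)"
        using y uadj_unitary[OF y] by (intro measurable_mmul) (auto simp: sets)
      ultimately show "mmul N y ` B \<in> sets M'" using measurable_sets B by metis
    qed
    also have "\<dots> = emeasure M' B" using M' y B sets by (auto simp: is_haar_def)
    finally show ?thesis .
  qed
  have "emeasure M A = (\<integral>\<^sup>+ x. emeasure M A \<partial>M')"
    using M' by (simp add: is_haar_def)
  also have "\<dots> = (\<integral>\<^sup>+ x. \<integral>\<^sup>+ y. indicator A (mmul N (uadj N x) y) \<partial>M \<partial>M')"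
    by (intro nn_integral_cong) (simp add: inner1)
  also have "\<dots> = (\<integral>\<^sup>+ y. \<integral>\<^sup>+ x. indicator A (mmul N (uadj N x) y) \<partial>M' \<partial>M)"
    by (rule P.Fubini'[symmetric]) (simp add: split_beta)
  also have "\<dots> = (\<integral>\<^sup>+ y. emeasure M' B \<partial>M)"
    by (intro nn_integral_cong) (simp add: inner2)
  also have "\<dots> = emeasure M' B" using M by (simp add: is_haar_def)
  finally show ?thesis by (simp add: B_def)
qed

text \<open>\<open>is_haar_inverse\<close> for the pairs \<open>(M, M')\<close> and
  \<open>(M', M')\<close> has the same right-hand side.\<close>

lemma is_haar_unique:
  assumes "is_haar N M" "is_haar N M'"
  shows "M = M'"
proof (rule measure_eqI)
  show "sets M = sets M'" using assms by (auto simp: is_haar_def)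
  fix A assume "A \<in> sets M"
  then have A: "A \<in> sets (uborel N)" using assms by (auto simp: is_haar_def)
  show "emeasure M A = emeasure M' A"
    using is_haar_inverse[OF assms A] is_haar_inverse[OF assms(2) assms(2) A] by simp
qed

subsection \<open>Existence of the invariant measure\<close>

definition entries :: "nat \<Rightarrow> (nat \<times> nat) set" where
  "entries N = {..<N} \<times> {..<N}"

text \<open>Lebesgue measure on \<open>N\<close> by \<open>N\<close> complex matrices, as a product
  over the index pairs. Translation invariance is inherited factor by factor; invariance under left
  multiplication by a unitary matrix mixes the factors and needs an argument of its own.\<close>

abbreviation mleb :: "nat \<Rightarrow> (nat \<times> nat \<Rightarrow> complex) measure" where
  "mleb N \<equiv> Pi\<^sub>M (entries N) (\<lambda>_. lborel)"

definition mshift :: "nat \<Rightarrow> (nat \<times> nat \<Rightarrow> complex) \<Rightarrow> (nat \<times> nat \<Rightarrow> complex) \<Rightarrow> nat \<times> nat \<Rightarrow> complex" where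
  "mshift N c x = (\<lambda>p\<in>entries N. x p + c p)"

definition mact :: "nat \<Rightarrow> (nat \<Rightarrow> nat \<Rightarrow> complex) \<Rightarrow> (nat \<times> nat \<Rightarrow> complex) \<Rightarrow> nat \<times> nat \<Rightarrow> complex" where
  "mact N V x = (\<lambda>p\<in>entries N. \<Sum>l<N. V (fst p) l * x (l, snd p))"

definition mnorm2 :: "nat \<Rightarrow> (nat \<times> nat \<Rightarrow> complex) \<Rightarrow> real" where
  "mnorm2 N x = (\<Sum>j<N. \<Sum>i<N. (cmod (x (i, j)))\<^sup>2)"

lemma finite_entries [simp]: "finite (entries N)"
  by (simp add: entries_def)

lemma entries_iff [simp]: "(i, j) \<in> entries N \<longleftrightarrow> i < N \<and> j < N"
  by (simp add: entries_def)

interpretation mleb: product_sigma_finite "\<lambda>_. lborel :: complex measure"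
  by standard

lemma sigma_finite_mleb: "sigma_finite_measure (mleb N)"
  by (rule mleb.sigma_finite) simp

lemma space_mleb: "space (mleb N) = extensional (entries N)"
  by (auto simp: space_PiM PiE_def)

lemma measurable_mleb_entry: "i < N \<Longrightarrow> j < N \<Longrightarrow> (\<lambda>x. x (i, j)) \<in> borel_measurable (mleb N)"
  using measurable_component_singleton[of "(i,j)" "entries N" "\<lambda>_. lborel"] by simp

lemma measurable_mlebI:
  assumes "\<And>i j. i < N \<Longrightarrow> j < N \<Longrightarrow> (\<lambda>x. f x (i, j)) \<in> borel_measurable M"
    and "\<And>x. x \<in> space M \<Longrightarrow> f x \<in> extensional (entries N)"
  shows "f \<in> measurable M (mleb N)"
proof (rule measurable_PiM_single')
  show "(\<lambda>x. f x p) \<in> measurable M lborel" if "p \<in> entries N" for p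
    using assms(1)[of "fst p" "snd p"] that by (cases p) simp
  show "f \<in> space M \<rightarrow> (\<Pi>\<^sub>E i\<in>entries N. space lborel)"
    using assms(2) by (auto simp: PiE_def)
qed

lemma measurable_mshift:
  assumes f: "f \<in> measurable M (mleb N)" and g: "g \<in> measurable M (mleb N)"
  shows "(\<lambda>x. mshift N (f x) (g x)) \<in> measurable M (mleb N)"
proof (rule measurable_mlebI)
  fix i j assume ij: "i < N" "j < N"
  have [measurable]: "(\<lambda>x. f x (i, j)) \<in> borel_measurable M" "(\<lambda>x. g x (i, j)) \<in> borel_measurable M"
    using measurable_compose[OF f measurable_mleb_entry[OF ij]] measurable_compose[OF g measurable_mleb_entry[OF ij]] by auto
  show "(\<lambda>x. mshift N (f x) (g x) (i, j)) \<in> borel_measurable M"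
    using ij by (simp add: mshift_def)
qed (auto simp: mshift_def)

lemma measurable_mact:
  assumes f: "f \<in> measurable M (mleb N)"
  shows "(\<lambda>x. mact N V (f x)) \<in> measurable M (mleb N)"
proof (rule measurable_mlebI)
  fix i j assume ij: "i < N" "j < N"
  have [measurable]: "(\<lambda>x. f x (i, j)) \<in> borel_measurable M" if "i < N" for i
    using measurable_compose[OF f measurable_mleb_entry[OF that ij(2)]] by auto
  show "(\<lambda>x. mact N V (f x) (i, j)) \<in> borel_measurable M"
    using ij by (simp add: mact_def)
qed (auto simp: mact_def)

lemma measurable_mnorm2: "mnorm2 N \<in> borel_measurable (mleb N)"
proof -
  have [measurable]: "(\<lambda>x. x (i, j)) \<in> borel_measurable (mleb N)" if "i < N" "j < N" for i j
    by (rule measurable_mleb_entry[OF that])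
  show ?thesis unfolding mnorm2_def by simp
qed

lemma distr_mshift: "distr (mleb N) (mleb N) (mshift N c) = mleb N"
proof (rule mleb.PiM_eqI)
  have m: "mshift N c \<in> measurable (mleb N) (mleb N)"
  proof (rule measurable_mlebI)
    fix i j assume ij: "i < N" "j < N"
    note [measurable] = measurable_mleb_entry[OF ij]
    show "(\<lambda>x. mshift N c x (i, j)) \<in> borel_measurable (mleb N)"
      using ij by (simp add: mshift_def)
  qed (auto simp: mshift_def)
  fix A :: "nat \<times> nat \<Rightarrow> complex set" assume A: "\<And>i. i \<in> entries N \<Longrightarrow> A i \<in> sets lborel"
  define B where "B p = ((+) (c p)) -` A p" for p
  have B: "B p \<in> sets borel" if "p \<in> entries N" for p
    using measurable_sets[of "(+) (c p)" borel borel "A p"] A[OF that] by (simp add: B_def)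
  have eB: "emeasure lborel (B p) = emeasure lborel (A p)" if "p \<in> entries N" for p
  proof -
    have "emeasure lborel (A p) = emeasure (distr lborel borel ((+) (c p))) (A p)"
      by (simp only: lborel_distr_plus)
    also have "\<dots> = emeasure lborel (B p)"
      using A[OF that] by (subst emeasure_distr) (auto simp: B_def)
    finally show ?thesis by simp
  qed
  have "emeasure (distr (mleb N) (mleb N) (mshift N c)) (Pi\<^sub>E (entries N) A) =
     emeasure (mleb N) (mshift N c -` Pi\<^sub>E (entries N) A \<inter> space (mleb N))"
    using A by (intro emeasure_distr m sets_PiM_I_finite) auto
  also have "mshift N c -` Pi\<^sub>E (entries N) A \<inter> space (mleb N) = Pi\<^sub>E (entries N) B"
    by (auto simp: space_mleb mshift_def B_def PiE_def Pi_iff add.commute)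
  also have "emeasure (mleb N) (Pi\<^sub>E (entries N) B) = (\<Prod>i\<in>entries N. emeasure lborel (B i))"
    using B by (intro mleb.emeasure_PiM) auto
  also have "\<dots> = (\<Prod>i\<in>entries N. emeasure lborel (A i))"
    using eB by (intro prod.cong) auto
  finally show "emeasure (distr (mleb N) (mleb N) (mshift N c)) (Pi\<^sub>E (entries N) A) =
     (\<Prod>i\<in>entries N. emeasure lborel (A i))" .
qed auto

lemma measurable_mshift': "mshift N c \<in> measurable (mleb N) (mleb N)"
proof (rule measurable_mlebI)
  fix i j assume ij: "i < N" "j < N"
  note [measurable] = measurable_mleb_entry[OF ij]
  show "(\<lambda>x. mshift N c x (i, j)) \<in> borel_measurable (mleb N)"
    using ij by (simp add: mshift_def)
qed (auto simp: mshift_def)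

lemma nn_integral_mshift:
  assumes "f \<in> borel_measurable (mleb N)"
  shows "(\<integral>\<^sup>+ x. f (mshift N c x) \<partial>mleb N) = (\<integral>\<^sup>+ x. f x \<partial>mleb N)"
proof -
  have "(\<integral>\<^sup>+ x. f x \<partial>distr (mleb N) (mleb N) (mshift N c)) = (\<integral>\<^sup>+ x. f (mshift N c x) \<partial>mleb N)"
    by (rule nn_integral_distr[OF measurable_mshift']) (use assms in simp)
  then show ?thesis by (simp only: distr_mshift)
qed

lemma mact_mact: "mact N V (mact N W x) = mact N (mmul N V W) x"
proof (rule ext)
  fix p :: "nat \<times> nat"
  obtain i j where p: "p = (i, j)" by (cases p)
  show "mact N V (mact N W x) p = mact N (mmul N V W) x p"
  proof (cases "i < N \<and> j < N")
    case True
    then have "mact N V (mact N W x) p = (\<Sum>l<N. V i l * (\<Sum>m<N. W l m * x (m, j)))"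
      by (simp add: mact_def p)
    also have "\<dots> = (\<Sum>m<N. (\<Sum>l<N. V i l * W l m) * x (m, j))"
      by (simp add: sum_distrib_left sum_distrib_right mult.assoc) (rule sum.swap)
    also have "\<dots> = mact N (mmul N V W) x p"
      using True by (simp add: mact_def p mmul_def)
    finally show ?thesis .
  next
    case False
    then have "p \<notin> entries N" by (simp add: p)
    then show ?thesis by (simp add: mact_def)
  qed
qed

lemma mact_uid:
  assumes "x \<in> extensional (entries N)" shows "mact N (uid N) x = x"
proof (rule ext)
  fix p :: "nat \<times> nat"
  obtain i j where p: "p = (i, j)" by (cases p)
  show "mact N (uid N) x p = x p"
  proof (cases "i < N \<and> j < N")
    case True
    then have "mact N (uid N) x p = (\<Sum>l<N. if i = l then x (l, j) else 0)"
      by (simp add: mact_def p uid_def if_distrib[of "\<lambda>z. z * _"] cong: if_cong)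
    then show ?thesis using True by (simp add: p)
  next
    case False
    then have "p \<notin> entries N" by (simp add: p)
    then show ?thesis using extensional_arb[OF assms] by (simp add: mact_def)
  qed
qed

lemma mact_ext: "mact N V x \<in> extensional (entries N)"
  by (simp add: mact_def)

lemma mact_mshift: "mact N V (mshift N c x) = mshift N (mact N V c) (mact N V x)"
  by (rule ext) (auto simp: mact_def mshift_def sum.distrib algebra_simps restrict_def entries_def)

lemma unitary_inner:
  assumes "V \<in> unitary_group N"
  shows "(\<Sum>i<N. cnj (\<Sum>l<N. V i l * a l) * (\<Sum>l<N. V i l * b l)) = (\<Sum>l<N. cnj (a l) * b l)"
proof -
  have "(\<Sum>i<N. cnj (\<Sum>l<N. V i l * a l) * (\<Sum>l<N. V i l * b l))
      = (\<Sum>i<N. \<Sum>l<N. \<Sum>m<N. (cnj (V i l) * V i m) * (cnj (a l) * b m))"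
    unfolding cnj_sum sum_product by (simp add: mult_ac)
  also have "\<dots> = (\<Sum>l<N. \<Sum>m<N. (\<Sum>i<N. cnj (V i l) * V i m) * (cnj (a l) * b m))"
    unfolding sum_distrib_right
    by (subst sum.swap, rule sum.cong[OF refl], rule sum.swap)
  also have "\<dots> = (\<Sum>l<N. \<Sum>m<N. if l = m then cnj (a l) * b m else 0)"
    using assms by (intro sum.cong refl) (auto simp: unitary_group_def)
  finally show ?thesis by simp
qed

lemma cnj_mult_self: "cnj z * z = complex_of_real ((cmod z)\<^sup>2)"
  by (simp only: complex_norm_square mult.commute)

lemma unitary_norm2:
  assumes "V \<in> unitary_group N"
  shows "(\<Sum>i<N. (cmod (\<Sum>l<N. V i l * a l))\<^sup>2) = (\<Sum>l<N. (cmod (a l))\<^sup>2)"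
proof -
  have "complex_of_real (\<Sum>i<N. (cmod (\<Sum>l<N. V i l * a l))\<^sup>2) = complex_of_real (\<Sum>l<N. (cmod (a l))\<^sup>2)"
    unfolding of_real_sum cnj_mult_self[symmetric] by (rule unitary_inner[OF assms])
  then show ?thesis by (simp only: of_real_eq_iff)
qed

lemma mnorm2_mact: "V \<in> unitary_group N \<Longrightarrow> mnorm2 N (mact N V x) = mnorm2 N x"
  unfolding mnorm2_def
  by (rule sum.cong[OF refl]) (simp add: mact_def unitary_norm2)

text \<open>For the Frobenius ball \<open>A\<close>, both sides of \<open>\<mu>(A) \<mu>(V\<inverse>B) = \<mu>(A) \<mu>(B)\<close> are the same double
  integral of \<open>1\<^sub>A(x) 1\<^sub>B(Vy + x)\<close>, because \<open>\<mu>\<close> is translation invariant and \<open>A\<close> is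
  invariant under \<open>V\<close> and \<open>-1\<close>.\<close>

lemma nn_integral_mact_ball:
  fixes c :: real
  assumes V: "V \<in> unitary_group N" and B: "B \<in> sets (mleb N)"
  defines "A \<equiv> {x \<in> space (mleb N). mnorm2 N x \<le> c}"
  shows "emeasure (mleb N) A * emeasure (mleb N) (mact N V -` B \<inter> space (mleb N)) =
         emeasure (mleb N) A * emeasure (mleb N) B"
proof -
  interpret sigma_finite_measure "mleb N" by (rule sigma_finite_mleb)
  interpret P: pair_sigma_finite "mleb N" "mleb N" ..
  let ?L = "mleb N"
  let ?neg = "\<lambda>x :: nat \<times> nat \<Rightarrow> complex. \<lambda>p. - x p"
  note V' = uadj_unitary[OF V]
  note [measurable] = measurable_mnorm2 B
  have A [measurable]: "A \<in> sets ?L" unfolding A_def by measurable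
  have T [measurable]: "mact N V \<in> measurable ?L ?L" using measurable_mact[OF measurable_ident] by simp
  have VW: "mact N V (mact N (uadj N V) x) = x" if "x \<in> extensional (entries N)" for x
    using that by (simp add: mact_mact mmul_uadj_right[OF V] mact_uid)
  have WV: "mact N (uadj N V) (mact N V x) = x" if "x \<in> extensional (entries N)" for x
    using that by (simp add: mact_mact mmul_uadj_left[OF V] mact_uid)
  have [measurable]: "(\<lambda>p. mshift N (mact N V (fst p)) (snd p)) \<in> measurable (?L \<Otimes>\<^sub>M ?L) ?L"
    by (intro measurable_mshift measurable_mact) auto
  have [measurable]: "(\<lambda>p. mshift N (?neg (mact N V (fst p))) (snd p)) \<in> measurable (?L \<Otimes>\<^sub>M ?L) ?L"
  proof (rule measurable_mlebI)
    fix i j assume ij: "i < N" "j < N"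
    note [measurable] = measurable_mleb_entry
    show "(\<lambda>p. mshift N (?neg (mact N V (fst p))) (snd p) (i, j)) \<in> borel_measurable (?L \<Otimes>\<^sub>M ?L)"
      using ij measurable_compose[OF T measurable_mleb_entry[OF ij]]
        measurable_mleb_entry[OF ij] by (simp add: mshift_def)
  qed (auto simp: mshift_def)
  have [measurable]: "(\<lambda>x. mshift N (mact N V y) x) \<in> measurable ?L ?L" for y
    by (rule measurable_mshift')
  have [measurable]: "(\<lambda>y. mshift N c (mact N V y)) \<in> measurable ?L ?L" for c
    using measurable_compose[OF T measurable_mshift'] by simp
  \<comment> \<open>Translating \<open>y\<close> by \<open>V^-1 x\<close> turns \<open>Vy\<close>
    into \<open>Vy + x\<close> without changing the integral, so the shift by \<open>x\<close> can
    be introduced for free.\<close>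
  have s1: "emeasure ?L (mact N V -` B \<inter> space ?L) = (\<integral>\<^sup>+ y. indicator B (mshift N x (mact N V y)) \<partial>?L)"
    if x: "x \<in> space ?L" for x
  proof -
    have "emeasure ?L (mact N V -` B \<inter> space ?L) = (\<integral>\<^sup>+ y. indicator B (mact N V y) \<partial>?L)"
      unfolding nn_integral_indicator[OF measurable_sets[OF T B], symmetric]
      by (rule nn_integral_cong) (auto simp: indicator_def)
    also have "\<dots> = (\<integral>\<^sup>+ y. indicator B (mact N V (mshift N (mact N (uadj N V) x) y)) \<partial>?L)"
      by (rule nn_integral_mshift[symmetric, of "\<lambda>y. indicator B (mact N V y)"]) measurable
    also have "\<dots> = (\<integral>\<^sup>+ y. indicator B (mshift N x (mact N V y)) \<partial>?L)"
      using x by (simp add: mact_mshift VW space_mleb)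
    finally show ?thesis .
  qed
  have comm: "mshift N a b = mshift N b a" for a b
    by (rule ext) (simp add: mshift_def restrict_def add.commute)
  have s2: "(\<integral>\<^sup>+ x. indicator A x * indicator B (mshift N (mact N V y) x) \<partial>?L) =
      (\<integral>\<^sup>+ x. indicator A (mshift N (?neg (mact N V y)) x) * indicator B x \<partial>?L)" for y
  proof -
    let ?f = "\<lambda>x. indicator A (mshift N (?neg (mact N V y)) x) * indicator B x :: ennreal"
    have "(\<integral>\<^sup>+ x. ?f x \<partial>?L) = (\<integral>\<^sup>+ x. ?f (mshift N (mact N V y) x) \<partial>?L)"
    proof (rule nn_integral_mshift[symmetric])
      have [measurable]: "(\<lambda>x. mshift N (?neg (mact N V y)) x) \<in> measurable ?L ?L"
        by (rule measurable_mshift')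
      show "?f \<in> borel_measurable ?L" by measurable
    qed
    also have "\<dots> = (\<integral>\<^sup>+ x. indicator A x * indicator B (mshift N (mact N V y) x) \<partial>?L)"
    proof (rule nn_integral_cong)
      fix x assume "x \<in> space ?L"
      then have "mshift N (?neg (mact N V y)) (mshift N (mact N V y) x) = x"
        by (intro ext) (auto simp: mshift_def space_mleb restrict_def extensional_def)
      then show "?f (mshift N (mact N V y) x) = indicator A x * indicator B (mshift N (mact N V y) x)"
        by simp
    qed
    finally show ?thesis by simp
  qed
  \<comment> \<open>The ball is invariant under \<open>V^-1\<close> and under negation, so
    \<open>x - Vy\<close> lies in it exactly when \<open>y - V^-1 x\<close> does; the latter is a
    translate of \<open>y\<close>.\<close>
  have s3: "(\<integral>\<^sup>+ y. indicator A (mshift N (?neg (mact N V y)) x) \<partial>?L) = emeasure ?L A"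
    if x: "x \<in> space ?L" for x
  proof -
    have eq: "indicator A (mshift N (?neg (mact N V y)) x) =
        (indicator A (mshift N (?neg (mact N (uadj N V) x)) y) :: ennreal)" if y: "y \<in> space ?L" for y
    proof -
      have e: "mact N (uadj N V) (mshift N (?neg (mact N V y)) x) (i, j) = - (mshift N (?neg (mact N (uadj N V) x)) y (i, j))"
        if "i < N" "j < N" for i j
      proof -
        have "mact N (uadj N V) (?neg (mact N V y)) (i, j) = - mact N (uadj N V) (mact N V y) (i, j)"
          using that by (simp add: mact_def sum_negf)
        then show ?thesis using that y by (simp only: mact_mshift) (simp add: mshift_def WV space_mleb)
      qed
      have "mnorm2 N (mshift N (?neg (mact N V y)) x) = mnorm2 N (mact N (uadj N V) (mshift N (?neg (mact N V y)) x))"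
        by (simp add: mnorm2_mact[OF V'])
      also have "\<dots> = mnorm2 N (mshift N (?neg (mact N (uadj N V) x)) y)"
        unfolding mnorm2_def by (intro sum.cong refl) (simp add: e)
      finally show ?thesis by (simp add: A_def indicator_def space_mleb mshift_def)
    qed
    have "(\<integral>\<^sup>+ y. indicator A (mshift N (?neg (mact N V y)) x) \<partial>?L) =
      (\<integral>\<^sup>+ y. indicator A (mshift N (?neg (mact N (uadj N V) x)) y) \<partial>?L)"
      by (intro nn_integral_cong eq)
    also have "\<dots> = (\<integral>\<^sup>+ y. indicator A y \<partial>?L)"
      by (rule nn_integral_mshift) measurable
    finally show ?thesis by simp
  qed
  have "emeasure ?L A * emeasure ?L (mact N V -` B \<inter> space ?L) =
     (\<integral>\<^sup>+ x. indicator A x * emeasure ?L (mact N V -` B \<inter> space ?L) \<partial>?L)"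
    by (simp add: nn_integral_multc)
  also have "\<dots> = (\<integral>\<^sup>+ x. (\<integral>\<^sup>+ y. indicator A x * indicator B (mshift N (mact N V y) x) \<partial>?L) \<partial>?L)"
    by (intro nn_integral_cong) (simp add: nn_integral_cmult s1 comm)
  also have "\<dots> = (\<integral>\<^sup>+ y. (\<integral>\<^sup>+ x. indicator A x * indicator B (mshift N (mact N V y) x) \<partial>?L) \<partial>?L)"
    by (rule P.Fubini') (simp add: split_beta)
  also have "\<dots> = (\<integral>\<^sup>+ y. (\<integral>\<^sup>+ x. indicator A (mshift N (?neg (mact N V y)) x) * indicator B x \<partial>?L) \<partial>?L)"
    by (simp only: s2)
  also have "\<dots> = (\<integral>\<^sup>+ x. (\<integral>\<^sup>+ y. indicator A (mshift N (?neg (mact N V y)) x) * indicator B x \<partial>?L) \<partial>?L)"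
    by (rule P.Fubini'[symmetric]) (simp add: split_beta)
  also have "\<dots> = (\<integral>\<^sup>+ x. emeasure ?L A * indicator B x \<partial>?L)"
  proof (intro nn_integral_cong)
    fix x assume x: "x \<in> space ?L"
    have [measurable]: "(\<lambda>y. mshift N (?neg (mact N V y)) x) \<in> measurable ?L ?L"
    proof (rule measurable_mlebI)
      fix i j assume ij: "i < N" "j < N"
      show "(\<lambda>y. mshift N (?neg (mact N V y)) x (i, j)) \<in> borel_measurable ?L"
        using ij measurable_compose[OF T measurable_mleb_entry[OF ij]] by (simp add: mshift_def)
    qed (auto simp: mshift_def)
    show "(\<integral>\<^sup>+ y. indicator A (mshift N (?neg (mact N V y)) x) * indicator B x \<partial>?L) = emeasure ?L A * indicator B x"
      by (subst nn_integral_multc) (auto simp: s3[OF x])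
  qed
  also have "\<dots> = emeasure ?L A * emeasure ?L B"
    by (simp add: nn_integral_cmult_indicator)
  finally show ?thesis .
qed

text \<open>Gram-Schmidt orthonormalisation commutes with left multiplication by unitary matrices, so
  it turns an invariant law on the Frobenius ball into an invariant measure on the group. For dependent columns the
  recursion still returns a value, since it then divides by \<open>0\<close>; \<open>gs_good\<close> excludes this case.\<close>

function gram_schmidt :: "nat \<Rightarrow> (nat \<times> nat \<Rightarrow> complex) \<Rightarrow> nat \<Rightarrow> nat \<Rightarrow> complex" where
  "gram_schmidt N x j =
    (let r = (\<lambda>i. x (i, j) - (\<Sum>l<j. (\<Sum>i<N. cnj (gram_schmidt N x l i) * x (i, j)) * gram_schmidt N x l i))
     in (\<lambda>i. r i / complex_of_real (sqrt (\<Sum>i<N. (cmod (r i))\<^sup>2))))"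
  by pat_completeness auto
termination by (relation "Wellfounded.measure (\<lambda>(N, x, j). j)") auto

declare gram_schmidt.simps [simp del]

definition gs_res :: "nat \<Rightarrow> (nat \<times> nat \<Rightarrow> complex) \<Rightarrow> nat \<Rightarrow> nat \<Rightarrow> complex" where
  "gs_res N x j i = x (i, j) - (\<Sum>l<j. (\<Sum>i<N. cnj (gram_schmidt N x l i) * x (i, j)) * gram_schmidt N x l i)"

definition gs_norm :: "nat \<Rightarrow> (nat \<times> nat \<Rightarrow> complex) \<Rightarrow> nat \<Rightarrow> real" where
  "gs_norm N x j = sqrt (\<Sum>i<N. (cmod (gs_res N x j i))\<^sup>2)"

lemma gram_schmidt_eq: "gram_schmidt N x j i = gs_res N x j i / complex_of_real (gs_norm N x j)"
  by (subst gram_schmidt.simps) (simp add: gs_norm_def gs_res_def)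

text \<open>The coefficients of the recursion are inner products of columns, which \<open>V\<close>
  preserves. So residuals are multiplied by \<open>V\<close>, their norms do not change, and the
  same holds after normalising.\<close>

lemma gs_mact:
  assumes V: "V \<in> unitary_group N" and "j < N"
  shows "(\<forall>i<N. gs_res N (mact N V x) j i = (\<Sum>l<N. V i l * gs_res N x j l)) \<and>
    gs_norm N (mact N V x) j = gs_norm N x j \<and>
    (\<forall>i<N. gram_schmidt N (mact N V x) j i = (\<Sum>l<N. V i l * gram_schmidt N x j l))"
  using \<open>j < N\<close>
proof (induction j rule: less_induct)
  case (less j)
  have IH: "gram_schmidt N (mact N V x) l i = (\<Sum>m<N. V i m * gram_schmidt N x l m)" if "l < j" "i < N" for l i
    using less.IH[OF that(1)] that less.prems by auto
  have y: "mact N V x (i, j) = (\<Sum>l<N. V i l * x (l, j))" if "i < N" for i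
    using that less.prems by (simp add: mact_def)
  have inner: "(\<Sum>i<N. cnj (gram_schmidt N (mact N V x) l i) * mact N V x (i, j)) =
     (\<Sum>i<N. cnj (gram_schmidt N x l i) * x (i, j))" if "l < j" for l
    using unitary_inner[OF V, of "gram_schmidt N x l" "\<lambda>i. x (i, j)"] by (simp add: IH[OF that] y)
  have res: "gs_res N (mact N V x) j i = (\<Sum>l<N. V i l * gs_res N x j l)" if "i < N" for i
  proof -
    have "gs_res N (mact N V x) j i = (\<Sum>m<N. V i m * x (m, j)) -
       (\<Sum>l<j. (\<Sum>i<N. cnj (gram_schmidt N x l i) * x (i, j)) * (\<Sum>m<N. V i m * gram_schmidt N x l m))"
      unfolding gs_res_def y[OF that]
    proof (rule arg_cong2[where f="(-)", OF refl], rule sum.cong[OF refl])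
      fix l assume "l \<in> {..<j}"
      then have l: "l < j" by simp
      show "(\<Sum>i<N. cnj (gram_schmidt N (mact N V x) l i) * mact N V x (i, j)) * gram_schmidt N (mact N V x) l i =
        (\<Sum>i<N. cnj (gram_schmidt N x l i) * x (i, j)) * (\<Sum>m<N. V i m * gram_schmidt N x l m)"
        unfolding inner[OF l] IH[OF l that] ..
    qed
    also have "\<dots> = (\<Sum>m<N. V i m * gs_res N x j m)"
      unfolding gs_res_def right_diff_distrib sum_subtractf sum_distrib_left
      by (subst sum.swap) (simp add: mult_ac)
    finally show ?thesis .
  qed
  have nrm: "gs_norm N (mact N V x) j = gs_norm N x j"
    unfolding gs_norm_def by (simp add: res unitary_norm2[OF V])
  have "gram_schmidt N (mact N V x) j i = (\<Sum>l<N. V i l * gram_schmidt N x j l)" if "i < N" for i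
    unfolding gram_schmidt_eq nrm by (simp add: res that sum_divide_distrib)
  with res nrm show ?case by blast
qed

definition gs_good :: "nat \<Rightarrow> (nat \<times> nat \<Rightarrow> complex) \<Rightarrow> bool" where
  "gs_good N x \<longleftrightarrow> (\<forall>j<N. gs_norm N x j \<noteq> 0)"

lemma gram_schmidt_normalized:
  assumes "gs_norm N x j \<noteq> 0"
  shows "(\<Sum>i<N. cnj (gram_schmidt N x j i) * gram_schmidt N x j i) = 1"
proof -
  let ?s = "\<Sum>i<N. (cmod (gs_res N x j i))\<^sup>2"
  have n2: "(gs_norm N x j)\<^sup>2 = ?s"
    unfolding gs_norm_def by (simp add: sum_nonneg)
  have "(\<Sum>i<N. cnj (gram_schmidt N x j i) * gram_schmidt N x j i)
      = (\<Sum>i<N. complex_of_real ((cmod (gs_res N x j i))\<^sup>2) / complex_of_real ((gs_norm N x j)\<^sup>2))"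
    unfolding gram_schmidt_eq cnj_mult_self[symmetric] by (simp add: power2_eq_square)
  also have "\<dots> = complex_of_real ?s / complex_of_real ((gs_norm N x j)\<^sup>2)"
    by (simp only: sum_divide_distrib[symmetric] of_real_sum)
  also have "\<dots> = 1" using assms n2 by (metis divide_self_if of_real_eq_0_iff power_eq_0_iff)
  finally show ?thesis .
qed

text \<open>Strong induction on the larger index: the columns before \<open>b\<close> are already
  orthonormal, the case of a larger first index being obtained by conjugation, so in the projection
  sum only the term of \<open>a\<close> survives and cancels.\<close>

lemma gram_schmidt_orthogonal:
  assumes "gs_good N x" "a < b" "b < N"
  shows "(\<Sum>i<N. cnj (gram_schmidt N x a i) * gram_schmidt N x b i) = 0"
  using assms(2,3)
proof (induction b arbitrary: a rule: less_induct)
  case (less b)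
  let ?q = "gram_schmidt N x"
  have orth: "(\<Sum>i<N. cnj (?q a i) * ?q l i) = (if l = a then 1 else 0)" if "l < b" for l
  proof -
    consider "l = a" | "a < l" | "l < a" by linarith
    then show ?thesis
    proof cases
      case 1
      then show ?thesis using gram_schmidt_normalized[of N x a] assms(1) less.prems by (simp add: gs_good_def)
    next
      case 2
      then show ?thesis using less.IH[OF that 2] that less.prems by simp
    next
      case 3
      have "(\<Sum>i<N. cnj (?q l i) * ?q a i) = 0" using less.IH[OF less.prems(1) 3] less.prems by simp
      then have "cnj (\<Sum>i<N. cnj (?q l i) * ?q a i) = 0" by simp
      then show ?thesis using 3 by (simp add: mult.commute)
    qed
  qed
  have "(\<Sum>i<N. cnj (?q a i) * gs_res N x b i) = (\<Sum>i<N. cnj (?q a i) * x (i, b)) -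
     (\<Sum>l<b. (\<Sum>i<N. cnj (?q l i) * x (i, b)) * (\<Sum>i<N. cnj (?q a i) * ?q l i))"
    unfolding gs_res_def right_diff_distrib sum_subtractf sum_distrib_left
    by (subst (2) sum.swap) (simp add: mult_ac)
  also have "\<dots> = 0"
    using less.prems by (simp add: orth if_distrib cong: if_cong)
  finally have "(\<Sum>i<N. cnj (?q a i) * gs_res N x b i) = 0" .
  then show ?case unfolding gram_schmidt_eq[of N x b] by (simp add: sum_divide_distrib[symmetric])
qed

text \<open>The default \<open>uid\<close> on degenerate arrays keeps all values in the group;
  equivariance is only claimed on good arrays. \<open>gram_schmidt\<close> takes the column index
  before the row index, hence the swap.\<close>

definition gs_mat :: "nat \<Rightarrow> (nat \<times> nat \<Rightarrow> complex) \<Rightarrow> nat \<Rightarrow> nat \<Rightarrow> complex" where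
  "gs_mat N x = (if gs_good N x then (\<lambda>i j. if i < N \<and> j < N then gram_schmidt N x j i else 0) else uid N)"

lemma gs_mat_unitary: "gs_mat N x \<in> unitary_group N"
proof (cases "gs_good N x")
  case True
  have "(\<Sum>l<N. cnj (gram_schmidt N x i l) * gram_schmidt N x j l) = (if i = j then 1 else 0)"
    if "i < N" "j < N" for i j
  proof -
    consider "i = j" | "i < j" | "j < i" by linarith
    then show ?thesis
    proof cases
      case 1
      then show ?thesis using gram_schmidt_normalized True that by (simp add: gs_good_def)
    next
      case 2
      then show ?thesis using gram_schmidt_orthogonal[OF True 2] that by simp
    next
      case 3
      have "cnj (\<Sum>l<N. cnj (gram_schmidt N x j l) * gram_schmidt N x i l) = 0"
        using gram_schmidt_orthogonal[OF True 3] that by simp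
      then show ?thesis using 3 by (simp add: mult.commute)
    qed
  qed
  then show ?thesis using True by (simp add: unitary_group_def gs_mat_def)
qed (simp add: gs_mat_def uid_unitary)

lemma gs_good_mact: "V \<in> unitary_group N \<Longrightarrow> gs_good N (mact N V x) = gs_good N x"
  by (simp add: gs_good_def gs_mact)

lemma gs_mat_mact:
  assumes "V \<in> unitary_group N" "gs_good N x"
  shows "gs_mat N (mact N V x) = mmul N V (gs_mat N x)"
  using assms by (intro ext) (simp add: gs_mat_def gs_good_mact mmul_def gs_mact)

lemma measurable_gram_schmidt:
  assumes "j < N"
  shows "(\<lambda>x. gs_norm N x j) \<in> borel_measurable (mleb N) \<and>
    (\<forall>i<N. (\<lambda>x. gram_schmidt N x j i) \<in> borel_measurable (mleb N))"
  using assms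
proof (induction j rule: less_induct)
  case (less j)
  note [measurable] = measurable_mleb_entry
  have [measurable]: "(\<lambda>x. gram_schmidt N x l i) \<in> borel_measurable (mleb N)" if "l < j" "i < N" for l i
    using less.IH[OF that(1)] that less.prems by auto
  have [measurable]: "(\<lambda>x. cnj (gram_schmidt N x l i)) \<in> borel_measurable (mleb N)" if "l < j" "i < N" for l i
    by (rule measurable_compose[of _ _ borel, OF _ borel_measurable_continuous_onI])
        (use that in \<open>auto intro!: continuous_intros\<close>)
  have res [measurable]: "(\<lambda>x. gs_res N x j i) \<in> borel_measurable (mleb N)" if "i < N" for i
    unfolding gs_res_def using that less.prems by simp
  have nrm [measurable]: "(\<lambda>x. gs_norm N x j) \<in> borel_measurable (mleb N)"
    unfolding gs_norm_def by simp
  have "(\<lambda>x. gram_schmidt N x j i) \<in> borel_measurable (mleb N)" if "i < N" for i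
    unfolding gram_schmidt_eq using that by simp
  with nrm show ?case by blast
qed

lemma measurable_gs_good: "{x \<in> space (mleb N). gs_good N x} \<in> sets (mleb N)"
proof -
  have [measurable]: "(\<lambda>x. gs_norm N x j) \<in> borel_measurable (mleb N)" if "j < N" for j
    using measurable_gram_schmidt[OF that] by blast
  have "{x \<in> space (mleb N). gs_good N x} = {x \<in> space (mleb N). \<forall>j\<in>{..<N}. gs_norm N x j \<noteq> 0}"
    by (auto simp: gs_good_def)
  also have "\<dots> \<in> sets (mleb N)" by (rule sets.sets_Collect_finite_All) auto
  finally show ?thesis .
qed

lemma measurable_gs_mat: "gs_mat N \<in> measurable (mleb N) (uborel N)"
proof (rule measurable_uborelI)
  show "(\<lambda>x. gs_mat N x i j) \<in> borel_measurable (mleb N)" for i j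
  proof (cases "i < N \<and> j < N")
    case True
    then have "(\<lambda>x. gs_mat N x i j) = (\<lambda>x. if gs_good N x then gram_schmidt N x j i else uid N i j)"
      by (auto simp: gs_mat_def)
    also have "\<dots> \<in> borel_measurable (mleb N)"
      using True measurable_gram_schmidt[of j N] by (intro measurable_If measurable_gs_good) auto
    finally show ?thesis .
  next
    case False
    then have "(\<lambda>x. gs_mat N x i j) = (\<lambda>x. 0)" by (auto simp: gs_mat_def uid_def)
    then show ?thesis by simp
  qed
qed (simp add: gs_mat_unitary)

text \<open>Unrolling the recursion; column \<open>j\<close> itself keeps coefficient 1. A vanishing
  residual is therefore a nontrivial linear relation between the columns. Zero norms do no harm,
  since division by 0 yields 0.\<close>

lemma gs_res_span: "\<exists>c. \<forall>i<N. gs_res N x j i = x (i, j) + (\<Sum>l<j. c l * x (i, l))"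
proof (induction j rule: less_induct)
  case (less j)
  then obtain c where c: "\<And>l i. l < j \<Longrightarrow> i < N \<Longrightarrow> gs_res N x l i = x (i, l) + (\<Sum>m<l. c l m * x (i, m))"
    by metis
  define a where "a l = (\<Sum>i<N. cnj (gram_schmidt N x l i) * x (i, j)) / complex_of_real (gs_norm N x l)" for l
  define d where "d l m = (if m = l then 1 else if m < l then c l m else 0)" for l m
  have gs: "gs_res N x l i = (\<Sum>m<j. d l m * x (i, m))" if "l < j" "i < N" for l i
  proof -
    have "(\<Sum>m<j. d l m * x (i, m)) = (\<Sum>m<Suc l. d l m * x (i, m))"
      using that by (intro sum.mono_neutral_right) (auto simp: d_def)
    also have "\<dots> = x (i, l) + (\<Sum>m<l. c l m * x (i, m))"
      by (simp add: d_def)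
    finally show ?thesis using c[OF that] by simp
  qed
  have "gs_res N x j i = x (i, j) + (\<Sum>m<j. (- (\<Sum>l<j. a l * d l m)) * x (i, m))" if i: "i < N" for i
  proof -
    have "gs_res N x j i = x (i, j) - (\<Sum>l<j. a l * gs_res N x l i)"
      by (simp add: gs_res_def[of N x j] gram_schmidt_eq[of N x _ i] a_def)
    also have "(\<Sum>l<j. a l * gs_res N x l i) = (\<Sum>l<j. \<Sum>m<j. a l * d l m * x (i, m))"
      using i by (simp add: gs sum_distrib_left mult.assoc)
    also have "\<dots> = (\<Sum>m<j. (\<Sum>l<j. a l * d l m) * x (i, m))"
      by (subst sum.swap) (simp add: sum_distrib_right)
    finally show ?thesis by (simp add: sum_negf)
  qed
  then show ?case by (intro exI[of _ "\<lambda>m. - (\<Sum>l<j. a l * d l m)"]) blast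
qed

text \<open>A zero residual gives a linear relation between columns. Read in the row
  \<open>m\<close> of its largest coefficient, it expresses \<open>b m\<close> by at most
  \<open>N\<close> terms, each smaller than \<open>|b m| / N\<close> or at most equal to it, with
  strict inequality somewhere. The lemma supplies a whole neighbourhood of the identity on which
  Gram-Schmidt does not degenerate.\<close>

lemma diagonally_dominant_gs_good:
  assumes "N > 0" and near: "\<And>i j. i < N \<Longrightarrow> j < N \<Longrightarrow> cmod (x (i, j) - uid N i j) < 1 / N"
  shows "gs_good N x"
  unfolding gs_good_def
proof (intro allI impI notI)
  fix j assume j: "j < N" and 0: "gs_norm N x j = 0"
  then have "(\<Sum>i<N. (cmod (gs_res N x j i))\<^sup>2) = 0"
    by (simp add: gs_norm_def)
  then have "\<forall>i<N. gs_res N x j i = 0" by (subst (asm) sum_nonneg_eq_0_iff) auto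
  with gs_res_span[of N x j] obtain c where
    c: "\<And>i. i < N \<Longrightarrow> x (i, j) + (\<Sum>l<j. c l * x (i, l)) = 0" by metis
  define b where "b l = (if l = j then 1 else c l)" for l
  have b: "(\<Sum>l\<le>j. b l * x (i, l)) = 0" if "i < N" for i
    using c[OF that] by (simp add: b_def lessThan_Suc_atMost[symmetric] add.commute)
  obtain m where m: "m \<le> j" "\<And>l. l \<le> j \<Longrightarrow> cmod (b l) \<le> cmod (b m)"
  proof -
    have "Max ((\<lambda>l. cmod (b l)) ` {..j}) \<in> (\<lambda>l. cmod (b l)) ` {..j}" by (rule Max_in) auto
    then obtain m where m: "Max ((\<lambda>l. cmod (b l)) ` {..j}) = cmod (b m)" "m \<in> {..j}" by (rule imageE)
    show ?thesis
    proof (rule that)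
      show "m \<le> j" using m(2) by simp
      show "cmod (b l) \<le> cmod (b m)" if "l \<le> j" for l
        unfolding m(1)[symmetric] using that by (intro Max_ge) auto
    qed
  qed
  have bm: "cmod (b m) \<ge> 1" using m(2)[of j] by (simp add: b_def)
  have "b m = - (\<Sum>l\<le>j. b l * (x (m, l) - uid N m l))"
  proof -
    have "(\<Sum>l\<le>j. b l * (x (m, l) - uid N m l)) = (\<Sum>l\<le>j. b l * x (m, l)) - (\<Sum>l\<le>j. b l * uid N m l)"
      by (simp add: right_diff_distrib sum_subtractf)
    also have "(\<Sum>l\<le>j. b l * uid N m l) = (\<Sum>l\<le>j. if m = l then b l else 0)"
      using m j by (intro sum.cong) (auto simp: uid_def)
    finally show ?thesis using b[of m] m j by simp
  qed
  then have "cmod (b m) = cmod (\<Sum>l\<le>j. b l * (x (m, l) - uid N m l))"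
    by (metis norm_minus_cancel)
  also have "\<dots> \<le> (\<Sum>l\<le>j. cmod (b l) * cmod (x (m, l) - uid N m l))"
    by (rule order.trans[OF norm_sum]) (simp add: norm_mult)
  also have "\<dots> < (\<Sum>l\<le>j. cmod (b m) * (1 / N))"
  proof (rule sum_strict_mono_ex1)
    show "\<forall>l\<in>{..j}. cmod (b l) * cmod (x (m, l) - uid N m l) \<le> cmod (b m) * (1 / N)"
    proof
      fix l assume "l \<in> {..j}"
      then have "cmod (b l) \<le> cmod (b m)" "cmod (x (m, l) - uid N m l) \<le> 1 / N"
        using m j near[of m l] by auto
      then show "cmod (b l) * cmod (x (m, l) - uid N m l) \<le> cmod (b m) * (1 / N)"
        by (intro mult_mono) auto
    qed
    have "cmod (b m) * cmod (x (m, m) - uid N m m) < cmod (b m) * (1 / N)"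
      using bm near[of m m] m j by (intro mult_strict_left_mono) auto
    then show "\<exists>l\<in>{..j}. cmod (b l) * cmod (x (m, l) - uid N m l) < cmod (b m) * (1 / N)"
      using m by auto
  qed simp
  also have "\<dots> = cmod (b m) * (Suc j / N)" by simp
  also have "\<dots> \<le> cmod (b m) * 1"
    using j by (intro mult_left_mono) auto
  finally show False by simp
qed

text \<open>The measure is the image under Gram-Schmidt of the uniform distribution on the
  nondegenerate matrices in a Frobenius ball.\<close>

lemma ex_is_haar: "\<exists>M. is_haar N M"
proof -
  let ?L = "mleb N"
  \<comment> \<open>In the box of radius \<open>1/N\<close> around the identity every entry has
    modulus at most 2, so the squared norm is at most \<open>4 N^2\<close>; the ball thus contains a
    box of positive measure.\<close>
  define A where "A = {x \<in> space ?L. mnorm2 N x \<le> 4 * N ^ 2}"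
  define S where "S = {x \<in> A. gs_good N x}"
  have A: "A \<in> sets ?L"
  proof -
    note [measurable] = measurable_mnorm2
    show ?thesis unfolding A_def by measurable
  qed
  have S: "S \<in> sets ?L"
  proof -
    have "S = A \<inter> {x \<in> space ?L. gs_good N x}" by (auto simp: S_def A_def)
    then show ?thesis using A measurable_gs_good by auto
  qed
  have Sp: "emeasure ?L S > 0"
  proof -
    define D where "D = Pi\<^sub>E (entries N) (\<lambda>p. ball (uid N (fst p) (snd p)) (1 / N))"
    have "D \<subseteq> S"
    proof
      fix x assume x: "x \<in> D"
      have near: "cmod (x (i, j) - uid N i j) < 1 / N" if "i < N" "j < N" for i j
      proof -
        have "x (i, j) \<in> ball (uid N i j) (1 / N)" using PiE_mem[OF x[unfolded D_def], of "(i, j)"] that by simp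
        then show ?thesis by (simp add: dist_norm norm_minus_commute)
      qed
      have good: "gs_good N x"
        by (cases "N = 0") (auto simp: gs_good_def[of 0] intro!: diagonally_dominant_gs_good near)
      have "cmod (x (i, j)) \<le> 2" if "i < N" "j < N" for i j
      proof -
        have "cmod (x (i, j)) \<le> cmod (x (i, j) - uid N i j) + cmod (uid N i j)"
          by (metis diff_add_cancel norm_triangle_ineq)
        moreover have "cmod (uid N i j) \<le> 1" by (simp add: uid_def)
        moreover have "1 / real N \<le> 1" using that by simp
        ultimately show ?thesis using near[OF that] by linarith
      qed
      then have "mnorm2 N x \<le> (\<Sum>j<N. \<Sum>i<N. 2\<^sup>2)"
        unfolding mnorm2_def by (intro sum_mono power_mono) auto
      also have "\<dots> = 4 * N ^ 2" by (simp add: power2_eq_square)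
      finally show "x \<in> S" using good x by (auto simp: S_def A_def space_mleb D_def PiE_def)
    qed
    moreover have "emeasure ?L D > 0"
    proof -
      have pos: "emeasure lborel (ball (c::complex) (1 / N)) > 0" if "N > 0" for c
        using content_ball_pos[of "1 / real N" c] that emeasure_lborel_ball_finite[of c "1/N"]
        by (simp add: measure_def enn2real_positive_iff)
      have "emeasure ?L D = (\<Prod>p\<in>entries N. emeasure lborel (ball (uid N (fst p) (snd p)) (1 / N)))"
        unfolding D_def by (rule mleb.emeasure_PiM) auto
      also have "\<dots> \<noteq> 0"
      proof (cases "N = 0")
        case False
        then have nz: "emeasure lborel (ball c (1 / real N)) \<noteq> 0" for c :: complex
          using pos[of c] by simp
        then show ?thesis by simp
      qed (simp add: entries_def)
      finally show ?thesis by (simp add: zero_less_iff_neq_zero)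
    qed
    ultimately show ?thesis using emeasure_mono[of D S ?L] S by (metis order_less_le_trans)
  qed
  have Af: "emeasure ?L A < \<infinity>"
  proof -
    have "A \<subseteq> Pi\<^sub>E (entries N) (\<lambda>p. cball 0 (2 * N))"
    proof
      fix x assume x: "x \<in> A"
      have "cmod (x (i, j)) \<le> 2 * N" if "i < N" "j < N" for i j
      proof -
        have "(cmod (x (i, j)))\<^sup>2 \<le> (\<Sum>i<N. (cmod (x (i, j)))\<^sup>2)"
          using that by (intro member_le_sum) auto
        also have "\<dots> \<le> mnorm2 N x"
          unfolding mnorm2_def using that by (intro member_le_sum[of j "{..<N}" "\<lambda>j. \<Sum>i<N. (cmod (x (i, j)))\<^sup>2"]) (auto intro: sum_nonneg)
        also have "\<dots> \<le> (2 * real N)\<^sup>2" using x by (simp add: A_def power_mult_distrib)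
        finally show ?thesis using power2_le_imp_le[of "cmod (x (i, j))" "2 * real N"] by simp
      qed
      then show "x \<in> Pi\<^sub>E (entries N) (\<lambda>p. cball 0 (2 * N))"
        using x space_mleb[of N] by (auto simp: A_def PiE_def)
    qed
    then have "emeasure ?L A \<le> emeasure ?L (Pi\<^sub>E (entries N) (\<lambda>p. cball 0 (2 * N)))"
      by (intro emeasure_mono sets_PiM_I_finite) auto
    also have "\<dots> = (\<Prod>p\<in>entries N. emeasure lborel (cball (0::complex) (2 * N)))"
      by (rule mleb.emeasure_PiM) auto
    also have "\<dots> < \<infinity>"
      using emeasure_lborel_cball_finite[of "0::complex" "2 * N"] by (simp add: power_eq_top_ennreal less_top[symmetric])
    finally show ?thesis .
  qed
  have SA: "emeasure ?L S \<le> emeasure ?L A" using A by (intro emeasure_mono) (auto simp: S_def)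
  have A0: "emeasure ?L A \<noteq> 0" "emeasure ?L A \<noteq> \<infinity>" and S0: "emeasure ?L S \<noteq> 0" "emeasure ?L S \<noteq> \<infinity>"
    using Sp Af SA by (auto simp: less_top)
  \<comment> \<open>The measure of the ball is neither 0 nor infinite, hence can be
    cancelled.\<close>
  have inv: "emeasure ?L (mact N V -` B \<inter> space ?L) = emeasure ?L B"
    if "V \<in> unitary_group N" "B \<in> sets ?L" for V B
    using nn_integral_mact_ball[OF that, of "4 * N ^ 2"] A0 unfolding A_def[symmetric]
    by (simp add: ennreal_mult_cancel_left)
  define M where "M = distr (uniform_measure ?L S) (uborel N) (gs_mat N)"
  have gm: "gs_mat N \<in> measurable (uniform_measure ?L S) (uborel N)"
    using measurable_gs_mat by (simp cong: measurable_cong_sets)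
  have eM: "emeasure M C = emeasure ?L (S \<inter> (gs_mat N -` C \<inter> space ?L)) / emeasure ?L S"
    if C: "C \<in> sets (uborel N)" for C
    unfolding M_def emeasure_distr[OF gm C]
    by (simp add: emeasure_uniform_measure[OF S measurable_sets[OF measurable_gs_mat C]])
  have "is_haar N M"
    unfolding is_haar_def
  proof (intro conjI ballI)
    show "space M = unitary_group N" by (simp add: M_def)
    show sM: "sets M = sets (uborel N)" by (simp add: M_def)
    have "S \<inter> (gs_mat N -` unitary_group N \<inter> space ?L) = S"
      using gs_mat_unitary by (auto simp: S_def A_def)
    then show "emeasure M (space M) = 1"
      using eM[of "unitary_group N"] sets.top[of "uborel N"] S0
      by (simp add: M_def ennreal_divide_self less_top)
    fix V C assume V: "V \<in> unitary_group N" and "C \<in> sets M"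
    then have C: "C \<in> sets (uborel N)" by (simp add: sM)
    have Cs: "C \<subseteq> unitary_group N" using sets.sets_into_space[OF C] by simp
    note V' = uadj_unitary[OF V]
    have VC: "mmul N V ` C \<in> sets (uborel N)"
    proof -
      have "mmul N V ` C = (\<lambda>x. mmul N (uadj N V) x) -` C \<inter> space (uborel N)"
        using mmul_image_iff[OF V Cs] mmul_image_subset[OF V Cs] by auto
      moreover have "(\<lambda>x. mmul N (uadj N V) x) \<in> measurable (uborel N) (uborel N)"
        using V' by (intro measurable_mmul) auto
      ultimately show ?thesis using measurable_sets C by metis
    qed
    \<comment> \<open>Equivariance moves the translation from the group to the space of arrays,
      where \<open>inv\<close> applies.\<close>
    have "S \<inter> (gs_mat N -` (mmul N V ` C) \<inter> space ?L) =
        mact N (uadj N V) -` (S \<inter> (gs_mat N -` C \<inter> space ?L)) \<inter> space ?L"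
    proof (rule Set.set_eqI)
      fix x
      have "x \<in> S \<Longrightarrow> gs_mat N x \<in> mmul N V ` C \<longleftrightarrow> gs_mat N (mact N (uadj N V) x) \<in> C"
        by (subst mmul_image_iff[OF V Cs gs_mat_unitary]) (auto simp: gs_mat_mact[OF V'] S_def)
      moreover have "x \<in> space ?L \<Longrightarrow> x \<in> S \<longleftrightarrow> mact N (uadj N V) x \<in> S"
        by (simp add: S_def A_def gs_good_mact[OF V'] mnorm2_mact[OF V'] space_mleb mact_ext)
      moreover have "mact N (uadj N V) x \<in> space ?L" by (simp add: space_mleb mact_ext)
      ultimately show "x \<in> S \<inter> (gs_mat N -` (mmul N V ` C) \<inter> space ?L) \<longleftrightarrow>
         x \<in> mact N (uadj N V) -` (S \<inter> (gs_mat N -` C \<inter> space ?L)) \<inter> space ?L"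
        by auto
    qed
    then have "emeasure ?L (S \<inter> (gs_mat N -` (mmul N V ` C) \<inter> space ?L)) = emeasure ?L (S \<inter> (gs_mat N -` C \<inter> space ?L))"
      using inv[OF V' sets.Int[OF S measurable_sets[OF measurable_gs_mat C]]] by (simp only:)
    then show "emeasure M (mmul N V ` C) = emeasure M C"
      by (simp add: eM[OF VC] eM[OF C])
  qed
  then show ?thesis by blast
qed

lemma is_haar_haar: "is_haar N (haar N)"
proof -
  obtain M where M: "is_haar N M" using ex_is_haar by blast
  have "haar N = (THE M. is_haar N M)" unfolding haar_def is_haar_def ..
  also have "is_haar N (THE M. is_haar N M)"
    by (rule theI[of "is_haar N" M]) (use M is_haar_unique in blast)+
  finally show ?thesis .
qed

subsection \<open>Integration over the unitary group\<close>

lemma space_haar [simp]: "space (haar N) = unitary_group N"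
  using is_haar_haar[of N] by (simp add: is_haar_def)

lemma sets_haar: "sets (haar N) = sets (uborel N)"
  using is_haar_haar[of N] by (simp add: is_haar_def)

lemma prob_haar: "emeasure (haar N) (space (haar N)) = 1"
  using is_haar_haar[of N] by (simp add: is_haar_def)

lemma finite_measure_haar: "finite_measure (haar N)"
  using prob_haar[of N] by (intro finite_measureI) auto

lemma measure_haar: "measure (haar N) (space (haar N)) = 1"
  using prob_haar[of N] by (simp add: measure_def)

lemma measurable_mmul_left:
  assumes "V \<in> unitary_group N" shows "mmul N V \<in> measurable (uborel N) (uborel N)"
  using assms by (intro measurable_mmul) auto

lemma emeasure_haar_vimage:
  assumes V: "V \<in> unitary_group N" and A: "A \<in> sets (uborel N)"
  shows "emeasure (haar N) (mmul N V -` A \<inter> unitary_group N) = emeasure (haar N) A"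
proof -
  have As: "A \<subseteq> unitary_group N" using sets.sets_into_space[OF A] by simp
  note V' = uadj_unitary[OF V]
  have "mmul N V -` A \<inter> unitary_group N = mmul N (uadj N V) ` A"
    using mmul_image_iff[OF V' As] mmul_image_subset[OF V' As] uadj_uadj_unitary[OF V] by auto
  then show ?thesis
    using is_haar_haar[of N] V' A sets_haar by (auto simp: is_haar_def)
qed

lemma distr_haar:
  assumes V: "V \<in> unitary_group N"
  shows "distr (haar N) (haar N) (mmul N V) = haar N"
proof (rule measure_eqI)
  fix A assume "A \<in> sets (distr (haar N) (haar N) (mmul N V))"
  then have A: "A \<in> sets (haar N)" by simp
  have m: "mmul N V \<in> measurable (haar N) (haar N)"
    using measurable_mmul_left[OF V] by (simp add: sets_haar cong: measurable_cong_sets)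
  show "emeasure (distr (haar N) (haar N) (mmul N V)) A = emeasure (haar N) A"
    using emeasure_haar_vimage[OF V] A by (simp add: emeasure_distr[OF m A] sets_haar)
qed simp

text \<open>Bounded measurable functions on the group form a class closed under arithmetic, so
  integrability of polynomial expressions in the entries follows by introduction rules
  alone.\<close>

definition bm :: "nat \<Rightarrow> ((nat \<Rightarrow> nat \<Rightarrow> complex) \<Rightarrow> complex) \<Rightarrow> bool" where
  "bm N f \<longleftrightarrow> f \<in> borel_measurable (uborel N) \<and> (\<exists>B. \<forall>U\<in>unitary_group N. cmod (f U) \<le> B)"

lemma bm_const: "bm N (\<lambda>_. c)"
  unfolding bm_def by auto

lemma bm_entry: "bm N (\<lambda>U. U i j)"
  unfolding bm_def by (intro conjI exI[of _ 1] ballI unitary_entry_le measurable_uborel_entry)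

lemma bm_add:
  assumes "bm N f" "bm N g" shows "bm N (\<lambda>U. f U + g U)"
proof -
  obtain B C where "\<forall>U\<in>unitary_group N. cmod (f U) \<le> B" "\<forall>U\<in>unitary_group N. cmod (g U) \<le> C"
    using assms by (auto simp: bm_def)
  then have "\<forall>U\<in>unitary_group N. cmod (f U + g U) \<le> B + C"
    by (meson add_mono norm_triangle_ineq order_trans)
  then show ?thesis using assms by (auto simp: bm_def)
qed

lemma bm_mult:
  assumes "bm N f" "bm N g" shows "bm N (\<lambda>U. f U * g U)"
proof -
  obtain B C where "\<forall>U\<in>unitary_group N. cmod (f U) \<le> B" "\<forall>U\<in>unitary_group N. cmod (g U) \<le> C"
    using assms by (auto simp: bm_def)
  then have "\<forall>U\<in>unitary_group N. cmod (f U * g U) \<le> B * C"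
    by (metis mult_mono' norm_ge_zero norm_mult)
  then show ?thesis using assms by (auto simp: bm_def)
qed

lemma bm_diff:
  assumes "bm N f" "bm N g" shows "bm N (\<lambda>U. f U - g U)"
  using bm_add[OF assms(1) bm_mult[OF bm_const[of N "-1"] assms(2)]] by simp

lemma bm_cnj:
  assumes "bm N f" shows "bm N (\<lambda>U. cnj (f U))"
proof -
  have "(\<lambda>U. cnj (f U)) \<in> borel_measurable (uborel N)"
    by (rule measurable_compose[of _ _ borel, OF _ borel_measurable_continuous_onI])
      (use assms in \<open>auto simp: bm_def intro!: continuous_intros\<close>)
  then show ?thesis using assms by (auto simp: bm_def)
qed

lemma bm_sum: "(\<And>i. i \<in> S \<Longrightarrow> bm N (f i)) \<Longrightarrow> bm N (\<lambda>U. \<Sum>i\<in>S. f i U)"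
  by (induction S rule: infinite_finite_induct) (simp_all add: bm_add bm_const)

lemma bm_prod: "(\<And>i. i \<in> S \<Longrightarrow> bm N (f i)) \<Longrightarrow> bm N (\<lambda>U. \<Prod>i\<in>S. f i U)"
  by (induction S rule: infinite_finite_induct) (simp_all add: bm_mult bm_const)

lemma bm_power: "bm N f \<Longrightarrow> bm N (\<lambda>U. f U ^ n)"
  by (induction n) (simp_all add: bm_mult bm_const)

lemma bm_mdet: "(\<And>i j. bm N (\<lambda>U. A U i j)) \<Longrightarrow> bm N (\<lambda>U. mdet N (A U))"
  unfolding mdet_def by (intro bm_sum bm_mult bm_const bm_prod)

lemma bm_integrable:
  assumes "bm N f" shows "integrable (haar N) f"
proof -
  interpret finite_measure "haar N" by (rule finite_measure_haar)
  obtain B where "\<forall>U\<in>unitary_group N. cmod (f U) \<le> B" using assms by (auto simp: bm_def)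
  moreover have "f \<in> borel_measurable (haar N)"
    using assms by (simp add: bm_def sets_haar cong: measurable_cong_sets)
  ultimately show ?thesis
    by (intro integrable_const_bound[where B=B]) auto
qed

lemma integral_haar_mmul:
  assumes V: "V \<in> unitary_group N" and f: "bm N f"
  shows "(\<integral>U. f (mmul N V U) \<partial>haar N) = (\<integral>U. f U \<partial>haar N)"
proof -
  have m: "mmul N V \<in> measurable (haar N) (haar N)"
    using measurable_mmul_left[OF V] by (simp add: sets_haar cong: measurable_cong_sets)
  have f': "f \<in> borel_measurable (haar N)"
    using f by (simp add: bm_def sets_haar cong: measurable_cong_sets)
  show ?thesis
    using integral_distr[OF m f'] distr_haar[OF V] by simp
qed

lemma integral_haar_const: "(\<integral>U. c \<partial>haar N) = (c :: complex)"
  using measure_haar[of N] by (simp add: scaleR_conv_of_real)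

subsection \<open>The reversed characteristic polynomial\<close>

text \<open>The polynomial \<open>det (1 + xU)\<close>. Its coefficients are the elementary
  symmetric functions of the eigenvalues, but are visibly polynomials in the entries of
  \<open>U\<close>, hence measurable and bounded.\<close>

definition dpoly :: "nat \<Rightarrow> (nat \<Rightarrow> nat \<Rightarrow> complex) \<Rightarrow> complex poly" where
  "dpoly N U = mdet N (\<lambda>i j. [:(if i = j then 1 else 0), U i j:])"

lemma poly_mdet: "poly (mdet N A) x = mdet N (\<lambda>i j. poly (A i j) x)"
  by (simp add: mdet_def poly_sum poly_prod)

lemma poly_dpoly: "poly (dpoly N U) x = mdet N (\<lambda>i j. (if i = j then 1 else 0) + x * U i j)"
  unfolding dpoly_def poly_mdet by simp

lemma mdet_cong: "(\<And>i j. i < N \<Longrightarrow> j < N \<Longrightarrow> A i j = B i j) \<Longrightarrow> mdet N A = mdet N B"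
  unfolding mdet_eq_det by (intro arg_cong[of _ _ Determinant.det] eq_matI) auto

lemma degree_dpoly: "degree (dpoly N U) \<le> N"
  using degree_det_le[of N "fmat N (\<lambda>i j. [:(if i = j then 1 else 0), U i j:])" 1]
  by (simp add: dpoly_def mdet_eq_det)

lemma mdet_scale: "mdet N (\<lambda>i j. c * A i j) = c ^ N * mdet N A"
  by (simp add: mdet_def prod.distrib sum_distrib_left mult_ac)

lemma mdet_uid: "mdet N (\<lambda>i j. if i = j then 1 else 0) = (1 :: complex)"
proof -
  have "mdet N (\<lambda>i j. if i = j then 1 else 0) = mdet N (uid N)"
    by (rule mdet_cong) (simp add: uid_def)
  then show ?thesis by (simp add: mdet_eq_det fmat_uid)
qed

lemma poly_dpoly_0 [simp]: "poly (dpoly N U) 0 = 1"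
  by (simp add: poly_dpoly mdet_uid)

lemma coeff_dpoly_0 [simp]: "coeff (dpoly N U) 0 = 1"
  using poly_dpoly_0[of N U] by (simp add: poly_0_coeff_0)

lemma coeff_prod_linear:
  fixes a b :: "nat \<Rightarrow> 'a::comm_ring_1"
  shows "coeff (\<Prod>i<n. [:a i, b i:]) n = (\<Prod>i<n. b i)"
proof (induction n)
  case (Suc n)
  have "degree (\<Prod>i<n. [:a i, b i:]) \<le> (\<Sum>i<n. degree [:a i, b i:])"
    using degree_prod_sum_le[of "{..<n}" "\<lambda>i. [:a i, b i:]"] by (simp add: o_def)
  also have "\<dots> \<le> (\<Sum>i<n. 1)" by (intro sum_mono) auto
  finally have "coeff (\<Prod>i<n. [:a i, b i:]) (Suc n) = 0" by (intro coeff_eq_0) simp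
  then show ?case using Suc by (simp add: mult.commute)
qed simp

lemma coeff_dpoly_N: "coeff (dpoly N U) N = mdet N U"
  unfolding dpoly_def mdet_def coeff_sum of_int_poly
  by (intro sum.cong refl) (simp add: coeff_prod_linear)

lemma bm_coeff_prod:
  "(\<And>i m. i \<in> S \<Longrightarrow> bm N (\<lambda>U. coeff (p i U) m)) \<Longrightarrow> bm N (\<lambda>U. coeff (\<Prod>i\<in>S. p i U) m)"
proof (induction S arbitrary: m rule: infinite_finite_induct)
  case (insert x F)
  then show ?case by (simp add: coeff_mult bm_sum bm_mult)
qed (simp_all add: bm_const)

lemma bm_coeff_dpoly:
  assumes "\<And>i j. bm N (\<lambda>U. A U i j)"
  shows "bm N (\<lambda>U. coeff (dpoly N (A U)) m)"
proof -
  have e: "bm N (\<lambda>U. coeff [:c, A U i j:] m)" for c i j m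
  proof (cases m)
    case (Suc m')
    then show ?thesis using assms by (cases m') (simp_all add: bm_const)
  qed (simp add: bm_const)
  show ?thesis
    unfolding dpoly_def mdet_def coeff_sum of_int_poly
    by (intro bm_sum, simp) (intro bm_mult bm_const bm_coeff_prod e)
qed

lemma bm_poly_dpoly:
  assumes "\<And>i j. bm N (\<lambda>U. A U i j)"
  shows "bm N (\<lambda>U. poly (dpoly N (A U)) x)"
  unfolding poly_dpoly using assms by (intro bm_mdet bm_add bm_mult bm_const)

lemma mdet_mmul: "mdet N (mmul N A B) = mdet N A * mdet N B"
  by (simp add: mdet_eq_det fmat_mmul) (rule Determinant.det_mult, auto)

lemma mdet_cnj: "mdet N (\<lambda>i j. cnj (A i j)) = cnj (mdet N A)"
  by (simp add: mdet_def)

lemma mdet_transpose: "mdet N (\<lambda>i j. A j i) = mdet N A"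
proof -
  have "fmat N (\<lambda>i j. A j i) = transpose_mat (fmat N A)" by (rule eq_matI) auto
  then show ?thesis by (simp add: mdet_eq_det det_transpose[of _ N])
qed

lemma mdet_uadj: "mdet N (uadj N U) = cnj (mdet N U)"
proof -
  have "mdet N (uadj N U) = mdet N (\<lambda>i j. cnj (U j i))" by (rule mdet_cong) (simp add: uadj_def)
  then show ?thesis using mdet_transpose[of N "\<lambda>i j. cnj (U i j)"] by (simp add: mdet_cnj)
qed

lemma mdet_unitary:
  assumes "U \<in> unitary_group N" shows "cnj (mdet N U) * mdet N U = 1"
proof -
  have "cnj (mdet N U) * mdet N U = mdet N (uid N)"
    by (simp add: mdet_uadj[symmetric] mdet_mmul[symmetric] mmul_uadj_left[OF assms])
  then show ?thesis by (simp add: mdet_eq_det fmat_uid)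
qed

lemma charpoly_eq: "charpoly N U = char_poly (fmat N U)"
proof -
  have "fmat N (\<lambda>i j. if i = j then [:- U i j, 1:] else [:- U i j:]) = char_poly_matrix (fmat N U)"
    by (rule eq_matI) (auto simp: char_poly_matrix_def)
  then show ?thesis by (simp add: charpoly_def mdet_eq_det char_poly_def)
qed

text \<open>With \<open>z = exp (-i theta)\<close>, each factor is \<open>z (1/z - e)\<close>. The
  characteristic polynomial has exactly \<open>N\<close> roots with multiplicity, so the product is
  \<open>z^N\<close> times its value at \<open>1/z\<close>, which is \<open>det (1 - zU)\<close>.
  The eigenvalue multiset disappears here for good.\<close>

lemma ZU_eq_dpoly: "ZU N U \<theta> = poly (dpoly N U) (- exp (- \<i> * complex_of_real \<theta>))"
proof -
  define z where "z = exp (- \<i> * complex_of_real \<theta>)"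
  have z: "z \<noteq> 0" by (simp add: z_def)
  let ?p = "charpoly N U"
  have deg: "degree ?p = N" "lead_coeff ?p = 1"
    using degree_monic_char_poly[of "fmat N U" N] by (auto simp: charpoly_eq)
  then have p: "(\<Prod>x\<in>#proots ?p. [:-x, 1:]) = ?p"
    using complex_poly_decompose_multiset[of ?p] by simp
  have sz: "size (proots ?p) = N"
    using size_proots_complex[of ?p] deg by simp
  have "ZU N U \<theta> = (\<Prod>e\<in>#proots ?p. 1 - e * z)"
    by (simp add: ZU_def eigenvalues_def z_def)
  also have "\<dots> = (\<Prod>e\<in>#proots ?p. z * (1 / z - e))"
    using z by (simp add: right_diff_distrib mult.commute)
  also have "\<dots> = z ^ N * (\<Prod>e\<in>#proots ?p. 1 / z - e)"
    by (simp add: prod_mset.distrib sz)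
  also have "(\<Prod>e\<in>#proots ?p. 1 / z - e) = poly (\<Prod>x\<in>#proots ?p. [:-x, 1:]) (1 / z)"
    by (simp add: poly_prod_mset image_mset.compositionality o_def)
  also have "\<dots> = poly ?p (1 / z)" by (simp only: p)
  also have "z ^ N * \<dots> = mdet N (\<lambda>i j. z * poly (if i = j then [:- U i j, 1:] else [:- U i j:]) (1 / z))"
    by (simp only: charpoly_def poly_mdet mdet_scale)
  also have "\<dots> = poly (dpoly N U) (- z)"
    unfolding poly_dpoly using z by (intro mdet_cong) (simp add: algebra_simps)
  finally show ?thesis by (simp add: z_def)
qed

lemma ZU_deriv: "vector_derivative (ZU N U) (at 0) = \<i> * poly (pderiv (dpoly N U)) (-1)"
proof -
  have "((\<lambda>t. poly (dpoly N U) (- exp (- \<i> * t))) has_field_derivative \<i> * poly (pderiv (dpoly N U)) (-1)) (at (of_real 0))"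
  proof -
    have "((\<lambda>t. - exp (- \<i> * t)) has_field_derivative \<i>) (at (of_real 0))"
      by (auto intro!: derivative_eq_intros)
    from DERIV_chain2[OF poly_DERIV this, of "dpoly N U"] show ?thesis by (simp add: mult.commute)
  qed
  then have "((\<lambda>t. poly (dpoly N U) (- exp (- \<i> * complex_of_real t))) has_vector_derivative \<i> * poly (pderiv (dpoly N U)) (-1)) (at 0)"
    by (rule has_vector_derivative_real_field)
  then have "(ZU N U has_vector_derivative \<i> * poly (pderiv (dpoly N U)) (-1)) (at 0)"
    by (simp add: ZU_eq_dpoly[abs_def])
  then show ?thesis by (rule vector_derivative_at)
qed

text \<open>The adjoint of \<open>1 - U\<close> is the adjoint of \<open>U\<close> times
  \<open>-(1 - U)\<close>; determinants give the functional equation. It replaces the conjugated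
  half of \<open>|Z|^(2k)\<close> by a power of \<open>cnj (det U)\<close>.\<close>

lemma cnj_dpoly_unitary:
  assumes "U \<in> unitary_group N"
  shows "cnj (poly (dpoly N U) (-1)) = (-1) ^ N * cnj (mdet N U) * poly (dpoly N U) (-1)"
proof -
  let ?D = "\<lambda>i j. (if i = j then 1 else 0) + (-1) * U i j"
  have "cnj (poly (dpoly N U) (-1)) = mdet N (uadj N ?D)"
    by (simp only: poly_dpoly mdet_uadj)
  also have "\<dots> = mdet N (mmul N (uadj N U) (\<lambda>i j. (-1) * ?D i j))"
  proof (rule mdet_cong)
    fix i j assume ij: "i < N" "j < N"
    have "(\<Sum>l<N. cnj (U l i) * U l j) = (if i = j then 1 else 0)"
      using assms ij by (simp add: unitary_group_def)
    moreover have "(\<Sum>l<N. cnj (U l i) * (if l = j then 1 else 0)) = cnj (U j i)"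
      using ij by (simp add: if_distrib cong: if_cong)
    ultimately show "uadj N ?D i j = mmul N (uadj N U) (\<lambda>i j. (-1) * ?D i j) i j"
      using ij by (simp add: uadj_def mmul_def right_diff_distrib sum_subtractf)
  qed
  also have "\<dots> = cnj (mdet N U) * ((-1) ^ N * poly (dpoly N U) (-1))"
    by (simp only: mdet_mmul mdet_uadj mdet_scale poly_dpoly)
  finally show ?thesis by simp
qed

section \<open>Mixed moments of the coefficients of \<open>det (1 + xU)\<close>\<close>

lemma poly_expand_le:
  fixes p :: "complex poly"
  shows "degree p \<le> N \<Longrightarrow> poly p x = (\<Sum>i\<le>N. coeff p i * x ^ i)"
  unfolding poly_altdef by (intro sum.mono_neutral_left) (auto simp: coeff_eq_0)

lemma poly_pderiv_expand:
  fixes p :: "complex poly"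
  assumes "degree p \<le> N"
  shows "x * poly (pderiv p) x = (\<Sum>i\<le>N. of_nat i * coeff p i * x ^ i)"
proof -
  have c: "coeff (pCons 0 (pderiv p)) i = of_nat i * coeff p i" for i
    by (cases i) (auto simp: coeff_pderiv)
  have "degree (pCons 0 (pderiv p)) \<le> N"
    by (rule degree_le) (use assms c in \<open>auto simp: coeff_eq_0\<close>)
  from poly_expand_le[OF this, of x] show ?thesis by (simp add: c)
qed

text \<open>The coefficient of the monomial with exponents \<open>m\<close> in the generating
  function of \<open>n\<close> variables.\<close>

definition mom :: "nat \<Rightarrow> nat \<Rightarrow> nat \<Rightarrow> (nat \<Rightarrow> nat) \<Rightarrow> complex" where
  "mom N k n m = (\<integral>U. cnj (mdet N U) ^ k * (\<Prod>j<n. coeff (dpoly N U) (m j)) \<partial>haar N)"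

definition exps :: "nat \<Rightarrow> nat \<Rightarrow> (nat \<Rightarrow> nat) set" where
  "exps n N = Pi\<^sub>E {..<n} (\<lambda>_. {..N})"

lemma finite_exps [simp]: "finite (exps n N)"
  by (simp add: exps_def finite_PiE)

lemma bm_mdet_id: "bm N (\<lambda>U. cnj (mdet N U) ^ k)"
  by (intro bm_power bm_cnj bm_mdet bm_entry)

lemma bm_mom: "bm N (\<lambda>U. cnj (mdet N U) ^ k * (\<Prod>j<n. coeff (dpoly N U) (m j)))"
  by (intro bm_mult bm_prod bm_coeff_dpoly bm_entry bm_mdet_id)

text \<open>The weights \<open>w\<close> allow each factor to be either a value of
  \<open>dpoly\<close> or its image under \<open>x d/dx\<close>, the latter multiplying the
  coefficient of index \<open>i\<close> by \<open>i\<close>.\<close>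

lemma integral_mom_expand:
  "(\<integral>U. cnj (mdet N U) ^ k * (\<Prod>j<n. \<Sum>i\<le>N. w j i * coeff (dpoly N U) i) \<partial>haar N) =
   (\<Sum>m\<in>exps n N. mom N k n m * (\<Prod>j<n. w j (m j)))"
proof -
  have "(\<integral>U. cnj (mdet N U) ^ k * (\<Prod>j<n. \<Sum>i\<le>N. w j i * coeff (dpoly N U) i) \<partial>haar N) =
    (\<integral>U. (\<Sum>m\<in>exps n N. (cnj (mdet N U) ^ k * (\<Prod>j<n. coeff (dpoly N U) (m j))) * (\<Prod>j<n. w j (m j))) \<partial>haar N)"
    unfolding exps_def by (simp add: prod_sum_PiE prod.distrib sum_distrib_left mult_ac)
  also have "\<dots> = (\<Sum>m\<in>exps n N. (\<integral>U. (cnj (mdet N U) ^ k * (\<Prod>j<n. coeff (dpoly N U) (m j))) * (\<Prod>j<n. w j (m j)) \<partial>haar N))"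
    by (intro Bochner_Integration.integral_sum bm_integrable bm_mult[OF bm_mom bm_const])
  finally show ?thesis by (simp add: mom_def)
qed

definition uscal :: "nat \<Rightarrow> complex \<Rightarrow> nat \<Rightarrow> nat \<Rightarrow> complex" where
  "uscal N z = (\<lambda>i j. z * uid N i j)"

lemma uscal_unitary: "cmod z = 1 \<Longrightarrow> uscal N z \<in> unitary_group N"
proof -
  assume z: "cmod z = 1"
  have "(\<Sum>l<N. cnj (uscal N z l i) * uscal N z l j) = (if i = j then 1 else 0)" if "i < N" "j < N" for i j
  proof -
    have "(\<Sum>l<N. cnj (uscal N z l i) * uscal N z l j) = (cnj z * z) * (\<Sum>l<N. cnj (uid N l i) * uid N l j)"
      by (simp add: uscal_def sum_distrib_left mult_ac)
    also have "cnj z * z = 1" using z by (simp add: cnj_mult_self)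
    finally show ?thesis using uid_unitary[of N] that by (simp add: unitary_group_def)
  qed
  then show ?thesis by (auto simp: unitary_group_def uscal_def uid_def)
qed

lemma mmul_uscal: "U \<in> unitary_group N \<Longrightarrow> mmul N (uscal N z) U = (\<lambda>i j. z * U i j)"
proof -
  assume U: "U \<in> unitary_group N"
  have "mmul N (uscal N z) U i j = z * mmul N (uid N) U i j" for i j
    by (simp add: mmul_def uscal_def sum_distrib_left mult.assoc)
  then show ?thesis by (simp add: mmul_uid_left_unitary[OF U] fun_eq_iff)
qed

lemma poly_dpoly_scale: "poly (dpoly N (\<lambda>i j. z * U i j)) x = poly (dpoly N U) (z * x)"
  unfolding poly_dpoly by (simp add: mult_ac)

lemma coeff_dpoly_scale: "coeff (dpoly N (\<lambda>i j. z * U i j)) m = z ^ m * coeff (dpoly N U) m"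
proof -
  have "dpoly N (\<lambda>i j. z * U i j) = pcompose (dpoly N U) [:0, z:]"
    by (rule poly_eq_poly_eq_iff[THEN iffD1])
      (simp add: fun_eq_iff poly_pcompose poly_dpoly_scale mult.commute)
  then show ?thesis by (simp add: coeff_pcompose_linear)
qed

text \<open>Rotating \<open>U\<close> by a scalar \<open>z\<close> of modulus 1 multiplies the
  integrand by \<open>cnj z ^ (kN)\<close> and by \<open>z\<close> to the total degree. Unless the
  two exponents agree, some \<open>z\<close> makes this factor -1.\<close>

lemma mom_homogeneous:
  assumes "mom N k n m \<noteq> 0"
  shows "(\<Sum>j<n. m j) = k * N"
proof (rule ccontr)
  define D where "D = (\<Sum>j<n. m j)"
  assume "(\<Sum>j<n. m j) \<noteq> k * N"
  then have "real D \<noteq> real (k * N)" unfolding D_def using of_nat_eq_iff by blast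
  then have ne: "real D - real (k * N) \<noteq> 0" by simp
  \<comment> \<open>The angle for which the difference of the two exponents produces a total
    rotation by \<open>pi\<close>.\<close>
  define t where "t = pi / (real D - real (k * N))"
  define z where "z = cis t"
  have V: "uscal N z \<in> unitary_group N" by (rule uscal_unitary) (simp add: z_def)
  have zz: "cnj z ^ (N * k) * z ^ D = -1"
  proof -
    have "cnj z ^ (N * k) * z ^ D = cis (real (N * k) * (- t) + real D * t)"
      by (simp only: z_def cis_cnj Complex.DeMoivre cis_mult)
    also have "real (N * k) * (- t) + real D * t = (real D - real (k * N)) * t" by (simp add: algebra_simps)
    also have "\<dots> = pi" using ne by (simp add: t_def)
    finally show ?thesis by simp
  qed
  have "mom N k n m = (\<integral>U. cnj (mdet N (mmul N (uscal N z) U)) ^ k * (\<Prod>j<n. coeff (dpoly N (mmul N (uscal N z) U)) (m j)) \<partial>haar N)"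
    unfolding mom_def by (rule integral_haar_mmul[OF V bm_mom, symmetric])
  also have "\<dots> = (\<integral>U. (cnj z ^ (N * k) * z ^ D) * (cnj (mdet N U) ^ k * (\<Prod>j<n. coeff (dpoly N U) (m j))) \<partial>haar N)"
    by (intro Bochner_Integration.integral_cong refl)
      (simp add: mmul_uscal coeff_dpoly_scale mdet_scale prod.distrib power_mult_distrib power_mult D_def power_sum[symmetric])
  also have "\<dots> = - mom N k n m"
    unfolding zz by (simp add: mom_def)
  finally have "mom N k n m = - mom N k n m" .
  then have "2 * mom N k n m = 0" unfolding mult_2 by (metis add.right_inverse)
  then show False using assms by simp
qed

text \<open>The lowest coefficient of \<open>dpoly\<close> is 1 and the highest is
  \<open>det U\<close>, so the integrand is \<open>|det U|^(2k) = 1\<close>. This is the only moment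
  evaluated directly, and it fixes the normalisation of F.\<close>

lemma mom_top: "mom N k (k + l) (\<lambda>j. if j < l then 0 else N) = 1"
proof -
  have "(\<Prod>j<k + l. coeff (dpoly N U) (if j < l then 0 else N)) = mdet N U ^ k" for U
  proof -
    have "(\<Prod>j<k + l. coeff (dpoly N U) (if j < l then 0 else N)) = (\<Prod>j\<in>{l..<k + l}. mdet N U)"
      by (rule prod.mono_neutral_cong_right) (auto simp: coeff_dpoly_N)
    then show ?thesis by simp
  qed
  then have "mom N k (k + l) (\<lambda>j. if j < l then 0 else N) = (\<integral>U. 1 \<partial>haar N)"
    unfolding mom_def
    by (intro Bochner_Integration.integral_cong refl)
       (simp add: power_mult_distrib[symmetric] mdet_unitary)
  then show ?thesis by (simp only: integral_haar_const)
qed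

lemma dpoly_neq_0: "dpoly N U \<noteq> 0"
  using coeff_dpoly_0[of N U] by fastforce

lemma sets_dpoly_zero: "{U \<in> unitary_group N. poly (dpoly N U) x = 0} \<in> sets (uborel N)"
proof -
  have "(\<lambda>U. poly (dpoly N U) x) \<in> borel_measurable (uborel N)"
    using bm_poly_dpoly[of N "\<lambda>U. U" x] bm_entry by (simp add: bm_def)
  from measurable_sets[OF this, of "{0}"] show ?thesis
    by (simp add: vimage_def Int_def conj_commute)
qed

text \<open>The rotated sets \<open>{U. det (1 - zU) = 0}\<close>, \<open>|z| = 1\<close>, all have the same measure, but a
  matrix lies in at most \<open>N\<close> of them.\<close>

lemma dpoly_zero_null: "emeasure (haar N) {U \<in> unitary_group N. poly (dpoly N U) (-1) = 0} = 0"
proof -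
  interpret finite_measure "haar N" by (rule finite_measure_haar)
  define S where "S x = {U \<in> unitary_group N. poly (dpoly N U) x = 0}" for x
  \<comment> \<open>Cayley transforms: infinitely many distinct points of the unit circle.\<close>
  define z :: "nat \<Rightarrow> complex" where "z t = (1 + \<i> * of_nat t) / (1 - \<i> * of_nat t)" for t
  have nz: "1 - \<i> * of_nat t \<noteq> 0" "1 + \<i> * of_nat t \<noteq> 0" for t :: nat
    by (auto simp: complex_eq_iff)
  have z1: "cmod (z t) = 1" for t
  proof -
    have "cnj (1 - \<i> * of_nat t) = 1 + \<i> * of_nat t" by simp
    then have "cmod (1 + \<i> * of_nat t) = cmod (1 - \<i> * of_nat t)" by (metis complex_mod_cnj)
    then show ?thesis using nz[of t] by (simp add: z_def norm_divide)
  qed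
  have zinj: "t = s" if "z t = z s" for t s
  proof -
    have "(1 + \<i> * of_nat t) * (1 - \<i> * of_nat s) = (1 + \<i> * of_nat s) * (1 - \<i> * of_nat t)"
      using that nz by (simp add: z_def frac_eq_eq)
    then have "2 * \<i> * (of_nat t - of_nat s) = 0" by (simp add: algebra_simps)
    then show ?thesis by simp
  qed
  have Ssets: "S x \<in> sets (haar N)" for x
    using sets_dpoly_zero by (simp add: S_def sets_haar)
  have eq: "emeasure (haar N) (S (- z t)) = emeasure (haar N) (S (-1))" for t
  proof -
    have "S (- z t) = mmul N (uscal N (z t)) -` S (-1) \<inter> unitary_group N"
      using mmul_unitary[OF uscal_unitary[OF z1[of t]]]
      by (auto simp: S_def mmul_uscal poly_dpoly_scale)
    then show ?thesis using emeasure_haar_vimage[OF uscal_unitary[OF z1[of t]], of "S (-1)"] Ssets by (simp add: sets_haar)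
  qed
  have bound: "real q * measure (haar N) (S (-1)) \<le> N" for q
  proof -
    have "real q * measure (haar N) (S (-1)) = (\<Sum>t<q. measure (haar N) (S (- z t)))"
      using eq by (simp add: measure_def)
    also have "\<dots> = (\<Sum>t<q. (\<integral>U. indicator (S (- z t)) U \<partial>haar N))"
    proof -
      have "S x \<inter> unitary_group N = S x" for x by (auto simp: S_def)
      then show ?thesis using Ssets by simp
    qed
    also have "\<dots> = (\<integral>U. (\<Sum>t<q. indicator (S (- z t)) U) \<partial>haar N)"
      by (rule Bochner_Integration.integral_sum[symmetric]) (use Ssets in \<open>auto simp: emeasure_finite less_top[symmetric]\<close>)
    also have "\<dots> \<le> (\<integral>U. real N \<partial>haar N)"
    proof (rule integral_mono)
      fix U assume U: "U \<in> space (haar N)"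
      have "(\<Sum>t<q. indicator (S (- z t)) U) = real (card {t. t < q \<and> poly (dpoly N U) (- z t) = 0})"
        using U by (simp add: S_def indicator_def sum.If_cases Int_def)
      also have "card {t. t < q \<and> poly (dpoly N U) (- z t) = 0} \<le> card {x. poly (dpoly N U) x = 0}"
        by (rule card_inj_on_le[where f="\<lambda>t. - z t"])
          (auto simp: inj_on_def zinj poly_roots_finite dpoly_neq_0)
      also have "\<dots> \<le> N" using card_poly_roots_bound[OF dpoly_neq_0, of N U] degree_dpoly[of N U] by linarith
      finally show "(\<Sum>t<q. indicator (S (- z t)) U) \<le> real N" by simp
    qed (use Ssets in \<open>auto simp: emeasure_finite less_top[symmetric]\<close>)
    also have "\<dots> = N" using measure_haar[of N] by simp
    finally show ?thesis .
  qed
  have "measure (haar N) (S (-1)) = 0"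
  proof (rule ccontr)
    assume "measure (haar N) (S (-1)) \<noteq> 0"
    then have p: "measure (haar N) (S (-1)) > 0" using measure_nonneg[of "haar N" "S (-1)"] by linarith
    then obtain q where "real N < real q * measure (haar N) (S (-1))"
      using reals_Archimedean3 by blast
    then show False using bound[of q] by simp
  qed
  then show ?thesis by (simp add: emeasure_eq_measure S_def)
qed

text \<open>Off the null set where Z vanishes, the integrand is a constant times
  \<open>cnj (det U) ^ k\<close>, \<open>r\<close> factors \<open>x d/dx det (1 + xU)\<close> and
  \<open>2k - r\<close> factors \<open>det (1 + xU)\<close>, all at \<open>x = -1\<close>. Since
  only moments of total degree \<open>kN\<close> survive, the signs \<open>(-1) ^ m j\<close>
  multiply to \<open>(-1) ^ (kN)\<close> and cancel the sign of the functional equation.\<close>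

lemma MN_eq_mom:
  assumes "r \<le> 2 * k"
  shows "MN N k r = (- \<i>) ^ r * (\<Sum>m\<in>exps (2 * k) N. mom N k (2 * k) m * (\<Prod>j<r. of_nat (m j)))"
proof -
  \<comment> \<open>The first \<open>r\<close> variables carry the derivative \<open>x d/dx\<close>,
    the others only the evaluation at -1.\<close>
  define w :: "nat \<Rightarrow> nat \<Rightarrow> complex" where "w j i = (if j < r then of_nat i else 1) * (-1) ^ i" for j i
  define c :: complex where "c = (-1) ^ (N * k) * (- \<i>) ^ r"
  let ?g = "\<lambda>U. c * (cnj (mdet N U) ^ k * (\<Prod>j<2 * k. \<Sum>i\<le>N. w j i * coeff (dpoly N U) i))"
  let ?f = "\<lambda>U. complex_of_real (cmod (ZU N U 0) ^ (2 * k)) * (vector_derivative (ZU N U) (at 0) / ZU N U 0) ^ r"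
  have eq: "?f U = ?g U" if U: "U \<in> unitary_group N" and nz: "poly (dpoly N U) (-1) \<noteq> 0" for U
  proof -
    let ?D = "dpoly N U"
    define Z where "Z = poly ?D (-1)"
    define Y where "Y = poly (pderiv ?D) (-1)"
    have Z0: "ZU N U 0 = Z" by (simp add: ZU_eq_dpoly Z_def)
    have S0: "(\<Sum>i\<le>N. (-1) ^ i * coeff ?D i) = Z"
      using poly_expand_le[OF degree_dpoly[of N U], of "-1"] by (simp add: Z_def mult.commute)
    have S1: "(\<Sum>i\<le>N. of_nat i * (-1) ^ i * coeff ?D i) = - Y"
      using poly_pderiv_expand[OF degree_dpoly[of N U], of "-1"] by (simp add: Y_def mult_ac)
    have "(\<Prod>j<2 * k. \<Sum>i\<le>N. w j i * coeff ?D i) = (\<Prod>j<2 * k. if j < r then - Y else Z)"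
      by (rule prod.cong) (auto simp: w_def S0 S1)
    also have "\<dots> = (- Y) ^ r * Z ^ (2 * k - r)"
    proof -
      have "{..<2 * k} \<inter> {j. j < r} = {..<r}" "{..<2 * k} \<inter> - {j. j < r} = {r..<2 * k}"
        using assms by auto
      then show ?thesis by (simp add: prod.If_cases)
    qed
    finally have g: "?g U = c * (cnj (mdet N U) ^ k * ((- Y) ^ r * Z ^ (2 * k - r)))" by simp
    have "complex_of_real (cmod Z ^ (2 * k)) = (cnj Z * Z) ^ k"
      by (simp add: cnj_mult_self power_mult)
    also have "\<dots> = (-1) ^ (N * k) * cnj (mdet N U) ^ k * Z ^ (2 * k)"
      unfolding cnj_dpoly_unitary[OF U, folded Z_def]
      by (simp add: power_mult_distrib power_mult power2_eq_square mult_ac)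
    finally have f: "?f U = (-1) ^ (N * k) * cnj (mdet N U) ^ k * Z ^ (2 * k) * (\<i> * Y / Z) ^ r"
      by (simp add: Z0 ZU_deriv Y_def)
    have "Z ^ (2 * k) = Z ^ (2 * k - r) * Z ^ r" using assms by (simp add: power_add[symmetric])
    then have "?f U = (-1) ^ (N * k) * cnj (mdet N U) ^ k * Z ^ (2 * k - r) * (\<i> * Y) ^ r"
      unfolding f using nz by (simp add: Z_def power_divide)
    also have "(\<i> * Y) ^ r = (- \<i>) ^ r * (- Y) ^ r" by (simp add: power_mult_distrib[symmetric])
    finally have "?f U = c * (cnj (mdet N U) ^ k * ((- Y) ^ r * Z ^ (2 * k - r)))"
      by (simp only: c_def mult_ac)
    also have "\<dots> = ?g U" by (rule g[symmetric])
    finally show ?thesis .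
  qed
  have bg: "bm N ?g"
    by (intro bm_mult bm_const bm_mdet_id bm_prod bm_sum bm_coeff_dpoly bm_entry)
  have ae: "AE U in haar N. ?f U = ?g U"
  proof (rule AE_I')
    show "{U \<in> unitary_group N. poly (dpoly N U) (-1) = 0} \<in> null_sets (haar N)"
      using dpoly_zero_null[of N] sets_dpoly_zero by (simp add: null_sets_def sets_haar)
    show "{U \<in> space (haar N). ?f U \<noteq> ?g U} \<subseteq> {U \<in> unitary_group N. poly (dpoly N U) (-1) = 0}"
      using eq by auto
  qed
  have mf: "?f \<in> borel_measurable (haar N)"
  proof -
    have "bm N (\<lambda>U. poly (dpoly N U) (-1))"
      by (intro bm_poly_dpoly bm_entry)
    from borel_measurable_integrable[OF bm_integrable[OF this]]
    have 1: "(\<lambda>U. poly (dpoly N U) (-1)) \<in> borel_measurable (haar N)" .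
    have p: "poly (pderiv (dpoly N U)) (-1) = 0 - (\<Sum>i\<le>N. of_nat i * coeff (dpoly N U) i * (-1) ^ i)" for U
      using poly_pderiv_expand[OF degree_dpoly[of N U], of "-1"]
      unfolding diff_0 by (metis minus_minus mult_minus1)
    have "bm N (\<lambda>U. poly (pderiv (dpoly N U)) (-1))"
      unfolding p by (intro bm_diff bm_const bm_sum bm_mult bm_coeff_dpoly bm_entry)
    from borel_measurable_integrable[OF bm_integrable[OF this]]
    have 2: "(\<lambda>U. poly (pderiv (dpoly N U)) (-1)) \<in> borel_measurable (haar N)" .
    note [measurable] = 1 2
    show ?thesis unfolding ZU_deriv ZU_eq_dpoly by simp
  qed
  have "MN N k r = (\<integral>U. ?g U \<partial>haar N)"
    unfolding MN_def using bm_integrable[OF bg] by (intro integral_cong_AE mf ae) auto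
  also have "\<dots> = c * (\<Sum>m\<in>exps (2 * k) N. mom N k (2 * k) m * (\<Prod>j<2 * k. w j (m j)))"
    by (simp add: integral_mom_expand)
  also have "(\<Sum>m\<in>exps (2 * k) N. mom N k (2 * k) m * (\<Prod>j<2 * k. w j (m j))) =
     (\<Sum>m\<in>exps (2 * k) N. (-1) ^ (k * N) * (mom N k (2 * k) m * (\<Prod>j<r. of_nat (m j))))"
  proof (rule sum.cong[OF refl])
    fix m
    have "(\<Prod>j<2 * k. w j (m j)) = (\<Prod>j<2 * k. if j < r then of_nat (m j) else 1) * (-1) ^ (\<Sum>j<2 * k. m j)"
      by (simp add: w_def prod.distrib power_sum)
    also have "(\<Prod>j<2 * k. if j < r then of_nat (m j) else (1::complex)) = (\<Prod>j<r. of_nat (m j))"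
      using assms by (intro prod.mono_neutral_cong_right) auto
    finally show "mom N k (2 * k) m * (\<Prod>j<2 * k. w j (m j)) = (-1) ^ (k * N) * (mom N k (2 * k) m * (\<Prod>j<r. of_nat (m j)))"
      using mom_homogeneous[of N k "2 * k" m] by (cases "mom N k (2 * k) m = 0") auto
  qed
  also have "c * \<dots> = ((-1) ^ (N * k) * (-1) ^ (k * N)) * ((- \<i>) ^ r * (\<Sum>m\<in>exps (2 * k) N. mom N k (2 * k) m * (\<Prod>j<r. of_nat (m j))))"
    by (simp only: c_def sum_distrib_left[symmetric] mult_ac)
  also have "(-1) ^ (N * k) * (-1) ^ (k * N) = (1 :: complex)"
    by (simp add: mult.commute[of k N] power_mult_distrib[symmetric])
  finally show ?thesis by simp
qed

subsection \<open>Rank one perturbations\<close>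

text \<open>One block matrix is factored into triangular block matrices in two ways, one for each
  side.\<close>

lemma det_sylvester:
  fixes A B :: "'a::idom mat"
  assumes A: "A \<in> carrier_mat n m" and B: "B \<in> carrier_mat m n"
  shows "Determinant.det (1\<^sub>m n + A * B) = Determinant.det (1\<^sub>m m + B * A)"
proof -
  let ?P = "four_block_mat (1\<^sub>m m) (- B) A (1\<^sub>m n)"
  have AB: "A * (- B) = - (A * B)" "(- B) * A = - (B * A)"
    using A B by auto
  let ?L = "four_block_mat (1\<^sub>m m) (0\<^sub>m m n) A (1\<^sub>m n)"
  let ?R1 = "four_block_mat (1\<^sub>m m) (- B) (0\<^sub>m n m) (1\<^sub>m n + A * B)"
  let ?R2 = "four_block_mat (1\<^sub>m m + B * A) (- B) (0\<^sub>m n m) (1\<^sub>m n)"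
  have L: "Determinant.det ?L = 1"
    using A by (subst det_four_block_mat_upper_right_zero[of _ m _ n]) auto
  have R1: "Determinant.det ?R1 = Determinant.det (1\<^sub>m n + A * B)"
    using A B by (subst det_four_block_mat_lower_left_zero[of _ m _ n]) auto
  have R2: "Determinant.det ?R2 = Determinant.det (1\<^sub>m m + B * A)"
    using A B by (subst det_four_block_mat_lower_left_zero[of _ m _ n]) auto
  have "?L * ?R1 = ?P"
    using A B AB
    by (subst mult_four_block_mat[of _ m m _ n _ n _ _ m _ n]) (auto intro!: arg_cong2[where f="four_block_mat _ _"] eq_matI)
  then have "Determinant.det ?P = Determinant.det (?L * ?R1)" by simp
  also have "\<dots> = Determinant.det ?L * Determinant.det ?R1"
    using A B by (intro det_mult[of _ "m + n"] four_block_carrier_mat) auto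
  finally have 1: "Determinant.det ?P = Determinant.det (1\<^sub>m n + A * B)" by (simp add: L R1)
  have "?R2 * ?L = ?P"
    using A B AB
    by (subst mult_four_block_mat[of _ m m _ n _ n _ _ m _ n]) (auto intro!: arg_cong2[where f="\<lambda>x y. four_block_mat x _ _ y"] eq_matI)
  then have "Determinant.det ?P = Determinant.det (?R2 * ?L)" by simp
  also have "\<dots> = Determinant.det ?R2 * Determinant.det ?L"
    using A B by (intro det_mult[of _ "m + n"] four_block_carrier_mat) auto
  finally have 2: "Determinant.det ?P = Determinant.det (1\<^sub>m m + B * A)" by (simp add: L R2)
  show ?thesis using 1 2 by simp
qed

lemma det_one_plus_outer:
  fixes u b :: "nat \<Rightarrow> 'a::idom"
  shows "Determinant.det (mat n n (\<lambda>(i, j). (if i = j then 1 else 0) + u i * b j)) = 1 + (\<Sum>i<n. b i * u i)"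
proof -
  let ?A = "mat n 1 (\<lambda>(i, _). u i)" and ?B = "mat 1 n (\<lambda>(_, j). b j)"
  have "mat n n (\<lambda>(i, j). (if i = j then 1 else 0) + u i * b j) = 1\<^sub>m n + ?A * ?B"
    by (rule eq_matI) (auto simp: scalar_prod_def)
  then have "Determinant.det (mat n n (\<lambda>(i, j). (if i = j then 1 else 0) + u i * b j)) = Determinant.det (1\<^sub>m 1 + ?B * ?A)"
    using det_sylvester[of ?A n 1 ?B] by simp
  also have "\<dots> = (1\<^sub>m 1 + ?B * ?A) $$ (0, 0)"
    by (rule det_single) auto
  finally show ?thesis by (simp add: scalar_prod_def atLeast0LessThan)
qed

text \<open>\<open>A + a b^T = A (1 + (K a) b^T)\<close>, and the second factor is covered by
  \<open>det_one_plus_outer\<close>.\<close>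

lemma det_rank_one_update:
  fixes A K :: "'a::idom mat"
  assumes A: "A \<in> carrier_mat n n" and K: "K \<in> carrier_mat n n" and AK: "A * K = 1\<^sub>m n"
  shows "Determinant.det (mat n n (\<lambda>(i, j). A $$ (i, j) + a i * b j)) =
    Determinant.det A * (1 + (\<Sum>i<n. \<Sum>j<n. b i * K $$ (i, j) * a j))"
proof -
  define u where "u i = (\<Sum>j<n. K $$ (i, j) * a j)" for i
  let ?C = "mat n n (\<lambda>(i, j). (if i = j then 1 else 0) + u i * b j)"
  have Au: "(\<Sum>l<n. A $$ (i, l) * u l) = a i" if i: "i < n" for i
  proof -
    have "(\<Sum>l<n. A $$ (i, l) * u l) = (\<Sum>j<n. (\<Sum>l<n. A $$ (i, l) * K $$ (l, j)) * a j)"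
      unfolding u_def sum_distrib_left sum_distrib_right by (subst sum.swap) (simp add: mult_ac)
    also have "\<dots> = (\<Sum>j<n. (A * K) $$ (i, j) * a j)"
      using A K i by (intro sum.cong refl) (simp add: scalar_prod_def atLeast0LessThan)
    also have "\<dots> = (\<Sum>j<n. if i = j then a j else 0)"
      unfolding AK using i by (intro sum.cong refl) simp
    finally show ?thesis using i by simp
  qed
  have "mat n n (\<lambda>(i, j). A $$ (i, j) + a i * b j) = A * ?C"
  proof (rule eq_matI)
    fix i j assume "i < dim_row (A * ?C)" "j < dim_col (A * ?C)"
    then have ij: "i < n" "j < n" using A by auto
    have "(A * ?C) $$ (i, j) = (\<Sum>l<n. A $$ (i, l) * ((if l = j then 1 else 0) + u l * b j))"
      using A ij by (simp add: scalar_prod_def atLeast0LessThan)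
    also have "\<dots> = (\<Sum>l<n. if l = j then A $$ (i, l) else 0) + (\<Sum>l<n. A $$ (i, l) * u l) * b j"
      unfolding sum_distrib_right sum.distrib[symmetric]
      by (intro sum.cong refl) (simp add: algebra_simps)
    also have "\<dots> = A $$ (i, j) + a i * b j" using ij by (simp add: Au)
    finally show "mat n n (\<lambda>(i, j). A $$ (i, j) + a i * b j) $$ (i, j) = (A * ?C) $$ (i, j)"
      using ij by simp
  qed (use A in auto)
  then have "Determinant.det (mat n n (\<lambda>(i, j). A $$ (i, j) + a i * b j)) = Determinant.det A * Determinant.det ?C"
    using A by (simp add: det_mult[of _ n])
  also have "Determinant.det ?C = 1 + (\<Sum>i<n. b i * u i)" by (rule det_one_plus_outer)
  finally show ?thesis by (simp add: u_def sum_distrib_left mult_ac)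
qed

definition minv :: "'a::field mat \<Rightarrow> 'a mat" where
  "minv A = inverse (Determinant.det A) \<cdot>\<^sub>m adj_mat A"

lemma minv:
  assumes A: "A \<in> carrier_mat n n" and "Determinant.det A \<noteq> 0"
  shows "minv A \<in> carrier_mat n n" "A * minv A = 1\<^sub>m n" "minv A * A = 1\<^sub>m n"
proof -
  note a = adj_mat[OF A]
  show "minv A \<in> carrier_mat n n" using a by (simp add: minv_def)
  have "A * minv A = inverse (Determinant.det A) \<cdot>\<^sub>m (A * adj_mat A)"
    unfolding minv_def by (rule mult_smult_distrib[OF A a(1)])
  then show "A * minv A = 1\<^sub>m n" using assms(2) unfolding a(2) by (auto intro!: eq_matI)
  have "minv A * A = inverse (Determinant.det A) \<cdot>\<^sub>m (adj_mat A * A)"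
    unfolding minv_def by (rule mult_smult_assoc_mat[OF a(1) A])
  then show "minv A * A = 1\<^sub>m n" using assms(2) unfolding a(3) by (auto intro!: eq_matI)
qed

definition amat :: "nat \<Rightarrow> (nat \<Rightarrow> nat \<Rightarrow> complex) \<Rightarrow> complex \<Rightarrow> complex mat" where
  "amat N U x = fmat N (\<lambda>i j. (if i = j then 1 else 0) + x * U i j)"

text \<open>The resolvent \<open>x U (1 + xU)^-1\<close>. Its trace is the logarithmic derivative
  \<open>x d/dx log det (1 + xU)\<close>, and its quadratic forms give the effect of rank one
  perturbations of \<open>U\<close>.\<close>

definition rmat :: "nat \<Rightarrow> (nat \<Rightarrow> nat \<Rightarrow> complex) \<Rightarrow> complex \<Rightarrow> complex mat" where
  "rmat N U x = x \<cdot>\<^sub>m (fmat N U * minv (amat N U x))"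

lemma amat_carrier [simp]: "amat N U x \<in> carrier_mat N N"
  by (simp add: amat_def)

lemma det_amat: "Determinant.det (amat N U x) = poly (dpoly N U) x"
  by (simp add: amat_def poly_dpoly mdet_eq_det)

text \<open>For small \<open>x\<close> a kernel vector of \<open>1 + xU\<close> is contradicted in
  the row of its largest entry, the entries of \<open>U\<close> having modulus at most 1. Such a
  neighbourhood of 0 suffices, since the identities proved on it are identities between
  polynomials.\<close>

lemma poly_dpoly_nonzero:
  assumes U: "U \<in> unitary_group N" and x: "cmod x * (N + 1) < 1"
  shows "poly (dpoly N U) x \<noteq> 0"
proof
  assume "poly (dpoly N U) x = 0"
  then have "Determinant.det (amat N U x) = 0" by (simp add: det_amat)
  then obtain v where v: "v \<in> carrier_vec N" "v \<noteq> 0\<^sub>v N" "amat N U x *\<^sub>v v = 0\<^sub>v N"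
    using det_0_iff_vec_prod_zero[OF amat_carrier] by blast
  define f where "f i = cmod (vec_index v i)" for i
  obtain i0 where i0: "i0 < N" "vec_index v i0 \<noteq> 0" using v(1,2) by (metis carrier_vecD eq_vecI index_zero_vec)
  have "Max (f ` {..<N}) \<in> f ` {..<N}" using i0 by (intro Max_in) auto
  then obtain m where m: "Max (f ` {..<N}) = f m" "m \<in> {..<N}" by (rule imageE)
  have fm: "f i \<le> f m" if "i < N" for i unfolding m(1)[symmetric] using that by (intro Max_ge) auto
  have "f i0 > 0" using i0(2) by (simp add: f_def)
  then have pos: "f m > 0" using fm[OF i0(1)] by linarith
  have "vec_index (amat N U x *\<^sub>v v) m = (\<Sum>j<N. ((if m = j then 1 else 0) + x * U m j) * vec_index v j)"
    using m v(1) by (simp add: amat_def scalar_prod_def atLeast0LessThan)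
  also have "\<dots> = (\<Sum>j<N. if m = j then vec_index v j else 0) + (\<Sum>j<N. x * U m j * vec_index v j)"
    unfolding sum.distrib[symmetric] by (intro sum.cong refl) (simp add: algebra_simps)
  also have "(\<Sum>j<N. if m = j then vec_index v j else 0) = vec_index v m" using m by simp
  finally have "vec_index v m = - (\<Sum>j<N. x * U m j * vec_index v j)"
    using v(3) m by (simp add: eq_neg_iff_add_eq_0)
  then have "f m = cmod (\<Sum>j<N. x * U m j * vec_index v j)" by (simp add: f_def)
  also have "\<dots> \<le> (\<Sum>j<N. cmod (x * U m j * vec_index v j))" by (rule norm_sum)
  also have "\<dots> \<le> (\<Sum>j<N. cmod x * 1 * f m)"
    unfolding norm_mult using unitary_entry_le[OF U] fm unfolding f_def
    by (intro sum_mono mult_mono) auto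
  also have "\<dots> = cmod x * N * f m" by simp
  also have "\<dots> \<le> cmod x * (N + 1) * f m" using pos by (intro mult_right_mono mult_left_mono) auto
  also have "\<dots> < 1 * f m" using x pos by (intro mult_strict_right_mono)
  finally show False by simp
qed

definition outer :: "nat \<Rightarrow> (nat \<Rightarrow> complex) \<Rightarrow> complex \<Rightarrow> nat \<Rightarrow> nat \<Rightarrow> complex" where
  "outer N v w = (\<lambda>i j. if i < N \<and> j < N then (if i = j then 1 else 0) + w * v i * cnj (v j) else 0)"

definition qform :: "nat \<Rightarrow> (nat \<Rightarrow> complex) \<Rightarrow> complex mat \<Rightarrow> complex" where
  "qform N v R = (\<Sum>i<N. \<Sum>j<N. cnj (v i) * R $$ (i, j) * v j)"

definition tr :: "nat \<Rightarrow> complex mat \<Rightarrow> complex" where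
  "tr N R = (\<Sum>i<N. R $$ (i, i))"

lemma mdet_outer: "mdet N (outer N v w) = 1 + w * (\<Sum>i<N. (cmod (v i))\<^sup>2)"
proof -
  have "fmat N (outer N v w) = mat N N (\<lambda>(i, j). (if i = j then 1 else 0) + (w * v i) * cnj (v j))"
    by (rule eq_matI) (auto simp: outer_def)
  then have "mdet N (outer N v w) = 1 + (\<Sum>i<N. cnj (v i) * (w * v i))"
    by (simp only: mdet_eq_det det_one_plus_outer)
  also have "(\<Sum>i<N. cnj (v i) * (w * v i)) = w * (\<Sum>i<N. cnj (v i) * v i)"
    by (simp add: sum_distrib_left mult_ac)
  finally show ?thesis unfolding of_real_sum cnj_mult_self .
qed

text \<open>The matrix multiplies \<open>v\<close> by \<open>z\<close> and fixes its orthogonal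
  complement. In terms of \<open>w\<close> and \<open>s = |v|^2\<close>, unitarity is the equation
  \<open>w + cnj w + |w|^2 s = 0\<close>.\<close>

lemma outer_unitary:
  assumes z: "cmod z = 1" and s: "s = (\<Sum>i<N. (cmod (v i))\<^sup>2)" "s \<noteq> 0"
  shows "outer N v ((z - 1) / of_real s) \<in> unitary_group N"
proof -
  define w where "w = (z - 1) / complex_of_real s"
  have ss: "(\<Sum>l<N. cnj (v l) * v l) = of_real s"
    unfolding s of_real_sum cnj_mult_self ..
  have ww: "w + cnj w + cnj w * w * of_real s = 0"
  proof -
    have "cnj z * z = 1" using z by (simp add: cnj_mult_self)
    then have "cnj (z - 1) * (z - 1) = 2 - z - cnj z" by (simp add: algebra_simps)
    moreover have "(w + cnj w + cnj w * w * of_real s) * of_real s = (z - 1) + cnj (z - 1) + cnj (z - 1) * (z - 1)"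
      using s(2) by (simp add: w_def field_simps)
    ultimately have "(w + cnj w + cnj w * w * of_real s) * of_real s = 0" by simp
    then show ?thesis using s(2) by simp
  qed
  have "(\<Sum>l<N. cnj (outer N v w l i) * outer N v w l j) = (if i = j then 1 else 0)" if ij: "i < N" "j < N" for i j
  proof -
    have "(\<Sum>l<N. cnj (outer N v w l i) * outer N v w l j) =
      (\<Sum>l<N. (if l = i then (if l = j then 1 else 0) else 0) + (if l = i then w * v l * cnj (v j) else 0)
        + (if l = j then cnj w * cnj (v l) * v i else 0) + cnj w * w * v i * cnj (v j) * (cnj (v l) * v l))"
      using ij by (intro sum.cong refl) (auto simp: outer_def algebra_simps)
    also have "\<dots> = (if i = j then 1 else 0) + w * v i * cnj (v j) + cnj w * cnj (v j) * v i
       + cnj w * w * v i * cnj (v j) * of_real s"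
      using ij by (simp add: sum.distrib sum_distrib_left[symmetric] ss)
    also have "\<dots> = (if i = j then 1 else 0) + (w + cnj w + cnj w * w * of_real s) * (v i * cnj (v j))"
      by (simp add: algebra_simps)
    finally show ?thesis unfolding ww by simp
  qed
  then show ?thesis unfolding w_def[symmetric] by (auto simp: unitary_group_def outer_def)
qed

text \<open>\<open>1 + x (1 + w v v^H) U\<close> is a rank one update of \<open>1 + xU\<close>. The
  result is affine in \<open>w\<close> for every complex \<open>w\<close>, whether or not the
  perturbing matrix is unitary; so products over the variables are polynomials in
  \<open>w\<close>.\<close>

lemma poly_dpoly_outer:
  assumes U: "U \<in> unitary_group N" and x: "cmod x * (N + 1) < 1"
  shows "poly (dpoly N (mmul N (outer N v w) U)) x = poly (dpoly N U) x * (1 + w * qform N v (rmat N U x))"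
proof -
  let ?A = "amat N U x" and ?K = "minv (amat N U x)"
  have dA: "Determinant.det ?A \<noteq> 0" using poly_dpoly_nonzero[OF U x] by (simp add: det_amat)
  note K = minv[OF amat_carrier dA]
  define b where "b j = x * (\<Sum>i<N. cnj (v i) * U i j)" for j
  have XU: "mmul N (outer N v w) U i j = U i j + w * v i * (\<Sum>l<N. cnj (v l) * U l j)" if "i < N" "j < N" for i j
  proof -
    have "mmul N (outer N v w) U i j = (\<Sum>l<N. (if i = l then U l j else 0) + w * v i * (cnj (v l) * U l j))"
      using that unfolding mmul_def by (auto simp: outer_def algebra_simps intro!: sum.cong)
    then show ?thesis using that by (simp add: sum.distrib sum_distrib_left)
  qed
  have "poly (dpoly N (mmul N (outer N v w) U)) x = Determinant.det (mat N N (\<lambda>(i, j). ?A $$ (i, j) + (w * v i) * b j))"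
    unfolding poly_dpoly mdet_eq_det
    by (intro arg_cong[of _ _ Determinant.det] eq_matI) (auto simp: XU amat_def b_def algebra_simps)
  also have "\<dots> = poly (dpoly N U) x * (1 + (\<Sum>i<N. \<Sum>j<N. b i * ?K $$ (i, j) * (w * v j)))"
    unfolding det_rank_one_update[OF amat_carrier K(1,2)] det_amat ..
  also have "(\<Sum>i<N. \<Sum>j<N. b i * ?K $$ (i, j) * (w * v j)) = w * qform N v (rmat N U x)"
  proof -
    have "qform N v (rmat N U x) = (\<Sum>i<N. \<Sum>j<N. \<Sum>l<N. cnj (v i) * (x * (U i l * ?K $$ (l, j))) * v j)"
      unfolding qform_def rmat_def using K(1)
      by (intro sum.cong refl) (simp add: scalar_prod_def atLeast0LessThan sum_distrib_left sum_distrib_right)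
    also have "\<dots> = (\<Sum>l<N. \<Sum>j<N. \<Sum>i<N. cnj (v i) * (x * (U i l * ?K $$ (l, j))) * v j)"
      by (subst sum.swap, subst (2) sum.swap, subst sum.swap) simp
    also have "\<dots> = (\<Sum>l<N. \<Sum>j<N. b l * ?K $$ (l, j) * v j)"
      by (simp add: b_def sum_distrib_left sum_distrib_right mult_ac)
    finally show ?thesis by (simp add: sum_distrib_left mult_ac)
  qed
  finally show ?thesis .
qed

lemma rmat_carrier:
  assumes U: "U \<in> unitary_group N" and x: "cmod x * (N + 1) < 1"
  shows "rmat N U x \<in> carrier_mat N N"
  using minv(1)[OF amat_carrier] poly_dpoly_nonzero[OF U x] unfolding rmat_def
  by (auto simp: det_amat intro!: smult_carrier_mat mult_carrier_mat)

text \<open>The resolvent identity: with \<open>A = 1 + xU\<close> and \<open>B = 1 + yU\<close>,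
  \<open>A^-1 - B^-1 = A^-1 (B - A) B^-1\<close> and \<open>B - A = (y - x) U\<close>. It expresses
  the trace of a product through single traces, so no new unknowns enter the differential
  equation.\<close>

lemma tr_resolvent:
  assumes U: "U \<in> unitary_group N" and x: "cmod x * (N + 1) < 1" and y: "cmod y * (N + 1) < 1"
  shows "(y - x) * tr N (rmat N U x * rmat N U y) = y * tr N (rmat N U x) - x * tr N (rmat N U y)"
proof -
  let ?A = "amat N U x" and ?B = "amat N U y" and ?M = "fmat N U"
  let ?K = "minv ?A" and ?L = "minv ?B"
  have M: "?M \<in> carrier_mat N N" by simp
  have "Determinant.det ?A \<noteq> 0" "Determinant.det ?B \<noteq> 0"
    using poly_dpoly_nonzero[OF U] x y by (auto simp: det_amat)
  note K = minv[OF amat_carrier this(1)] and L = minv[OF amat_carrier this(2)]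
  have BA: "?B - ?A = (y - x) \<cdot>\<^sub>m ?M"
    by (rule eq_matI) (auto simp: amat_def algebra_simps)
  have "?K * (?B - ?A) * ?L = ?K * ?B * ?L - ?K * ?A * ?L"
    using K(1) L(1) by (simp add: mult_minus_distrib_mat[of _ N N _ N] minus_mult_distrib_mat[of _ N N _ _ N])
  also have "\<dots> = ?K - ?L"
    using K L by (simp add: assoc_mult_mat[of _ N N _ N _ N])
  finally have KL: "(y - x) \<cdot>\<^sub>m (?K * ?M * ?L) = ?K - ?L"
    using K(1) L(1) unfolding BA by (simp add: mult_smult_distrib[of _ N N _ N] mult_smult_assoc_mat[of _ N N _ N])
  have "(y - x) \<cdot>\<^sub>m (rmat N U x * rmat N U y) = (x * y) \<cdot>\<^sub>m (?M * ((y - x) \<cdot>\<^sub>m (?K * ?M * ?L)))"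
  proof -
    have cK: "?M * ?K \<in> carrier_mat N N" and cL: "?M * ?L \<in> carrier_mat N N" and KML: "?K * ?M * ?L \<in> carrier_mat N N"
      using K(1) L(1) by auto
    have "rmat N U x * rmat N U y = x \<cdot>\<^sub>m (y \<cdot>\<^sub>m ((?M * ?K) * (?M * ?L)))"
      unfolding rmat_def mult_smult_assoc_mat[OF cK smult_carrier_mat[OF cL]] mult_smult_distrib[OF cK cL] ..
    also have "(?M * ?K) * (?M * ?L) = ?M * (?K * ?M * ?L)"
      by (simp only: assoc_mult_mat[OF M K(1) cL] assoc_mult_mat[OF K(1) M L(1)])
    finally show ?thesis unfolding mult_smult_distrib[OF M KML]
      using KML by (intro eq_matI) (auto simp: mult_ac)
  qed
  also have "\<dots> = (x * y) \<cdot>\<^sub>m (?M * ?K - ?M * ?L)"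
    unfolding KL using K(1) L(1) by (simp add: mult_minus_distrib_mat[of _ N N _ N])
  finally have e: "(y - x) \<cdot>\<^sub>m (rmat N U x * rmat N U y) = (x * y) \<cdot>\<^sub>m (?M * ?K - ?M * ?L)" .
  have "(y - x) * tr N (rmat N U x * rmat N U y) = tr N ((y - x) \<cdot>\<^sub>m (rmat N U x * rmat N U y))"
    using rmat_carrier[OF U x] rmat_carrier[OF U y] by (simp add: tr_def sum_distrib_left)
  also have "\<dots> = y * tr N (rmat N U x) - x * tr N (rmat N U y)"
    unfolding e using K(1) L(1) by (simp add: tr_def rmat_def sum_distrib_left sum_subtractf[symmetric] algebra_simps)
  finally show ?thesis .
qed


lemma coeff_1_prod_linear:
  fixes b :: "nat \<Rightarrow> 'a::comm_ring_1"
  shows "coeff (\<Prod>i<n. [:1, b i:]) 1 = (\<Sum>i<n. b i) \<and> coeff (\<Prod>i<n. [:1, b i:]) 0 = 1"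
  by (induction n) (auto simp: mult.commute)

text \<open>A permutation other than the identity moves at least two points, and each moved point
  contributes a factor without constant term; so only the identity reaches degree 1.\<close>

lemma coeff_1_dpoly: "coeff (dpoly N M) 1 = (\<Sum>i<N. M i i)"
proof -
  let ?f = "\<lambda>p i. [:(if i = p i then 1 else 0), M i (p i):]"
  have 0: "coeff (\<Prod>i<N. ?f p i) 1 = 0" if p: "p permutes {..<N}" "p \<noteq> id" for p
  proof -
    obtain a where a: "p a \<noteq> a" using p(2) by (auto simp: fun_eq_iff)
    then have aN: "a \<in> {..<N}" using p(1) by (metis permutes_not_in)
    have pa: "p a \<in> {..<N}" "p (p a) \<noteq> p a"
      using permutes_in_image[OF p(1)] aN a permutes_inj[OF p(1)] by (auto dest: injD)
    have "(\<Prod>i<N. ?f p i) = ?f p a * (?f p (p a) * (\<Prod>i\<in>{..<N} - {a} - {p a}. ?f p i))"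
      using aN pa a by (simp only: prod.remove[of "{..<N}" a] prod.remove[of "{..<N} - {a}" "p a"] finite_lessThan finite_Diff Diff_iff singleton_iff simp_thms)
    also have "\<dots> = [:0, 1:] * ([:0, 1:] * ([:M a (p a) * M (p a) (p (p a)):] * (\<Prod>i\<in>{..<N} - {a} - {p a}. ?f p i)))"
      using a pa by (simp add: mult.commute[of "M a (p a)"])
    finally show ?thesis by simp
  qed
  have "coeff (dpoly N M) 1 = (\<Sum>p | p permutes {..<N}. of_int (sign p) * coeff (\<Prod>i<N. ?f p i) 1)"
    unfolding dpoly_def mdet_def coeff_sum of_int_poly by simp
  also have "\<dots> = (\<Sum>p\<in>{id}. of_int (sign p) * coeff (\<Prod>i<N. ?f p i) 1)"
    by (rule sum.mono_neutral_right) (auto simp: finite_permutations permutes_id 0[unfolded One_nat_def])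
  also have "\<dots> = (\<Sum>i<N. M i i)"
    using coeff_1_prod_linear[of "\<lambda>i. M i i" N] by simp
  finally show ?thesis .
qed

text \<open>Jacobi's formula: \<open>det (1 + (x + h) U) = det A det (1 + h A^-1 U)\<close> with
  \<open>A = 1 + xU\<close>, compared in the coefficient of \<open>h\<close>.\<close>

lemma tr_rmat:
  assumes U: "U \<in> unitary_group N" and x: "cmod x * (N + 1) < 1"
  shows "x * poly (pderiv (dpoly N U)) x = poly (dpoly N U) x * tr N (rmat N U x)"
proof -
  let ?A = "amat N U x" and ?K = "minv (amat N U x)" and ?M = "fmat N U"
  have dA: "Determinant.det ?A \<noteq> 0" using poly_dpoly_nonzero[OF U x] by (simp add: det_amat)
  note K = minv[OF amat_carrier dA]
  define W where "W i j = (?K * ?M) $$ (i, j)" for i j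
  have "poly (pcompose (dpoly N U) [:x, 1:]) h = poly (Polynomial.smult (poly (dpoly N U) x) (dpoly N W)) h" for h
  proof -
    have "amat N U (x + h) = ?A + h \<cdot>\<^sub>m ?M"
      by (rule eq_matI) (auto simp: amat_def algebra_simps)
    also have "\<dots> = ?A * (1\<^sub>m N + h \<cdot>\<^sub>m (?K * ?M))"
    proof -
      have "?A * (1\<^sub>m N + h \<cdot>\<^sub>m (?K * ?M)) = ?A * 1\<^sub>m N + ?A * (h \<cdot>\<^sub>m (?K * ?M))"
        using K(1) by (intro mult_add_distrib_mat[of _ N N _ N]) auto
      also have "?A * (h \<cdot>\<^sub>m (?K * ?M)) = h \<cdot>\<^sub>m (?A * (?K * ?M))"
        using K(1) by (intro mult_smult_distrib[of _ N N _ N]) auto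
      also have "?A * (?K * ?M) = (?A * ?K) * ?M"
        using K(1) by (intro assoc_mult_mat[of _ N N _ N _ N, symmetric]) auto
      finally show ?thesis using K(2) right_mult_one_mat[OF amat_carrier[of N U x]] by simp
    qed
    finally have "poly (dpoly N U) (x + h) = Determinant.det (?A * (1\<^sub>m N + h \<cdot>\<^sub>m (?K * ?M)))"
      by (simp only: det_amat[symmetric])
    also have "\<dots> = Determinant.det ?A * Determinant.det (1\<^sub>m N + h \<cdot>\<^sub>m (?K * ?M))"
      using K(1) by (intro det_mult[of _ N]) auto
    also have "1\<^sub>m N + h \<cdot>\<^sub>m (?K * ?M) = fmat N (\<lambda>i j. (if i = j then 1 else 0) + h * W i j)"
      using K(1) by (intro eq_matI) (auto simp: W_def)
    finally show ?thesis by (simp add: poly_pcompose det_amat poly_dpoly[of N W] mdet_eq_det)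
  qed
  then have "pcompose (dpoly N U) [:x, 1:] = Polynomial.smult (poly (dpoly N U) x) (dpoly N W)"
    by (intro poly_eq_poly_eq_iff[THEN iffD1]) (simp add: fun_eq_iff)
  then have "coeff (pderiv (pcompose (dpoly N U) [:x, 1:])) 0 = poly (dpoly N U) x * (\<Sum>i<N. W i i)"
    by (simp add: coeff_pderiv coeff_1_dpoly[unfolded One_nat_def])
  moreover have "coeff (pderiv (pcompose (dpoly N U) [:x, 1:])) 0 = poly (pderiv (dpoly N U)) x"
    by (simp add: pderiv_pcompose pderiv_pCons poly_0_coeff_0[symmetric] poly_pcompose)
  moreover have "tr N (rmat N U x) = x * (\<Sum>i<N. W i i)"
  proof -
    have "(\<Sum>i<N. W i i) = (\<Sum>i<N. \<Sum>j<N. ?K $$ (i, j) * U j i)"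
      using K(1) by (intro sum.cong refl) (simp add: W_def scalar_prod_def atLeast0LessThan)
    also have "\<dots> = (\<Sum>i<N. (?M * ?K) $$ (i, i))"
      using K(1) by (subst sum.swap, intro sum.cong refl) (simp add: scalar_prod_def atLeast0LessThan mult.commute)
    finally show ?thesis using K(1) by (simp add: tr_def rmat_def sum_distrib_left)
  qed
  ultimately show ?thesis by (simp add: mult_ac)
qed

section \<open>The second order identity from translation invariance\<close>

definition pairsum :: "nat \<Rightarrow> (nat \<Rightarrow> complex) \<Rightarrow> (nat \<Rightarrow> nat \<Rightarrow> complex) \<Rightarrow> complex" where
  "pairsum n d f = (\<Sum>j<n. \<Sum>l\<in>{..<n} - {j}. f j l * (\<Prod>i\<in>{..<n} - {j} - {l}. d i))"

lemma pairsum_sum: "(\<Sum>i\<in>I. pairsum n d (h i)) = pairsum n d (\<lambda>j l. \<Sum>i\<in>I. h i j l)"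
  unfolding pairsum_def by (subst sum.swap, rule sum.cong[OF refl], subst sum.swap) (simp add: sum_distrib_right)

lemma pairsum_mult: "c * pairsum n d h = pairsum n d (\<lambda>j l. c * h j l)"
  unfolding pairsum_def by (simp add: sum_distrib_left mult.assoc)

lemma pairsum_diff: "pairsum n d h - pairsum n d h' = pairsum n d (\<lambda>j l. h j l - h' j l)"
  unfolding pairsum_def by (simp add: sum_subtractf left_diff_distrib)

text \<open>Second derivative of the product at 0. The factor 2 reflects that \<open>pairsum\<close>
  runs over ordered pairs.\<close>

lemma coeff_2_prod_linear:
  "2 * coeff (\<Prod>j<n. [:d j, b j:]) 2 = pairsum n d (\<lambda>j l. b j * b l)"
proof -
  let ?P = "\<Prod>j<n. [:d j, b j:]"
  have "2 * coeff ?P 2 = poly (pderiv (pderiv ?P)) 0"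
    by (simp add: poly_0_coeff_0 coeff_pderiv numeral_2_eq_2)
  also have "pderiv (pderiv ?P) = (\<Sum>j<n. (\<Sum>l\<in>{..<n} - {j}. (\<Prod>i\<in>{..<n} - {j} - {l}. [:d i, b i:]) * [:b l:]) * [:b j:])"
    by (simp add: pderiv_prod pderiv_sum pderiv_smult pderiv_pCons)
  also have "poly \<dots> 0 = pairsum n d (\<lambda>j l. b j * b l)"
    unfolding pairsum_def poly_sum poly_mult poly_prod sum_distrib_right
    by (intro sum.cong refl) (simp add: mult_ac)
  finally show ?thesis .
qed

lemma degree_prod_linear_le: "degree (\<Prod>j<n. [:d j, b j:] :: complex poly) \<le> n"
proof -
  have "degree (\<Prod>j<n. [:d j, b j:] :: complex poly) \<le> (\<Sum>j<n. degree [:d j, b j:])"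
    using degree_prod_sum_le[of "{..<n}" "\<lambda>i. [:d i, b i:]"] by (simp add: o_def)
  also have "\<dots> \<le> (\<Sum>j<n. 1)" by (intro sum_mono) auto
  finally show ?thesis by simp
qed

lemma infinite_unit_circle: "infinite {z :: complex. cmod z = 1}"
proof
  assume "finite {z :: complex. cmod z = 1}"
  then have "finite (range (\<lambda>t::nat. (1 + \<i> * of_nat t) / (1 - \<i> * of_nat t) :: complex))"
  proof (rule finite_subset[rotated], safe)
    fix t :: nat
    have "1 - \<i> * of_nat t \<noteq> 0" by (auto simp: complex_eq_iff)
    moreover have "cnj (1 - \<i> * of_nat t) = 1 + \<i> * of_nat t" by simp
    then have "cmod (1 + \<i> * of_nat t) = cmod (1 - \<i> * of_nat t)" by (metis complex_mod_cnj)
    ultimately show "cmod ((1 + \<i> * of_nat t) / (1 - \<i> * of_nat t)) = 1" by (simp add: norm_divide)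
  qed
  moreover have "inj (\<lambda>t::nat. (1 + \<i> * of_nat t) / (1 - \<i> * of_nat t) :: complex)"
  proof (rule injI)
    fix t s :: nat
    assume *: "(1 + \<i> * of_nat t) / (1 - \<i> * of_nat t) = ((1 + \<i> * of_nat s) / (1 - \<i> * of_nat s) :: complex)"
    have "1 - \<i> * of_nat t \<noteq> 0" "1 - \<i> * of_nat s \<noteq> 0" by (auto simp: complex_eq_iff)
    with * have "(1 + \<i> * of_nat t) * (1 - \<i> * of_nat s) = (1 + \<i> * of_nat s) * (1 - \<i> * of_nat t)"
      by (simp add: frac_eq_eq)
    then have "2 * \<i> * (of_nat t - of_nat s) = 0" by (simp add: algebra_simps)
    then show "t = s" by simp
  qed
  ultimately show False using finite_imageD by blast
qed

lemma poly_eqI_infinite: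
  fixes p q :: "complex poly"
  assumes "infinite S" "\<And>w. w \<in> S \<Longrightarrow> poly p w = poly q w"
  shows "p = q"
proof (rule ccontr)
  assume "p \<noteq> q"
  then have "finite {w. poly (p - q) w = 0}" by (intro poly_roots_finite) simp
  moreover have "S \<subseteq> {w. poly (p - q) w = 0}" using assms(2) by auto
  ultimately show False using assms(1) finite_subset by blast
qed

definition dval :: "nat \<Rightarrow> (nat \<Rightarrow> complex) \<Rightarrow> (nat \<Rightarrow> nat \<Rightarrow> complex) \<Rightarrow> nat \<Rightarrow> complex" where
  "dval N x U j = poly (dpoly N U) (x j)"

text \<open>The slope in \<open>w\<close> of the affine function in \<open>poly_dpoly_outer\<close>,
  read off at \<open>w = 1\<close>, although \<open>outer N v 1\<close> is in general not
  unitary.\<close>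

definition bval :: "nat \<Rightarrow> (nat \<Rightarrow> complex) \<Rightarrow> (nat \<Rightarrow> complex) \<Rightarrow> (nat \<Rightarrow> nat \<Rightarrow> complex) \<Rightarrow> nat \<Rightarrow> complex" where
  "bval N x v U j = poly (dpoly N (mmul N (outer N v 1) U)) (x j) - poly (dpoly N U) (x j)"

text \<open>Twice the coefficient of \<open>w^2\<close> in \<open>(1 + w |v|^2)^k\<close>, the
  \<open>k\<close>-th power of the determinant of \<open>1 + w v v^H\<close>.\<close>

definition kap :: "nat \<Rightarrow> nat \<Rightarrow> (nat \<Rightarrow> complex) \<Rightarrow> complex" where
  "kap N k v = 2 * coeff ([:1, complex_of_real (\<Sum>i<N. (cmod (v i))\<^sup>2):] ^ k) 2"

lemma bm_mmul: "bm N (\<lambda>U. mmul N X U i j)"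
  unfolding mmul_def by (cases "i < N \<and> j < N") (auto intro!: bm_sum bm_mult bm_const bm_entry)

lemma bm_dval: "bm N (\<lambda>U. dval N x U j)"
  unfolding dval_def by (intro bm_poly_dpoly bm_entry)

lemma bm_bval: "bm N (\<lambda>U. bval N x v U j)"
  unfolding bval_def by (intro bm_diff bm_poly_dpoly bm_entry bm_mmul)

lemma bm_pairsum:
  "(\<And>j. bm N (\<lambda>U. d U j)) \<Longrightarrow> (\<And>j l. bm N (\<lambda>U. f U j l)) \<Longrightarrow> bm N (\<lambda>U. pairsum n (d U) (f U))"
  unfolding pairsum_def by (intro bm_sum bm_mult bm_prod)

text \<open>The integral of the left translate by the unitary matrix \<open>1 + w vv\<^sup>*\<close> with
  \<open>w = (z - 1)/|v|\<^sup>2\<close> is a polynomial in \<open>w\<close>, and comparing the coefficients of \<open>w\<^sup>2\<close> gives the claim.\<close>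

lemma integral_pairsum_bval:
  assumes x: "\<And>j. j < n \<Longrightarrow> cmod (x j) * real (N + 1) < 1"
  shows "(\<integral>U. cnj (mdet N U) ^ k * pairsum n (dval N x U) (\<lambda>j l. bval N x v U j * bval N x v U l) \<partial>haar N)
     = kap N k v * (\<integral>U. cnj (mdet N U) ^ k * (\<Prod>j<n. dval N x U j) \<partial>haar N)"
proof -
  define s where "s = (\<Sum>i<N. (cmod (v i))\<^sup>2)"
  define F where "F = (\<integral>U. cnj (mdet N U) ^ k * (\<Prod>j<n. dval N x U j) \<partial>haar N)"
  define P where "P U = (\<Prod>j<n. [:dval N x U j, bval N x v U j:])" for U
  have bmP: "bm N (\<lambda>U. coeff (P U) i)" for i
  proof -
    have "bm N (\<lambda>U. coeff [:dval N x U j, bval N x v U j:] m)" for j m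
    proof (cases m)
      case (Suc m')
      then show ?thesis by (cases m') (simp_all add: bm_const bm_bval)
    qed (simp add: bm_dval)
    then show ?thesis unfolding P_def by (intro bm_coeff_prod)
  qed
  have dw: "poly (dpoly N (mmul N (outer N v w) U)) (x j) = dval N x U j + w * bval N x v U j"
    if "U \<in> unitary_group N" "j < n" for U w j
    using poly_dpoly_outer[OF that(1) x[OF that(2)], of v w] poly_dpoly_outer[OF that(1) x[OF that(2)], of v 1]
    by (simp add: dval_def bval_def algebra_simps)
  have main: "(\<integral>U. cnj (mdet N U) ^ k * coeff (P U) 2 \<partial>haar N) = coeff ([:1, of_real s:] ^ k) 2 * F"
  \<comment> \<open>For \<open>v = 0\<close> the choice \<open>w = (z - 1) / |v|^2\<close> is
    meaningless; the perturbation is then trivial and both second order coefficients are 0.\<close>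
  proof (cases "s = 0")
    case True
    have "v i = 0" if "i < N" for i
      using True that unfolding s_def by (subst (asm) sum_nonneg_eq_0_iff) auto
    then have "outer N v 1 = outer N (\<lambda>_. 0) 0" by (auto simp: outer_def fun_eq_iff)
    then have "bval N x v U j = 0" if "U \<in> unitary_group N" "j < n" for U j
      using dw[OF that, of 1] poly_dpoly_outer[OF that(1) x[OF that(2)], of "\<lambda>_. 0" 0] by (simp add: dval_def)
    then have "P U = [:\<Prod>j<n. dval N x U j:]" if "U \<in> unitary_group N" for U
    proof -
      have "P U = (\<Prod>j<n. [:dval N x U j:])"
        unfolding P_def using \<open>\<And>U j. _ \<Longrightarrow> _ \<Longrightarrow> bval N x v U j = 0\<close> that by (intro prod.cong) auto
      moreover have "(\<Prod>j<q. [:c j:]) = [:\<Prod>j<q. c j:]" for q and c :: "nat \<Rightarrow> complex"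
        by (induction q) (auto simp: one_pCons mult.commute)
      ultimately show ?thesis by simp
    qed
    then have "(\<integral>U. cnj (mdet N U) ^ k * coeff (P U) 2 \<partial>haar N) = (\<integral>U. 0 \<partial>haar N)"
      by (intro Bochner_Integration.integral_cong refl) (simp add: numeral_2_eq_2)
    moreover have "coeff ([:1, of_real s:] ^ k :: complex poly) 2 = 0"
      using True by (simp add: one_pCons[symmetric] numeral_2_eq_2)
    ultimately show ?thesis by simp
  next
    case False
    define Q where "Q = (\<Sum>i\<le>n. monom (\<integral>U. cnj (mdet N U) ^ k * coeff (P U) i \<partial>haar N) i)"
    define S where "S = (\<lambda>z. (z - 1) / complex_of_real s) ` {z. cmod z = 1}"
    have inf: "infinite S"
    proof -
      have "inj_on (\<lambda>z. (z - 1) / complex_of_real s) {z. cmod z = 1}"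
        using False by (intro inj_onI) (simp add: divide_cancel_right)
      then show ?thesis unfolding S_def using infinite_unit_circle finite_imageD by blast
    qed
    have "poly Q w = poly (Polynomial.smult F ([:1, of_real s:] ^ k)) w" if wS: "w \<in> S" for w
    proof -
      obtain z where z: "cmod z = 1" "w = (z - 1) / of_real s" using wS by (auto simp: S_def)
      have X: "outer N v w \<in> unitary_group N" unfolding z(2) by (rule outer_unitary[OF z(1) s_def False])
      have zz: "z * cnj z = 1" using z(1) by (simp add: complex_norm_square[symmetric])
      have dX: "mdet N (outer N v w) = z"
        using False unfolding mdet_outer s_def[symmetric] z(2) by simp
      have "poly Q w = (\<Sum>i\<le>n. (\<integral>U. cnj (mdet N U) ^ k * coeff (P U) i * w ^ i \<partial>haar N))"
        unfolding Q_def by (simp add: poly_sum poly_monom)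
      also have "\<dots> = (\<integral>U. (\<Sum>i\<le>n. cnj (mdet N U) ^ k * coeff (P U) i * w ^ i) \<partial>haar N)"
        by (intro Bochner_Integration.integral_sum[symmetric] bm_integrable bm_mult bm_mdet_id bmP bm_const)
      also have "\<dots> = (\<integral>U. z ^ k * (cnj (mdet N (mmul N (outer N v w) U)) ^ k * (\<Prod>j<n. dval N x (mmul N (outer N v w) U) j)) \<partial>haar N)"
      proof (intro Bochner_Integration.integral_cong refl)
        fix U assume "U \<in> space (haar N)"
        then have U: "U \<in> unitary_group N" by simp
        have "(\<Sum>i\<le>n. cnj (mdet N U) ^ k * coeff (P U) i * w ^ i) = cnj (mdet N U) ^ k * poly (P U) w"
          using poly_expand_le[of "P U" n w] degree_prod_linear_le[of "dval N x U" "bval N x v U" n]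
          by (simp add: P_def sum_distrib_left mult.assoc)
        also have "poly (P U) w = (\<Prod>j<n. dval N x (mmul N (outer N v w) U) j)"
          unfolding P_def poly_prod using dw[OF U, of _ w]
          by (intro prod.cong refl) (simp add: dval_def[of N x "mmul N (outer N v w) U"])
        finally have e: "(\<Sum>i\<le>n. cnj (mdet N U) ^ k * coeff (P U) i * w ^ i) =
          cnj (mdet N U) ^ k * (\<Prod>j<n. dval N x (mmul N (outer N v w) U) j)" .
        \<comment> \<open>The perturbing matrix has determinant \<open>z\<close> of modulus 1, so
          passing to the translated determinant costs \<open>z ^ k\<close>; as
          \<open>z = 1 + w s\<close>, this is the polynomial in \<open>w\<close> on the other
          side.\<close>
        have cn: "cnj (mdet N U) ^ k = z ^ k * cnj (mdet N (mmul N (outer N v w) U)) ^ k"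
          using zz by (simp add: mdet_mmul dX power_mult_distrib[symmetric] mult.assoc[symmetric])
        show "(\<Sum>i\<le>n. cnj (mdet N U) ^ k * coeff (P U) i * w ^ i) =
          z ^ k * (cnj (mdet N (mmul N (outer N v w) U)) ^ k * (\<Prod>j<n. dval N x (mmul N (outer N v w) U) j))"
          unfolding e unfolding cn by (rule mult.assoc)
      qed
      also have "\<dots> = z ^ k * F"
        unfolding F_def using integral_haar_mmul[OF X, of "\<lambda>U. cnj (mdet N U) ^ k * (\<Prod>j<n. dval N x U j)"]
        by (simp add: bm_mult bm_mdet_id bm_prod bm_dval)
      also have "\<dots> = poly (Polynomial.smult F ([:1, of_real s:] ^ k)) w"
        using False by (simp add: z(2) poly_power)
      finally show ?thesis .
    qed
    then have Q: "Q = Polynomial.smult F ([:1, of_real s:] ^ k)" by (rule poly_eqI_infinite[OF inf])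
    show ?thesis
    proof (cases "2 \<le> n")
      case True
      have "coeff Q 2 = (\<integral>U. cnj (mdet N U) ^ k * coeff (P U) 2 \<partial>haar N)"
        using True unfolding Q_def coeff_sum coeff_monom by (subst sum.delta) auto
      then show ?thesis unfolding Q by (simp add: mult.commute)
    next
      case False
      then have "coeff Q 2 = 0" unfolding Q_def coeff_sum coeff_monom by (subst sum.delta) auto
      moreover have "coeff (P U) 2 = 0" for U
        using degree_prod_linear_le[of "dval N x U" "bval N x v U" n] False unfolding P_def by (intro coeff_eq_0) simp
      ultimately show ?thesis unfolding Q by auto
    qed
  qed
  have "(\<integral>U. cnj (mdet N U) ^ k * pairsum n (dval N x U) (\<lambda>j l. bval N x v U j * bval N x v U l) \<partial>haar N)
     = (\<integral>U. 2 * (cnj (mdet N U) ^ k * coeff (P U) 2) \<partial>haar N)"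
    unfolding P_def coeff_2_prod_linear[symmetric] by (simp add: mult_ac)
  also have "\<dots> = 2 * (\<integral>U. cnj (mdet N U) ^ k * coeff (P U) 2 \<partial>haar N)" by simp
  finally show ?thesis unfolding main F_def[symmetric] by (simp add: kap_def s_def)
qed

definition evec :: "nat \<Rightarrow> complex \<Rightarrow> nat \<Rightarrow> nat \<Rightarrow> complex" where
  "evec a w b = (\<lambda>i. (if i = a then 1 else 0) + w * (if i = b then 1 else 0))"

lemma qform_evec:
  assumes "a < N" "b < N"
  shows "qform N (evec a w b) R = R $$ (a, a) + w * R $$ (a, b) + cnj w * R $$ (b, a) + cnj w * w * R $$ (b, b)"
proof -
  have "qform N (evec a w b) R = (\<Sum>i<N. \<Sum>j<N.
      (if i = a then if j = a then R $$ (i, j) else 0 else 0) + w * (if i = a then if j = b then R $$ (i, j) else 0 else 0)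
      + cnj w * (if i = b then if j = a then R $$ (i, j) else 0 else 0) + cnj w * w * (if i = b then if j = b then R $$ (i, j) else 0 else 0))"
    unfolding qform_def evec_def by (intro sum.cong refl) (simp add: algebra_simps)
  also have "\<dots> = R $$ (a, a) + w * R $$ (a, b) + cnj w * R $$ (b, a) + cnj w * w * R $$ (b, b)"
  proof -
    have "(\<Sum>i<N. \<Sum>j<N. if i = c then if j = d then R $$ (i, j) else 0 else 0) = R $$ (c, d)"
      if "c < N" "d < N" for c d
    proof -
      have "(\<Sum>j<N. if i = c then if j = d then R $$ (i, j) else 0 else 0) = (if i = c then R $$ (i, d) else 0)" for i
        using that by (cases "i = c") auto
      then show ?thesis using that by simp
    qed
    then show ?thesis using assms by (simp add: sum.distrib sum_distrib_left[symmetric])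
  qed
  finally show ?thesis .
qed

text \<open>Averages the quadratic forms over \<open>v = e\<^sub>a + w e\<^sub>b\<close>, \<open>w \<in> {1,-1,i,-i}\<close>: only the terms
  invariant under the phase of \<open>w\<close> survive.\<close>

lemma qform_average:
  assumes R: "R \<in> carrier_mat N N" and S: "S \<in> carrier_mat N N"
  shows "(\<Sum>w\<in>{1, -1, \<i>, -\<i>}. \<Sum>a<N. \<Sum>b<N. qform N (evec a w b) R * qform N (evec a w b) S)
    - 8 * of_nat N * (\<Sum>a<N. qform N (evec a 0 a) R * qform N (evec a 0 a) S)
    = 8 * (tr N R * tr N S + tr N (R * S))"
proof -
  have four: "(\<Sum>w\<in>{1, -1, \<i>, -\<i>}. g w) = g 1 + g (-1) + g \<i> + g (-\<i>)" for g :: "complex \<Rightarrow> complex"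
    by (simp add: complex_eq_iff)
  have "(\<Sum>w\<in>{1, -1, \<i>, -\<i>}. \<Sum>a<N. \<Sum>b<N. qform N (evec a w b) R * qform N (evec a w b) S) =
    (\<Sum>a<N. \<Sum>b<N. \<Sum>w\<in>{1, -1, \<i>, -\<i>}. qform N (evec a w b) R * qform N (evec a w b) S)"
    by (subst sum.swap, rule sum.cong[OF refl], rule sum.swap)
  also have "\<dots> = (\<Sum>a<N. \<Sum>b<N. 4 * (R $$ (a, a) * S $$ (a, a) + R $$ (b, b) * S $$ (b, b))
     + 4 * (R $$ (a, a) * S $$ (b, b) + R $$ (b, b) * S $$ (a, a)) + 4 * (R $$ (a, b) * S $$ (b, a) + R $$ (b, a) * S $$ (a, b)))"
  proof (intro sum.cong refl)
    fix a b assume "a \<in> {..<N}" "b \<in> {..<N}"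
    then have ab: "a < N" "b < N" by auto
    show "(\<Sum>w\<in>{1, -1, \<i>, -\<i>}. qform N (evec a w b) R * qform N (evec a w b) S) =
      4 * (R $$ (a, a) * S $$ (a, a) + R $$ (b, b) * S $$ (b, b))
     + 4 * (R $$ (a, a) * S $$ (b, b) + R $$ (b, b) * S $$ (a, a)) + 4 * (R $$ (a, b) * S $$ (b, a) + R $$ (b, a) * S $$ (a, b))"
      unfolding four qform_evec[OF ab] by (simp add: algebra_simps)
  qed
  \<comment> \<open>The first sum is not a combination of traces. It equals the contribution of the
    vectors \<open>e_a\<close> alone, which the statement subtracts.\<close>
  also have "\<dots> = 8 * of_nat N * (\<Sum>a<N. R $$ (a, a) * S $$ (a, a)) + 8 * (tr N R * tr N S) + 8 * (\<Sum>a<N. \<Sum>b<N. R $$ (a, b) * S $$ (b, a))"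
  proof -
    have 1: "(\<Sum>a<N. \<Sum>b<N. R $$ (a, a) * S $$ (a, a) + R $$ (b, b) * S $$ (b, b)) = 2 * of_nat N * (\<Sum>a<N. R $$ (a, a) * S $$ (a, a))"
      by (simp add: sum.distrib sum_distrib_left mult.assoc)
    have 2: "(\<Sum>a<N. \<Sum>b<N. R $$ (a, a) * S $$ (b, b) + R $$ (b, b) * S $$ (a, a)) = 2 * (tr N R * tr N S)"
    proof -
      have "(\<Sum>a<N. \<Sum>b<N. R $$ (b, b) * S $$ (a, a)) = (\<Sum>a<N. \<Sum>b<N. R $$ (a, a) * S $$ (b, b))" by (rule sum.swap)
      then show ?thesis unfolding tr_def sum_product mult_2 sum.distrib by (simp only:)
    qed
    have 3: "(\<Sum>a<N. \<Sum>b<N. R $$ (a, b) * S $$ (b, a) + R $$ (b, a) * S $$ (a, b)) = 2 * (\<Sum>a<N. \<Sum>b<N. R $$ (a, b) * S $$ (b, a))"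
    proof -
      have "(\<Sum>a<N. \<Sum>b<N. R $$ (b, a) * S $$ (a, b)) = (\<Sum>a<N. \<Sum>b<N. R $$ (a, b) * S $$ (b, a))" by (rule sum.swap)
      then show ?thesis unfolding mult_2 sum.distrib by (simp only:)
    qed
    have "(\<Sum>a<N. \<Sum>b<N. 4 * (R $$ (a, a) * S $$ (a, a) + R $$ (b, b) * S $$ (b, b))
     + 4 * (R $$ (a, a) * S $$ (b, b) + R $$ (b, b) * S $$ (a, a)) + 4 * (R $$ (a, b) * S $$ (b, a) + R $$ (b, a) * S $$ (a, b))) =
     4 * (\<Sum>a<N. \<Sum>b<N. R $$ (a, a) * S $$ (a, a) + R $$ (b, b) * S $$ (b, b)) +
     4 * (\<Sum>a<N. \<Sum>b<N. R $$ (a, a) * S $$ (b, b) + R $$ (b, b) * S $$ (a, a)) +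
     4 * (\<Sum>a<N. \<Sum>b<N. R $$ (a, b) * S $$ (b, a) + R $$ (b, a) * S $$ (a, b))"
      by (simp only: sum.distrib sum_distrib_left distrib_left)
    then show ?thesis unfolding 1 2 3 by simp
  qed
  also have "(\<Sum>a<N. \<Sum>b<N. R $$ (a, b) * S $$ (b, a)) = tr N (R * S)"
    using R S unfolding tr_def by (intro sum.cong refl) (simp add: scalar_prod_def atLeast0LessThan)
  finally have "(\<Sum>w\<in>{1, -1, \<i>, -\<i>}. \<Sum>a<N. \<Sum>b<N. qform N (evec a w b) R * qform N (evec a w b) S) =
     8 * of_nat N * (\<Sum>a<N. R $$ (a, a) * S $$ (a, a)) + 8 * (tr N R * tr N S) + 8 * tr N (R * S)" .
  moreover have "(\<Sum>a<N. qform N (evec a 0 a) R * qform N (evec a 0 a) S) = (\<Sum>a<N. R $$ (a, a) * S $$ (a, a))"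
    by (intro sum.cong refl) (simp add: qform_evec)
  ultimately show ?thesis by (simp add: algebra_simps)
qed


text \<open>For weight 1 this is F; the weight \<open>m j\<close> is the effect of
  \<open>x_j d/dx_j\<close>, and products of such weights that of iterated derivatives.\<close>

definition msum :: "nat \<Rightarrow> nat \<Rightarrow> nat \<Rightarrow> ((nat \<Rightarrow> nat) \<Rightarrow> complex) \<Rightarrow> (nat \<Rightarrow> complex) \<Rightarrow> complex" where
  "msum N k n \<phi> x = (\<Sum>m\<in>exps n N. mom N k n m * \<phi> m * (\<Prod>j<n. x j ^ m j))"

lemma integral_eq_msum:
  "(\<integral>U. cnj (mdet N U) ^ k * (\<Prod>j<n. if j \<in> S then x j * poly (pderiv (dpoly N U)) (x j) else dval N x U j) \<partial>haar N)
   = msum N k n (\<lambda>m. \<Prod>j\<in>{..<n} \<inter> S. of_nat (m j)) x"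
proof -
  define w :: "nat \<Rightarrow> nat \<Rightarrow> complex" where "w j i = (if j \<in> S then of_nat i else 1) * x j ^ i" for j i
  have "(\<Prod>j<n. if j \<in> S then x j * poly (pderiv (dpoly N U)) (x j) else dval N x U j) =
    (\<Prod>j<n. \<Sum>i\<le>N. w j i * coeff (dpoly N U) i)" for U
    using poly_pderiv_expand[OF degree_dpoly[of N U]] poly_expand_le[OF degree_dpoly[of N U]]
    by (intro prod.cong refl) (simp add: w_def dval_def mult_ac)
  then have "(\<integral>U. cnj (mdet N U) ^ k * (\<Prod>j<n. if j \<in> S then x j * poly (pderiv (dpoly N U)) (x j) else dval N x U j) \<partial>haar N)
     = (\<Sum>m\<in>exps n N. mom N k n m * (\<Prod>j<n. w j (m j)))"
    by (simp add: integral_mom_expand)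
  also have "\<dots> = msum N k n (\<lambda>m. \<Prod>j\<in>{..<n} \<inter> S. of_nat (m j)) x"
    unfolding msum_def w_def prod.distrib by (simp add: prod.inter_restrict mult_ac)
  finally show ?thesis .
qed

text \<open>The quadratic identities of \<open>integral_pairsum_bval\<close> are combined over the
  vectors of \<open>qform_average\<close>. A pair \<open>j\<close>, \<open>l\<close> then
  contributes \<open>tr R_j tr R_l + tr (R_j R_l)\<close>; \<open>tr_rmat\<close> turns traces into
  derivatives, and \<open>tr_resolvent\<close> produces the quotient, for which the variables must
  be distinct.\<close>

lemma msum_pde:
  obtains C where "\<And>x. (\<And>j. j < n \<Longrightarrow> cmod (x j) * real (N + 1) < 1) \<Longrightarrow> inj_on x {..<n} \<Longrightarrow>
    (\<Sum>j<n. \<Sum>l\<in>{..<n} - {j}. msum N k n (\<lambda>m. of_nat (m j) * of_nat (m l)) x +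
       (x l * msum N k n (\<lambda>m. of_nat (m j)) x - x j * msum N k n (\<lambda>m. of_nat (m l)) x) / (x l - x j))
    = C * msum N k n (\<lambda>_. 1) x"
proof
  \<comment> \<open>The constants \<open>kap\<close> combined as in \<open>qform_average\<close>;
    independent of \<open>x\<close>.\<close>
  define C0 where "C0 = ((\<Sum>w\<in>{1, -1, \<i>, -\<i>}. \<Sum>a<N. \<Sum>b<N. kap N k (evec a w b)) - 8 * of_nat N * (\<Sum>a<N. kap N k (evec a 0 a))) / 8"
  fix x :: "nat \<Rightarrow> complex"
  assume x: "\<And>j. j < n \<Longrightarrow> cmod (x j) * real (N + 1) < 1" and inj: "inj_on x {..<n}"
  let ?D = "\<lambda>U. dval N x U"
  let ?E = "\<lambda>f. (\<integral>U. cnj (mdet N U) ^ k * f U \<partial>haar N)"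
  define \<delta> where "\<delta> U j = x j * poly (pderiv (dpoly N U)) (x j)" for U j
  define F where "F = ?E (\<lambda>U. \<Prod>j<n. ?D U j)"
  define B where "B v U = pairsum n (?D U) (\<lambda>j l. bval N x v U j * bval N x v U l)" for v U
  define G where "G U = pairsum n (?D U) (\<lambda>j l. \<delta> U j * \<delta> U l + (x l * (\<delta> U j * ?D U l) - x j * (\<delta> U l * ?D U j)) / (x l - x j))" for U
  have bmB: "bm N (\<lambda>U. cnj (mdet N U) ^ k * B v U)" for v
    unfolding B_def by (intro bm_mult bm_mdet_id bm_pairsum bm_dval bm_bval)
  have EB: "?E (B v) = kap N k v * F" for v
    unfolding B_def F_def by (rule integral_pairsum_bval[OF x])
  have pt: "(\<Sum>w\<in>{1, -1, \<i>, -\<i>}. \<Sum>a<N. \<Sum>b<N. B (evec a w b) U) - 8 * of_nat N * (\<Sum>a<N. B (evec a 0 a) U) = 8 * G U"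
    if U: "U \<in> unitary_group N" for U
  proof -
    let ?R = "\<lambda>j. rmat N U (x j)"
    have bv: "bval N x v U j = ?D U j * qform N v (?R j)" if "j < n" for v j
      unfolding bval_def poly_dpoly_outer[OF U x[OF that]] dval_def by (simp add: algebra_simps)
    have dl: "\<delta> U j = ?D U j * tr N (?R j)" if "j < n" for j
      unfolding \<delta>_def dval_def by (rule tr_rmat[OF U x[OF that]])
    have T: "(\<Sum>w\<in>{1, -1, \<i>, -\<i>}. \<Sum>a<N. \<Sum>b<N. bval N x (evec a w b) U j * bval N x (evec a w b) U l) -
       8 * of_nat N * (\<Sum>a<N. bval N x (evec a 0 a) U j * bval N x (evec a 0 a) U l) =
       8 * (\<delta> U j * \<delta> U l + (x l * (\<delta> U j * ?D U l) - x j * (\<delta> U l * ?D U j)) / (x l - x j))"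
      if jl: "j < n" "l < n" "l \<noteq> j" for j l
    proof -
      have "(\<Sum>w\<in>{1, -1, \<i>, -\<i>}. \<Sum>a<N. \<Sum>b<N. bval N x (evec a w b) U j * bval N x (evec a w b) U l) -
         8 * of_nat N * (\<Sum>a<N. bval N x (evec a 0 a) U j * bval N x (evec a 0 a) U l) =
         ?D U j * ?D U l * ((\<Sum>w\<in>{1, -1, \<i>, -\<i>}. \<Sum>a<N. \<Sum>b<N. qform N (evec a w b) (?R j) * qform N (evec a w b) (?R l)) -
         8 * of_nat N * (\<Sum>a<N. qform N (evec a 0 a) (?R j) * qform N (evec a 0 a) (?R l)))"
        unfolding bv[OF jl(1)] bv[OF jl(2)] right_diff_distrib sum_distrib_left
        by (simp only: mult_ac)
      also have "\<dots> = ?D U j * ?D U l * (8 * (tr N (?R j) * tr N (?R l) + tr N (?R j * ?R l)))"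
        by (simp only: qform_average[OF rmat_carrier[OF U x[OF jl(1)]] rmat_carrier[OF U x[OF jl(2)]]])
      also have "tr N (?R j * ?R l) = (x l * tr N (?R j) - x j * tr N (?R l)) / (x l - x j)"
      proof -
        have "x l - x j \<noteq> 0" using inj jl by (auto simp: inj_on_def)
        then show ?thesis using tr_resolvent[OF U x[OF jl(1)] x[OF jl(2)]] by (simp add: field_simps)
      qed
      also have "?D U j * ?D U l * (8 * (tr N (?R j) * tr N (?R l) + (x l * tr N (?R j) - x j * tr N (?R l)) / (x l - x j))) =
         8 * (\<delta> U j * \<delta> U l + (x l * (\<delta> U j * ?D U l) - x j * (\<delta> U l * ?D U j)) / (x l - x j))"
        unfolding dl[OF jl(1)] dl[OF jl(2)] by (simp add: algebra_simps diff_divide_distrib)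
      finally show ?thesis .
    qed
    have "(\<Sum>w\<in>{1, -1, \<i>, -\<i>}. \<Sum>a<N. \<Sum>b<N. B (evec a w b) U) - 8 * of_nat N * (\<Sum>a<N. B (evec a 0 a) U) =
      pairsum n (?D U) (\<lambda>j l. 8 * (\<delta> U j * \<delta> U l + (x l * (\<delta> U j * ?D U l) - x j * (\<delta> U l * ?D U j)) / (x l - x j)))"
      unfolding B_def pairsum_sum pairsum_mult pairsum_diff unfolding pairsum_def using T by (intro sum.cong refl arg_cong2[where f="(*)"]) auto
    also have "\<dots> = 8 * G U" unfolding G_def by (rule pairsum_mult[symmetric])
    finally show ?thesis .
  qed
  have EG: "?E G = C0 * F"
  proof -
    have "8 * ?E G = (\<integral>U. 8 * (cnj (mdet N U) ^ k * G U) \<partial>haar N)" by simp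
    also have "\<dots> = (\<integral>U. (\<Sum>w\<in>{1, -1, \<i>, -\<i>}. \<Sum>a<N. \<Sum>b<N. cnj (mdet N U) ^ k * B (evec a w b) U) -
        8 * of_nat N * (\<Sum>a<N. cnj (mdet N U) ^ k * B (evec a 0 a) U) \<partial>haar N)"
    proof (intro Bochner_Integration.integral_cong refl)
      fix U assume "U \<in> space (haar N)"
      then have U: "U \<in> unitary_group N" by simp
      have "8 * (cnj (mdet N U) ^ k * G U) = cnj (mdet N U) ^ k * (8 * G U)" by (simp only: mult_ac)
      also have "\<dots> = (\<Sum>w\<in>{1, -1, \<i>, -\<i>}. \<Sum>a<N. \<Sum>b<N. cnj (mdet N U) ^ k * B (evec a w b) U) -
        8 * of_nat N * (\<Sum>a<N. cnj (mdet N U) ^ k * B (evec a 0 a) U)"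
        unfolding pt[OF U, symmetric] right_diff_distrib sum_distrib_left by (simp only: mult_ac)
      finally show "8 * (cnj (mdet N U) ^ k * G U) = (\<Sum>w\<in>{1, -1, \<i>, -\<i>}. \<Sum>a<N. \<Sum>b<N. cnj (mdet N U) ^ k * B (evec a w b) U) -
        8 * of_nat N * (\<Sum>a<N. cnj (mdet N U) ^ k * B (evec a 0 a) U)" .
    qed
    also have "\<dots> = (\<Sum>w\<in>{1, -1, \<i>, -\<i>}. \<Sum>a<N. \<Sum>b<N. ?E (B (evec a w b))) - 8 * of_nat N * (\<Sum>a<N. ?E (B (evec a 0 a)))"
    proof -
      have I: "integrable (haar N) (\<lambda>U. cnj (mdet N U) ^ k * B v U)" for v by (rule bm_integrable[OF bmB])
      show ?thesis
        by (subst Bochner_Integration.integral_diff)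
          (auto simp del: sum.insert intro!: Bochner_Integration.integrable_sum I integrable_mult_right simp: Bochner_Integration.integral_sum[OF Bochner_Integration.integrable_sum] Bochner_Integration.integral_sum I)
    qed
    also have "\<dots> = 8 * C0 * F"
      unfolding EB sum_distrib_right[symmetric] C0_def by (simp add: left_diff_distrib mult.assoc)
    finally show ?thesis by simp
  qed
  have set2: "(\<Prod>i<n. if i \<in> {j, l} then f i else g i) = f j * f l * (\<Prod>i\<in>{..<n} - {j} - {l}. g i)"
    if "j < n" "l < n" "l \<noteq> j" for j l and f g :: "nat \<Rightarrow> complex"
  proof -
    have "(\<Prod>i<n. if i \<in> {j, l} then f i else g i) = f j * (f l * (\<Prod>i\<in>{..<n} - {j} - {l}. if i \<in> {j, l} then f i else g i))"
      using that by (subst prod.remove[of _ j], simp, simp, subst prod.remove[of _ l]) auto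
    also have "(\<Prod>i\<in>{..<n} - {j} - {l}. if i \<in> {j, l} then f i else g i) = (\<Prod>i\<in>{..<n} - {j} - {l}. g i)"
      by (intro prod.cong) auto
    finally show ?thesis by (simp add: mult.assoc)
  qed
  have bd: "bm N (\<lambda>U. \<delta> U j)" for j
    unfolding \<delta>_def poly_pderiv_expand[OF degree_dpoly] by (intro bm_sum bm_mult bm_const bm_coeff_dpoly bm_entry)
  have E2: "?E (\<lambda>U. \<delta> U j * \<delta> U l * (\<Prod>i\<in>{..<n} - {j} - {l}. ?D U i)) = msum N k n (\<lambda>m. of_nat (m j) * of_nat (m l)) x"
    if jl: "j < n" "l < n" "l \<noteq> j" for j l
  proof -
    have "{..<n} \<inter> {j, l} = {j, l}" using jl by auto
    then show ?thesis using integral_eq_msum[where N = N and k = k and n = n and S = "{j, l}" and x = x] jl(3)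
      unfolding \<delta>_def[symmetric] set2[OF jl, of "\<delta> _" "?D _"] by simp
  qed
  have E1: "?E (\<lambda>U. \<delta> U j * ?D U l * (\<Prod>i\<in>{..<n} - {j} - {l}. ?D U i)) = msum N k n (\<lambda>m. of_nat (m j)) x"
    if jl: "j < n" "l < n" "l \<noteq> j" for j l
  proof -
    have "{..<n} \<inter> {j} = {j}" using jl by auto
    moreover have "(\<Prod>i<n. if i \<in> {j} then \<delta> U i else ?D U i) = \<delta> U j * ?D U l * (\<Prod>i\<in>{..<n} - {j} - {l}. ?D U i)" for U
    proof -
      have "(\<Prod>i<n. if i \<in> {j} then \<delta> U i else ?D U i) = (\<Prod>i<n. if i \<in> {j, l} then (if i = j then \<delta> U i else ?D U i) else ?D U i)"
        by (intro prod.cong) auto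
      then show ?thesis using jl(3) by (simp only: set2[OF jl]) simp
    qed
    ultimately show ?thesis using integral_eq_msum[where N = N and k = k and n = n and S = "{j}" and x = x]
      unfolding \<delta>_def[symmetric] by simp
  qed
  have F: "F = msum N k n (\<lambda>_. 1) x"
    using integral_eq_msum[where N = N and k = k and n = n and S = "{}" and x = x] by (simp add: F_def)
  have tm: "?E (\<lambda>U. (\<delta> U j * \<delta> U l + (x l * (\<delta> U j * ?D U l) - x j * (\<delta> U l * ?D U j)) / (x l - x j)) * (\<Prod>i\<in>{..<n} - {j} - {l}. ?D U i)) =
     msum N k n (\<lambda>m. of_nat (m j) * of_nat (m l)) x +
       (x l * msum N k n (\<lambda>m. of_nat (m j)) x - x j * msum N k n (\<lambda>m. of_nat (m l)) x) / (x l - x j)"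
    if jl: "j < n" "l < n" "l \<noteq> j" for j l
  proof -
    let ?p = "\<lambda>U. \<Prod>i\<in>{..<n} - {j} - {l}. ?D U i"
    have sw: "{..<n} - {l} - {j} = {..<n} - {j} - {l}" by auto
    have I: "integrable (haar N) (\<lambda>U. cnj (mdet N U) ^ k * (\<delta> U j * \<delta> U l * ?p U))"
      "integrable (haar N) (\<lambda>U. cnj (mdet N U) ^ k * (\<delta> U j * ?D U l * ?p U))"
      "integrable (haar N) (\<lambda>U. cnj (mdet N U) ^ k * (\<delta> U l * ?D U j * ?p U))"
      by (intro bm_integrable bm_mult bm_mdet_id bd bm_dval bm_prod)+
    have "?E (\<lambda>U. (\<delta> U j * \<delta> U l + (x l * (\<delta> U j * ?D U l) - x j * (\<delta> U l * ?D U j)) / (x l - x j)) * ?p U) =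
      (\<integral>U. cnj (mdet N U) ^ k * (\<delta> U j * \<delta> U l * ?p U) + (x l / (x l - x j) * (cnj (mdet N U) ^ k * (\<delta> U j * ?D U l * ?p U))
        - x j / (x l - x j) * (cnj (mdet N U) ^ k * (\<delta> U l * ?D U j * ?p U))) \<partial>haar N)"
      by (intro Bochner_Integration.integral_cong refl) (simp add: algebra_simps diff_divide_distrib)
    also have "\<dots> = ?E (\<lambda>U. \<delta> U j * \<delta> U l * ?p U) + (x l / (x l - x j) * ?E (\<lambda>U. \<delta> U j * ?D U l * ?p U)
        - x j / (x l - x j) * ?E (\<lambda>U. \<delta> U l * ?D U j * ?p U))"
      using I by (subst Bochner_Integration.integral_add, simp, simp, subst Bochner_Integration.integral_diff) simp_all
    also have "?E (\<lambda>U. \<delta> U l * ?D U j * ?p U) = msum N k n (\<lambda>m. of_nat (m l)) x"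
      using E1[OF jl(2,1)] jl(3) unfolding sw by simp
    finally show ?thesis unfolding E2[OF jl] E1[OF jl] by (simp add: diff_divide_distrib)
  qed
  have "?E G = (\<Sum>j<n. \<Sum>l\<in>{..<n} - {j}. ?E (\<lambda>U. (\<delta> U j * \<delta> U l + (x l * (\<delta> U j * ?D U l) - x j * (\<delta> U l * ?D U j)) / (x l - x j)) * (\<Prod>i\<in>{..<n} - {j} - {l}. ?D U i)))"
  proof -
    have I: "integrable (haar N) (\<lambda>U. cnj (mdet N U) ^ k * ((\<delta> U j * \<delta> U l + (x l * (\<delta> U j * ?D U l) - x j * (\<delta> U l * ?D U j)) / (x l - x j)) * (\<Prod>i\<in>{..<n} - {j} - {l}. ?D U i)))" for j l
      unfolding divide_inverse by (intro bm_integrable bm_mult bm_add bm_diff bm_const bm_mdet_id bd bm_dval bm_prod)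
    show ?thesis
      unfolding G_def pairsum_def sum_distrib_left
      by (simp add: Bochner_Integration.integral_sum[OF Bochner_Integration.integrable_sum] Bochner_Integration.integral_sum I)
  qed
  also have "\<dots> = (\<Sum>j<n. \<Sum>l\<in>{..<n} - {j}. msum N k n (\<lambda>m. of_nat (m j) * of_nat (m l)) x +
       (x l * msum N k n (\<lambda>m. of_nat (m j)) x - x j * msum N k n (\<lambda>m. of_nat (m l)) x) / (x l - x j))"
    using tm by (intro sum.cong refl) auto
  finally show "(\<Sum>j<n. \<Sum>l\<in>{..<n} - {j}. msum N k n (\<lambda>m. of_nat (m j) * of_nat (m l)) x +
       (x l * msum N k n (\<lambda>m. of_nat (m j)) x - x j * msum N k n (\<lambda>m. of_nat (m l)) x) / (x l - x j))
    = C0 * msum N k n (\<lambda>_. 1) x"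
    unfolding EG F by simp
qed

subsection \<open>Exponential sums in several variables\<close>

lemma digits_inj:
  fixes m m' :: "nat \<Rightarrow> nat"
  assumes "\<And>j. j < n \<Longrightarrow> m j < B" "\<And>j. j < n \<Longrightarrow> m' j < B"
    and "(\<Sum>j<n. m j * B ^ j) = (\<Sum>j<n. m' j * B ^ j)"
  shows "\<forall>j<n. m j = m' j"
  using assms
proof (induction n arbitrary: m m')
  case (Suc n)
  have sh: "(\<Sum>j<Suc n. f j * B ^ j) = f 0 + B * (\<Sum>j<n. f (Suc j) * B ^ j)" for f :: "nat \<Rightarrow> nat"
    unfolding sum.lessThan_Suc_shift sum_distrib_left by (simp add: mult_ac)
  have e: "m 0 + B * (\<Sum>j<n. m (Suc j) * B ^ j) = m' 0 + B * (\<Sum>j<n. m' (Suc j) * B ^ j)"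
    using Suc.prems(3) unfolding sh .
  have b: "m 0 < B" "m' 0 < B" using Suc.prems(1,2) by auto
  have 0: "m 0 = m' 0" using arg_cong[OF e, of "\<lambda>x. x mod B"] b by simp
  have "(\<Sum>j<n. m (Suc j) * B ^ j) = (\<Sum>j<n. m' (Suc j) * B ^ j)"
    using e 0 b by simp
  then have "\<forall>j<n. m (Suc j) = m' (Suc j)"
    by (intro Suc.IH[of "\<lambda>j. m (Suc j)" "\<lambda>j. m' (Suc j)"] Suc.prems(1,2)) auto
  then show ?case using 0 unfolding All_less_Suc2 by simp
qed simp

text \<open>Kronecker's substitution \<open>x\<^sub>j = y ^ (B ^ j)\<close> reduces the linear independence of
  monomials to one variable.\<close>

lemma exp_sum_zero:
  fixes b :: "'i \<Rightarrow> complex" and \<mu> :: "'i \<Rightarrow> nat \<Rightarrow> nat" and \<phi> :: "(nat \<Rightarrow> nat) \<Rightarrow> complex"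
  assumes I: "finite I" and \<epsilon>: "\<epsilon> > 0"
    and zero: "\<And>x. (\<And>j. j < n \<Longrightarrow> cmod (x j) < \<epsilon>) \<Longrightarrow> inj_on x {..<n} \<Longrightarrow> (\<Sum>i\<in>I. b i * (\<Prod>j<n. x j ^ \<mu> i j)) = 0"
  shows "(\<Sum>i\<in>I. b i * \<phi> (restrict (\<mu> i) {..<n})) = 0"
proof -
  \<comment> \<open>The base exceeds every exponent, so the codes are injective; being at least 2,
    it also keeps the powers \<open>y ^ (B ^ j)\<close> distinct for
    \<open>0 < y < 1\<close>.\<close>
  define B where "B = (\<Sum>i\<in>I. \<Sum>j<n. \<mu> i j) + 2"
  have B: "\<mu> i j < B" if "i \<in> I" "j < n" for i j
  proof -
    have "\<mu> i j \<le> (\<Sum>j<n. \<mu> i j)" using that by (intro member_le_sum) auto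
    also have "\<dots> \<le> (\<Sum>i\<in>I. \<Sum>j<n. \<mu> i j)" using that I by (intro member_le_sum[of i I "\<lambda>i. \<Sum>j<n. \<mu> i j"]) auto
    finally show ?thesis by (simp add: B_def)
  qed
  define code where "code m = (\<Sum>j<n. m j * B ^ j)" for m :: "nat \<Rightarrow> nat"
  define p where "p = (\<Sum>i\<in>I. monom (b i) (code (\<mu> i)))"
  define Y where "Y = complex_of_real ` {0<..<min \<epsilon> 1}"
  have "infinite Y" unfolding Y_def using \<epsilon>
    by (subst finite_image_iff) (auto simp: inj_on_def infinite_Ioo)
  moreover have "poly p w = poly 0 w" if w: "w \<in> Y" for w
  proof -
    obtain y where y: "w = of_real y" "0 < y" "y < \<epsilon>" "y < 1" using w by (auto simp: Y_def)
    define x where "x j = w ^ (B ^ j)" for j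
    have "cmod (x j) < \<epsilon>" for j
    proof -
      have "cmod (x j) = y ^ (B ^ j)" using y by (simp add: x_def norm_power)
      also have "\<dots> \<le> y ^ 1" using y by (intro power_decreasing) (auto simp: B_def)
      finally show ?thesis using y by simp
    qed
    moreover have "inj_on x {..<n}"
    proof (rule inj_onI)
      fix j l assume "x j = x l"
      then have "y ^ (B ^ j) = y ^ (B ^ l)" unfolding x_def y(1) by (simp only: of_real_power[symmetric] of_real_eq_iff)
      then have "B ^ j = B ^ l" using y power_inject_exp'[of y] by (metis less_irrefl linorder_neqE_nat power_strict_decreasing)
      then show "j = l" by (simp add: B_def power_inject_exp)
    qed
    ultimately have "(\<Sum>i\<in>I. b i * (\<Prod>j<n. x j ^ \<mu> i j)) = 0" by (intro zero)
    moreover have "(\<Prod>j<n. x j ^ \<mu> i j) = w ^ code (\<mu> i)" for i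
      by (simp add: x_def code_def power_mult[symmetric] power_sum mult.commute)
    ultimately show ?thesis by (simp add: p_def poly_sum poly_monom)
  qed
  ultimately have "p = 0" by (rule poly_eqI_infinite)
  then have c0: "(\<Sum>i\<in>{i\<in>I. code (\<mu> i) = c}. b i) = 0" for c
  proof -
    have "coeff p c = (\<Sum>i\<in>I. if code (\<mu> i) = c then b i else 0)" by (simp add: p_def coeff_sum)
    also have "\<dots> = (\<Sum>i\<in>{i\<in>I. code (\<mu> i) = c}. b i)" using I by (simp add: sum.inter_filter)
    finally show ?thesis using \<open>p = 0\<close> by simp
  qed
  have "(\<Sum>i\<in>I. b i * \<phi> (restrict (\<mu> i) {..<n})) =
    (\<Sum>c\<in>(\<lambda>i. code (\<mu> i)) ` I. \<Sum>i\<in>{i\<in>I. code (\<mu> i) = c}. b i * \<phi> (restrict (\<mu> i) {..<n}))"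
    by (rule sum.image_gen[OF I])
  also have "\<dots> = (\<Sum>c\<in>(\<lambda>i. code (\<mu> i)) ` I. 0)"
  proof (rule sum.cong[OF refl])
    fix c assume "c \<in> (\<lambda>i. code (\<mu> i)) ` I"
    then obtain i0 where i0: "i0 \<in> I" "code (\<mu> i0) = c" by auto
    have "restrict (\<mu> i) {..<n} = restrict (\<mu> i0) {..<n}" if "i \<in> I" "code (\<mu> i) = c" for i
    proof -
      have "\<forall>j<n. \<mu> i j = \<mu> i0 j"
        using that i0 B by (intro digits_inj[where B = B]) (auto simp: code_def)
      then show ?thesis by (auto simp: restrict_def fun_eq_iff)
    qed
    then have "(\<Sum>i\<in>{i\<in>I. code (\<mu> i) = c}. b i * \<phi> (restrict (\<mu> i) {..<n})) =
      (\<Sum>i\<in>{i\<in>I. code (\<mu> i) = c}. b i) * \<phi> (restrict (\<mu> i0) {..<n})"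
      unfolding sum_distrib_right by (intro sum.cong refl) auto
    then show "(\<Sum>i\<in>{i\<in>I. code (\<mu> i) = c}. b i * \<phi> (restrict (\<mu> i) {..<n})) = 0" by (simp add: c0)
  qed
  finally show ?thesis by simp
qed

text \<open>Two monomial sums that agree near 0 still agree after each monomial is replaced by an
  arbitrary function of its exponents. This carries identities from the neighbourhood of 0 to
  derivatives at other points; the proof puts both sums over one disjoint union.\<close>

lemma exp_sum_eq:
  fixes b :: "'i \<Rightarrow> complex" and \<mu> :: "'i \<Rightarrow> nat \<Rightarrow> nat" and b' :: "'j \<Rightarrow> complex" and \<mu>' :: "'j \<Rightarrow> nat \<Rightarrow> nat"
  assumes I: "finite I" and J: "finite J" and \<epsilon>: "\<epsilon> > 0"
    and eq: "\<And>x. (\<And>j. j < n \<Longrightarrow> cmod (x j) < \<epsilon>) \<Longrightarrow> inj_on x {..<n} \<Longrightarrow>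
      (\<Sum>i\<in>I. b i * (\<Prod>j<n. x j ^ \<mu> i j)) = (\<Sum>i\<in>J. b' i * (\<Prod>j<n. x j ^ \<mu>' i j))"
  shows "(\<Sum>i\<in>I. b i * \<phi> (restrict (\<mu> i) {..<n})) = (\<Sum>i\<in>J. b' i * \<phi> (restrict (\<mu>' i) {..<n}))"
proof -
  let ?b = "case_sum b (\<lambda>i. - b' i)" and ?\<mu> = "case_sum \<mu> \<mu>'"
  have "(\<Sum>i\<in>I <+> J. ?b i * \<phi> (restrict (?\<mu> i) {..<n})) = 0"
  proof (rule exp_sum_zero[OF _ \<epsilon>])
    show "finite (I <+> J)" using I J by simp
    fix x :: "nat \<Rightarrow> complex" assume x: "\<And>j. j < n \<Longrightarrow> cmod (x j) < \<epsilon>" "inj_on x {..<n}"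
    show "(\<Sum>i\<in>I <+> J. ?b i * (\<Prod>j<n. x j ^ ?\<mu> i j)) = 0"
      using eq[OF x] I J by (simp add: sum.Plus sum_negf)
  qed
  then show ?thesis using I J by (simp add: sum.Plus sum_negf)
qed

subsection \<open>Vandermonde determinants\<close>

definition alt :: "nat \<Rightarrow> (nat \<Rightarrow> nat) \<Rightarrow> (nat \<Rightarrow> complex) \<Rightarrow> complex" where
  "alt n l x = (\<Sum>p | p permutes {..<n}. of_int (sign p) * (\<Prod>j<n. x j ^ l (p j)))"

lemma alt_eq_mdet: "alt n l x = mdet n (\<lambda>j i. x j ^ l i)"
  by (simp add: alt_def mdet_def)

lemma alt_eq_0:
  assumes "i < n" "j < n" "i \<noteq> j" "x i = x j"
  shows "alt n l x = 0"
  unfolding alt_eq_mdet mdet_eq_det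
proof (rule det_identical_rows[of _ n i j])
  show "row (fmat n (\<lambda>j i. x j ^ l i)) i = row (fmat n (\<lambda>j i. x j ^ l i)) j"
    using assms by (intro eq_vecI) auto
qed (use assms in auto)

text \<open>A kernel vector is the coefficient list of a nonzero polynomial of degree below
  \<open>n\<close> with \<open>n\<close> distinct roots.\<close>

lemma alt_id_nonzero:
  assumes "inj_on x {..<n}"
  shows "alt n (\<lambda>i. i) x \<noteq> 0"
proof
  assume "alt n (\<lambda>i. i) x = 0"
  then have "Determinant.det (fmat n (\<lambda>j i. x j ^ i)) = 0" by (simp add: alt_eq_mdet mdet_eq_det)
  then obtain v where v: "v \<in> carrier_vec n" "v \<noteq> 0\<^sub>v n" "fmat n (\<lambda>j i. x j ^ i) *\<^sub>v v = 0\<^sub>v n"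
    using det_0_iff_vec_prod_zero[OF fmat_carrier] by blast
  define p where "p = (\<Sum>i<n. monom (vec_index v i) i)"
  have cp: "coeff p i = (if i < n then vec_index v i else 0)" for i
    by (simp add: p_def coeff_sum if_distrib cong: if_cong)
  obtain i0 where i0: "i0 < n" "vec_index v i0 \<noteq> 0" using v(1,2) by (metis carrier_vecD eq_vecI index_zero_vec)
  have p0: "p \<noteq> 0" using cp[of i0] i0 by auto
  have "poly p (x j) = 0" if "j < n" for j
  proof -
    have "poly p (x j) = vec_index (fmat n (\<lambda>j i. x j ^ i) *\<^sub>v v) j"
      using that v(1) by (simp add: p_def poly_sum poly_monom scalar_prod_def atLeast0LessThan mult.commute)
    then show ?thesis using v(3) that by simp
  qed
  then have "card (x ` {..<n}) \<le> card {y. poly p y = 0}"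
    using p0 by (intro card_mono poly_roots_finite) auto
  also have "\<dots> \<le> degree p" by (rule card_poly_roots_bound[OF p0])
  also have "degree p \<le> n - 1" by (rule degree_le) (auto simp: cp)
  finally show False using assms i0 by (simp add: card_image)
qed

lemma poly_eq_prod_roots:
  fixes p :: "complex poly"
  assumes S: "finite S" and deg: "degree p \<le> card S" and root: "\<And>s. s \<in> S \<Longrightarrow> poly p s = 0"
  shows "\<exists>K. p = Polynomial.smult K (\<Prod>s\<in>S. [:-s, 1:])"
proof -
  let ?q = "\<Prod>s\<in>S. [:-s, 1:]"
  have dq1: "degree ?q = card S" by (simp add: degree_prod_eq_sum_degree)
  have "lead_coeff ?q = 1" by (simp only: lead_coeff_prod) simp
  note dq = dq1 this
  define r where "r = p - Polynomial.smult (coeff p (card S)) ?q"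
  have "r = 0"
  proof (rule ccontr)
    assume r: "r \<noteq> 0"
    have "poly r s = 0" if "s \<in> S" for s
      using root[OF that] S that by (auto simp: r_def poly_prod)
    then have "card S \<le> card {y. poly r y = 0}"
      using r by (intro card_mono poly_roots_finite) auto
    also have "\<dots> \<le> degree r" by (rule card_poly_roots_bound[OF r])
    finally have "card S \<le> degree r" .
    moreover have "degree r \<le> card S"
      unfolding r_def using deg dq by (intro degree_diff_le) (auto intro: order.trans[OF degree_smult_le])
    ultimately have "degree r = card S" by simp
    moreover have "coeff r (card S) = 0" using dq(2) unfolding dq(1) by (simp add: r_def)
    ultimately show False using r by (metis leading_coeff_0_iff)
  qed
  then show ?thesis by (auto simp: r_def)
qed

text \<open>The image of the Vandermonde determinant under \<open>x_j d/dx_j\<close>, term by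
  term.\<close>

definition altd :: "nat \<Rightarrow> nat \<Rightarrow> (nat \<Rightarrow> complex) \<Rightarrow> complex" where
  "altd n j x = (\<Sum>p | p permutes {..<n}. of_int (sign p) * of_nat (p j) * (\<Prod>j<n. x j ^ p j))"

text \<open>As a polynomial in \<open>x_j\<close> alone, the Vandermonde determinant has degree at
  most \<open>n - 1\<close> and vanishes at the other \<open>n - 1\<close> variables. So it is a
  multiple of the product of the \<open>x_j - x_l\<close>, whose logarithmic derivative is the sum
  of \<open>1 / (x_j - x_l)\<close>.\<close>

lemma altd_eq:
  assumes j: "j < n" and inj: "inj_on x {..<n}"
  shows "altd n j x = alt n (\<lambda>i. i) x * (\<Sum>l\<in>{..<n} - {j}. x j / (x j - x l))"
proof -
  define c where "c p = of_int (sign p) * (\<Prod>i\<in>{..<n} - {j}. x i ^ p i)" for p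
  define P where "P = (\<Sum>p | p permutes {..<n}. monom (c p) (p j))"
  have val: "poly P y = alt n (\<lambda>i. i) (x(j := y))" for y
  proof -
    have "(\<Prod>i<n. (x(j := y)) i ^ p i) = y ^ p j * (\<Prod>i\<in>{..<n} - {j}. x i ^ p i)" for p
      using j by (subst prod.remove[of _ j]) auto
    then show ?thesis by (simp add: P_def alt_def poly_sum poly_monom c_def mult_ac)
  qed
  let ?S = "x ` ({..<n} - {j})"
  have inj': "inj_on x ({..<n} - {j})" using inj by (rule inj_on_subset) auto
  have cS: "card ?S = n - 1" using inj' j by (simp add: card_image)
  have "degree P \<le> n - 1"
  proof (rule degree_le, intro allI impI)
    fix i assume "n - 1 < i"
    then have "p j \<noteq> i" if "p permutes {..<n}" for p
      using permutes_in_image[OF that, of j] j by auto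
    then show "coeff P i = 0" by (simp add: P_def coeff_sum)
  qed
  moreover have "poly P s = 0" if s: "s \<in> ?S" for s
  proof -
    obtain i where i: "i < n" "i \<noteq> j" "s = x i" using s by auto
    then show ?thesis unfolding val using j by (intro alt_eq_0[of i n j]) auto
  qed
  ultimately obtain K where K: "P = Polynomial.smult K (\<Prod>s\<in>?S. [:-s, 1:])"
    using poly_eq_prod_roots[of ?S P] cS by auto
  then have K': "P = Polynomial.smult K (\<Prod>l\<in>{..<n} - {j}. [:-x l, 1:])"
    by (simp add: prod.reindex[OF inj'])
  have ne: "x j - x l \<noteq> 0" if "l \<in> {..<n} - {j}" for l
    using inj j that by (auto simp: inj_on_def)
  have "x j * poly (pderiv P) (x j) = altd n j x"
  proof -
    have "y * poly (pderiv (monom a m)) y = of_nat m * a * y ^ m" for y a :: complex and m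
      by (cases m) (auto simp: pderiv_monom poly_monom)
    then have "x j * poly (pderiv P) (x j) = (\<Sum>p | p permutes {..<n}. of_nat (p j) * c p * x j ^ p j)"
      by (simp add: P_def pderiv_sum poly_sum sum_distrib_left)
    also have "\<dots> = altd n j x"
    proof -
      have "(\<Prod>i<n. x i ^ p i) = x j ^ p j * (\<Prod>i\<in>{..<n} - {j}. x i ^ p i)" for p
        using j by (subst prod.remove[of _ j]) auto
      then show ?thesis unfolding altd_def c_def by (simp add: mult_ac)
    qed
    finally show ?thesis .
  qed
  moreover have "poly (pderiv P) (x j) = poly P (x j) * (\<Sum>l\<in>{..<n} - {j}. 1 / (x j - x l))"
  proof -
    have "poly (pderiv (\<Prod>l\<in>{..<n} - {j}. [:-x l, 1:])) (x j) = (\<Sum>l\<in>{..<n} - {j}. (\<Prod>i\<in>{..<n} - {j} - {l}. x j - x i))"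
      by (simp add: pderiv_prod poly_sum poly_prod pderiv_pCons)
    also have "\<dots> = (\<Sum>l\<in>{..<n} - {j}. (\<Prod>i\<in>{..<n} - {j}. x j - x i) * (1 / (x j - x l)))"
    proof (rule sum.cong[OF refl])
      fix l assume l: "l \<in> {..<n} - {j}"
      show "(\<Prod>i\<in>{..<n} - {j} - {l}. x j - x i) = (\<Prod>i\<in>{..<n} - {j}. x j - x i) * (1 / (x j - x l))"
        using prod.remove[of "{..<n} - {j}" l "\<lambda>i. x j - x i"] l ne[OF l] by simp
    qed
    finally show ?thesis unfolding K' by (simp add: pderiv_smult poly_prod sum_distrib_left mult_ac)
  qed
  moreover have "poly P (x j) = alt n (\<lambda>i. i) x" by (simp add: val)
  ultimately show ?thesis by (simp add: sum_distrib_left mult_ac)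
qed

subsection \<open>The generating function times the Vandermonde determinant\<close>

lemma mom_cong: "(\<And>j. j < n \<Longrightarrow> m j = m' j) \<Longrightarrow> mom N k n m = mom N k n m'"
  by (simp add: mom_def)

lemma mom_permute:
  assumes "p permutes {..<n}" shows "mom N k n (m \<circ> p) = mom N k n m"
proof -
  have "(\<Prod>j<n. coeff (dpoly N U) (m j)) = (\<Prod>j<n. coeff (dpoly N U) ((m \<circ> p) j))" for U
    using prod.permute[OF assms, of "\<lambda>j. coeff (dpoly N U) (m j)"] by (simp add: o_def)
  then show ?thesis by (simp add: mom_def)
qed

definition ix :: "nat \<Rightarrow> nat \<Rightarrow> ((nat \<Rightarrow> nat) \<times> (nat \<Rightarrow> nat)) set" where
  "ix n N = {p. p permutes {..<n}} \<times> exps n N"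

text \<open>The expanded product of the Vandermonde determinant and F, each term weighted by a
  function of its two exponent vectors \<open>p\<close> and \<open>m\<close>. A weight that splits
  as \<open>u p * v m\<close> splits the sum.\<close>

definition wsum :: "nat \<Rightarrow> nat \<Rightarrow> nat \<Rightarrow> ((nat \<Rightarrow> nat) \<Rightarrow> (nat \<Rightarrow> nat) \<Rightarrow> complex) \<Rightarrow> (nat \<Rightarrow> complex) \<Rightarrow> complex" where
  "wsum N k n \<phi> x = (\<Sum>(p, m)\<in>ix n N. of_int (sign p) * mom N k n m * \<phi> p m * (\<Prod>j<n. x j ^ (p j + m j)))"

definition altw :: "nat \<Rightarrow> ((nat \<Rightarrow> nat) \<Rightarrow> complex) \<Rightarrow> (nat \<Rightarrow> complex) \<Rightarrow> complex" where
  "altw n u x = (\<Sum>p | p permutes {..<n}. of_int (sign p) * u p * (\<Prod>j<n. x j ^ p j))"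

lemma finite_ix [simp]: "finite (ix n N)"
  by (simp add: ix_def finite_permutations)

lemma wsum_prod: "wsum N k n (\<lambda>p m. u p * v m) x = altw n u x * msum N k n v x"
  unfolding wsum_def altw_def msum_def ix_def sum_product sum.cartesian_product
  by (intro sum.cong refl) (auto simp: power_add prod.distrib)

lemma wsum_add: "wsum N k n (\<lambda>p m. f p m + g p m) x = wsum N k n f x + wsum N k n g x"
  by (simp add: wsum_def algebra_simps split_beta sum.distrib)

lemma wsum_sum: "finite S \<Longrightarrow> wsum N k n (\<lambda>p m. \<Sum>i\<in>S. f i p m) x = (\<Sum>i\<in>S. wsum N k n (f i) x)"
proof -
  have "wsum N k n (\<lambda>p m. \<Sum>i\<in>S. f i p m) x = (\<Sum>pm\<in>ix n N. \<Sum>i\<in>S. case pm of (p, m) \<Rightarrow> of_int (sign p) * mom N k n m * f i p m * (\<Prod>j<n. x j ^ (p j + m j)))"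
    unfolding wsum_def by (intro sum.cong refl) (simp add: split_beta sum_distrib_left sum_distrib_right)
  also have "\<dots> = (\<Sum>i\<in>S. wsum N k n (f i) x)"
    unfolding wsum_def by (rule sum.swap)
  finally show ?thesis .
qed

lemma altw_cong: "(\<And>p. p permutes {..<n} \<Longrightarrow> u p = c) \<Longrightarrow> altw n u x = c * alt n (\<lambda>i. i) x"
  unfolding altw_def alt_def sum_distrib_left by (intro sum.cong refl) auto

lemma altw_sum: "finite S \<Longrightarrow> altw n (\<lambda>p. \<Sum>i\<in>S. f i p) x = (\<Sum>i\<in>S. altw n (f i) x)"
  unfolding altw_def by (simp add: sum_distrib_left sum_distrib_right) (rule sum.swap)

lemma altw_index: "altw n (\<lambda>p. of_nat (p j)) x = altd n j x"
  by (simp add: altw_def altd_def)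

text \<open>Twice the second elementary symmetric function of the exponents. When their sum is
  fixed, it determines the sum of their squares.\<close>

definition esym2 :: "nat \<Rightarrow> (nat \<Rightarrow> nat) \<Rightarrow> complex" where
  "esym2 n q = (\<Sum>j<n. \<Sum>l\<in>{..<n} - {j}. of_nat (q j) * of_nat (q l))"

lemma esym2_eq: "esym2 n q = (of_nat (\<Sum>j<n. q j))\<^sup>2 - of_nat (\<Sum>j<n. (q j)\<^sup>2)"
proof -
  have "(\<Sum>l\<in>{..<n} - {j}. of_nat (q j) * of_nat (q l)) = of_nat (q j) * (\<Sum>l<n. of_nat (q l)) - (of_nat (q j) :: complex)\<^sup>2"
    if "j < n" for j :: nat
    using that sum.remove[of "{..<n}" j "\<lambda>l. of_nat (q j) * of_nat (q l) :: complex"]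
    unfolding sum_distrib_left power2_eq_square by simp
  then have "esym2 n q = (\<Sum>j<n. of_nat (q j) * (\<Sum>l<n. of_nat (q l)) - (of_nat (q j))\<^sup>2)"
    unfolding esym2_def by (intro sum.cong refl) auto
  then show ?thesis by (simp add: sum_subtractf sum_distrib_right power2_eq_square)
qed

lemma esym2_cong: "(\<And>j. j < n \<Longrightarrow> q j = q' j) \<Longrightarrow> esym2 n q = esym2 n q'"
  by (simp add: esym2_eq)

text \<open>The weight of \<open>p + m\<close> splits into the weight of \<open>p\<close>, a
  constant; the weight of \<open>m\<close>, given by \<open>msum_pde\<close>; and cross terms. By
  \<open>altd_eq\<close> the singular terms of \<open>msum_pde\<close> times the Vandermonde
  determinant are expressions in \<open>altd\<close>, and these cancel against the cross terms. What
  is left contains only the sum of all \<open>x_j d/dx_j F\<close>, which is \<open>kN F\<close> by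
  homogeneity.\<close>

lemma wsum_esym2:
  obtains C where "\<And>x. (\<And>j. j < n \<Longrightarrow> cmod (x j) < 1 / real (N + 1)) \<Longrightarrow> inj_on x {..<n} \<Longrightarrow>
     wsum N k n (\<lambda>p m. esym2 n (\<lambda>j. p j + m j)) x = C * wsum N k n (\<lambda>_ _. 1) x"
proof (rule msum_pde[where n = n and N = N and k = k])
  fix C
  assume C: "\<And>x. (\<And>j. j < n \<Longrightarrow> cmod (x j) * real (N + 1) < 1) \<Longrightarrow> inj_on x {..<n} \<Longrightarrow>
    (\<Sum>j<n. \<Sum>l\<in>{..<n} - {j}. msum N k n (\<lambda>m. of_nat (m j) * of_nat (m l)) x +
       (x l * msum N k n (\<lambda>m. of_nat (m j)) x - x j * msum N k n (\<lambda>m. of_nat (m l)) x) / (x l - x j))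
    = C * msum N k n (\<lambda>_. 1) x"
  define D :: complex where "D = of_nat (\<Sum>j<n. j)"
  define C' where "C' = esym2 n (\<lambda>j. j) + C + 2 * (D - (of_nat n - 1)) * of_nat (k * N)"
  show thesis
  proof (rule that[of C'])
    fix x :: "nat \<Rightarrow> complex" assume x: "\<And>j. j < n \<Longrightarrow> cmod (x j) < 1 / real (N + 1)" and inj: "inj_on x {..<n}"
    define V where "V = alt n (\<lambda>i. i) x"
    define F where "F = msum N k n (\<lambda>_. 1) x"
    define F1 where "F1 j = msum N k n (\<lambda>m. of_nat (m j)) x" for j
    define F2 where "F2 j l = msum N k n (\<lambda>m. of_nat (m j) * of_nat (m l)) x" for j l
    have pde: "(\<Sum>j<n. \<Sum>l\<in>{..<n} - {j}. F2 j l + (x l * F1 j - x j * F1 l) / (x l - x j)) = C * F"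
      unfolding F_def F1_def F2_def using x by (intro C[OF _ inj]) (simp add: field_simps)
    have ne: "x j - x l \<noteq> 0" if "j < n" "l \<in> {..<n} - {j}" for j l
      using inj that by (auto simp: inj_on_def)
    have hom: "(\<Sum>j<n. F1 j) = of_nat (k * N) * F"
    proof -
      have "(\<Sum>j<n. F1 j) = (\<Sum>m\<in>exps n N. mom N k n m * (\<Sum>j<n. of_nat (m j)) * (\<Prod>j<n. x j ^ m j))"
        unfolding F1_def msum_def by (subst sum.swap) (simp add: sum_distrib_left sum_distrib_right)
      also have "\<dots> = (\<Sum>m\<in>exps n N. of_nat (k * N) * (mom N k n m * 1 * (\<Prod>j<n. x j ^ m j)))"
      proof (rule sum.cong[OF refl])
        fix m
        show "mom N k n m * (\<Sum>j<n. of_nat (m j)) * (\<Prod>j<n. x j ^ m j) = of_nat (k * N) * (mom N k n m * 1 * (\<Prod>j<n. x j ^ m j))"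
          using mom_homogeneous[of N k n m] by (cases "mom N k n m = 0") (simp_all add: of_nat_sum[symmetric] del: of_nat_sum of_nat_mult)
      qed
      finally show ?thesis by (simp only: F_def msum_def sum_distrib_left)
    qed
    \<comment> \<open>The summand is symmetric in the pair, so both halves agree;
      \<open>x_l / (x_l - x_j) = 1 - x_j / (x_j - x_l)\<close> brings it into the form of
      \<open>altd_eq\<close>.\<close>
    have cross: "V * (\<Sum>j<n. \<Sum>l\<in>{..<n} - {j}. (x l * F1 j - x j * F1 l) / (x l - x j)) =
      2 * (\<Sum>j<n. F1 j * ((of_nat n - 1) * V - altd n j x))"
    proof -
      define T where "T = (\<Sum>j<n. \<Sum>l\<in>{..<n} - {j}. x l * F1 j / (x l - x j))"
      have "(\<Sum>j<n. \<Sum>l\<in>{..<n} - {j}. x j * F1 l / (x j - x l)) = T"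
      proof -
        have r: "(\<Sum>j<n. \<Sum>l\<in>{..<n} - {j}. g j l) = (\<Sum>j<n. \<Sum>l<n. if l = j then 0 else g j l)" for g :: "nat \<Rightarrow> nat \<Rightarrow> complex"
          by (intro sum.cong refl sum.mono_neutral_cong_left) auto
        show ?thesis unfolding T_def r by (subst sum.swap) (intro sum.cong refl, auto)
      qed
      moreover have "(\<Sum>j<n. \<Sum>l\<in>{..<n} - {j}. (x l * F1 j - x j * F1 l) / (x l - x j)) =
         T + (\<Sum>j<n. \<Sum>l\<in>{..<n} - {j}. x j * F1 l / (x j - x l))"
        unfolding T_def sum.distrib[symmetric]
      proof (intro sum.cong refl)
        fix j l assume "j \<in> {..<n}" "l \<in> {..<n} - {j}"
        then have "x j - x l \<noteq> 0" using ne by auto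
        then show "(x l * F1 j - x j * F1 l) / (x l - x j) = x l * F1 j / (x l - x j) + x j * F1 l / (x j - x l)"
          using minus_divide_right[of "x j * F1 l" "x l - x j"] by (simp add: diff_divide_distrib)
      qed
      moreover have "V * T = (\<Sum>j<n. F1 j * ((of_nat n - 1) * V - altd n j x))"
        unfolding T_def sum_distrib_left
      proof (rule sum.cong[OF refl])
        fix j assume "j \<in> {..<n}"
        then have j: "j < n" by simp
        have "x l / (x l - x j) = 1 - x j / (x j - x l)" if "l \<in> {..<n} - {j}" for l
        proof -
          have "x j - x l \<noteq> 0" "x l - x j \<noteq> 0" using ne[OF j that] by auto
          then show ?thesis by (simp add: field_simps)
        qed
        then have s: "(\<Sum>l\<in>{..<n} - {j}. x l / (x l - x j)) = of_nat n - 1 - (\<Sum>l\<in>{..<n} - {j}. x j / (x j - x l))"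
          using j by (simp add: sum_subtractf of_nat_diff)
        have "V * (\<Sum>l\<in>{..<n} - {j}. x l / (x l - x j)) = (of_nat n - 1) * V - altd n j x"
          unfolding s altd_eq[OF j inj] V_def[symmetric] by (simp add: algebra_simps)
        moreover have "(\<Sum>l\<in>{..<n} - {j}. V * (x l * F1 j / (x l - x j))) = F1 j * (V * (\<Sum>l\<in>{..<n} - {j}. x l / (x l - x j)))"
          by (simp add: sum_distrib_left mult_ac)
        ultimately show "(\<Sum>l\<in>{..<n} - {j}. V * (x l * F1 j / (x l - x j))) = F1 j * ((of_nat n - 1) * V - altd n j x)"
          by simp
      qed
      ultimately show ?thesis by (simp add: distrib_left)
    qed
    have D: "(\<Sum>j<n. altd n j x) = D * V"
    proof -
      have "(\<Sum>j<n. altd n j x) = altw n (\<lambda>p. \<Sum>j<n. of_nat (p j)) x"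
        by (simp add: altw_sum altw_index)
      also have "\<dots> = D * V"
        unfolding V_def D_def
      proof (rule altw_cong)
        fix p assume "p permutes {..<n}"
        from sum.permute[OF this, of "\<lambda>j. j"]
        show "(\<Sum>j<n. of_nat (p j)) = (of_nat (\<Sum>j<n. j) :: complex)" by (simp add: o_def of_nat_sum[symmetric] del: of_nat_sum)
      qed
      finally show ?thesis .
    qed
    have E: "altw n (esym2 n) x = esym2 n (\<lambda>j. j) * V"
      unfolding V_def
    proof (rule altw_cong)
      fix p assume p: "p permutes {..<n}"
      show "esym2 n p = esym2 n (\<lambda>j. j)"
        using sum.permute[OF p, of "\<lambda>j. j"] sum.permute[OF p, of "\<lambda>j. j\<^sup>2"] by (simp only: esym2_eq o_def)
    qed
    have "wsum N k n (\<lambda>p m. esym2 n (\<lambda>j. p j + m j)) x =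
      wsum N k n (\<lambda>p m. esym2 n p * 1) x + (\<Sum>j<n. \<Sum>l\<in>{..<n} - {j}. altd n j x * F1 l + altd n l x * F1 j) +
      wsum N k n (\<lambda>p m. 1 * esym2 n m) x"
    proof -
      have "esym2 n (\<lambda>j. p j + m j) = esym2 n p * 1 + (\<Sum>j<n. \<Sum>l\<in>{..<n} - {j}. of_nat (p j) * of_nat (m l) + of_nat (p l) * of_nat (m j)) + 1 * esym2 n m" for p m
        unfolding esym2_def by (simp add: sum.distrib algebra_simps)
      then have "wsum N k n (\<lambda>p m. esym2 n (\<lambda>j. p j + m j)) x = wsum N k n (\<lambda>p m. esym2 n p * 1 + (\<Sum>j<n. \<Sum>l\<in>{..<n} - {j}. of_nat (p j) * of_nat (m l) + of_nat (p l) * of_nat (m j)) + 1 * esym2 n m) x"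
        by simp
      then show ?thesis by (simp only: wsum_add wsum_sum finite_lessThan finite_Diff wsum_prod altw_index F1_def)
    qed
    also have "wsum N k n (\<lambda>p m. esym2 n p * 1) x = esym2 n (\<lambda>j. j) * V * F"
      unfolding wsum_prod E F_def ..
    also have "wsum N k n (\<lambda>p m. 1 * esym2 n m) x = V * (\<Sum>j<n. \<Sum>l\<in>{..<n} - {j}. F2 j l)"
    proof -
      have "msum N k n (esym2 n) x = (\<Sum>j<n. \<Sum>l\<in>{..<n} - {j}. F2 j l)"
        unfolding F2_def msum_def esym2_def sum_distrib_left sum_distrib_right
        by (subst sum.swap, rule sum.cong[OF refl], rule sum.swap)
      then show ?thesis unfolding wsum_prod V_def by (simp add: altw_cong[of n _ 1])
    qed
    also have "(\<Sum>j<n. \<Sum>l\<in>{..<n} - {j}. altd n j x * F1 l + altd n l x * F1 j) = 2 * (\<Sum>j<n. F1 j * (D * V - altd n j x))"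
    proof -
      have a: "(\<Sum>j<n. \<Sum>l\<in>{..<n} - {j}. altd n l x * F1 j) = (\<Sum>j<n. F1 j * (D * V - altd n j x))"
        unfolding D[symmetric] by (intro sum.cong refl) (simp add: sum_diff1 sum_distrib_left right_diff_distrib mult.commute)
      have r: "(\<Sum>j<n. \<Sum>l\<in>{..<n} - {j}. g j l) = (\<Sum>j<n. \<Sum>l<n. if l = j then 0 else g j l)" for g :: "nat \<Rightarrow> nat \<Rightarrow> complex"
        by (intro sum.cong refl sum.mono_neutral_cong_left) auto
      have "(\<Sum>j<n. \<Sum>l\<in>{..<n} - {j}. altd n j x * F1 l) = (\<Sum>j<n. \<Sum>l\<in>{..<n} - {j}. altd n l x * F1 j)"
        unfolding r by (subst sum.swap) (intro sum.cong refl, auto)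
      then show ?thesis unfolding sum.distrib a by simp
    qed
    finally have "wsum N k n (\<lambda>p m. esym2 n (\<lambda>j. p j + m j)) x =
      esym2 n (\<lambda>j. j) * V * F + 2 * (\<Sum>j<n. F1 j * (D * V - altd n j x)) + V * (\<Sum>j<n. \<Sum>l\<in>{..<n} - {j}. F2 j l)" .
    also have "V * (\<Sum>j<n. \<Sum>l\<in>{..<n} - {j}. F2 j l) = V * (C * F) - 2 * (\<Sum>j<n. F1 j * ((of_nat n - 1) * V - altd n j x))"
      unfolding pde[symmetric] cross[symmetric] sum.distrib by (simp add: algebra_simps)
    also have "2 * (\<Sum>j<n. F1 j * (D * V - altd n j x)) = 2 * (\<Sum>j<n. F1 j * ((of_nat n - 1) * V - altd n j x)) + 2 * (D - (of_nat n - 1)) * V * (\<Sum>j<n. F1 j)"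
    proof -
      have "(\<Sum>j<n. F1 j * (D * V - altd n j x)) = (\<Sum>j<n. F1 j * ((of_nat n - 1) * V - altd n j x)) + (D - (of_nat n - 1)) * V * (\<Sum>j<n. F1 j)"
        unfolding sum_distrib_left sum.distrib[symmetric] by (intro sum.cong refl) (simp add: algebra_simps)
      then show ?thesis by (simp only: distrib_left mult.assoc)
    qed
    also have "esym2 n (\<lambda>j. j) * V * F + (2 * (\<Sum>j<n. F1 j * ((of_nat n - 1) * V - altd n j x)) + 2 * (D - (of_nat n - 1)) * V * (\<Sum>j<n. F1 j)) +
        (V * (C * F) - 2 * (\<Sum>j<n. F1 j * ((of_nat n - 1) * V - altd n j x))) = C' * (V * F)"
      unfolding hom C'_def by (simp add: algebra_simps)
    also have "V * F = wsum N k n (\<lambda>_ _. 1) x"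
      using wsum_prod[of N k n "\<lambda>_. 1" "\<lambda>_. 1" x] by (simp add: V_def F_def altw_cong[of n _ 1])
    finally show "wsum N k n (\<lambda>p m. esym2 n (\<lambda>j. p j + m j)) x = C' * wsum N k n (\<lambda>_ _. 1) x" .
  qed
qed

text \<open>The coefficient of \<open>x\<^sup>q\<close> in the product of the Vandermonde determinant and the generating function.\<close>

definition acoef :: "nat \<Rightarrow> nat \<Rightarrow> nat \<Rightarrow> (nat \<Rightarrow> nat) \<Rightarrow> complex" where
  "acoef N k n q = (\<Sum>(p, m)\<in>ix n N. if restrict (\<lambda>j. p j + m j) {..<n} = q then of_int (sign p) * mom N k n m else 0)"

text \<open>\<open>wsum_esym2\<close> says that the product is an eigenvector of an operator acting
  on the monomial with exponents \<open>q\<close> by the factor \<open>esym2 n q\<close>. Comparing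
  coefficients, all monomials that occur share the eigenvalue.\<close>

lemma acoef_esym2:
  obtains C where "\<And>q. q \<in> extensional {..<n} \<Longrightarrow> acoef N k n q \<noteq> 0 \<Longrightarrow> esym2 n q = C"
proof (rule wsum_esym2[where n = n and N = N and k = k])
  fix C
  assume C: "\<And>x. (\<And>j. j < n \<Longrightarrow> cmod (x j) < 1 / real (N + 1)) \<Longrightarrow> inj_on x {..<n} \<Longrightarrow>
     wsum N k n (\<lambda>p m. esym2 n (\<lambda>j. p j + m j)) x = C * wsum N k n (\<lambda>_ _. 1) x"
  show thesis
  proof (rule that[of C])
    fix q :: "nat \<Rightarrow> nat" assume q: "q \<in> extensional {..<n}" and nz: "acoef N k n q \<noteq> 0"
    define b where "b = (\<lambda>(p, m). of_int (sign p) * mom N k n m * (esym2 n (\<lambda>j. p j + m j) - C))"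
    define \<mu> where "\<mu> = (\<lambda>(p::nat\<Rightarrow>nat, m::nat\<Rightarrow>nat). \<lambda>j. p j + m j)"
    have "(\<Sum>i\<in>ix n N. b i * (if restrict (\<mu> i) {..<n} = q then 1 else 0)) = 0"
    proof (rule exp_sum_zero[where \<epsilon> = "1 / real (N + 1)" and \<phi> = "\<lambda>s. if s = q then 1 else 0"])
      fix x :: "nat \<Rightarrow> complex"
      assume x: "\<And>j. j < n \<Longrightarrow> cmod (x j) < 1 / real (N + 1)" "inj_on x {..<n}"
      have "(\<Sum>i\<in>ix n N. b i * (\<Prod>j<n. x j ^ \<mu> i j)) =
         wsum N k n (\<lambda>p m. esym2 n (\<lambda>j. p j + m j)) x - C * wsum N k n (\<lambda>_ _. 1) x"
        unfolding wsum_def sum_distrib_left sum_subtractf[symmetric]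
        by (intro sum.cong refl) (auto simp: b_def \<mu>_def algebra_simps)
      then show "(\<Sum>i\<in>ix n N. b i * (\<Prod>j<n. x j ^ \<mu> i j)) = 0" using C[OF x] by simp
    qed auto
    moreover have "(\<Sum>i\<in>ix n N. b i * (if restrict (\<mu> i) {..<n} = q then 1 else 0)) = acoef N k n q * (esym2 n q - C)"
      unfolding acoef_def sum_distrib_right
    proof (intro sum.cong refl, clarify)
      fix p m
      show "b (p, m) * (if restrict (\<mu> (p, m)) {..<n} = q then 1 else 0) =
        (if (\<lambda>j\<in>{..<n}. p j + m j) = q then complex_of_int (sign p) * mom N k n m else 0) * (esym2 n q - C)"
      proof (cases "(\<lambda>j\<in>{..<n}. p j + m j) = q")
        case True
        then have "esym2 n q = esym2 n (\<lambda>j. p j + m j)" by (intro esym2_cong) auto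
        then show ?thesis using True by (simp add: b_def \<mu>_def)
      qed (simp add: \<mu>_def)
    qed
    ultimately show "esym2 n q = C" using nz by simp
  qed
qed

text \<open>The Vandermonde determinant is alternating and F is symmetric by
  \<open>mom_permute\<close>; both facts enter through one reindexing of the pairs
  \<open>(p, m)\<close>.\<close>

lemma acoef_permute:
  assumes \<pi>: "\<pi> permutes {..<n}" and q: "q \<in> extensional {..<n}"
  shows "acoef N k n (q \<circ> \<pi>) = of_int (sign \<pi>) * acoef N k n q"
proof -
  let ?i = "inv_into UNIV \<pi>"
  have i: "?i permutes {..<n}" by (rule permutes_inv[OF \<pi>])
  have pi: "\<pi> \<circ> ?i = id" "?i \<circ> \<pi> = id" using permutes_inv_o[OF \<pi>] by auto
  have ex: "m \<circ> \<rho> \<in> exps n N" if "m \<in> exps n N" "\<rho> permutes {..<n}" for m \<rho>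
    using that permutes_in_image[OF that(2)] permutes_not_in[OF that(2)]
    by (auto simp: exps_def PiE_def extensional_def Pi_iff)
  have iff: "restrict (\<lambda>j. (p \<circ> \<rho>) j + (m \<circ> \<rho>) j) {..<n} = q' \<circ> \<rho> \<longleftrightarrow> restrict (\<lambda>j. p j + m j) {..<n} = q'"
    if \<rho>: "\<rho> permutes {..<n}" and q': "q' \<in> extensional {..<n}" for p m q' :: "nat \<Rightarrow> nat" and \<rho>
  proof -
    have r1: "restrict (\<lambda>j. (p \<circ> \<rho>) j + (m \<circ> \<rho>) j) {..<n} = restrict (\<lambda>j. p j + m j) {..<n} \<circ> \<rho>"
    proof (rule ext)
      fix j
      show "restrict (\<lambda>j. (p \<circ> \<rho>) j + (m \<circ> \<rho>) j) {..<n} j = (restrict (\<lambda>j. p j + m j) {..<n} \<circ> \<rho>) j"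
        using permutes_in_image[OF \<rho>, of j] by (auto simp: restrict_def)
    qed
    have r2: "f \<circ> \<rho> = g \<circ> \<rho> \<longleftrightarrow> f = g" for f g :: "nat \<Rightarrow> nat"
    proof
      assume h: "f \<circ> \<rho> = g \<circ> \<rho>"
      show "f = g"
      proof (rule ext)
        fix y
        obtain z where "y = \<rho> z" using permutes_surj[OF \<rho>] by (meson surjD)
        then show "f y = g y" using fun_cong[OF h, of z] by simp
      qed
    qed simp
    show ?thesis unfolding r1 by (rule r2)
  qed
  have "of_int (sign \<pi>) * acoef N k n q = (\<Sum>(p, m)\<in>ix n N. if restrict (\<lambda>j. p j + m j) {..<n} = q then of_int (sign \<pi>) * of_int (sign p) * mom N k n m else 0)"
    unfolding acoef_def sum_distrib_left by (intro sum.cong refl) auto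
  also have "\<dots> = acoef N k n (q \<circ> \<pi>)"
    unfolding acoef_def
  proof (rule sum.reindex_bij_witness[where j = "\<lambda>(p, m). (p \<circ> \<pi>, m \<circ> \<pi>)" and i = "\<lambda>(p, m). (p \<circ> ?i, m \<circ> ?i)"])
    fix a assume a: "a \<in> ix n N"
    obtain p m where pm: "a = (p, m)" by (cases a)
    have p: "p permutes {..<n}" "m \<in> exps n N" using a by (auto simp: ix_def pm)
    show "(case case a of (p, m) \<Rightarrow> (p \<circ> \<pi>, m \<circ> \<pi>) of (p, m) \<Rightarrow> (p \<circ> ?i, m \<circ> ?i)) = a"
      by (simp add: pm comp_assoc pi)
    show "(case a of (p, m) \<Rightarrow> (p \<circ> \<pi>, m \<circ> \<pi>)) \<in> ix n N"
      using permutes_compose[OF \<pi> p(1)] ex[OF p(2) \<pi>] by (simp add: pm ix_def)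
    show "(case case a of (p, m) \<Rightarrow> (p \<circ> ?i, m \<circ> ?i) of (p, m) \<Rightarrow> (p \<circ> \<pi>, m \<circ> \<pi>)) = a"
      by (simp add: pm comp_assoc pi)
    show "(case a of (p, m) \<Rightarrow> (p \<circ> ?i, m \<circ> ?i)) \<in> ix n N"
      using permutes_compose[OF i p(1)] ex[OF p(2) i] by (simp add: pm ix_def)
    have "sign (p \<circ> \<pi>) = sign p * sign \<pi>"
      using p(1) \<pi> by (intro sign_compose) (auto intro: permutation_permutes[THEN iffD2])
    then show "(case case a of (p, m) \<Rightarrow> (p \<circ> \<pi>, m \<circ> \<pi>) of (p, m) \<Rightarrow> if (\<lambda>j\<in>{..<n}. p j + m j) = q \<circ> \<pi> then of_int (sign p) * mom N k n m else 0) =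
      (case a of (p, m) \<Rightarrow> if (\<lambda>j\<in>{..<n}. p j + m j) = q then of_int (sign \<pi>) * of_int (sign p) * mom N k n m else 0)"
      using iff[OF \<pi> q, of p m] by (simp add: pm mom_permute[OF \<pi>] mult_ac)
  qed
  finally show ?thesis by simp
qed

lemma acoef_inj:
  assumes q: "q \<in> extensional {..<n}" and nz: "acoef N k n q \<noteq> 0"
  shows "inj_on q {..<n}"
proof (rule inj_onI, rule ccontr)
  fix i j assume ij: "i \<in> {..<n}" "j \<in> {..<n}" "q i = q j" "i \<noteq> j"
  let ?t = "Transposition.transpose i j :: nat \<Rightarrow> nat"
  have t: "?t permutes {..<n}" using ij by (intro permutes_swap_id) auto
  have "q \<circ> ?t = q" using ij by (auto simp: fun_eq_iff Transposition.transpose_def)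
  then have "acoef N k n q = - acoef N k n q"
    using acoef_permute[OF t q, of N k] ij(4) by (simp add: sign_swap_id)
  then have "2 * acoef N k n q = 0" unfolding mult_2 by (metis add.right_inverse)
  then show False using nz by simp
qed

text \<open>The sum combines the degree of the Vandermonde determinant with the homogeneity of F.
  The bound holds because each variable has degree at most \<open>n - 1\<close> in the one and
  \<open>N\<close> in the other.\<close>

lemma acoef_sum:
  assumes "acoef N k n q \<noteq> 0"
  shows "(\<Sum>j<n. q j) = (\<Sum>j<n. j) + k * N" "\<forall>j<n. q j \<le> N + n - 1"
proof -
  obtain a where a: "a \<in> ix n N" "(case a of (p, m) \<Rightarrow> if restrict (\<lambda>j. p j + m j) {..<n} = q then of_int (sign p) * mom N k n m else 0) \<noteq> 0"
    using assms unfolding acoef_def by (rule sum.not_neutral_contains_not_neutral)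
  then obtain p m where pm: "(p, m) \<in> ix n N" "restrict (\<lambda>j. p j + m j) {..<n} = q" "mom N k n m \<noteq> 0"
    by (cases a) (auto split: if_splits)
  have p: "p permutes {..<n}" "m \<in> exps n N" using pm(1) by (auto simp: ix_def)
  have q: "q j = p j + m j" if "j < n" for j using pm(2) that by auto
  have "(\<Sum>j<n. q j) = (\<Sum>j<n. p j) + (\<Sum>j<n. m j)" by (simp add: q sum.distrib)
  also have "(\<Sum>j<n. p j) = (\<Sum>j<n. j)" using sum.permute[OF p(1), of "\<lambda>j. j"] by (simp add: o_def)
  also have "(\<Sum>j<n. m j) = k * N" by (rule mom_homogeneous[OF pm(3)])
  finally show "(\<Sum>j<n. q j) = (\<Sum>j<n. j) + k * N" .
  show "\<forall>j<n. q j \<le> N + n - 1"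
  proof (intro allI impI)
    fix j assume j: "j < n"
    have "p j < n" using permutes_in_image[OF p(1), of j] j by simp
    moreover have "m j \<le> N" using p(2) j by (auto simp: exps_def)
    ultimately show "q j \<le> N + n - 1" using q[OF j] by linarith
  qed
qed

section \<open>Identification of the single alternant\<close>

definition ltop :: "nat \<Rightarrow> nat \<Rightarrow> nat \<Rightarrow> nat" where
  "ltop N k j = (if j < k then j else N + j)"

text \<open>The inequalities make each block invariant. On a block a permutation has the same sum as
  the identity, so inequality at every point forces equality.\<close>

lemma permutes_two_blocks:
  fixes p :: "nat \<Rightarrow> nat"
  assumes p: "p permutes {..<n}" and lo: "\<And>j. j < k \<Longrightarrow> j < n \<Longrightarrow> p j \<le> j" and hi: "\<And>j. k \<le> j \<Longrightarrow> j < n \<Longrightarrow> j \<le> p j"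
    and k: "k \<le> n"
  shows "p = id"
proof -
  have inj: "inj p" by (rule permutes_inj[OF p])
  have As: "p ` {..<k} \<subseteq> {..<k}"
  proof
    fix y assume "y \<in> p ` {..<k}"
    then obtain j where j: "y = p j" "j < k" by auto
    then have "p j \<le> j" using k by (intro lo) auto
    then show "y \<in> {..<k}" using j by simp
  qed
  have A: "p ` {..<k} = {..<k}"
    by (rule endo_inj_surj[OF finite_lessThan As inj_on_subset[OF inj subset_UNIV]])
  have Bs: "p ` {k..<n} \<subseteq> {k..<n}"
  proof
    fix y assume "y \<in> p ` {k..<n}"
    then obtain j where j: "y = p j" "k \<le> j" "j < n" by auto
    then show "y \<in> {k..<n}" using hi[OF j(2,3)] permutes_in_image[OF p, of j] by auto
  qed
  have B: "p ` {k..<n} = {k..<n}"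
    by (rule endo_inj_surj[OF finite_atLeastLessThan Bs inj_on_subset[OF inj subset_UNIV]])
  have 1: "p j = j" if "j < k" for j
  proof (rule sum_mono_inv[of p "{..<k}" "\<lambda>j. j"])
    show "sum p {..<k} = \<Sum>{..<k}" using sum.reindex[of p "{..<k}" "\<lambda>j. j"] A inj_on_subset[OF inj subset_UNIV] by simp
  qed (use lo k that in auto)
  have 2: "p j = j" if "k \<le> j" "j < n" for j
  proof (rule sym, rule sum_mono_inv[of "\<lambda>j. j" "{k..<n}" p])
    show "\<Sum>{k..<n} = sum p {k..<n}" using sum.reindex[of p "{k..<n}" "\<lambda>j. j"] B inj_on_subset[OF inj subset_UNIV] by simp
  qed (use hi that in auto)
  show ?thesis
  proof (rule ext)
    fix j show "p j = id j" using 1 2 permutes_not_in[OF p, of j] by (cases "j < n"; cases "j < k") auto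
  qed
qed

text \<open>Only one pair contributes: \<open>p j + m j = j\<close> gives \<open>p j \<le> j\<close>
  in the lower half, and m j \<le> N gives \<open>p j \<ge> j\<close> in the upper half. So
  \<open>p\<close> is the identity and the moment is that of \<open>mom_top\<close>.\<close>

lemma acoef_ltop: "acoef N k (2 * k) (restrict (ltop N k) {..<2 * k}) = 1"
proof -
  let ?n = "2 * k"
  let ?m = "restrict (\<lambda>j. if j < k then 0 else N) {..<?n}"
  let ?f = "\<lambda>(p, m). if restrict (\<lambda>j. p j + m j) {..<?n} = restrict (ltop N k) {..<?n} then of_int (sign p) * mom N k ?n m else 0"
  have only: "a = (id, ?m)" if a: "a \<in> ix ?n N" "?f a \<noteq> 0" for a
  proof -
    obtain p m where pm: "a = (p, m)" by (cases a)
    have p: "p permutes {..<?n}" "m \<in> exps ?n N" using a by (auto simp: ix_def pm)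
    have e: "restrict (\<lambda>j. p j + m j) {..<?n} = restrict (ltop N k) {..<?n}" using a(2) by (auto simp: pm split: if_splits)
    have e': "p j + m j = ltop N k j" if "j < ?n" for j using fun_cong[OF e, of j] that by simp
    have mN: "m j \<le> N" if "j < ?n" for j using p(2) that by (auto simp: exps_def)
    have "p = id"
    proof (rule permutes_two_blocks[OF p(1), of k])
      show "p j \<le> j" if "j < k" "j < ?n" for j using e'[OF that(2)] that by (simp add: ltop_def)
      show "j \<le> p j" if "k \<le> j" "j < ?n" for j using e'[OF that(2)] mN[OF that(2)] that by (simp add: ltop_def)
    qed simp
    moreover have "m = ?m"
    proof (rule ext)
      fix j show "m j = ?m j"
        using e'[of j] p(2) \<open>p = id\<close> by (cases "j < ?n") (auto simp: ltop_def exps_def PiE_def extensional_def split: if_splits)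
    qed
    ultimately show ?thesis by (simp add: pm)
  qed
  have in_ix: "(id, ?m) \<in> ix ?n N" by (auto simp: ix_def permutes_id exps_def)
  have "acoef N k ?n (restrict (ltop N k) {..<?n}) = (\<Sum>a\<in>{(id, ?m)}. ?f a)"
    unfolding acoef_def using only in_ix by (intro sum.mono_neutral_right) auto
  also have "\<dots> = mom N k ?n ?m"
    by (auto simp: ltop_def restrict_def fun_eq_iff)
  also have "\<dots> = mom N k (k + k) (\<lambda>j. if j < k then 0 else N)"
    unfolding mult_2 by (rule mom_cong) auto
  also have "\<dots> = 1" by (rule mom_top)
  finally show ?thesis .
qed

text \<open>Measure squared distances from the centre of the range 0, ...,
  \<open>N + 2k - 1\<close>. The values of \<open>ltop\<close> are the \<open>2k\<close> points at
  distance at least \<open>(N + 1)/2\<close>; any other point is strictly closer. Equal sums and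
  sums of squares give equal total distance, so no value of \<open>ltop\<close> can have been
  exchanged.\<close>

lemma extremal_exponents:
  fixes q :: "nat \<Rightarrow> nat"
  assumes inj: "inj_on q {..<2 * k}" and le: "\<And>j. j < 2 * k \<Longrightarrow> q j \<le> N + 2 * k - 1"
    and s1: "(\<Sum>j<2 * k. q j) = (\<Sum>j<2 * k. ltop N k j)"
    and s2: "(\<Sum>j<2 * k. (q j)\<^sup>2) = (\<Sum>j<2 * k. (ltop N k j)\<^sup>2)"
  shows "q ` {..<2 * k} = ltop N k ` {..<2 * k}"
proof -
  let ?n = "2 * k"
  \<comment> \<open>The largest admissible exponent. Working with \<open>2m - L\<close> over the
    integers avoids halves and truncated subtraction.\<close>
  define L :: int where "L = int N + 2 * int k - 1"
  define w where "w m = (2 * int m - L)\<^sup>2" for m :: nat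
  let ?T = "q ` {..<?n}" and ?S = "ltop N k ` {..<?n}"
  have injl: "inj_on (ltop N k) {..<?n}" by (auto simp: inj_on_def ltop_def split: if_splits)
  have exp: "(\<Sum>j<?n. w (f j)) = 4 * int (\<Sum>j<?n. (f j)\<^sup>2) - 4 * L * int (\<Sum>j<?n. f j) + int ?n * L\<^sup>2" for f
    unfolding w_def by (simp add: power2_diff sum.distrib sum_subtractf sum_distrib_left algebra_simps power2_eq_square)
  have sumw: "sum w ?T = sum w ?S"
    using sum.reindex[OF inj, of w] sum.reindex[OF injl, of w] exp[of q] exp[of "ltop N k"] s1 s2 by (simp add: o_def)
  have card: "card ?T = card ?S" by (simp add: card_image inj injl)
  have wS: "w m \<ge> (int N + 1)\<^sup>2" if m: "m \<in> ?S" for m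
  proof -
    obtain j where j: "j < ?n" "m = ltop N k j" using m by auto
    have "\<bar>2 * int m - L\<bar> \<ge> int N + 1"
      using j by (cases "j < k") (auto simp: ltop_def L_def)
    then have "(int N + 1)\<^sup>2 \<le> \<bar>2 * int m - L\<bar>\<^sup>2" by (intro power_mono) auto
    then show ?thesis by (simp add: w_def)
  qed
  have wT: "w m < (int N + 1)\<^sup>2" if m: "m \<in> ?T - ?S" for m
  proof -
    obtain j where j: "j < ?n" "m = q j" using m by auto
    have mL: "m \<le> N + ?n - 1" using le[OF j(1)] j by simp
    have k1: "m \<ge> k"
    proof (rule ccontr)
      assume "\<not> k \<le> m"
      then have "m = ltop N k m" "m < ?n" by (auto simp: ltop_def)
      then show False using m by blast
    qed
    have k2: "m < N + k"
    proof (rule ccontr)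
      assume "\<not> m < N + k"
      then have "m = ltop N k (m - N)" "m - N < ?n" using mL j by (auto simp: ltop_def)
      then show False using m by blast
    qed
    have "\<bar>2 * int m - L\<bar> < int N + 1" using k1 k2 by (auto simp: L_def)
    then have "\<bar>2 * int m - L\<bar>\<^sup>2 < (int N + 1)\<^sup>2" by (intro power_strict_mono) auto
    then show ?thesis by (simp add: w_def)
  qed
  have fin: "finite ?T" "finite ?S" by auto
  have c: "card (?T - ?S) = card (?S - ?T)"
    using card card_Diff_subset_Int[of ?T ?S] card_Diff_subset_Int[of ?S ?T] by (simp add: Int_commute)
  have "?T - ?S = {}"
  proof (rule ccontr)
    assume ne: "?T - ?S \<noteq> {}"
    have "sum w (?T - ?S) < of_nat (card (?T - ?S)) * (int N + 1)\<^sup>2"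
      using sum_strict_mono[of "?T - ?S" w "\<lambda>_. (int N + 1)\<^sup>2"] wT ne by simp
    also have "\<dots> = of_nat (card (?S - ?T)) * (int N + 1)\<^sup>2" by (simp only: c)
    also have "\<dots> \<le> sum w (?S - ?T)"
      using sum_mono[of "?S - ?T" "\<lambda>_. (int N + 1)\<^sup>2" w] wS by simp
    finally have "sum w (?T - ?S) < sum w (?S - ?T)" .
    moreover have "sum w ?T = sum w (?T \<inter> ?S) + sum w (?T - ?S)" by (rule sum.Int_Diff) simp
    moreover have "sum w ?S = sum w (?S \<inter> ?T) + sum w (?S - ?T)" by (rule sum.Int_Diff) simp
    ultimately show False using sumw by (simp add: Int_commute)
  qed
  then show ?thesis using card fin by (metis Diff_eq_empty_iff card_subset_eq)
qed

text \<open>By the lemmas above every exponent vector that occurs is a permutation of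
  \<open>ltop\<close>, and antisymmetry fixes its coefficient to the sign.\<close>

lemma wsum_eq_alt: "wsum N k (2 * k) (\<lambda>_ _. 1) x = alt (2 * k) (ltop N k) x"
proof -
  let ?n = "2 * k"
  let ?l = "restrict (ltop N k) {..<?n}"
  let ?P = "{p. p permutes {..<?n}}"
  define \<phi> where "\<phi> q = (\<Prod>j<?n. x j ^ q j)" for q :: "nat \<Rightarrow> nat"
  define r where "r = (\<lambda>(p, m). restrict (\<lambda>j. p j + m j) {..<?n} :: nat \<Rightarrow> nat)"
  define b where "b = (\<lambda>(p :: nat \<Rightarrow> nat, m). of_int (sign p) * mom N k ?n m)"
  define a where "a = acoef N k ?n"
  have a_eq: "a q = (\<Sum>i\<in>{i \<in> ix ?n N. r i = q}. b i)" for q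
    unfolding a_def acoef_def r_def b_def sum.inter_filter[OF finite_ix] by (intro sum.cong refl) auto
  have injl: "inj_on (ltop N k) {..<?n}" by (auto simp: inj_on_def ltop_def split: if_splits)
  have lext: "?l \<in> extensional {..<?n}" by simp
  obtain C where C: "\<And>q. q \<in> extensional {..<?n} \<Longrightarrow> a q \<noteq> 0 \<Longrightarrow> esym2 ?n q = C"
    unfolding a_def by (rule acoef_esym2[where n = ?n and N = N and k = k]) blast
  have al: "a ?l = 1" unfolding a_def by (rule acoef_ltop)
  have Cl: "C = esym2 ?n ?l" using C[OF lext] al by simp
  have sl: "(\<Sum>j<?n. ?l j) = (\<Sum>j<?n. j) + k * N" using acoef_sum(1)[of N k ?n ?l] al by (simp add: a_def)
  have orbit: "q \<in> (\<lambda>p. ?l \<circ> p) ` ?P" if q: "q \<in> extensional {..<?n}" "a q \<noteq> 0" for q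
  proof -
    have inj: "inj_on q {..<?n}" using acoef_inj q unfolding a_def by blast
    have s: "(\<Sum>j<?n. q j) = (\<Sum>j<?n. ?l j)" and le: "\<forall>j<?n. q j \<le> N + ?n - 1"
      using acoef_sum[of N k ?n q] q sl unfolding a_def by auto
    have "esym2 ?n q = esym2 ?n ?l" using C[OF q] Cl by simp
    then have "of_nat (\<Sum>j<?n. (q j)\<^sup>2) = (of_nat (\<Sum>j<?n. (?l j)\<^sup>2) :: complex)"
      unfolding esym2_eq s by simp
    then have s2: "(\<Sum>j<?n. (q j)\<^sup>2) = (\<Sum>j<?n. (?l j)\<^sup>2)" by (simp only: of_nat_eq_iff)
    have im: "q ` {..<?n} = ltop N k ` {..<?n}"
      using s s2 le by (intro extremal_exponents inj) auto
    define p where "p j = (if j < ?n then inv_into {..<?n} (ltop N k) (q j) else j)" for j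
    have pj: "p j < ?n \<and> ltop N k (p j) = q j" if "j < ?n" for j
    proof -
      have "q j \<in> ltop N k ` {..<?n}" using im that by blast
      then show ?thesis using inv_into_into[of "q j" "ltop N k" "{..<?n}"] f_inv_into_f[of "q j" "ltop N k" "{..<?n}"] that
        by (simp add: p_def)
    qed
    have "inj_on p {..<?n}" using pj inj by (metis (mono_tags, lifting) inj_on_def lessThan_iff)
    moreover have "p ` {..<?n} \<subseteq> {..<?n}" using pj by auto
    ultimately have "bij_betw p {..<?n} {..<?n}" by (simp add: bij_betw_def endo_inj_surj)
    then have "p permutes {..<?n}" by (rule bij_imp_permutes) (simp add: p_def)
    moreover have "q = ?l \<circ> p"
    proof (rule ext)
      fix j show "q j = (?l \<circ> p) j"
        using pj[of j] q(1) by (cases "j < ?n") (auto simp: extensional_def p_def)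
    qed
    ultimately show ?thesis by blast
  qed
  have injP: "inj_on (\<lambda>p. ?l \<circ> p) ?P"
  proof (rule inj_onI, rule ext)
    fix p p' j assume p: "p \<in> ?P" "p' \<in> ?P" "?l \<circ> p = ?l \<circ> p'"
    show "p j = p' j"
    proof (cases "j < ?n")
      case True
      have b: "p j < ?n" "p' j < ?n" using p(1,2) permutes_in_image[of p "{..<?n}" j] permutes_in_image[of p' "{..<?n}" j] True by auto
      have "ltop N k (p j) = ltop N k (p' j)" using fun_cong[OF p(3), of j] b by simp
      then show ?thesis using injl b by (auto simp: inj_on_def)
    next
      case False
      then show ?thesis using p(1,2) permutes_not_in[of p "{..<?n}" j] permutes_not_in[of p' "{..<?n}" j] by simp
    qed
  qed
  have "wsum N k ?n (\<lambda>_ _. 1) x = (\<Sum>i\<in>ix ?n N. b i * \<phi> (r i))"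
    unfolding wsum_def by (intro sum.cong refl) (auto simp: b_def r_def \<phi>_def)
  also have "\<dots> = (\<Sum>q\<in>r ` ix ?n N. \<Sum>i\<in>{i \<in> ix ?n N. r i = q}. b i * \<phi> (r i))"
    by (rule sum.image_gen) simp
  also have "\<dots> = (\<Sum>q\<in>r ` ix ?n N. a q * \<phi> q)"
    unfolding a_eq sum_distrib_right by (intro sum.cong refl) auto
  also have "\<dots> = (\<Sum>q\<in>r ` ix ?n N \<union> (\<lambda>p. ?l \<circ> p) ` ?P. a q * \<phi> q)"
  proof (rule sum.mono_neutral_left)
    have "a q = 0" if "q \<notin> r ` ix ?n N" for q
    proof -
      have "{i \<in> ix ?n N. r i = q} = {}" using that by auto
      then show ?thesis unfolding a_eq by (metis sum.empty)
    qed
    then show "\<forall>i\<in>r ` ix ?n N \<union> (\<lambda>p. ?l \<circ> p) ` ?P - r ` ix ?n N. a i * \<phi> i = 0" by auto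
  qed (auto simp: finite_permutations)
  also have "\<dots> = (\<Sum>q\<in>(\<lambda>p. ?l \<circ> p) ` ?P. a q * \<phi> q)"
  proof (rule sum.mono_neutral_right)
    have ext: "r i \<in> extensional {..<?n}" for i by (cases i) (simp add: r_def)
    show "\<forall>q\<in>r ` ix ?n N \<union> (\<lambda>p. ?l \<circ> p) ` ?P - (\<lambda>p. ?l \<circ> p) ` ?P. a q * \<phi> q = 0"
    proof
      fix q assume q: "q \<in> r ` ix ?n N \<union> (\<lambda>p. ?l \<circ> p) ` ?P - (\<lambda>p. ?l \<circ> p) ` ?P"
      then obtain i where "q = r i" by blast
      then have "q \<in> extensional {..<?n}" using ext by simp
      then have "a q = 0" using orbit[of q] q by blast
      then show "a q * \<phi> q = 0" by simp
    qed
  qed (auto simp: finite_permutations)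
  also have "\<dots> = (\<Sum>p\<in>?P. a (?l \<circ> p) * \<phi> (?l \<circ> p))"
    by (simp add: sum.reindex[OF injP])
  also have "\<dots> = alt ?n (ltop N k) x"
    unfolding alt_def
  proof (rule sum.cong[OF refl])
    fix p assume "p \<in> ?P"
    then have p: "p permutes {..<?n}" by simp
    have "a (?l \<circ> p) = of_int (sign p)" using acoef_permute[OF p lext, of N k] al by (simp add: a_def)
    moreover have "\<phi> (?l \<circ> p) = (\<Prod>j<?n. x j ^ ltop N k (p j))"
      unfolding \<phi>_def using permutes_in_image[OF p] by (intro prod.cong refl) auto
    ultimately show "a (?l \<circ> p) * \<phi> (?l \<circ> p) = of_int (sign p) * (\<Prod>j<?n. x j ^ ltop N k (p j))" by simp
  qed
  finally show ?thesis .
qed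

text \<open>F as a quotient of alternants, that is, a Schur function in the classical
  definition.\<close>

lemma alt_msum: "alt (2 * k) (\<lambda>i. i) x * msum N k (2 * k) (\<lambda>_. 1) x = alt (2 * k) (ltop N k) x"
  using wsum_prod[of N k "2 * k" "\<lambda>_. 1" "\<lambda>_. 1" x] wsum_eq_alt[of N k x] altw_cong[of "2 * k" "\<lambda>_. 1" 1 x] by simp

subsection \<open>Compositions and the Jacobi-Trudi identity\<close>

definition comps :: "nat \<Rightarrow> nat \<Rightarrow> (nat \<Rightarrow> nat) set" where
  "comps n M = {\<mu> \<in> Pi\<^sub>E {..<n} (\<lambda>_. {..M}). (\<Sum>j<n. \<mu> j) = M}"

lemma finite_comps [simp]: "finite (comps n M)"
  by (simp add: comps_def finite_PiE)

lemma comps_iff: "\<mu> \<in> comps n M \<longleftrightarrow> \<mu> \<in> extensional {..<n} \<and> (\<Sum>j<n. \<mu> j) = M"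
proof -
  have "\<mu> j \<le> M" if "(\<Sum>j<n. \<mu> j) = M" "j < n" for j
    using member_le_sum[of j "{..<n}" \<mu>] that by simp
  then show ?thesis by (auto simp: comps_def PiE_def)
qed

lemma fps_prod_nth:
  fixes w :: "nat \<Rightarrow> nat \<Rightarrow> 'a::comm_ring_1"
  shows "fps_nth (\<Prod>j<n. Abs_fps (w j)) M = (\<Sum>\<mu>\<in>comps n M. \<Prod>j<n. w j (\<mu> j))"
proof (induction n arbitrary: M)
  case 0
  have "comps 0 M = (if M = 0 then {\<lambda>_. undefined} else {})" by (auto simp: comps_iff extensional_def)
  then show ?case by simp
next
  case (Suc n)
  have "fps_nth (\<Prod>j<Suc n. Abs_fps (w j)) M = (\<Sum>i\<le>M. fps_nth (\<Prod>j<n. Abs_fps (w j)) i * w n (M - i))"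
    by (simp add: fps_mult_nth atMost_atLeast0)
  also have "\<dots> = (\<Sum>i\<le>M. \<Sum>\<mu>\<in>comps n i. (\<Prod>j<n. w j (\<mu> j)) * w n (M - i))"
    by (simp add: Suc.IH sum_distrib_right)
  also have "\<dots> = (\<Sum>(i, \<mu>)\<in>Sigma {..M} (comps n). (\<Prod>j<n. w j (\<mu> j)) * w n (M - i))"
    by (rule sum.Sigma) auto
  also have "\<dots> = (\<Sum>\<mu>\<in>comps (Suc n) M. \<Prod>j<Suc n. w j (\<mu> j))"
  proof (rule sum.reindex_bij_witness[where i = "\<lambda>\<nu>. (\<Sum>j<n. \<nu> j, restrict \<nu> {..<n})" and j = "\<lambda>(i, \<mu>). \<mu>(n := M - i)"])
    fix a assume a: "a \<in> Sigma {..M} (comps n)"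
    obtain i \<mu> where im: "a = (i, \<mu>)" by (cases a)
    have i: "i \<le> M" "\<mu> \<in> extensional {..<n}" "(\<Sum>j<n. \<mu> j) = i" using a by (auto simp: im comps_iff)
    show "((\<Sum>j<n. (case a of (i, \<mu>) \<Rightarrow> \<mu>(n := M - i)) j), restrict (case a of (i, \<mu>) \<Rightarrow> \<mu>(n := M - i)) {..<n}) = a"
      using i by (auto simp: im extensional_def fun_eq_iff)
    show "(case a of (i, \<mu>) \<Rightarrow> \<mu>(n := M - i)) \<in> comps (Suc n) M"
      using i by (auto simp: im comps_iff extensional_def)
    show "(\<Prod>j<Suc n. w j ((case a of (i, \<mu>) \<Rightarrow> \<mu>(n := M - i)) j)) = (case a of (i, \<mu>) \<Rightarrow> (\<Prod>j<n. w j (\<mu> j)) * w n (M - i))"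
      by (simp add: im)
  next
    fix \<nu> assume "\<nu> \<in> comps (Suc n) M"
    then have n: "\<nu> \<in> extensional {..<Suc n}" "(\<Sum>j<n. \<nu> j) + \<nu> n = M" by (auto simp: comps_iff)
    show "(case (\<Sum>j<n. \<nu> j, restrict \<nu> {..<n}) of (i, \<mu>) \<Rightarrow> \<mu>(n := M - i)) = \<nu>"
    proof (rule ext)
      fix j show "(case (\<Sum>j<n. \<nu> j, restrict \<nu> {..<n}) of (i, \<mu>) \<Rightarrow> \<mu>(n := M - i)) j = \<nu> j"
        using n by (cases "j < Suc n") (auto simp: extensional_def less_Suc_eq)
    qed
    show "(\<Sum>j<n. \<nu> j, restrict \<nu> {..<n}) \<in> Sigma {..M} (comps n)" using n by (auto simp: comps_iff)
  qed
  finally show ?case .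
qed

definition hsym :: "nat \<Rightarrow> (nat \<Rightarrow> complex) \<Rightarrow> nat \<Rightarrow> complex" where
  "hsym n x M = fps_nth (\<Prod>j<n. Abs_fps (\<lambda>a. x j ^ a)) M"

text \<open>The complete homogeneous symmetric function of degree \<open>a - s\<close>, with value 0
  for negative degree, where subtraction on \<open>nat\<close> would give degree 0.\<close>

definition hz :: "nat \<Rightarrow> (nat \<Rightarrow> complex) \<Rightarrow> nat \<Rightarrow> nat \<Rightarrow> complex" where
  "hz n x a s = (if s \<le> a then hsym n x (a - s) else 0)"

lemma hsym_0 [simp]: "hsym n x 0 = 1"
  unfolding hsym_def by (induction n) (auto simp: fps_mult_nth)

lemma geometric_fps: "Abs_fps (\<lambda>a. c ^ a) * fps_of_poly [:1, - c :: complex:] = 1"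
proof -
  have h: "fps_of_poly [:1, - c:] = 1 - fps_const c * fps_X"
    by (rule fps_ext) (auto simp: coeff_pCons split: nat.split)
  have "Abs_fps (\<lambda>a. c ^ a) * fps_of_poly [:1, - c :: complex:] = Abs_fps (\<lambda>a. c ^ a) - fps_const c * (Abs_fps (\<lambda>a. c ^ a) * fps_X)"
    unfolding h by (simp add: right_diff_distrib mult.left_commute)
  also have "\<dots> = 1"
  proof (rule fps_ext)
    fix a show "fps_nth (Abs_fps (\<lambda>a. c ^ a) - fps_const c * (Abs_fps (\<lambda>a. c ^ a) * fps_X)) a = fps_nth 1 a"
      by (cases a) auto
  qed
  finally show ?thesis .
qed

text \<open>Multiplying the generating function of the \<open>hsym\<close> by all factors
  \<open>1 - x_q t\<close> with \<open>q \<noteq> p\<close> leaves the geometric series in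
  \<open>x_p\<close>.\<close>

lemma power_eq_sum_hz:
  assumes p: "p < n"
  shows "x p ^ a = (\<Sum>s<n. coeff (\<Prod>q\<in>{..<n} - {p}. [:1, - x q:]) s * hz n x a s)"
proof -
  let ?e = "\<Prod>q\<in>{..<n} - {p}. [:1, - x q:]"
  let ?g = "\<lambda>q. Abs_fps (\<lambda>a. x q ^ a)"
  have "fps_of_poly ?e * (\<Prod>j<n. ?g j) = (\<Prod>q\<in>{..<n} - {p}. fps_of_poly [:1, - x q:]) * (?g p * (\<Prod>q\<in>{..<n} - {p}. ?g q))"
    using p prod.remove[of "{..<n}" p ?g] by (simp add: fps_of_poly_prod)
  also have "\<dots> = ?g p * (\<Prod>q\<in>{..<n} - {p}. ?g q * fps_of_poly [:1, - x q:])"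
    by (simp add: prod.distrib mult_ac)
  also have "\<dots> = ?g p" by (simp add: geometric_fps)
  finally have "x p ^ a = fps_nth (fps_of_poly ?e * (\<Prod>j<n. ?g j)) a" by simp
  also have "\<dots> = (\<Sum>s\<le>a. coeff ?e s * hsym n x (a - s))"
    by (simp add: fps_mult_nth hsym_def atMost_atLeast0)
  also have "\<dots> = (\<Sum>s\<in>{..a} \<inter> {..<n}. coeff ?e s * hsym n x (a - s))"
  proof (rule sum.mono_neutral_right)
    have "degree ?e \<le> (\<Sum>q\<in>{..<n} - {p}. degree [:1, - x q:])"
      using degree_prod_sum_le[of "{..<n} - {p}" "\<lambda>q. [:1, - x q:]"] by (simp add: o_def)
    also have "\<dots> \<le> (\<Sum>q\<in>{..<n} - {p}. 1)" by (intro sum_mono) auto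
    finally have "degree ?e \<le> n - 1" using p by simp
    then have "coeff ?e s = 0" if "s \<ge> n" for s using that p by (intro coeff_eq_0) auto
    then show "\<forall>i\<in>{..a} - {..a} \<inter> {..<n}. coeff ?e i * hsym n x (a - i) = 0"
      by (metis DiffE IntI lessThan_iff mult_zero_left not_le)
  qed auto
  also have "\<dots> = (\<Sum>s<n. coeff ?e s * hz n x a s)"
    by (rule sum.mono_neutral_cong_left) (auto simp: hz_def)
  finally show ?thesis .
qed

text \<open>\<open>power_eq_sum_hz\<close> factors the matrix of the alternant into a part depending
  only on \<open>x\<close> and the matrix of the \<open>hz\<close>. The constant is the same for all
  \<open>l\<close>; at \<open>l i = i\<close> it turns out to be the Vandermonde
  determinant.\<close>

lemma alt_eq_mult: "\<exists>c. \<forall>l. alt n l x = c * mdet n (\<lambda>i s. hz n x (l i) s)"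
proof -
  let ?E = "fmat n (\<lambda>p s. coeff (\<Prod>q\<in>{..<n} - {p}. [:1, - x q:]) s)"
  have "alt n l x = Determinant.det ?E * mdet n (\<lambda>i s. hz n x (l i) s)" for l
  proof -
    have "fmat n (\<lambda>j i. x j ^ l i) = ?E * fmat n (\<lambda>s i. hz n x (l i) s)"
      by (rule eq_matI) (auto simp: scalar_prod_def atLeast0LessThan power_eq_sum_hz)
    then have "alt n l x = Determinant.det ?E * Determinant.det (fmat n (\<lambda>s i. hz n x (l i) s))"
      by (simp add: alt_eq_mdet mdet_eq_det det_mult[of _ n])
    also have "Determinant.det (fmat n (\<lambda>s i. hz n x (l i) s)) = mdet n (\<lambda>i s. hz n x (l i) s)"
      using mdet_transpose[of n "\<lambda>i s. hz n x (l i) s"] by (simp add: mdet_eq_det)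
    finally show ?thesis .
  qed
  then show ?thesis by blast
qed

lemma mdet_lower_unitriangular:
  fixes A :: "nat \<Rightarrow> nat \<Rightarrow> complex"
  assumes "\<And>i j. i < j \<Longrightarrow> j < n \<Longrightarrow> A i j = 0" "\<And>i. i < n \<Longrightarrow> A i i = 1"
  shows "mdet n A = 1"
proof -
  have "mdet n A = prod_list (diag_mat (fmat n A))"
    unfolding mdet_eq_det by (rule det_lower_triangular[of n]) (use assms in auto)
  also have "\<dots> = prod_list (map (\<lambda>i. 1) [0..<n])"
    unfolding diag_mat_def using assms(2) by (intro arg_cong[of _ _ prod_list] map_cong) auto
  finally show ?thesis by (simp add: map_replicate_const)
qed

lemma mdet_hz_id: "mdet n (\<lambda>i s. hz n x i s) = 1"
  by (rule mdet_lower_unitriangular) (auto simp: hz_def)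

text \<open>The first \<open>k\<close> rows belong to the unshifted exponents and form a
  unitriangular block followed by zeros, so only the lower right block matters. There the column
  offset \<open>k\<close> cancels the row offset.\<close>

lemma mdet_hz_ltop: "mdet (2 * k) (\<lambda>i s. hz n x (ltop N k i) s) = mdet k (\<lambda>i s. hz n x (N + i) s)"
proof -
  let ?A = "fmat k (\<lambda>i s. hz n x i s)" and ?B = "0\<^sub>m k k"
    and ?C = "fmat k (\<lambda>i s. hz n x (N + k + i) s)" and ?D = "fmat k (\<lambda>i s. hz n x (N + i) s)"
  have "fmat (2 * k) (\<lambda>i s. hz n x (ltop N k i) s) = four_block_mat ?A ?B ?C ?D"
    by (rule eq_matI) (auto simp: ltop_def hz_def)
  then have "mdet (2 * k) (\<lambda>i s. hz n x (ltop N k i) s) = Determinant.det ?A * Determinant.det ?D"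
    by (simp add: mdet_eq_det det_four_block_mat_upper_right_zero[of _ k _ k])
  moreover have "Determinant.det ?A = 1"
    using mdet_lower_unitriangular[of k "\<lambda>i s. hz n x i s"] by (simp add: mdet_eq_det hz_def)
  ultimately show ?thesis by (simp add: mdet_eq_det)
qed

lemma msum_jacobi_trudi:
  assumes "inj_on x {..<2 * k}"
  shows "msum N k (2 * k) (\<lambda>_. 1) x = mdet k (\<lambda>i s. hz (2 * k) x (N + i) s)"
proof -
  obtain c where c: "\<And>l. alt (2 * k) l x = c * mdet (2 * k) (\<lambda>i s. hz (2 * k) x (l i) s)"
    using alt_eq_mult[of "2 * k" x] by blast
  have id: "alt (2 * k) (\<lambda>i. i) x = c" using c[of "\<lambda>i. i"] by (simp add: mdet_hz_id)
  have "c * msum N k (2 * k) (\<lambda>_. 1) x = c * mdet k (\<lambda>i s. hz (2 * k) x (N + i) s)"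
    using alt_msum[of k x N] c[of "ltop N k"] by (simp add: id mdet_hz_ltop)
  moreover have "c \<noteq> 0" using alt_id_nonzero[OF assms] id by simp
  ultimately show ?thesis by simp
qed

subsection \<open>Mixed moments as sums of binomial determinants\<close>

text \<open>The power series \<open>t^c / (1 - t)^(m + c + 1)\<close>.\<close>

definition pbin :: "nat \<Rightarrow> nat \<Rightarrow> complex fps" where
  "pbin m c = Abs_fps (\<lambda>M. of_nat ((M + m) choose (m + c)))"

lemma one_minus_X_pbin:
  "(1 - fps_X) * pbin (Suc m) c = pbin m c"
  "(1 - fps_X) * pbin m (Suc c) = fps_X * pbin m c"
proof -
  show "(1 - fps_X) * pbin (Suc m) c = pbin m c"
  proof (rule fps_ext)
    fix M show "fps_nth ((1 - fps_X) * pbin (Suc m) c) M = fps_nth (pbin m c) M"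
    proof (cases M)
      case 0
      then show ?thesis by (cases c) (simp_all add: pbin_def left_diff_distrib binomial_eq_0)
    qed (simp add: pbin_def left_diff_distrib)
  qed
  show "(1 - fps_X) * pbin m (Suc c) = fps_X * pbin m c"
  proof (rule fps_ext)
    fix M show "fps_nth ((1 - fps_X) * pbin m (Suc c)) M = fps_nth (fps_X * pbin m c) M"
      by (cases M) (simp_all add: pbin_def left_diff_distrib binomial_eq_0)
  qed
qed

lemma one_minus_X_nonzero: "(1 - fps_X :: complex fps) \<noteq> 0"
proof
  assume "(1 - fps_X :: complex fps) = 0"
  then have "fps_nth (1 - fps_X :: complex fps) 0 = 0" by simp
  then show False by simp
qed

lemma pbin_mult_geometric: "pbin m c * Abs_fps (\<lambda>_. 1) = pbin (Suc m) c"
proof -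
  have g: "(1 - fps_X) * Abs_fps (\<lambda>_. 1 :: complex) = 1"
  proof (rule fps_ext)
    fix M show "fps_nth ((1 - fps_X) * Abs_fps (\<lambda>_. 1 :: complex)) M = fps_nth 1 M"
      by (cases M) (simp_all add: left_diff_distrib)
  qed
  have "(1 - fps_X) * (pbin m c * Abs_fps (\<lambda>_. 1)) = pbin m c * ((1 - fps_X) * Abs_fps (\<lambda>_. 1 :: complex))"
    by (simp only: mult_ac)
  also have "\<dots> = (1 - fps_X) * pbin (Suc m) c" by (simp add: g one_minus_X_pbin(1))
  finally show ?thesis using one_minus_X_nonzero by simp
qed

lemma pbin_mult_linear: "pbin m c * Abs_fps (\<lambda>a. of_nat a) = pbin (Suc m) (Suc c)"
proof -
  have g: "(1 - fps_X) * Abs_fps (\<lambda>a. of_nat a :: complex) = fps_X * Abs_fps (\<lambda>_. 1)"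
  proof (rule fps_ext)
    fix M show "fps_nth ((1 - fps_X) * Abs_fps (\<lambda>a. of_nat a :: complex)) M = fps_nth (fps_X * Abs_fps (\<lambda>_. 1)) M"
      by (cases M) (simp_all add: left_diff_distrib)
  qed
  have "(1 - fps_X) * (pbin m c * Abs_fps (\<lambda>a. of_nat a)) = pbin m c * ((1 - fps_X) * Abs_fps (\<lambda>a. of_nat a))"
    by (simp only: mult_ac)
  also have "\<dots> = fps_X * (pbin m c * Abs_fps (\<lambda>_. 1))" unfolding g by (simp only: mult_ac)
  also have "\<dots> = (1 - fps_X) * pbin (Suc m) (Suc c)" unfolding pbin_mult_geometric one_minus_X_pbin(2) ..
  finally show ?thesis using one_minus_X_nonzero by simp
qed

text \<open>The generating function is a product of \<open>n\<close> factors: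
  \<open>t / (1 - t)^2\<close> for positions in \<open>J\<close> and \<open>1 / (1 - t)\<close> for
  the others. Its coefficients are those of \<open>pbin\<close>.\<close>

lemma sum_comps_prod:
  assumes "J \<subseteq> {..<n}" "n > 0"
  shows "(\<Sum>\<mu>\<in>comps n M. \<Prod>j\<in>J. of_nat (\<mu> j)) = (of_nat ((M + n - 1) choose (n - 1 + card J)) :: complex)"
proof -
  define w where "w j = (if j \<in> J then (\<lambda>a. of_nat a) else (\<lambda>_. 1 :: complex))" for j
  have prod: "(\<Prod>j<Suc m. Abs_fps (w j)) = pbin m (card (J \<inter> {..<Suc m}))" for m
  proof (induction m)
    case 0
    have "J \<inter> {..<Suc 0} = (if 0 \<in> J then {0} else {})" by auto
    then show ?case by (auto simp: w_def pbin_def)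
  next
    case (Suc m)
    have c: "card (J \<inter> {..<Suc (Suc m)}) = (if Suc m \<in> J then Suc (card (J \<inter> {..<Suc m})) else card (J \<inter> {..<Suc m}))"
      by (simp add: lessThan_Suc Int_insert_right)
    have "(\<Prod>j<Suc (Suc m). Abs_fps (w j)) = pbin m (card (J \<inter> {..<Suc m})) * Abs_fps (w (Suc m))"
      using Suc.IH by simp
    also have "\<dots> = pbin (Suc m) (card (J \<inter> {..<Suc (Suc m)}))"
      unfolding c by (simp add: w_def pbin_mult_geometric pbin_mult_linear)
    finally show ?case .
  qed
  obtain m where m: "n = Suc m" using assms(2) by (cases n) auto
  have "J \<inter> {..<n} = J" using assms(1) by auto
  then have "fps_nth (\<Prod>j<n. Abs_fps (w j)) M = of_nat ((M + n - 1) choose (n - 1 + card J))"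
    using prod[of m] by (simp add: m pbin_def)
  moreover have "(\<Prod>j<n. w j (\<mu> j)) = (\<Prod>j\<in>J. of_nat (\<mu> j))" for \<mu>
    unfolding w_def using assms(1) by (intro prod.mono_neutral_cong_right) auto
  ultimately show ?thesis by (simp add: fps_prod_nth)
qed

definition fib :: "nat \<Rightarrow> (nat \<Rightarrow> nat) \<Rightarrow> nat \<Rightarrow> nat" where
  "fib r f i = card {j. j < r \<and> f j = i}"

text \<open>The Jacobi-Trudi determinant is expanded into monomials, and \<open>exp_sum_eq\<close>
  replaces each monomial by the product of its first \<open>r\<close> exponents. The assumption k
  \<le> N ensures that no index \<open>N + i - \<sigma> i\<close> is truncated.\<close>

lemma sum_mom_eq:
  assumes r: "r \<le> 2 * k" and k: "0 < k" and N: "k \<le> N"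
  shows "(\<Sum>m\<in>exps (2 * k) N. mom N k (2 * k) m * (\<Prod>j<r. of_nat (m j))) =
    (\<Sum>f\<in>{..<r} \<rightarrow>\<^sub>E {..<k}. \<Sum>\<sigma> | \<sigma> permutes {..<k}. of_int (sign \<sigma>) *
       (\<Prod>i<k. of_nat ((N + i - \<sigma> i + 2 * k - 1) choose (2 * k - 1 + fib r f i))))"
proof -
  let ?n = "2 * k"
  let ?P = "{\<sigma>. \<sigma> permutes {..<k}}"
  let ?M = "\<lambda>\<sigma>. Pi\<^sub>E {..<k} (\<lambda>i. comps ?n (N + i - \<sigma> i))"
  let ?b' = "\<lambda>(\<sigma> :: nat \<Rightarrow> nat, \<mu> :: nat \<Rightarrow> nat \<Rightarrow> nat). of_int (sign \<sigma>) :: complex"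
  let ?\<mu>' = "\<lambda>(\<sigma> :: nat \<Rightarrow> nat, \<mu> :: nat \<Rightarrow> nat \<Rightarrow> nat). \<lambda>j. \<Sum>i<k. \<mu> i j"
  let ?\<phi> = "\<lambda>m :: nat \<Rightarrow> nat. \<Prod>j<r. of_nat (m j) :: complex"
  have fin: "finite (Sigma ?P ?M)"
    by (intro finite_SigmaI finite_permutations finite_PiE) auto
  have \<sigma>k: "\<sigma> i < k" if "\<sigma> permutes {..<k}" "i < k" for \<sigma> i
    using permutes_in_image[OF that(1), of i] that by simp
  have jt: "msum N k ?n (\<lambda>_. 1) x = (\<Sum>a\<in>Sigma ?P ?M. ?b' a * (\<Prod>j<?n. x j ^ ?\<mu>' a j))"
    if x: "inj_on x {..<?n}" for x
  proof -
    have "msum N k ?n (\<lambda>_. 1) x = (\<Sum>\<sigma>\<in>?P. of_int (sign \<sigma>) * (\<Prod>i<k. hz ?n x (N + i) (\<sigma> i)))"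
      unfolding msum_jacobi_trudi[OF x] mdet_def ..
    also have "\<dots> = (\<Sum>\<sigma>\<in>?P. \<Sum>\<mu>\<in>?M \<sigma>. of_int (sign \<sigma>) * (\<Prod>j<?n. x j ^ (\<Sum>i<k. \<mu> i j)))"
    proof (rule sum.cong[OF refl])
      fix \<sigma> assume "\<sigma> \<in> ?P"
      then have \<sigma>: "\<sigma> permutes {..<k}" by simp
      have "(\<Prod>i<k. hz ?n x (N + i) (\<sigma> i)) = (\<Prod>i<k. \<Sum>\<mu>\<in>comps ?n (N + i - \<sigma> i). \<Prod>j<?n. x j ^ \<mu> j)"
      proof (rule prod.cong[OF refl])
        fix i assume "i \<in> {..<k}"
        then have "\<sigma> i \<le> N + i" using \<sigma>k[OF \<sigma>, of i] N by simp
        then show "hz ?n x (N + i) (\<sigma> i) = (\<Sum>\<mu>\<in>comps ?n (N + i - \<sigma> i). \<Prod>j<?n. x j ^ \<mu> j)"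
          by (simp add: hz_def hsym_def fps_prod_nth)
      qed
      also have "\<dots> = (\<Sum>\<mu>\<in>?M \<sigma>. \<Prod>i<k. \<Prod>j<?n. x j ^ \<mu> i j)"
        by (rule prod_sum_PiE) auto
      also have "\<dots> = (\<Sum>\<mu>\<in>?M \<sigma>. \<Prod>j<?n. x j ^ (\<Sum>i<k. \<mu> i j))"
        unfolding power_sum by (intro sum.cong refl prod.swap)
      finally show "of_int (sign \<sigma>) * (\<Prod>i<k. hz ?n x (N + i) (\<sigma> i)) = (\<Sum>\<mu>\<in>?M \<sigma>. of_int (sign \<sigma>) * (\<Prod>j<?n. x j ^ (\<Sum>i<k. \<mu> i j)))"
        by (simp add: sum_distrib_left)
    qed
    also have "\<dots> = (\<Sum>a\<in>Sigma ?P ?M. ?b' a * (\<Prod>j<?n. x j ^ ?\<mu>' a j))"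
      by (subst sum.Sigma) (auto simp: finite_permutations finite_PiE split_beta intro!: sum.cong)
    finally show ?thesis .
  qed
  have \<phi>r: "?\<phi> (restrict m {..<?n}) = ?\<phi> m" for m
    using r by (intro prod.cong) auto
  have "(\<Sum>m\<in>exps ?n N. mom N k ?n m * ?\<phi> (restrict m {..<?n})) = (\<Sum>a\<in>Sigma ?P ?M. ?b' a * ?\<phi> (restrict (?\<mu>' a) {..<?n}))"
  proof (rule exp_sum_eq[where \<epsilon> = 1])
    fix x :: "nat \<Rightarrow> complex" assume "inj_on x {..<?n}"
    from jt[OF this] show "(\<Sum>m\<in>exps ?n N. mom N k ?n m * (\<Prod>j<?n. x j ^ m j)) = (\<Sum>a\<in>Sigma ?P ?M. ?b' a * (\<Prod>j<?n. x j ^ ?\<mu>' a j))"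
      by (simp add: msum_def)
  qed (use fin in auto)
  then have "(\<Sum>m\<in>exps ?n N. mom N k ?n m * ?\<phi> m) = (\<Sum>a\<in>Sigma ?P ?M. ?b' a * ?\<phi> (?\<mu>' a))"
    unfolding \<phi>r .
  also have "\<dots> = (\<Sum>\<sigma>\<in>?P. \<Sum>\<mu>\<in>?M \<sigma>. of_int (sign \<sigma>) * (\<Prod>j<r. of_nat (\<Sum>i<k. \<mu> i j)))"
    by (subst sum.Sigma) (auto simp: finite_permutations finite_PiE split_beta intro!: sum.cong)
  also have "\<dots> = (\<Sum>\<sigma>\<in>?P. \<Sum>f\<in>{..<r} \<rightarrow>\<^sub>E {..<k}. of_int (sign \<sigma>) *
       (\<Prod>i<k. of_nat ((N + i - \<sigma> i + 2 * k - 1) choose (2 * k - 1 + fib r f i))))"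
  proof (rule sum.cong[OF refl])
    fix \<sigma> assume "\<sigma> \<in> ?P"
    \<comment> \<open>Each exponent is a sum over the \<open>k\<close> rows of the determinant.
      Expanding the product amounts to choosing a row \<open>f j\<close> for every
      \<open>j < r\<close>, after which the rows are independent of each other.\<close>
    have "(\<Sum>\<mu>\<in>?M \<sigma>. \<Prod>j<r. of_nat (\<Sum>i<k. \<mu> i j) :: complex) = (\<Sum>\<mu>\<in>?M \<sigma>. \<Sum>f\<in>{..<r} \<rightarrow>\<^sub>E {..<k}. \<Prod>j<r. of_nat (\<mu> (f j) j))"
      unfolding of_nat_sum by (intro sum.cong refl prod_sum_PiE) auto
    also have "\<dots> = (\<Sum>f\<in>{..<r} \<rightarrow>\<^sub>E {..<k}. \<Sum>\<mu>\<in>?M \<sigma>. \<Prod>j<r. of_nat (\<mu> (f j) j))"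
      by (rule sum.swap)
    also have "\<dots> = (\<Sum>f\<in>{..<r} \<rightarrow>\<^sub>E {..<k}. \<Prod>i<k. of_nat ((N + i - \<sigma> i + 2 * k - 1) choose (2 * k - 1 + fib r f i)))"
    proof (rule sum.cong[OF refl])
      fix f assume f: "f \<in> {..<r} \<rightarrow>\<^sub>E {..<k}"
      let ?J = "\<lambda>i. {j. j < r \<and> f j = i}"
      have "(\<Sum>\<mu>\<in>?M \<sigma>. \<Prod>j<r. of_nat (\<mu> (f j) j) :: complex) = (\<Sum>\<mu>\<in>?M \<sigma>. \<Prod>i<k. \<Prod>j\<in>?J i. of_nat (\<mu> i j))"
      proof (rule sum.cong[OF refl])
        fix \<mu>
        have "(\<Prod>i<k. \<Prod>j\<in>?J i. of_nat (\<mu> i j) :: complex) = (\<Prod>i<k. \<Prod>j\<in>{j \<in> {..<r}. f j = i}. of_nat (\<mu> (f j) j))"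
          by (intro prod.cong refl) auto
        also have "\<dots> = (\<Prod>j<r. of_nat (\<mu> (f j) j))"
          using f by (intro prod.group) auto
        finally show "(\<Prod>j<r. of_nat (\<mu> (f j) j) :: complex) = (\<Prod>i<k. \<Prod>j\<in>?J i. of_nat (\<mu> i j))" by simp
      qed
      also have "\<dots> = (\<Prod>i<k. \<Sum>\<mu>\<in>comps ?n (N + i - \<sigma> i). \<Prod>j\<in>?J i. of_nat (\<mu> j))"
        by (rule prod_sum_PiE[symmetric]) auto
      also have "\<dots> = (\<Prod>i<k. of_nat ((N + i - \<sigma> i + 2 * k - 1) choose (2 * k - 1 + fib r f i)))"
        unfolding fib_def using r k by (intro prod.cong refl sum_comps_prod) auto
      finally show "(\<Sum>\<mu>\<in>?M \<sigma>. \<Prod>j<r. of_nat (\<mu> (f j) j)) = (\<Prod>i<k. of_nat ((N + i - \<sigma> i + 2 * k - 1) choose (2 * k - 1 + fib r f i)) :: complex)" .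
    qed
    finally show "(\<Sum>\<mu>\<in>?M \<sigma>. of_int (sign \<sigma>) * (\<Prod>j<r. of_nat (\<Sum>i<k. \<mu> i j) :: complex)) =
      (\<Sum>f\<in>{..<r} \<rightarrow>\<^sub>E {..<k}. of_int (sign \<sigma>) * (\<Prod>i<k. of_nat ((N + i - \<sigma> i + 2 * k - 1) choose (2 * k - 1 + fib r f i))))"
      by (simp only: sum_distrib_left[symmetric])
  qed
  also have "\<dots> = (\<Sum>f\<in>{..<r} \<rightarrow>\<^sub>E {..<k}. \<Sum>\<sigma>\<in>?P. of_int (sign \<sigma>) *
       (\<Prod>i<k. of_nat ((N + i - \<sigma> i + 2 * k - 1) choose (2 * k - 1 + fib r f i))))"
    by (rule sum.swap)
  finally show ?thesis .
qed

subsection \<open>The limit\<close>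

text \<open>The matrix of the \<open>a choose s\<close> is unitriangular.\<close>

lemma mdet_binomial_columns:
  fixes q :: "nat \<Rightarrow> nat \<Rightarrow> complex"
  shows "mdet k (\<lambda>i a. \<Sum>s<k. of_nat (a choose s) * q i s) = mdet k q"
proof -
  have "fmat k (\<lambda>i a. \<Sum>s<k. of_nat (a choose s) * q i s) = fmat k q * fmat k (\<lambda>s a. of_nat (a choose s))"
    by (rule eq_matI) (auto simp: scalar_prod_def atLeast0LessThan mult.commute)
  then have "mdet k (\<lambda>i a. \<Sum>s<k. of_nat (a choose s) * q i s) = mdet k q * mdet k (\<lambda>s a. of_nat (a choose s))"
    by (simp add: mdet_eq_det det_mult[of _ k])
  also have "mdet k (\<lambda>s a. of_nat (a choose s)) = (1 :: complex)"
    using mdet_transpose[of k "\<lambda>a s. of_nat (a choose s) :: complex"]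
      mdet_lower_unitriangular[of k "\<lambda>a s. of_nat (a choose s)"] by simp
  finally show ?thesis by simp
qed

lemma vandermonde_lt:
  assumes "a < k" "k \<le> Suc m"
  shows "(z + a) choose m = (\<Sum>s<k. (a choose s) * (z choose (m - s)))"
proof -
  have "(z + a) choose m = (\<Sum>s\<le>m. (a choose s) * (z choose (m - s)))"
    using vandermonde[of a z m] by (simp add: add.commute)
  also have "\<dots> = (\<Sum>s<k. (a choose s) * (z choose (m - s)))"
    using assms by (intro sum.mono_neutral_right) (auto simp: binomial_eq_0)
  finally show ?thesis .
qed

text \<open>By Vandermonde's convolution, passing from lower indices \<open>l i - a\<close> to upper
  indices \<open>y i + a\<close> is a unimodular column operation; it is applied once for each of
  the two permutations. This is the exact form of the cancellation: \<open>k (k - 1)\<close> powers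
  of \<open>z\<close> disappear. The bound on \<open>m\<close> keeps the lower indices from being
  truncated.\<close>

lemma alternating_binomial:
  assumes "\<And>i. i < k \<Longrightarrow> 2 * k \<le> Suc (m i)"
  shows "(\<Sum>\<pi> | \<pi> permutes {..<k}. \<Sum>\<tau> | \<tau> permutes {..<k}. of_int (sign \<pi>) * of_int (sign \<tau>) * (\<Prod>i<k. of_nat ((z + \<pi> i + \<tau> i) choose m i))) =
    (\<Sum>\<pi> | \<pi> permutes {..<k}. \<Sum>\<tau> | \<tau> permutes {..<k}. of_int (sign \<pi>) * of_int (sign \<tau>) * (\<Prod>i<k. of_nat (z choose (m i - \<pi> i - \<tau> i)) :: complex))"
proof -
  let ?P = "{\<pi>. \<pi> permutes {..<k}}"
  have lt: "\<tau> i < k" if "\<tau> permutes {..<k}" "i < k" for \<tau> i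
    using permutes_in_image[OF that(1), of i] that by simp
  have step: "(\<Sum>\<pi>\<in>?P. of_int (sign \<pi>) * (\<Prod>i<k. of_nat ((y i + \<pi> i) choose l i))) =
      (\<Sum>\<pi>\<in>?P. of_int (sign \<pi>) * (\<Prod>i<k. of_nat (y i choose (l i - \<pi> i)) :: complex))"
    if "\<And>i. i < k \<Longrightarrow> k \<le> Suc (l i)" for y l
  proof -
    have "(\<Sum>\<pi>\<in>?P. of_int (sign \<pi>) * (\<Prod>i<k. of_nat ((y i + \<pi> i) choose l i))) = mdet k (\<lambda>i a. of_nat ((y i + a) choose l i) :: complex)"
      by (simp add: mdet_def)
    also have "\<dots> = mdet k (\<lambda>i a. \<Sum>s<k. of_nat (a choose s) * of_nat (y i choose (l i - s)))"
      by (rule mdet_cong) (simp add: vandermonde_lt[OF _ that])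
    also have "\<dots> = mdet k (\<lambda>i a. of_nat (y i choose (l i - a)))" by (rule mdet_binomial_columns)
    finally show ?thesis by (simp add: mdet_def)
  qed
  have "(\<Sum>\<pi>\<in>?P. \<Sum>\<tau>\<in>?P. of_int (sign \<pi>) * of_int (sign \<tau>) * (\<Prod>i<k. of_nat ((z + \<pi> i + \<tau> i) choose m i) :: complex)) =
    (\<Sum>\<pi>\<in>?P. of_int (sign \<pi>) * (\<Sum>\<tau>\<in>?P. of_int (sign \<tau>) * (\<Prod>i<k. of_nat ((z + \<pi> i + \<tau> i) choose m i))))"
    by (simp add: sum_distrib_left mult.assoc)
  also have "\<dots> = (\<Sum>\<pi>\<in>?P. of_int (sign \<pi>) * (\<Sum>\<tau>\<in>?P. of_int (sign \<tau>) * (\<Prod>i<k. of_nat ((z + \<pi> i) choose (m i - \<tau> i)))))"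
  proof (subst step)
    show "k \<le> Suc (m i)" if "i < k" for i using assms[OF that] by simp
  qed simp
  also have "\<dots> = (\<Sum>\<tau>\<in>?P. of_int (sign \<tau>) * (\<Sum>\<pi>\<in>?P. of_int (sign \<pi>) * (\<Prod>i<k. of_nat ((z + \<pi> i) choose (m i - \<tau> i)))))"
    unfolding sum_distrib_left by (subst sum.swap) (simp add: mult_ac)
  also have "\<dots> = (\<Sum>\<tau>\<in>?P. of_int (sign \<tau>) * (\<Sum>\<pi>\<in>?P. of_int (sign \<pi>) * (\<Prod>i<k. of_nat (z choose (m i - \<tau> i - \<pi> i)))))"
  proof (rule sum.cong[OF refl])
    fix \<tau> assume "\<tau> \<in> ?P"
    then have "k \<le> Suc (m i - \<tau> i)" if "i < k" for i using assms[OF that] lt[of \<tau> i] that by simp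
    then show "of_int (sign \<tau>) * (\<Sum>\<pi>\<in>?P. of_int (sign \<pi>) * (\<Prod>i<k. of_nat ((z + \<pi> i) choose (m i - \<tau> i)))) =
      of_int (sign \<tau>) * (\<Sum>\<pi>\<in>?P. of_int (sign \<pi>) * (\<Prod>i<k. of_nat (z choose (m i - \<tau> i - \<pi> i)) :: complex))"
      by (subst step) auto
  qed
  finally show ?thesis by (simp add: sum_distrib_left mult.assoc)
qed

lemma sum_permutations_left:
  assumes q: "q permutes S"
  shows "(\<Sum>p | p permutes S. f p) = (\<Sum>p | p permutes S. f (q \<circ> p))"
proof (rule sum.reindex_bij_witness[where i = "\<lambda>p. q \<circ> p" and j = "\<lambda>p. inv_into UNIV q \<circ> p"])
  note inv = permutes_inv_o[OF q]
  fix p assume "p \<in> {p. p permutes S}"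
  then have p: "p permutes S" by simp
  show "q \<circ> (inv_into UNIV q \<circ> p) = p" "inv_into UNIV q \<circ> (q \<circ> p) = p" by (simp_all add: comp_assoc[symmetric] inv)
  show "inv_into UNIV q \<circ> p \<in> {p. p permutes S}" "q \<circ> p \<in> {p. p permutes S}"
    using permutes_compose[OF p permutes_inv[OF q]] permutes_compose[OF p q] by auto
  show "f (q \<circ> (inv_into UNIV q \<circ> p)) = f p" by (simp add: comp_assoc[symmetric] inv)
qed

definition rev_perm :: "nat \<Rightarrow> nat \<Rightarrow> nat" where
  "rev_perm k i = (if i < k then k - 1 - i else i)"

lemma rev_perm_permutes: "rev_perm k permutes {..<k}"
proof (rule bij_imp_permutes)
  show "bij_betw (rev_perm k) {..<k} {..<k}"
    by (rule bij_betw_byWitness[where f' = "rev_perm k"]) (auto simp: rev_perm_def)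
qed (simp add: rev_perm_def)

lemma sign_compose_permutes:
  assumes "p permutes {..<k::nat}" "q permutes {..<k}"
  shows "sign (p \<circ> q) = sign p * sign q"
  using assms by (intro sign_compose) (auto intro!: permutation_permutes[THEN iffD2])

lemma sign_square: "of_int (sign p) * of_int (sign p) = (1 :: complex)"
  by (simp add: of_int_mult[symmetric] sign_def del: of_int_mult)

text \<open>Relabelling the fibres of \<open>f\<close> symmetrises the determinant in its row parameters.\<close>

lemma sum_fib_permute:
  assumes \<pi>: "\<pi> permutes {..<k}"
  shows "(\<Sum>f\<in>{..<r} \<rightarrow>\<^sub>E {..<k}. D (fib r f)) = (\<Sum>f\<in>{..<r} \<rightarrow>\<^sub>E {..<k}. D (fib r f \<circ> \<pi>) :: complex)"
proof (rule sum.reindex_bij_witness[where i = "\<lambda>f. \<lambda>j\<in>{..<r}. inv_into UNIV \<pi> (f j)" and j = "\<lambda>f. \<lambda>j\<in>{..<r}. \<pi> (f j)"])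
  note inv = permutes_inverses[OF \<pi>]
  have i: "inv_into UNIV \<pi> permutes {..<k}" by (rule permutes_inv[OF \<pi>])
  fix f assume f: "f \<in> {..<r} \<rightarrow>\<^sub>E {..<k}"
  show "(\<lambda>j\<in>{..<r}. inv_into UNIV \<pi> ((\<lambda>j\<in>{..<r}. \<pi> (f j)) j)) = f"
    using f inv by (auto simp: fun_eq_iff PiE_def extensional_def)
  show "(\<lambda>j\<in>{..<r}. \<pi> ((\<lambda>j\<in>{..<r}. inv_into UNIV \<pi> (f j)) j)) = f"
    using f inv by (auto simp: fun_eq_iff PiE_def extensional_def)
  show "(\<lambda>j\<in>{..<r}. \<pi> (f j)) \<in> {..<r} \<rightarrow>\<^sub>E {..<k}"
    using f permutes_in_image[OF \<pi>] by (auto simp: PiE_def Pi_iff)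
  show "(\<lambda>j\<in>{..<r}. inv_into UNIV \<pi> (f j)) \<in> {..<r} \<rightarrow>\<^sub>E {..<k}"
    using f permutes_in_image[OF i] by (auto simp: PiE_def Pi_iff)
  have "fib r (\<lambda>j\<in>{..<r}. \<pi> (f j)) \<circ> \<pi> = fib r f"
  proof (rule ext)
    fix i
    have "{j. j < r \<and> (\<lambda>j\<in>{..<r}. \<pi> (f j)) j = \<pi> i} = {j. j < r \<and> f j = i}"
      using permutes_inj[OF \<pi>] by (auto dest: injD)
    then show "(fib r (\<lambda>j\<in>{..<r}. \<pi> (f j)) \<circ> \<pi>) i = fib r f i" by (simp add: fib_def)
  qed
  then show "D (fib r (\<lambda>j\<in>{..<r}. \<pi> (f j)) \<circ> \<pi>) = D (fib r f)" by simp
qed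

text \<open>The determinant alternates in a single permutation; averaging over relabellings of the
  rows, which the sum over \<open>f\<close> permits, makes a second one appear and gives the factor
  \<open>1 / k!\<close>. Then \<open>alternating_binomial\<close> applies. On the right the lower
  indices of each term add up to \<open>k^2 + r\<close>, the true order of growth.\<close>

lemma sum_binomial_eq:
  assumes N: "k \<le> N"
  shows "(\<Sum>f\<in>{..<r} \<rightarrow>\<^sub>E {..<k}. \<Sum>\<sigma> | \<sigma> permutes {..<k}. of_int (sign \<sigma>) *
       (\<Prod>i<k. of_nat ((N + i - \<sigma> i + 2 * k - 1) choose (2 * k - 1 + fib r f i)))) =
    1 / fact k * (\<Sum>f\<in>{..<r} \<rightarrow>\<^sub>E {..<k}. \<Sum>\<sigma> | \<sigma> permutes {..<k}. \<Sum>\<tau> | \<tau> permutes {..<k}.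
       of_int (sign \<sigma>) * of_int (sign \<tau>) * (\<Prod>i<k. of_nat ((N + k) choose (k + fib r f i + \<sigma> i - \<tau> i)) :: complex))"
proof -
  let ?P = "{\<pi>. \<pi> permutes {..<k}}" and ?F = "{..<r} \<rightarrow>\<^sub>E {..<k}"
  let ?C = "\<lambda>x y. of_nat (x choose y) :: complex"
  let ?s = "\<lambda>p. of_int (sign p) :: complex"
  define D where "D \<rho> = (\<Sum>\<sigma>\<in>?P. ?s \<sigma> * (\<Prod>i<k. ?C (N + i - \<sigma> i + 2 * k - 1) (2 * k - 1 + \<rho> i)))" for \<rho>
  have lt: "\<tau> i < k" if "\<tau> permutes {..<k}" "i < k" for \<tau> i
    using permutes_in_image[OF that(1), of i] that by simp
  \<comment> \<open>Permuting the factors by \<pi> and summing over \<tau> = \<sigma> \<circ> \<pi>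
    lets \<pi> play the part of the second alternating permutation.\<close>
  have D1: "D (\<rho> \<circ> inv_into UNIV \<pi>) = (\<Sum>\<tau>\<in>?P. ?s \<pi> * ?s \<tau> * (\<Prod>i<k. ?C (N + \<pi> i - \<tau> i + 2 * k - 1) (2 * k - 1 + \<rho> i)))"
    if \<pi>: "\<pi> permutes {..<k}" for \<pi> \<rho>
  proof -
    let ?i = "inv_into UNIV \<pi>"
    have i: "?i permutes {..<k}" by (rule permutes_inv[OF \<pi>])
    have "(\<Prod>i<k. ?C (N + i - \<sigma> i + 2 * k - 1) (2 * k - 1 + (\<rho> \<circ> ?i) i)) =
      (\<Prod>i<k. ?C (N + \<pi> i - (\<sigma> \<circ> \<pi>) i + 2 * k - 1) (2 * k - 1 + \<rho> i))" for \<sigma>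
      using prod.permute[OF \<pi>, of "\<lambda>i. ?C (N + i - \<sigma> i + 2 * k - 1) (2 * k - 1 + (\<rho> \<circ> ?i) i)"]
      by (simp add: o_def permutes_inverses[OF \<pi>])
    then have "D (\<rho> \<circ> ?i) = (\<Sum>\<sigma>\<in>?P. ?s \<sigma> * (\<Prod>i<k. ?C (N + \<pi> i - (\<sigma> \<circ> \<pi>) i + 2 * k - 1) (2 * k - 1 + \<rho> i)))"
      by (simp add: D_def)
    also have "\<dots> = (\<Sum>\<sigma>\<in>?P. ?s \<pi> * ?s (\<sigma> \<circ> \<pi>) * (\<Prod>i<k. ?C (N + \<pi> i - (\<sigma> \<circ> \<pi>) i + 2 * k - 1) (2 * k - 1 + \<rho> i)))"
    proof (rule sum.cong[OF refl])
      fix \<sigma> assume "\<sigma> \<in> ?P"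
      then have "?s \<pi> * ?s (\<sigma> \<circ> \<pi>) = ?s \<sigma> * (?s \<pi> * ?s \<pi>)"
        using sign_compose_permutes[of \<sigma> k \<pi>] \<pi> by (simp add: mult_ac)
      then show "?s \<sigma> * (\<Prod>i<k. ?C (N + \<pi> i - (\<sigma> \<circ> \<pi>) i + 2 * k - 1) (2 * k - 1 + \<rho> i)) =
        ?s \<pi> * ?s (\<sigma> \<circ> \<pi>) * (\<Prod>i<k. ?C (N + \<pi> i - (\<sigma> \<circ> \<pi>) i + 2 * k - 1) (2 * k - 1 + \<rho> i))"
        by (simp add: sign_square)
    qed
    also have "\<dots> = (\<Sum>\<tau>\<in>?P. ?s \<pi> * ?s \<tau> * (\<Prod>i<k. ?C (N + \<pi> i - \<tau> i + 2 * k - 1) (2 * k - 1 + \<rho> i)))"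
      by (rule sum_permutations_compose_right[OF \<pi>, symmetric])
    finally show ?thesis .
  qed
  have D2: "(\<Sum>\<pi>\<in>?P. D (\<rho> \<circ> inv_into UNIV \<pi>)) =
     (\<Sum>\<sigma>\<in>?P. \<Sum>\<tau>\<in>?P. ?s \<sigma> * ?s \<tau> * (\<Prod>i<k. ?C (N + k) (k + \<rho> i + \<sigma> i - \<tau> i)))" for \<rho>
  proof -
    let ?r = "rev_perm k"
    note r = rev_perm_permutes[of k]
    have rl: "?r i = k - 1 - i" if "i < k" for i using that by (simp add: rev_perm_def)
    have sr: "?s (?r \<circ> p) = ?s ?r * ?s p" if "p permutes {..<k}" for p
      using sign_compose_permutes[OF r that] by simp
    have "(\<Sum>\<pi>\<in>?P. D (\<rho> \<circ> inv_into UNIV \<pi>)) = (\<Sum>\<pi>\<in>?P. \<Sum>\<tau>\<in>?P. ?s \<pi> * ?s \<tau> * (\<Prod>i<k. ?C (N + \<pi> i - \<tau> i + 2 * k - 1) (2 * k - 1 + \<rho> i)))"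
      by (intro sum.cong refl D1) auto
    \<comment> \<open>Reversal replaces -\<tau> by \<tau> - (k - 1), so the upper index becomes
      \<open>N + k + \<pi> i + \<tau> i\<close>, increasing in both permutations.\<close>
    also have "\<dots> = (\<Sum>\<pi>\<in>?P. \<Sum>\<tau>\<in>?P. ?s \<pi> * ?s (?r \<circ> \<tau>) * (\<Prod>i<k. ?C (N + \<pi> i - (?r \<circ> \<tau>) i + 2 * k - 1) (2 * k - 1 + \<rho> i)))"
      by (intro sum.cong refl sum_permutations_left[OF r])
    also have "\<dots> = (\<Sum>\<pi>\<in>?P. \<Sum>\<tau>\<in>?P. ?s ?r * (?s \<pi> * ?s \<tau> * (\<Prod>i<k. ?C (N + k + \<pi> i + \<tau> i) (2 * k - 1 + \<rho> i))))"
    proof (intro sum.cong refl)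
      fix \<pi> \<tau> assume "\<pi> \<in> ?P" "\<tau> \<in> ?P"
      then have p: "\<pi> permutes {..<k}" "\<tau> permutes {..<k}" by auto
      have "N + \<pi> i - (?r \<circ> \<tau>) i + 2 * k - 1 = N + k + \<pi> i + \<tau> i" if "i < k" for i
        using lt[OF p(2) that] N that by (simp add: rl)
      then show "?s \<pi> * ?s (?r \<circ> \<tau>) * (\<Prod>i<k. ?C (N + \<pi> i - (?r \<circ> \<tau>) i + 2 * k - 1) (2 * k - 1 + \<rho> i)) =
        ?s ?r * (?s \<pi> * ?s \<tau> * (\<Prod>i<k. ?C (N + k + \<pi> i + \<tau> i) (2 * k - 1 + \<rho> i)))"
        by (simp add: sr[OF p(2)] mult_ac)
    qed
    also have "\<dots> = ?s ?r * (\<Sum>\<pi>\<in>?P. \<Sum>\<tau>\<in>?P. ?s \<pi> * ?s \<tau> * (\<Prod>i<k. ?C (N + k + \<pi> i + \<tau> i) (2 * k - 1 + \<rho> i)))"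
      by (simp only: sum_distrib_left)
    also have "\<dots> = ?s ?r * (\<Sum>\<pi>\<in>?P. \<Sum>\<tau>\<in>?P. ?s \<pi> * ?s \<tau> * (\<Prod>i<k. ?C (N + k) (2 * k - 1 + \<rho> i - \<pi> i - \<tau> i)))"
      by (subst alternating_binomial) auto
    \<comment> \<open>A second reversal turns \<open>2k - 1 - \<pi> i\<close> into
      \<open>k + \<sigma> i\<close>; its sign cancels that of the first.\<close>
    also have "\<dots> = ?s ?r * (\<Sum>\<sigma>\<in>?P. \<Sum>\<tau>\<in>?P. ?s (?r \<circ> \<sigma>) * ?s \<tau> * (\<Prod>i<k. ?C (N + k) (2 * k - 1 + \<rho> i - (?r \<circ> \<sigma>) i - \<tau> i)))"
      by (subst sum_permutations_left[OF r]) simp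
    also have "\<dots> = (\<Sum>\<sigma>\<in>?P. \<Sum>\<tau>\<in>?P. ?s \<sigma> * ?s \<tau> * (\<Prod>i<k. ?C (N + k) (k + \<rho> i + \<sigma> i - \<tau> i)))"
      unfolding sum_distrib_left
    proof (intro sum.cong refl)
      fix \<sigma> \<tau> assume "\<sigma> \<in> ?P" "\<tau> \<in> ?P"
      then have p: "\<sigma> permutes {..<k}" "\<tau> permutes {..<k}" by auto
      have e: "2 * k - 1 + \<rho> i - (?r \<circ> \<sigma>) i - \<tau> i = k + \<rho> i + \<sigma> i - \<tau> i" if "i < k" for i
        using lt[OF p(1) that] lt[OF p(2) that] that by (simp add: rl)
      have sX: "?s ?r * (?s (?r \<circ> \<sigma>) * ?s \<tau> * X) = (?s ?r * ?s ?r) * (?s \<sigma> * ?s \<tau> * X)" for X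
        by (simp add: sr[OF p(1)] mult_ac)
      have eC: "(\<Prod>i<k. ?C (N + k) (2 * k - 1 + \<rho> i - (?r \<circ> \<sigma>) i - \<tau> i)) = (\<Prod>i<k. ?C (N + k) (k + \<rho> i + \<sigma> i - \<tau> i))"
        by (intro prod.cong refl) (simp only: e lessThan_iff)
      show "?s ?r * (?s (?r \<circ> \<sigma>) * ?s \<tau> * (\<Prod>i<k. ?C (N + k) (2 * k - 1 + \<rho> i - (?r \<circ> \<sigma>) i - \<tau> i))) =
         ?s \<sigma> * ?s \<tau> * (\<Prod>i<k. ?C (N + k) (k + \<rho> i + \<sigma> i - \<tau> i))"
        unfolding eC sX sign_square by simp
    qed
    finally show ?thesis .
  qed
  have "fact k * (\<Sum>f\<in>?F. D (fib r f)) = (\<Sum>\<pi>\<in>?P. \<Sum>f\<in>?F. D (fib r f))"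
    by (simp add: card_permutations)
  also have "\<dots> = (\<Sum>\<pi>\<in>?P. \<Sum>f\<in>?F. D (fib r f \<circ> inv_into UNIV \<pi>))"
  proof (rule sum.cong[OF refl])
    fix \<pi> assume "\<pi> \<in> ?P"
    then have "inv_into UNIV \<pi> permutes {..<k}" by (simp add: permutes_inv)
    then show "(\<Sum>f\<in>?F. D (fib r f)) = (\<Sum>f\<in>?F. D (fib r f \<circ> inv_into UNIV \<pi>))" by (rule sum_fib_permute)
  qed
  also have "\<dots> = (\<Sum>f\<in>?F. \<Sum>\<pi>\<in>?P. D (fib r f \<circ> inv_into UNIV \<pi>))" by (rule sum.swap)
  also have "\<dots> = (\<Sum>f\<in>?F. \<Sum>\<sigma>\<in>?P. \<Sum>\<tau>\<in>?P. ?s \<sigma> * ?s \<tau> * (\<Prod>i<k. ?C (N + k) (k + fib r f i + \<sigma> i - \<tau> i)))"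
    by (simp only: D2)
  finally show ?thesis by (simp add: D_def field_simps)
qed

lemma binomial_limit: "(\<lambda>N. of_nat ((N + k) choose e) / of_nat N ^ e :: complex) \<longlonglongrightarrow> 1 / fact e"
proof -
  have fac: "(\<lambda>N. (of_nat (N + k) - of_nat i) / of_nat N :: complex) \<longlonglongrightarrow> 1" for i
  proof -
    have "(\<lambda>N. 1 + (of_nat k - of_nat i) * (1 / of_nat N) :: complex) \<longlonglongrightarrow> 1 + (of_nat k - of_nat i) * 0"
      by (intro tendsto_intros lim_1_over_n)
    then have l: "(\<lambda>N. 1 + (of_nat k - of_nat i) * (1 / of_nat N) :: complex) \<longlonglongrightarrow> 1" by simp
    show ?thesis
    proof (rule Lim_transform_eventually[OF l])
      show "\<forall>\<^sub>F N in sequentially. 1 + (of_nat k - of_nat i) * (1 / of_nat N) = (of_nat (N + k) - of_nat i) / (of_nat N :: complex)"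
        using eventually_gt_at_top[of 0] by eventually_elim (simp add: field_simps)
    qed
  qed
  have "(\<lambda>N. (\<Prod>i<e. (of_nat (N + k) - of_nat i) / of_nat N) / fact e :: complex) \<longlonglongrightarrow> (\<Prod>i<e. 1) / fact e"
    by (intro tendsto_divide tendsto_prod fac tendsto_const) simp
  moreover have "(\<Prod>i<e. (of_nat (N + k) - of_nat i) / of_nat N) / fact e = (of_nat ((N + k) choose e) / of_nat N ^ e :: complex)" for N
    by (simp add: binomial_gbinomial gbinomial_prod_rev prod_dividef atLeast0LessThan)
  ultimately show ?thesis by simp
qed

lemma sum_fib: "f \<in> {..<r} \<rightarrow>\<^sub>E {..<k} \<Longrightarrow> (\<Sum>i<k. fib r f i) = r"
proof -
  assume f: "f \<in> {..<r} \<rightarrow>\<^sub>E {..<k}"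
  have "(\<Sum>i<k. fib r f i) = (\<Sum>i<k. \<Sum>j\<in>{j \<in> {..<r}. f j = i}. 1)"
    by (simp add: fib_def)
  also have "\<dots> = (\<Sum>j<r. 1)" using f by (intro sum.group) auto
  finally show ?thesis by simp
qed

lemma fps_deriv_prod:
  fixes G :: "nat \<Rightarrow> complex fps"
  shows "fps_deriv (\<Prod>i<k. G i) = (\<Sum>a<k. \<Prod>i<k. if i = a then fps_deriv (G i) else G i)"
proof (induction k)
  case (Suc k)
  have "(\<Prod>i<Suc k. if i = k then fps_deriv (G i) else G i) = (\<Prod>i<k. G i) * fps_deriv (G k)"
    by simp
  moreover have "(\<Sum>a<k. \<Prod>i<Suc k. if i = a then fps_deriv (G i) else G i) = (\<Sum>a<k. \<Prod>i<k. if i = a then fps_deriv (G i) else G i) * G k"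
    unfolding sum_distrib_right by (intro sum.cong refl) auto
  ultimately show ?case using Suc.IH by simp
qed simp

text \<open>The number of maps with fibre sizes \<rho> is the multinomial coefficient. In terms of
  exponential generating functions, adding a point to the domain is differentiating the
  product.\<close>

lemma sum_fib_comps:
  fixes g :: "nat \<Rightarrow> nat \<Rightarrow> complex"
  shows "(\<Sum>f\<in>{..<r} \<rightarrow>\<^sub>E {..<k}. \<Prod>i<k. g i (fib r f i)) = fact r * (\<Sum>\<rho>\<in>comps k r. \<Prod>i<k. g i (\<rho> i) / fact (\<rho> i))"
proof -
  have "(\<Sum>f\<in>{..<r} \<rightarrow>\<^sub>E {..<k}. \<Prod>i<k. g i (fib r f i)) = fact r * fps_nth (\<Prod>i<k. Abs_fps (\<lambda>a. g i a / fact a)) r"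
  proof (induction r arbitrary: g)
    case 0
    have "fps_nth (\<Prod>i<k. Abs_fps (\<lambda>a. g i a / fact a)) 0 = (\<Prod>i<k. g i 0)"
      by (induction k) (simp_all add: fps_mult_nth)
    then show ?case by (simp add: fib_def)
  next
    case (Suc r)
    \<comment> \<open>Sending the new point to \<open>a\<close> enlarges the fibre over
      \<open>a\<close> by one.\<close>
    define h where "h a i = (if i = a then (\<lambda>x. g i (Suc x)) else g i)" for a i
    have "(\<Sum>f\<in>{..<Suc r} \<rightarrow>\<^sub>E {..<k}. \<Prod>i<k. g i (fib (Suc r) f i)) =
      (\<Sum>(a, f)\<in>{..<k} \<times> ({..<r} \<rightarrow>\<^sub>E {..<k}). \<Prod>i<k. h a i (fib r f i))"
    proof (rule sum.reindex_bij_witness[where i = "\<lambda>(a, f). f(r := a)" and j = "\<lambda>f. (f r, restrict f {..<r})"])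
      fix f assume f: "f \<in> {..<Suc r} \<rightarrow>\<^sub>E {..<k}"
      show "(case (f r, restrict f {..<r}) of (a, f) \<Rightarrow> f(r := a)) = f"
        using f by (auto simp: fun_eq_iff PiE_def extensional_def less_Suc_eq)
      show "(f r, restrict f {..<r}) \<in> {..<k} \<times> ({..<r} \<rightarrow>\<^sub>E {..<k})"
        using f by (auto simp: PiE_def Pi_iff)
      have "fib (Suc r) f i = (if i = f r then Suc (fib r (restrict f {..<r}) i) else fib r (restrict f {..<r}) i)" for i
      proof -
        have 1: "{j. j < r \<and> restrict f {..<r} j = i} = {j. j < r \<and> f j = i}" by auto
        have 2: "{j. j < Suc r \<and> f j = i} = (if i = f r then insert r {j. j < r \<and> f j = i} else {j. j < r \<and> f j = i})"
          by (auto simp: less_Suc_eq)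
        show ?thesis unfolding fib_def 1 2 by simp
      qed
      then show "(case (f r, restrict f {..<r}) of (a, f) \<Rightarrow> \<Prod>i<k. h a i (fib r f i)) = (\<Prod>i<k. g i (fib (Suc r) f i))"
        by (auto simp: h_def intro!: prod.cong)
    next
      fix b assume b: "b \<in> {..<k} \<times> ({..<r} \<rightarrow>\<^sub>E {..<k})"
      obtain a f where af: "b = (a, f)" by (cases b)
      show "((case b of (a, f) \<Rightarrow> f(r := a)) r, restrict (case b of (a, f) \<Rightarrow> f(r := a)) {..<r}) = b"
        using b by (auto simp: af fun_eq_iff PiE_def extensional_def)
      show "(case b of (a, f) \<Rightarrow> f(r := a)) \<in> {..<Suc r} \<rightarrow>\<^sub>E {..<k}"
        using b by (auto simp: af PiE_def Pi_iff extensional_def less_Suc_eq)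
    qed
    also have "\<dots> = (\<Sum>a<k. \<Sum>f\<in>{..<r} \<rightarrow>\<^sub>E {..<k}. \<Prod>i<k. h a i (fib r f i))"
      by (simp add: sum.cartesian_product)
    also have "\<dots> = (\<Sum>a<k. fact r * fps_nth (\<Prod>i<k. Abs_fps (\<lambda>x. h a i x / fact x)) r)"
      by (simp only: Suc.IH)
    also have "\<dots> = fact r * fps_nth (\<Sum>a<k. \<Prod>i<k. Abs_fps (\<lambda>x. h a i x / fact x)) r"
      by (simp add: sum_distrib_left fps_sum_nth)
    also have "(\<Sum>a<k. \<Prod>i<k. Abs_fps (\<lambda>x. h a i x / fact x)) = fps_deriv (\<Prod>i<k. Abs_fps (\<lambda>x. g i x / fact x))"
    proof -
      have "Abs_fps (\<lambda>x. h a i x / fact x) = (if i = a then fps_deriv (Abs_fps (\<lambda>x. g i x / fact x)) else Abs_fps (\<lambda>x. g i x / fact x))" for a i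
      proof (rule fps_ext)
        fix x
        have "of_nat (Suc x) * (y / fact (Suc x)) = (y / fact x :: complex)" for y
          by (simp add: fact_Suc del: of_nat_Suc)
        then show "fps_nth (Abs_fps (\<lambda>x. h a i x / fact x)) x =
          fps_nth (if i = a then fps_deriv (Abs_fps (\<lambda>x. g i x / fact x)) else Abs_fps (\<lambda>x. g i x / fact x)) x"
          by (simp add: h_def del: of_nat_Suc fact_Suc)
      qed
      then show ?thesis unfolding fps_deriv_prod by simp
    qed
    also have "fact r * fps_nth (fps_deriv (\<Prod>i<k. Abs_fps (\<lambda>x. g i x / fact x))) r = fact (Suc r) * fps_nth (\<Prod>i<k. Abs_fps (\<lambda>x. g i x / fact x)) (Suc r)"
      by (simp add: mult_ac)
    finally show ?case .
  qed
  then show ?thesis by (simp add: fps_prod_nth)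
qed

text \<open>The value on which both sides of the theorem meet: \<open>MN_limit\<close> reaches it
  from the moments and \<open>partition_sum\<close> from the partitions.\<close>

definition limval :: "nat \<Rightarrow> nat \<Rightarrow> complex" where
  "limval k r = 1 / fact k * (\<Sum>\<sigma> | \<sigma> permutes {..<k}. \<Sum>\<tau> | \<tau> permutes {..<k}.
     of_int (sign \<sigma>) * of_int (sign \<tau>) * (\<Sum>\<rho>\<in>comps k r. \<Prod>i<k. 1 / (fact (\<rho> i) * fact (k + \<rho> i + \<sigma> i - \<tau> i))))"

text \<open>In each term the lower indices sum to \<open>k^2 + r\<close>, as \<sigma> and \<tau>
  have equal sums. The power of \<open>N\<close> therefore distributes over the factors, and the
  limit can be taken factor by factor.\<close>

lemma MN_limit:
  assumes r: "r \<le> 2 * k" and k: "0 < k"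
  shows "(\<lambda>N. MN N k r / of_nat N ^ (k\<^sup>2 + r)) \<longlonglongrightarrow> (- \<i>) ^ r * (fact r * limval k r)"
proof -
  let ?P = "{\<pi>. \<pi> permutes {..<k}}" and ?F = "{..<r} \<rightarrow>\<^sub>E {..<k}"
  let ?s = "\<lambda>p. of_int (sign p) :: complex"
  let ?e = "\<lambda>f \<sigma> \<tau> i. k + fib r f i + \<sigma> i - \<tau> i"
  define G where "G N = (- \<i>) ^ r * (1 / fact k * (\<Sum>f\<in>?F. \<Sum>\<sigma>\<in>?P. \<Sum>\<tau>\<in>?P. ?s \<sigma> * ?s \<tau> *
      (\<Prod>i<k. of_nat ((N + k) choose ?e f \<sigma> \<tau> i) / of_nat N ^ ?e f \<sigma> \<tau> i)))" for N
  have lt: "\<tau> i < k" if "\<tau> permutes {..<k}" "i < k" for \<tau> i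
    using permutes_in_image[OF that(1), of i] that by simp
  have "G \<longlonglongrightarrow> (- \<i>) ^ r * (1 / fact k * (\<Sum>f\<in>?F. \<Sum>\<sigma>\<in>?P. \<Sum>\<tau>\<in>?P. ?s \<sigma> * ?s \<tau> *
      (\<Prod>i<k. 1 / fact (?e f \<sigma> \<tau> i))))"
    unfolding G_def by (intro tendsto_mult tendsto_const tendsto_sum tendsto_prod binomial_limit)
  also have "(\<Sum>f\<in>?F. \<Sum>\<sigma>\<in>?P. \<Sum>\<tau>\<in>?P. ?s \<sigma> * ?s \<tau> * (\<Prod>i<k. 1 / fact (?e f \<sigma> \<tau> i))) =
     (\<Sum>\<sigma>\<in>?P. \<Sum>\<tau>\<in>?P. ?s \<sigma> * ?s \<tau> * (\<Sum>f\<in>?F. \<Prod>i<k. 1 / fact (?e f \<sigma> \<tau> i)))"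
    unfolding sum_distrib_left by (subst sum.swap, rule sum.cong[OF refl], rule sum.swap)
  also have "\<dots> = (\<Sum>\<sigma>\<in>?P. \<Sum>\<tau>\<in>?P. ?s \<sigma> * ?s \<tau> * (fact r * (\<Sum>\<rho>\<in>comps k r. \<Prod>i<k. 1 / (fact (\<rho> i) * fact (k + \<rho> i + \<sigma> i - \<tau> i)))))"
  proof (intro sum.cong refl arg_cong2[where f = "(*)"])
    fix \<sigma> \<tau>
    show "(\<Sum>f\<in>?F. \<Prod>i<k. 1 / fact (?e f \<sigma> \<tau> i)) = (fact r * (\<Sum>\<rho>\<in>comps k r. \<Prod>i<k. 1 / (fact (\<rho> i) * fact (k + \<rho> i + \<sigma> i - \<tau> i))) :: complex)"
      using sum_fib_comps[where k = k and r = r and g = "\<lambda>i x. 1 / fact (k + x + \<sigma> i - \<tau> i)"] by (simp add: mult.commute)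
  qed
  also have "1 / fact k * \<dots> = fact r * limval k r"
    unfolding limval_def by (simp add: sum_distrib_left mult_ac)
  finally have lim: "G \<longlonglongrightarrow> (- \<i>) ^ r * (fact r * limval k r)" .
  have ev: "\<forall>\<^sub>F N in sequentially. G N = MN N k r / of_nat N ^ (k\<^sup>2 + r)"
    using eventually_ge_at_top[of "max k 1"]
  proof eventually_elim
    case (elim N)
    have "MN N k r / of_nat N ^ (k\<^sup>2 + r) = (- \<i>) ^ r * (1 / fact k * (\<Sum>f\<in>?F. \<Sum>\<sigma>\<in>?P. \<Sum>\<tau>\<in>?P. ?s \<sigma> * ?s \<tau> *
      (\<Prod>i<k. of_nat ((N + k) choose ?e f \<sigma> \<tau> i)))) / of_nat N ^ (k\<^sup>2 + r)"
      using elim by (simp only: MN_eq_mom[OF r] sum_mom_eq[OF r k] sum_binomial_eq max.bounded_iff)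
    also have "\<dots> = (- \<i>) ^ r * (1 / fact k * (\<Sum>f\<in>?F. \<Sum>\<sigma>\<in>?P. \<Sum>\<tau>\<in>?P. ?s \<sigma> * ?s \<tau> *
      ((\<Prod>i<k. of_nat ((N + k) choose ?e f \<sigma> \<tau> i)) / of_nat N ^ (k\<^sup>2 + r))))"
      by (simp only: sum_divide_distrib[symmetric] times_divide_eq_right)
    also have "\<dots> = G N"
      unfolding G_def
    proof (intro arg_cong2[where f = "(*)"] sum.cong refl)
      fix f \<sigma> \<tau> assume f: "f \<in> ?F" and "\<sigma> \<in> ?P" "\<tau> \<in> ?P"
      then have p: "\<sigma> permutes {..<k}" "\<tau> permutes {..<k}" by auto
      have ps: "(\<Sum>i<k. p i) = (\<Sum>i<k. i)" if "p permutes {..<k}" for p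
        using sum.permute[OF that, of "\<lambda>i. i"] by (simp add: o_def)
      have "(\<Sum>i<k. ?e f \<sigma> \<tau> i) + (\<Sum>i<k. \<tau> i) = (\<Sum>i<k. k + fib r f i + \<sigma> i)"
        unfolding sum.distrib[symmetric] using lt[OF p(2)] by (intro sum.cong refl) (simp add: less_imp_le trans_le_add1)
      also have "\<dots> = k\<^sup>2 + r + (\<Sum>i<k. i)"
        by (simp add: sum.distrib sum_fib[OF f] ps[OF p(1)] power2_eq_square)
      finally have s: "(\<Sum>i<k. ?e f \<sigma> \<tau> i) = k\<^sup>2 + r" by (simp add: ps[OF p(2)])
      show "(\<Prod>i<k. of_nat ((N + k) choose ?e f \<sigma> \<tau> i)) / of_nat N ^ (k\<^sup>2 + r) =
        (\<Prod>i<k. of_nat ((N + k) choose ?e f \<sigma> \<tau> i) / (of_nat N :: complex) ^ ?e f \<sigma> \<tau> i)"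
        unfolding s[symmetric] prod_dividef power_sum ..
    qed
    finally show ?case by simp
  qed
  show ?thesis by (rule Lim_transform_eventually[OF lim ev])
qed

subsection \<open>Counting semistandard tableaux\<close>

text \<open>Shapes are given by their row lengths, 0 past the last row, so that the recursion on the
  number of entries need not keep track of list lengths; \<open>lshape\<close> translates.\<close>

definition cells :: "(nat \<Rightarrow> nat) \<Rightarrow> (nat \<times> nat) set" where
  "cells L = {(i, j). j < L i}"

definition tabs :: "(nat \<Rightarrow> nat) \<Rightarrow> nat \<Rightarrow> ((nat \<times> nat) \<Rightarrow> nat) set" where
  "tabs L k = {T \<in> cells L \<rightarrow>\<^sub>E {..<k}.
      (\<forall>i j. (i, Suc j) \<in> cells L \<longrightarrow> T (i, j) \<le> T (i, Suc j)) \<and>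
      (\<forall>i j. (Suc i, j) \<in> cells L \<longrightarrow> T (i, j) < T (Suc i, j))}"

definition shape :: "nat \<Rightarrow> (nat \<Rightarrow> nat) \<Rightarrow> bool" where
  "shape k L \<longleftrightarrow> (\<forall>i. L (Suc i) \<le> L i) \<and> (\<forall>i\<ge>k. L i = 0)"

lemma cells_iff [simp]: "(i, j) \<in> cells L \<longleftrightarrow> j < L i"
  by (simp add: cells_def)

lemma finite_cells: "shape k L \<Longrightarrow> finite (cells L)"
proof -
  assume L: "shape k L"
  have "cells L \<subseteq> (\<Union>i<k. {i} \<times> {..<L i})"
  proof
    fix c assume c: "c \<in> cells L"
    obtain i j where ij: "c = (i, j)" by (cases c)
    then have "i < k" using c L by (cases "i < k") (auto simp: shape_def)
    then show "c \<in> (\<Union>i<k. {i} \<times> {..<L i})" using c ij by auto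
  qed
  then show ?thesis by (rule finite_subset) auto
qed

lemma finite_tabs: "shape k' L \<Longrightarrow> finite (tabs L k)"
  unfolding tabs_def by (rule finite_subset[of _ "cells L \<rightarrow>\<^sub>E {..<k}"]) (auto intro!: finite_PiE finite_cells)

lemma tabs_mem:
  assumes "T \<in> tabs L k"
  shows "j < L i \<Longrightarrow> T (i, j) < k" "Suc j < L i \<Longrightarrow> T (i, j) \<le> T (i, Suc j)"
    "j < L (Suc i) \<Longrightarrow> T (i, j) < T (Suc i, j)" "T \<in> extensional (cells L)"
  using assms by (auto simp: tabs_def PiE_def Pi_iff)

lemma tabs_row_mono:
  assumes T: "T \<in> tabs L k" and "j \<le> j'" "j' < L i"
  shows "T (i, j) \<le> T (i, j')"
  using assms(2,3)
proof (induction j' rule: dec_induct)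
  case (step m)
  then show ?case using tabs_mem(2)[OF T, of m i] by simp
qed simp

lemma tabs_ge_row:
  assumes L: "\<And>i. L (Suc i) \<le> L i" and T: "T \<in> tabs L k" and "j < L i"
  shows "i \<le> T (i, j)"
  using assms(3)
proof (induction i)
  case (Suc i)
  then have "j < L i" using L[of i] by simp
  then show ?case using Suc.IH tabs_mem(3)[OF T Suc.prems] by simp
qed simp

definition interl :: "nat \<Rightarrow> (nat \<Rightarrow> nat) \<Rightarrow> (nat \<Rightarrow> nat) set" where
  "interl k L = {M. (\<forall>i<k. L (Suc i) \<le> M i \<and> M i \<le> L i) \<and> (\<forall>i\<ge>k. M i = 0)}"

lemma interl_shape:
  assumes "shape (Suc k) L" "M \<in> interl k L" shows "shape k M"
  unfolding shape_def
proof (intro conjI allI)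
  fix i
  show "M (Suc i) \<le> M i"
  proof (cases "Suc i < k")
    case True
    then have "M (Suc i) \<le> L (Suc i)" "L (Suc i) \<le> M i" using assms(2) by (auto simp: interl_def)
    then show ?thesis by simp
  qed (use assms(2) in \<open>auto simp: interl_def\<close>)
qed (use assms(2) in \<open>auto simp: interl_def\<close>)

text \<open>Removing the entries equal to \<open>k\<close> from a tableau leaves a tableau on an interlacing shape.\<close>

lemma card_tabs_Suc:
  assumes L: "shape (Suc k) L"
  shows "card (tabs L (Suc k)) = (\<Sum>M\<in>interl k L. card (tabs M k))"
proof -
  have Lm: "L (Suc i) \<le> L i" for i using L by (simp add: shape_def)
  have L0: "L i = 0" if "i > k" for i using L that by (simp add: shape_def)
  \<comment> \<open>\<open>sh\<close> is the shape of the part of \<open>T\<close> with entries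
    below \<open>k\<close>; \<open>ext\<close> fills the remaining cells with
    \<open>k\<close>.\<close>
  define sh where "sh T i = card {j. j < L i \<and> T (i, j) < k}" for T :: "nat \<times> nat \<Rightarrow> nat" and i
  define ext where "ext M T = (\<lambda>(i, j)\<in>cells L. if j < M i then T (i, j) else k)" for M :: "nat \<Rightarrow> nat" and T :: "nat \<times> nat \<Rightarrow> nat"
  have shset: "{j. j < L i \<and> T (i, j) < k} = {..<sh T i}" if T: "T \<in> tabs L (Suc k)" for T i
  proof -
    let ?A = "{j. j < L i \<and> T (i, j) < k}"
    have fin: "finite ?A" by simp
    have down: "j' \<in> ?A" if "j \<in> ?A" "j' \<le> j" for j j'
      using that tabs_row_mono[OF T, of j' j i] by auto
    have "?A = {..<card ?A}"
    proof (cases "?A = {}")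
      case False
      have "?A = {..Max ?A}" using down[OF Max_in[OF fin False]] Max_ge[OF fin] by blast
      then have "card ?A = Suc (Max ?A)" by (metis card_atMost)
      then show ?thesis using \<open>?A = {..Max ?A}\<close> by (simp add: lessThan_Suc_atMost)
    next
      case True
      then have "card ?A = 0" by (metis card.empty)
      then show ?thesis using True by (metis lessThan_0)
    qed
    then show ?thesis by (simp add: sh_def)
  qed
  have sh_iff: "j < sh T i \<longleftrightarrow> j < L i \<and> T (i, j) < k" if "T \<in> tabs L (Suc k)" for T i j
    using shset[OF that, of i] by auto
  have sh_in: "sh T \<in> interl k L" if T: "T \<in> tabs L (Suc k)" for T
    unfolding interl_def
  proof (intro CollectI conjI allI impI)
    fix i
    \<comment> \<open>A cell with a cell below it has an entry smaller than one that is at most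
      \<open>k\<close>, so it is not removed.\<close>
    show "L (Suc i) \<le> sh T i"
    proof (rule ccontr)
      assume "\<not> L (Suc i) \<le> sh T i"
      then have j: "sh T i < L (Suc i)" by simp
      have "T (i, sh T i) < T (Suc i, sh T i)" by (rule tabs_mem(3)[OF T j])
      moreover have "T (Suc i, sh T i) < Suc k" by (rule tabs_mem(1)[OF T j])
      ultimately have "T (i, sh T i) < k" by simp
      then have "sh T i < sh T i" using sh_iff[OF T, of "sh T i" i] j Lm[of i] by simp
      then show False by simp
    qed
    show "sh T i \<le> L i" using sh_iff[OF T, of "L i" i] by simp
  next
    \<comment> \<open>By column strictness, entries in row \<open>i\<close> are at least
      \<open>i\<close>, so from row \<open>k\<close> on none is below \<open>k\<close>.\<close>
    fix i assume "k \<le> i"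
    show "sh T i = 0"
    proof (rule ccontr)
      assume "sh T i \<noteq> 0"
      then have "0 < L i" "T (i, 0) < k" using sh_iff[OF T, of 0 i] by auto
      then show False using tabs_ge_row[OF Lm T, of 0 i] \<open>k \<le> i\<close> by simp
    qed
  qed
  have res: "restrict T (cells (sh T)) \<in> tabs (sh T) k" if T: "T \<in> tabs L (Suc k)" for T
    unfolding tabs_def
  proof (intro CollectI conjI allI impI)
    show "restrict T (cells (sh T)) \<in> cells (sh T) \<rightarrow>\<^sub>E {..<k}" using sh_iff[OF T] by auto
  next
    fix i j assume "(i, Suc j) \<in> cells (sh T)"
    then have j: "Suc j < sh T i" by simp
    then have "j < sh T i" by simp
    then show "restrict T (cells (sh T)) (i, j) \<le> restrict T (cells (sh T)) (i, Suc j)"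
      using j tabs_mem(2)[OF T, of j i] sh_iff[OF T, of "Suc j" i] by simp
  next
    fix i j assume "(Suc i, j) \<in> cells (sh T)"
    then have j: "j < sh T (Suc i)" by simp
    then have "T (i, j) < T (Suc i, j)" "T (Suc i, j) < k" "j < L i"
      using tabs_mem(3)[OF T, of j i] sh_iff[OF T, of j "Suc i"] Lm[of i] by auto
    then show "restrict T (cells (sh T)) (i, j) < restrict T (cells (sh T)) (Suc i, j)"
      using j sh_iff[OF T, of j i] by simp
  qed
  have ext_tab: "ext M T \<in> tabs L (Suc k)" if M: "M \<in> interl k L" and T: "T \<in> tabs M k" for M T
    unfolding tabs_def
  proof (intro CollectI conjI allI impI)
    show "ext M T \<in> cells L \<rightarrow>\<^sub>E {..<Suc k}" using tabs_mem(1)[OF T] by (auto simp: ext_def less_Suc_eq)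
  next
    fix i j assume "(i, Suc j) \<in> cells L"
    then have j: "Suc j < L i" by simp
    show "ext M T (i, j) \<le> ext M T (i, Suc j)"
      using j tabs_mem(1)[OF T, of j i] tabs_mem(2)[OF T, of j i] by (auto simp: ext_def)
  next
    fix i j assume "(Suc i, j) \<in> cells L"
    then have j: "j < L (Suc i)" by simp
    then have "i < k" using L0[of "Suc i"] by (cases "i < k") auto
    then have jM: "j < M i" "j < L i" using M j Lm[of i] by (auto simp: interl_def)
    then show "ext M T (i, j) < ext M T (Suc i, j)"
      using j tabs_mem(1)[OF T, of j i] tabs_mem(3)[OF T, of j i] by (auto simp: ext_def)
  qed
  have Mle: "M i \<le> L i" if "M \<in> interl k L" for M i
    using that by (cases "i < k") (auto simp: interl_def)
  have sh_ext: "sh (ext M T) = M" if M: "M \<in> interl k L" and T: "T \<in> tabs M k" for M T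
  proof (rule ext)
    fix i
    have "{j. j < L i \<and> ext M T (i, j) < k} = {..<M i}"
      using tabs_mem(1)[OF T, of _ i] Mle[OF M, of i] by (auto simp: ext_def split: if_splits)
    then show "sh (ext M T) i = M i" by (simp add: sh_def)
  qed
  have "card (tabs L (Suc k)) = card (Sigma (interl k L) (\<lambda>M. tabs M k))"
  proof (rule bij_betw_same_card, rule bij_betw_byWitness[where f = "\<lambda>T. (sh T, restrict T (cells (sh T)))" and f' = "\<lambda>(M, T). ext M T"])
    show "\<forall>T\<in>tabs L (Suc k). (case (sh T, restrict T (cells (sh T))) of (M, T) \<Rightarrow> ext M T) = T"
    proof
      fix T assume T: "T \<in> tabs L (Suc k)"
      have "ext (sh T) (restrict T (cells (sh T))) c = T c" for c
      proof (cases c)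
        case (Pair i j)
        show ?thesis
        proof (cases "j < L i")
          case True
          have "T (i, j) = k" if "\<not> j < sh T i"
            using that sh_iff[OF T, of j i] tabs_mem(1)[OF T True] True by simp
          then show ?thesis using True by (simp add: Pair ext_def)
        next
          case False
          then show ?thesis using tabs_mem(4)[OF T] by (simp add: Pair ext_def extensional_def)
        qed
      qed
      then show "(case (sh T, restrict T (cells (sh T))) of (M, T) \<Rightarrow> ext M T) = T" by (simp add: fun_eq_iff)
    qed
    show "\<forall>a\<in>Sigma (interl k L) (\<lambda>M. tabs M k). (sh (case a of (M, T) \<Rightarrow> ext M T), restrict (case a of (M, T) \<Rightarrow> ext M T) (cells (sh (case a of (M, T) \<Rightarrow> ext M T)))) = a"
    proof
      fix a assume "a \<in> Sigma (interl k L) (\<lambda>M. tabs M k)"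
      then obtain M T where a: "a = (M, T)" and M: "M \<in> interl k L" and T: "T \<in> tabs M k" by auto
      have "restrict (ext M T) (cells M) = T"
      proof (rule ext)
        fix c :: "nat \<times> nat"
        obtain i j where c: "c = (i, j)" by (cases c)
        show "restrict (ext M T) (cells M) c = T c"
          using tabs_mem(4)[OF T] Mle[OF M, of i] by (auto simp: c ext_def extensional_def)
      qed
      then show "(sh (case a of (M, T) \<Rightarrow> ext M T), restrict (case a of (M, T) \<Rightarrow> ext M T) (cells (sh (case a of (M, T) \<Rightarrow> ext M T)))) = a"
        by (simp add: a sh_ext[OF M T])
    qed
    show "(\<lambda>T. (sh T, restrict T (cells (sh T)))) ` tabs L (Suc k) \<subseteq> Sigma (interl k L) (\<lambda>M. tabs M k)"
      using sh_in res by auto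
    show "(\<lambda>(M, T). ext M T) ` Sigma (interl k L) (\<lambda>M. tabs M k) \<subseteq> tabs L (Suc k)"
      using ext_tab by auto
  qed
  also have "\<dots> = (\<Sum>M\<in>interl k L. card (tabs M k))"
  proof (rule card_SigmaI)
    have "interl k L \<subseteq> (\<lambda>f i. if i < k then f i else 0) ` (Pi\<^sub>E {..<k} (\<lambda>i. {..L i}))"
    proof
      fix M assume M: "M \<in> interl k L"
      have "M = (\<lambda>i. if i < k then restrict M {..<k} i else 0)" using M by (auto simp: interl_def fun_eq_iff)
      moreover have "restrict M {..<k} \<in> Pi\<^sub>E {..<k} (\<lambda>i. {..L i})" using M by (auto simp: interl_def)
      ultimately show "M \<in> (\<lambda>f i. if i < k then f i else 0) ` (Pi\<^sub>E {..<k} (\<lambda>i. {..L i}))" by blast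
    qed
    then show "finite (interl k L)" by (rule finite_subset) (auto intro!: finite_PiE)
    show "\<forall>M\<in>interl k L. finite (tabs M k)" using interl_shape[OF L] finite_tabs by blast
  qed
  finally show ?thesis .
qed

text \<open>Up to the order of columns, the Vandermonde determinant of \<open>l\<close> divided by
  the factorials of 0, ..., \<open>k - 1\<close>: the dimension formula in binomial form.\<close>

definition bdet :: "nat \<Rightarrow> (nat \<Rightarrow> nat) \<Rightarrow> complex" where
  "bdet k l = mdet k (\<lambda>i j. of_nat (l i choose (k - 1 - j)))"

lemma mdet_row_sums:
  fixes q :: "nat \<Rightarrow> nat \<Rightarrow> complex"
  assumes "\<And>i. i < k \<Longrightarrow> finite (X i)"
  shows "mdet k (\<lambda>i j. \<Sum>x\<in>X i. q x j) = (\<Sum>x\<in>Pi\<^sub>E {..<k} X. mdet k (\<lambda>i j. q (x i) j))"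
proof -
  have "mdet k (\<lambda>i j. \<Sum>x\<in>X i. q x j) = (\<Sum>p | p permutes {..<k}. \<Sum>x\<in>Pi\<^sub>E {..<k} X. of_int (sign p) * (\<Prod>i<k. q (x i) (p i)))"
    unfolding mdet_def sum_distrib_left[symmetric] using assms
    by (intro sum.cong refl arg_cong2[where f = "(*)"] prod_sum_PiE) auto
  also have "\<dots> = (\<Sum>x\<in>Pi\<^sub>E {..<k} X. mdet k (\<lambda>i j. q (x i) j))"
    unfolding mdet_def by (rule sum.swap)
  finally show ?thesis .
qed

lemma binomial_diff_sum:
  "a \<le> b \<Longrightarrow> of_nat (b choose Suc m) - of_nat (a choose Suc m) = (\<Sum>x\<in>{a..<b}. of_nat (x choose m) :: complex)"
proof (induction b rule: dec_induct)
  case (step b)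
  then show ?case by (simp add: algebra_simps)
qed simp

text \<open>Subtract from every row the next one. The last column, constantly 1, becomes zero except
  in the last row, and each other difference telescopes into a sum of binomials with lower index one
  less. The remaining determinant is expanded in its rows.\<close>

lemma bdet_Suc:
  assumes "\<And>i. i < k \<Longrightarrow> l (Suc i) \<le> l i"
  shows "bdet (Suc k) l = (\<Sum>x\<in>Pi\<^sub>E {..<k} (\<lambda>i. {l (Suc i)..<l i}). bdet k x)"
proof -
  let ?B = "\<lambda>i j. of_nat (l i choose (k - j)) :: complex"
  let ?S = "\<lambda>i j. if i = j then 1 else if j = Suc i then -1 else 0 :: complex"
  let ?R = "\<lambda>i j. if i < k then ?B i j - ?B (Suc i) j else ?B i j"
  have "fmat (Suc k) ?R = fmat (Suc k) ?S * fmat (Suc k) ?B"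
  proof (rule eq_matI)
    fix i j assume "i < dim_row (fmat (Suc k) ?S * fmat (Suc k) ?B)" "j < dim_col (fmat (Suc k) ?S * fmat (Suc k) ?B)"
    then have ij: "i < Suc k" "j < Suc k" by auto
    have "(fmat (Suc k) ?S * fmat (Suc k) ?B) $$ (i, j) = (\<Sum>m<Suc k. ?S i m * ?B m j)"
      using ij by (simp add: scalar_prod_def atLeast0LessThan del: sum.lessThan_Suc)
    also have "\<dots> = (\<Sum>m<Suc k. (if m = i then ?B m j else 0) - (if m = Suc i then ?B m j else 0))"
      by (intro sum.cong refl) auto
    also have "\<dots> = ?R i j"
      using ij unfolding sum_subtractf by (auto simp del: sum.lessThan_Suc simp: sum.delta)
    finally show "fmat (Suc k) ?R $$ (i, j) = (fmat (Suc k) ?S * fmat (Suc k) ?B) $$ (i, j)" using ij by simp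
  qed auto
  then have "mdet (Suc k) ?R = mdet (Suc k) ?S * mdet (Suc k) ?B"
    by (simp add: mdet_eq_det det_mult[of _ "Suc k"])
  also have "mdet (Suc k) ?S = 1"
    using mdet_lower_unitriangular[of "Suc k" "\<lambda>i j. ?S j i"] mdet_transpose[of "Suc k" ?S] by simp
  also have "mdet (Suc k) ?B = bdet (Suc k) l" by (simp add: bdet_def)
  finally have 1: "bdet (Suc k) l = mdet (Suc k) ?R" by simp
  let ?A = "fmat k (\<lambda>i j. \<Sum>x\<in>{l (Suc i)..<l i}. of_nat (x choose (k - 1 - j)) :: complex)"
  have "fmat (Suc k) ?R = four_block_mat ?A (0\<^sub>m k 1) (mat 1 k (\<lambda>(_, j). ?B k j)) (1\<^sub>m 1)"
  proof (rule eq_matI)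
    fix i j assume "i < dim_row (four_block_mat ?A (0\<^sub>m k 1) (mat 1 k (\<lambda>(_, j). ?B k j)) (1\<^sub>m 1))"
      "j < dim_col (four_block_mat ?A (0\<^sub>m k 1) (mat 1 k (\<lambda>(_, j). ?B k j)) (1\<^sub>m 1))"
    then have ij: "i < Suc k" "j < Suc k" by auto
    have "?B i j - ?B (Suc i) j = (\<Sum>x\<in>{l (Suc i)..<l i}. of_nat (x choose (k - 1 - j)))" if "i < k" "j < k"
    proof -
      have "k - j = Suc (k - 1 - j)" using that by simp
      then show ?thesis using binomial_diff_sum[OF assms[OF that(1)], of "k - 1 - j"] by simp
    qed
    then show "fmat (Suc k) ?R $$ (i, j) = four_block_mat ?A (0\<^sub>m k 1) (mat 1 k (\<lambda>(_, j). ?B k j)) (1\<^sub>m 1) $$ (i, j)"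
      using ij by (cases "i < k"; cases "j < k") (auto simp: less_Suc_eq)
  qed auto
  then have "mdet (Suc k) ?R = Determinant.det ?A"
    unfolding mdet_eq_det by (simp add: det_four_block_mat_upper_right_zero[of _ k _ 1])
  also have "\<dots> = (\<Sum>x\<in>Pi\<^sub>E {..<k} (\<lambda>i. {l (Suc i)..<l i}). bdet k x)"
    unfolding mdet_eq_det[symmetric] bdet_def by (rule mdet_row_sums) auto
  finally show ?thesis using 1 by simp
qed

text \<open>Both sides satisfy the same branching recursion. In the shifted parts, interlacing
  becomes the independent conditions that \<open>x i\<close> lies in the half-open interval from
  \<open>l (Suc i)\<close> to \<open>l i\<close>.\<close>

lemma card_tabs:
  assumes "shape k L"
  shows "of_nat (card (tabs L k)) = bdet k (\<lambda>i. L i + k - 1 - i)"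
  using assms
proof (induction k arbitrary: L)
  case 0
  then have "cells L = {}" by (auto simp: cells_def shape_def)
  then have "tabs L 0 = {\<lambda>_. undefined}" by (auto simp: tabs_def)
  then show ?case by (simp add: bdet_def mdet_def)
next
  case (Suc k)
  let ?l = "\<lambda>i. L i + Suc k - 1 - i"
  have Lm: "L (Suc i) \<le> L i" for i using Suc.prems by (simp add: shape_def)
  have "of_nat (card (tabs L (Suc k))) = (\<Sum>M\<in>interl k L. bdet k (\<lambda>i. M i + k - 1 - i))"
    using interl_shape[OF Suc.prems] by (simp add: card_tabs_Suc[OF Suc.prems] Suc.IH)
  also have "\<dots> = (\<Sum>x\<in>Pi\<^sub>E {..<k} (\<lambda>i. {?l (Suc i)..<?l i}). bdet k x)"
  proof (rule sum.reindex_bij_witness[where i = "\<lambda>x i. if i < k then x i + Suc i - k else 0" and j = "\<lambda>M. \<lambda>i\<in>{..<k}. M i + k - 1 - i"])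
    fix M assume M: "M \<in> interl k L"
    show "(\<lambda>i. if i < k then (\<lambda>i\<in>{..<k}. M i + k - 1 - i) i + Suc i - k else 0) = M"
      using M by (auto simp: interl_def fun_eq_iff)
    show "(\<lambda>i\<in>{..<k}. M i + k - 1 - i) \<in> Pi\<^sub>E {..<k} (\<lambda>i. {?l (Suc i)..<?l i})"
    proof (rule restrict_PiE_iff[THEN iffD2], rule ballI)
      fix i assume "i \<in> {..<k}"
      then have "i < k" "L (Suc i) \<le> M i" "M i \<le> L i" using M by (simp_all add: interl_def)
      then have "?l (Suc i) \<le> M i + k - 1 - i" "M i + k - 1 - i < ?l i" by linarith+
      then show "M i + k - 1 - i \<in> {?l (Suc i)..<?l i}" by simp
    qed
    show "bdet k (\<lambda>i\<in>{..<k}. M i + k - 1 - i) = bdet k (\<lambda>i. M i + k - 1 - i)"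
      unfolding bdet_def by (rule mdet_cong) simp
  next
    fix x assume x: "x \<in> Pi\<^sub>E {..<k} (\<lambda>i. {?l (Suc i)..<?l i})"
    have xi: "?l (Suc i) \<le> x i \<and> x i < ?l i" if "i < k" for i using PiE_mem[OF x, of i] that by simp
    show "(\<lambda>i\<in>{..<k}. (if i < k then x i + Suc i - k else 0) + k - 1 - i) = x"
    proof (rule ext)
      fix i show "(\<lambda>i\<in>{..<k}. (if i < k then x i + Suc i - k else 0) + k - 1 - i) i = x i"
        using xi[of i] x by (cases "i < k") (auto simp: PiE_def extensional_def)
    qed
    show "(\<lambda>i. if i < k then x i + Suc i - k else 0) \<in> interl k L"
      unfolding interl_def
    proof (intro CollectI conjI allI impI)
      fix i assume i: "i < k"
      then have "L (Suc i) \<le> x i + Suc i - k" "x i + Suc i - k \<le> L i" using xi[OF i] by linarith+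
      then show "L (Suc i) \<le> (if i < k then x i + Suc i - k else 0)" "(if i < k then x i + Suc i - k else 0) \<le> L i"
        using i by simp_all
    qed simp
  qed
  also have "\<dots> = bdet (Suc k) ?l"
  proof (rule bdet_Suc[symmetric])
    fix i assume "i < k"
    then show "?l (Suc i) \<le> ?l i" using Lm[of i] by simp
  qed
  finally show ?case .
qed

subsection \<open>The sum over partitions\<close>

definition lshape :: "nat list \<Rightarrow> nat \<Rightarrow> nat" where
  "lshape lam i = (if i < length lam then lam ! i else 0)"

lemma young_cells_eq: "young_cells lam = cells (lshape lam)"
  by (auto simp: young_cells_def cells_def lshape_def split: if_splits)

lemma ssyt_eq: "ssyt lam k = tabs (lshape lam) k"
  by (simp add: ssyt_def tabs_def young_cells_eq)

lemma schur_ones: "schur lam k (\<lambda>_. 1) = of_nat (card (tabs (lshape lam) k))"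
  by (simp add: schur_def ssyt_eq)

lemma lshape_mono:
  assumes "lam \<in> partitions r" shows "lshape lam (Suc i) \<le> lshape lam i"
  using assms sorted_wrt_nth_less[of "(\<ge>)" lam i "Suc i"] by (auto simp: lshape_def partitions_def)

lemma lshape_pos: "lam \<in> partitions r \<Longrightarrow> i < length lam \<Longrightarrow> 0 < lshape lam i"
  by (auto simp: lshape_def partitions_def)

text \<open>A column with more than \<open>k\<close> cells cannot increase strictly within
  \<open>k\<close> values.\<close>

lemma schur_ones_zero:
  assumes lam: "lam \<in> partitions r" and "k < length lam"
  shows "schur lam k (\<lambda>_. 1) = 0"
proof -
  have "tabs (lshape lam) k = {}"
  proof (rule ccontr)
    assume "tabs (lshape lam) k \<noteq> {}"
    then obtain T where T: "T \<in> tabs (lshape lam) k" by auto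
    have p: "0 < lshape lam k" using lshape_pos[OF lam assms(2)] .
    show False using tabs_ge_row[OF lshape_mono[OF lam] T p] tabs_mem(1)[OF T p] by simp
  qed
  then show ?thesis by (simp add: schur_ones)
qed

lemma schur_ones_bdet:
  assumes lam: "lam \<in> partitions r" and "length lam \<le> k"
  shows "schur lam k (\<lambda>_. 1) = bdet k (\<lambda>i. lshape lam i + k - 1 - i)"
  unfolding schur_ones
proof (rule card_tabs)
  show "shape k (lshape lam)" using lshape_mono[OF lam] assms(2) by (auto simp: shape_def lshape_def)
qed

section \<open>The summand of a partition as a function of its shifted parts\<close>

definition invf :: "nat \<Rightarrow> nat \<Rightarrow> complex" where
  "invf l a = (if a \<le> l then 1 / fact (l - a) else 0)"

lemma mdet_mult_rows: "mdet k (\<lambda>i j. c i * A i j) = (\<Prod>i<k. c i) * (mdet k A :: complex)"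
  by (simp add: mdet_def prod.distrib sum_distrib_left mult_ac)

lemma mdet_mult_cols: "mdet k (\<lambda>i j. c j * A i j) = (\<Prod>j<k. c j) * (mdet k A :: complex)"
proof -
  have "mdet k (\<lambda>i j. c j * A i j) = mdet k (\<lambda>i j. c i * A j i)"
    using mdet_transpose[of k "\<lambda>i j. c j * A i j"] by simp
  then show ?thesis using mdet_mult_rows[of k c "\<lambda>i j. A j i"] mdet_transpose[of k A] by simp
qed

lemma mdet_permute_rows:
  assumes "p permutes {..<k}"
  shows "mdet k (\<lambda>i j. A (p i) j) = of_int (sign p) * (mdet k A :: complex)"
proof -
  have lt: "p i < k" if "i < k" for i using permutes_in_image[OF assms, of i] that by simp
  have "fmat k (\<lambda>i j. A (p i) j) = mat k k (\<lambda>(i, j). fmat k A $$ (p i, j))"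
    by (rule eq_matI) (auto simp: lt)
  moreover have "p permutes {0..<k}" using assms by (simp add: atLeast0LessThan)
  ultimately show ?thesis
    using det_permute_rows[of "fmat k A" k p] by (simp add: mdet_eq_det)
qed

lemma mdet_permute_cols:
  assumes "p permutes {..<k}"
  shows "mdet k (\<lambda>i j. A i (p j)) = of_int (sign p) * (mdet k A :: complex)"
  using mdet_permute_rows[OF assms, of "\<lambda>i j. A j i"] mdet_transpose[of k A] mdet_transpose[of k "\<lambda>i j. A i (p j)"] by simp

lemma mdet_rev_cols: "mdet k (\<lambda>i j. A i (k - 1 - j)) = of_int (sign (rev_perm k)) * (mdet k A :: complex)"
proof -
  have "mdet k (\<lambda>i j. A i (k - 1 - j)) = mdet k (\<lambda>i j. A i (rev_perm k j))"
    by (rule mdet_cong) (simp add: rev_perm_def)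
  then show ?thesis using mdet_permute_cols[OF rev_perm_permutes, of k A] by simp
qed

text \<open>In \<open>htil (2k - j) m\<close> with \<open>m = \<lambda>_i - i + j\<close>, the
  factorial of \<open>R + m - 1\<close> does not depend on \<open>j\<close> and the numerator does
  not depend on \<open>i\<close>. Both come out of the determinant and leave inverse factorials in
  the shifted parts.\<close>

lemma stil_eq:
  assumes len: "length lam \<le> k"
  shows "stil (int (2 * k)) lam =
    (\<Prod>j<k. fact (2 * k - 1 - j)) * (\<Prod>i<k. 1 / fact (lshape lam i + k - 1 - i + k)) *
    mdet k (\<lambda>i j. invf (lshape lam i + k - 1 - i) (k - 1 - j))"
proof -
  let ?n = "length lam"
  let ?L = "lshape lam"
  let ?H = "\<lambda>i j. htil (int (2 * k) - int j) (int (?L i) - int i + int j)"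
  have entry: "?H i j = 1 / fact (?L i + k - 1 - i + k) * (fact (2 * k - 1 - j) * invf (?L i + k - 1 - i) (k - 1 - j))"
    if ij: "i < k" "j < k" for i j
  proof (cases "i \<le> ?L i + j")
    case True
    have 1: "nat (int (2 * k) - int j - 1) = 2 * k - 1 - j" using ij by simp
    have 2: "nat (int (2 * k) - int j + (int (?L i) - int i + int j) - 1) = ?L i + k - 1 - i + k" using ij by simp
    have 3: "nat (int (?L i) - int i + int j) = ?L i + k - 1 - i - (k - 1 - j)" using ij True by simp
    have 4: "k - 1 - j \<le> ?L i + k - 1 - i" using ij True by simp
    show ?thesis unfolding htil_def invf_def 1 2 3 using True 4 by simp
  next
    case False
    then have "\<not> k - 1 - j \<le> ?L i + k - 1 - i" using ij by simp
    then show ?thesis using False by (simp add: htil_def invf_def)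
  qed
  \<comment> \<open>Rows past the end of the partition belong to parts 0: they vanish left of the
    diagonal and are 1 on it. Padding to size \<open>k\<close> thus adds a unitriangular corner
    block.\<close>
  have "mdet k ?H = mdet ?n ?H"
  proof -
    let ?A = "fmat ?n ?H" and ?B = "mat ?n (k - ?n) (\<lambda>(i, j). ?H i (?n + j))" and ?D = "fmat (k - ?n) (\<lambda>i j. ?H (?n + i) (?n + j))"
    have z: "?H i j = 0" if "?n \<le> i" "j < i" for i j
      using that by (simp add: htil_def lshape_def)
    have o: "?H i i = 1" if "?n \<le> i" "i < k" for i
      using that by (simp add: htil_def lshape_def)
    have "fmat k ?H = four_block_mat ?A ?B (0\<^sub>m (k - ?n) ?n) ?D"
      by (rule eq_matI) (use len z in \<open>auto simp: diff_add_eq add_diff_eq\<close>)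
    then have "mdet k ?H = Determinant.det ?A * Determinant.det ?D"
      unfolding mdet_eq_det by (simp add: det_four_block_mat_lower_left_zero[of _ ?n _ "k - ?n"])
    moreover have "Determinant.det ?D = 1"
    proof -
      have "mdet (k - ?n) (\<lambda>i j. ?H (?n + j) (?n + i)) = 1"
      proof (rule mdet_lower_unitriangular)
        show "?H (?n + j) (?n + i) = 0" if "i < j" "j < k - ?n" for i j using z[of "?n + j" "?n + i"] that by simp
        show "?H (?n + i) (?n + i) = 1" if "i < k - ?n" for i using o[of "?n + i"] that by simp
      qed
      then show ?thesis using mdet_transpose[of "k - ?n" "\<lambda>i j. ?H (?n + i) (?n + j)"] by (simp add: mdet_eq_det)
    qed
    ultimately show ?thesis by (simp add: mdet_eq_det)
  qed
  also have "mdet ?n ?H = stil (int (2 * k)) lam"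
    unfolding stil_def by (rule mdet_cong) (simp add: lshape_def)
  finally have "stil (int (2 * k)) lam = mdet k (\<lambda>i j. 1 / fact (?L i + k - 1 - i + k) * (fact (2 * k - 1 - j) * invf (?L i + k - 1 - i) (k - 1 - j)))"
    using entry by (metis (no_types, lifting) mdet_cong)
  then show ?thesis unfolding mdet_mult_rows mdet_mult_cols by (simp add: mult_ac)
qed

text \<open>The normalised summand of the partition with shifted parts \<open>l\<close>. The first
  determinant stems from \<open>stil\<close>; the second combines the Schur value with the row
  factors of \<open>stil\<close>. Unlike the original summand it makes sense for every tuple
  \<open>l\<close>.\<close>

definition phi :: "nat \<Rightarrow> (nat \<Rightarrow> nat) \<Rightarrow> complex" where
  "phi k l = mdet k (\<lambda>i a. invf (l i) a) * mdet k (\<lambda>i a. 1 / fact (l i + k - a))"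

text \<open>An inverse factorial \<open>1 / (l + k - a)!\<close> is \<open>a!\<close> times a
  binomial coefficient over \<open>(l + k)!\<close>, and raising the upper index by \<open>k\<close>
  is a unitriangular column operation.\<close>

lemma mdet_inverse_fact:
  "mdet k (\<lambda>i a. 1 / fact (l i + k - a)) = (\<Prod>j<k. fact j) * (\<Prod>i<k. 1 / fact (l i + k)) * mdet k (\<lambda>i a. of_nat (l i choose a) :: complex)"
proof -
  have "(1 / fact (l i + k - a) :: complex) = 1 / fact (l i + k) * (fact a * of_nat ((l i + k) choose a))" if "a < k" for i a
    using binomial_fact[of a "l i + k", where ?'a = complex] that by simp
  then have "mdet k (\<lambda>i a. 1 / fact (l i + k - a) :: complex) = mdet k (\<lambda>i a. 1 / fact (l i + k) * (fact a * of_nat ((l i + k) choose a)))"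
    by (intro mdet_cong) auto
  also have "\<dots> = (\<Prod>i<k. 1 / fact (l i + k)) * ((\<Prod>j<k. fact j) * mdet k (\<lambda>i a. of_nat ((l i + k) choose a)))"
    unfolding mdet_mult_rows mdet_mult_cols ..
  also have "mdet k (\<lambda>i a. of_nat ((l i + k) choose a)) = (mdet k (\<lambda>i a. of_nat (l i choose a)) :: complex)"
  proof -
    let ?t = "\<lambda>s a. if s \<le> a then of_nat (k choose (a - s)) else 0 :: complex"
    have "fmat k (\<lambda>i a. of_nat ((l i + k) choose a) :: complex) = fmat k (\<lambda>i a. of_nat (l i choose a)) * fmat k ?t"
    proof (rule eq_matI)
      fix i a assume "i < dim_row (fmat k (\<lambda>i a. of_nat (l i choose a)) * fmat k ?t)" "a < dim_col (fmat k (\<lambda>i a. of_nat (l i choose a) :: complex) * fmat k ?t)"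
      then have ia: "i < k" "a < k" by auto
      have "of_nat ((l i + k) choose a) = (\<Sum>s\<le>a. of_nat (l i choose s) * of_nat (k choose (a - s)) :: complex)"
        by (simp add: vandermonde[symmetric])
      also have "\<dots> = (\<Sum>s<k. of_nat (l i choose s) * ?t s a)"
        using ia by (intro sum.mono_neutral_cong_left) auto
      finally show "fmat k (\<lambda>i a. of_nat ((l i + k) choose a) :: complex) $$ (i, a) = (fmat k (\<lambda>i a. of_nat (l i choose a)) * fmat k ?t) $$ (i, a)"
        using ia by (simp add: scalar_prod_def atLeast0LessThan)
    qed auto
    then have "mdet k (\<lambda>i a. of_nat ((l i + k) choose a) :: complex) = mdet k (\<lambda>i a. of_nat (l i choose a)) * mdet k ?t"
      by (simp add: mdet_eq_det det_mult[of _ k])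
    moreover have "mdet k ?t = 1"
      using mdet_lower_unitriangular[of k "\<lambda>i j. ?t j i"] mdet_transpose[of k ?t] by simp
    ultimately show ?thesis by simp
  qed
  finally show ?thesis by (simp add: mult_ac)
qed

text \<open>The quotient of Barnes values is precisely the product of the column factors in
  \<open>stil_eq\<close>.\<close>

lemma barnesG_ratio: "barnesG (2 * k + 1) = barnesG (k + 1) * (\<Prod>j<k. fact (2 * k - 1 - j))"
proof -
  have "(\<Prod>j<2 * k. fact j :: complex) = (\<Prod>j<k. fact j) * (\<Prod>j\<in>{k..<2 * k}. fact j)"
    using prod.atLeastLessThan_concat[of 0 k "2 * k" "fact :: nat \<Rightarrow> complex"] by (simp add: atLeast0LessThan)
  also have "(\<Prod>j\<in>{k..<2 * k}. fact j :: complex) = (\<Prod>j<k. fact (2 * k - 1 - j))"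
    by (rule prod.reindex_bij_witness[where i = "\<lambda>j. 2 * k - 1 - j" and j = "\<lambda>j. 2 * k - 1 - j"]) auto
  finally show ?thesis by (simp add: barnesG_def)
qed

text \<open>Both determinants have their columns in reversed order, so the two signs cancel. One
  Barnes factor is used up by the column factors of \<open>stil\<close>, and the one that remains
  supplies the product of factorials in \<open>mdet_inverse_fact\<close>.\<close>

lemma partition_term:
  assumes lam: "lam \<in> partitions r" and len: "length lam \<le> k"
  shows "barnesG (k + 1) ^ 2 / barnesG (2 * k + 1) * (stil (int (2 * k)) lam * schur lam k (\<lambda>_. 1)) =
    phi k (\<lambda>i. lshape lam i + k - 1 - i)"
proof -
  let ?l = "\<lambda>i. lshape lam i + k - 1 - i"
  let ?s = "of_int (sign (rev_perm k)) :: complex"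
  let ?Q = "\<Prod>j<k. fact (2 * k - 1 - j) :: complex"
  let ?c = "\<Prod>i<k. 1 / fact (?l i + k) :: complex"
  let ?I = "mdet k (\<lambda>i a. invf (?l i) a)" and ?C = "mdet k (\<lambda>i a. of_nat (?l i choose a)) :: complex"
  have G: "barnesG (k + 1) \<noteq> 0" "?Q \<noteq> 0" by (auto simp: barnesG_def)
  have st: "stil (int (2 * k)) lam = ?Q * ?c * (?s * ?I)"
    unfolding stil_eq[OF len] using mdet_rev_cols[of k "\<lambda>i a. invf (?l i) a"] by simp
  have sc: "schur lam k (\<lambda>_. 1) = ?s * ?C"
    unfolding schur_ones_bdet[OF lam len] bdet_def using mdet_rev_cols[of k "\<lambda>i a. of_nat (?l i choose a)"] by simp
  have "barnesG (k + 1) ^ 2 / barnesG (2 * k + 1) * (stil (int (2 * k)) lam * schur lam k (\<lambda>_. 1)) =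
     (barnesG (k + 1) / ?Q) * (?Q * ?c * (?s * ?I) * (?s * ?C))"
    unfolding st sc barnesG_ratio using G(1) by (simp add: power2_eq_square)
  also have "\<dots> = barnesG (k + 1) * (?s * ?s) * ?c * ?I * ?C"
    using G(2) by (simp add: field_simps)
  also have "\<dots> = ?I * (barnesG (k + 1) * ?c * ?C)" by (simp add: sign_square mult_ac)
  also have "barnesG (k + 1) * ?c * ?C = mdet k (\<lambda>i a. 1 / fact (?l i + k - a))"
    unfolding mdet_inverse_fact by (simp add: barnesG_def)
  finally show ?thesis by (simp add: phi_def)
qed

text \<open>Two determinants, hence two equal signs. Together with the vanishing on repeated entries
  this allows the ordering of the parts to be dropped.\<close>

lemma phi_permute:
  assumes "p permutes {..<k}" shows "phi k (l \<circ> p) = phi k l"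
proof -
  let ?s = "of_int (sign p) :: complex"
  have "phi k (l \<circ> p) = (?s * mdet k (\<lambda>i a. invf (l i) a)) * (?s * mdet k (\<lambda>i a. 1 / fact (l i + k - a)))"
    using mdet_permute_rows[OF assms, of "\<lambda>i a. invf (l i) a"] mdet_permute_rows[OF assms, of "\<lambda>i a. 1 / fact (l i + k - a)"]
    by (simp add: phi_def)
  also have "\<dots> = (?s * ?s) * phi k l" by (simp add: phi_def mult_ac)
  finally show ?thesis by (simp add: sign_square)
qed

lemma phi_cong: "(\<And>i. i < k \<Longrightarrow> l i = l' i) \<Longrightarrow> phi k l = phi k l'"
  unfolding phi_def by (intro arg_cong2[where f = "(*)"] mdet_cong) auto

lemma phi_not_inj:
  assumes "\<not> inj_on l {..<k}" shows "phi k l = 0"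
proof -
  obtain i j where ij: "i < k" "j < k" "i \<noteq> j" "l i = l j" using assms by (auto simp: inj_on_def)
  have "Determinant.det (fmat k (\<lambda>i a. invf (l i) a)) = 0"
  proof (rule det_identical_rows[of _ k i j])
    show "row (fmat k (\<lambda>i a. invf (l i) a)) i = row (fmat k (\<lambda>i a. invf (l i) a)) j"
      using ij by (intro eq_vecI) auto
  qed (use ij in auto)
  then show ?thesis by (simp add: phi_def mdet_eq_det)
qed

section \<open>From decreasing tuples to all compositions\<close>

definition decs :: "nat \<Rightarrow> nat \<Rightarrow> (nat \<Rightarrow> nat) set" where
  "decs k s = {l \<in> comps k s. \<forall>i j. i < j \<longrightarrow> j < k \<longrightarrow> l j < l i}"

lemma decs_inj: "l \<in> decs k s \<Longrightarrow> inj_on l {..<k}"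
  unfolding inj_on_def decs_def by (metis (mono_tags, lifting) lessThan_iff linorder_neqE_nat mem_Collect_eq nat_less_le)

lemma permutes_of_same_image:
  fixes q l :: "nat \<Rightarrow> nat"
  assumes q: "inj_on q {..<n}" and im: "q ` {..<n} = l ` {..<n}"
  shows "\<exists>p. p permutes {..<n} \<and> (\<forall>j<n. q j = l (p j))"
proof -
  define p where "p j = (if j < n then inv_into {..<n} l (q j) else j)" for j
  have pj: "p j < n \<and> l (p j) = q j" if "j < n" for j
  proof -
    have "q j \<in> l ` {..<n}" using im that by blast
    then show ?thesis using inv_into_into[of "q j" l "{..<n}"] f_inv_into_f[of "q j" l "{..<n}"] that
      by (simp add: p_def)
  qed
  have "inj_on p {..<n}" using pj q by (metis (mono_tags, lifting) inj_on_def lessThan_iff)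
  moreover have "p ` {..<n} \<subseteq> {..<n}" using pj by auto
  ultimately have "bij_betw p {..<n} {..<n}" by (simp add: bij_betw_def endo_inj_surj)
  then have "p permutes {..<n}" by (rule bij_imp_permutes) (simp add: p_def)
  then show ?thesis using pj by metis
qed

lemma dec_eq_of_same_image:
  fixes l l' :: "nat \<Rightarrow> nat"
  assumes "\<And>i j. i < j \<Longrightarrow> j < k \<Longrightarrow> l j < l i" "\<And>i j. i < j \<Longrightarrow> j < k \<Longrightarrow> l' j < l' i"
    and im: "l ` {..<k} = l' ` {..<k}" and "i < k"
  shows "l i = l' i"
proof -
  let ?xs = "\<lambda>l. rev (map l [0..<k])"
  have s: "sorted (?xs l) \<and> distinct (?xs l)" if "\<And>i j. i < j \<Longrightarrow> j < k \<Longrightarrow> l j < l i" for l :: "nat \<Rightarrow> nat"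
  proof
    show "sorted (?xs l)"
      unfolding sorted_wrt_rev sorted_wrt_map using that by (auto simp: sorted_wrt_iff_nth_less intro: less_imp_le)
    have "inj_on l {0..<k}" using that unfolding inj_on_def
      by (metis atLeastLessThan_iff linorder_neqE_nat nat_less_le)
    then show "distinct (?xs l)" by (simp add: distinct_map)
  qed
  have "?xs l = ?xs l'"
    using s[OF assms(1)] s[OF assms(2)] im by (intro sorted_distinct_set_unique) (auto simp: atLeast0LessThan)
  then have "map l [0..<k] = map l' [0..<k]" by simp
  then show ?thesis using assms(4) by simp
qed

text \<open>A tuple with distinct entries is, in exactly one way, a decreasing tuple composed with a
  permutation; all \<open>k!\<close> rearrangements have the same value of \<open>phi\<close>, and
  tuples with a repeated entry contribute 0.\<close>

lemma sum_decs: "(\<Sum>l\<in>comps k s. phi k l) = fact k * (\<Sum>l\<in>decs k s. phi k l)"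
proof -
  let ?P = "{p. p permutes {..<k}}"
  let ?J = "{l \<in> comps k s. inj_on l {..<k}}"
  have "(\<Sum>l\<in>comps k s. phi k l) = (\<Sum>l\<in>?J. phi k l)"
    by (rule sum.mono_neutral_right) (auto intro: phi_not_inj)
  also have "\<dots> = (\<Sum>a\<in>decs k s \<times> ?P. phi k (fst a \<circ> snd a))"
  proof (rule sum.reindex_bij_betw[symmetric])
    have cp: "l \<circ> p \<in> ?J" if l: "l \<in> decs k s" and p: "p permutes {..<k}" for l p
    proof -
      have "l \<circ> p \<in> extensional {..<k}"
        using l permutes_not_in[OF p] by (auto simp: decs_def comps_iff extensional_def)
      moreover have "(\<Sum>j<k. (l \<circ> p) j) = s"
        using sum.permute[OF p, of l] l by (simp add: decs_def comps_iff)
      moreover have "inj_on (l \<circ> p) {..<k}"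
        using decs_inj[OF l] permutes_inj_on[OF p] permutes_image[OF p] by (intro comp_inj_on) auto
      ultimately show ?thesis by (simp add: comps_iff)
    qed
    show "bij_betw (\<lambda>a. fst a \<circ> snd a) (decs k s \<times> ?P) ?J"
      unfolding bij_betw_def
    proof
      show "inj_on (\<lambda>a. fst a \<circ> snd a) (decs k s \<times> ?P)"
      proof (rule inj_onI)
        fix a b assume a: "a \<in> decs k s \<times> ?P" and b: "b \<in> decs k s \<times> ?P" and e: "fst a \<circ> snd a = fst b \<circ> snd b"
        obtain l p l' p' where ab: "a = (l, p)" "b = (l', p')" by (cases a, cases b)
        have l: "l \<in> decs k s" "l' \<in> decs k s" and p: "p permutes {..<k}" "p' permutes {..<k}" using a b by (auto simp: ab)
        have e': "l \<circ> p = l' \<circ> p'" using e by (simp add: ab)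
        have "l ` {..<k} = (l \<circ> p) ` {..<k}" "l' ` {..<k} = (l' \<circ> p') ` {..<k}"
          by (simp_all only: image_comp[symmetric] permutes_image[OF p(1)] permutes_image[OF p(2)])
        then have im: "l ` {..<k} = l' ` {..<k}" using e' by simp
        have ll: "l = l'"
        proof (rule ext)
          fix i show "l i = l' i"
            using dec_eq_of_same_image[of k l l' i] l im
            by (cases "i < k") (auto simp: decs_def comps_iff extensional_def)
        qed
        have "p = p'"
        proof (rule ext)
          fix i show "p i = p' i"
          proof (cases "i < k")
            case True
            have "l (p i) = l (p' i)" using fun_cong[OF e', of i] ll by simp
            then show ?thesis using decs_inj[OF l(1)] True permutes_in_image[OF p(1), of i] permutes_in_image[OF p(2), of i]
              by (auto simp: inj_on_def)
          next
            case False
            then show ?thesis using permutes_not_in[OF p(1), of i] permutes_not_in[OF p(2), of i] by simp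
          qed
        qed
        then show "a = b" by (simp add: ab ll)
      qed
      show "(\<lambda>a. fst a \<circ> snd a) ` (decs k s \<times> ?P) = ?J"
      proof
        show "(\<lambda>a. fst a \<circ> snd a) ` (decs k s \<times> ?P) \<subseteq> ?J" using cp by auto
        show "?J \<subseteq> (\<lambda>a. fst a \<circ> snd a) ` (decs k s \<times> ?P)"
        proof
          fix q assume "q \<in> ?J"
          then have q: "q \<in> comps k s" "inj_on q {..<k}" by auto
          let ?A = "q ` {..<k}"
          let ?xs = "rev (sorted_list_of_set ?A)"
          have len: "length ?xs = k" using q(2) by (simp add: card_image)
          define l where "l = (\<lambda>i\<in>{..<k}. ?xs ! i)"
          have im: "q ` {..<k} = l ` {..<k}"
          proof -
            have "l ` {..<k} = (\<lambda>i. ?xs ! i) ` {..<length ?xs}" by (simp add: l_def len del: length_rev)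
            also have "\<dots> = set ?xs" by (auto simp: set_conv_nth simp del: length_rev set_rev)
            finally show ?thesis by simp
          qed
          have dec: "l j < l i" if "i < j" "j < k" for i j
          proof -
            have "sorted_wrt (<) (sorted_list_of_set ?A)" by simp
            then have "sorted_wrt (\<lambda>x y. y < x) ?xs" by (simp add: sorted_wrt_rev)
            then show ?thesis using sorted_wrt_nth_less[of "\<lambda>x y. y < x" ?xs i j] that len by (simp add: l_def)
          qed
          obtain p where p: "p permutes {..<k}" "\<And>j. j < k \<Longrightarrow> q j = l (p j)"
            using permutes_of_same_image[OF q(2) im] by blast
          have lext: "l \<in> extensional {..<k}" by (simp add: l_def)
          have ql: "q = l \<circ> p"
          proof (rule ext)
            fix j show "q j = (l \<circ> p) j"
              using p(2)[of j] q(1) lext permutes_not_in[OF p(1), of j] by (cases "j < k") (auto simp: comps_iff extensional_def)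
          qed
          have "(\<Sum>j<k. l j) = s" using sum.permute[OF p(1), of l] q(1) ql by (simp add: comps_iff)
          then have "l \<in> decs k s" using lext dec by (simp add: decs_def comps_iff)
          then show "q \<in> (\<lambda>a. fst a \<circ> snd a) ` (decs k s \<times> ?P)" using p(1) ql by force
        qed
      qed
    qed
  qed
  also have "\<dots> = (\<Sum>(l, p)\<in>decs k s \<times> ?P. phi k l)"
    by (intro sum.cong refl) (auto simp: phi_permute)
  also have "\<dots> = fact k * (\<Sum>l\<in>decs k s. phi k l)"
    by (simp add: sum.cartesian_product[symmetric] card_permutations sum_distrib_left)
  finally show ?thesis .
qed

text \<open>Both determinants are expanded, over \<sigma> and \<tau>. Terms with some
  \<open>l i < \<sigma> i\<close> vanish by the default in \<open>invf\<close>; for the others the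
  substitution \<rho> = l - \<sigma> removes the staircase sum from the total and gives the terms of
  \<open>limval\<close>.\<close>

lemma sum_phi: "(\<Sum>l\<in>comps k (r + (\<Sum>i<k. i)). phi k l) = fact k * limval k r"
proof -
  let ?P = "{p. p permutes {..<k}}"
  let ?S = "r + (\<Sum>i<k. i)"
  let ?s = "\<lambda>p. of_int (sign p) :: complex"
  have lt: "p i < k" if "p permutes {..<k}" "i < k" for p i
    using permutes_in_image[OF that(1), of i] that by simp
  have "(\<Sum>l\<in>comps k ?S. phi k l) = (\<Sum>l\<in>comps k ?S. \<Sum>\<sigma>\<in>?P. \<Sum>\<tau>\<in>?P. ?s \<sigma> * ?s \<tau> * (\<Prod>i<k. invf (l i) (\<sigma> i) * (1 / fact (l i + k - \<tau> i))))"
    unfolding phi_def mdet_def sum_product prod.distrib by (simp add: mult_ac)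
  also have "\<dots> = (\<Sum>\<sigma>\<in>?P. \<Sum>\<tau>\<in>?P. ?s \<sigma> * ?s \<tau> * (\<Sum>l\<in>comps k ?S. \<Prod>i<k. invf (l i) (\<sigma> i) * (1 / fact (l i + k - \<tau> i))))"
    unfolding sum_distrib_left by (subst sum.swap, rule sum.cong[OF refl], rule sum.swap)
  also have "\<dots> = (\<Sum>\<sigma>\<in>?P. \<Sum>\<tau>\<in>?P. ?s \<sigma> * ?s \<tau> * (\<Sum>\<rho>\<in>comps k r. \<Prod>i<k. 1 / (fact (\<rho> i) * fact (k + \<rho> i + \<sigma> i - \<tau> i))))"
  proof (rule sum.cong[OF refl], rule sum.cong[OF refl], rule arg_cong2[where f = "(*)", OF refl])
    fix \<sigma> \<tau> assume "\<sigma> \<in> ?P" "\<tau> \<in> ?P"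
    then have p: "\<sigma> permutes {..<k}" "\<tau> permutes {..<k}" by auto
    let ?f = "\<lambda>l. \<Prod>i<k. invf (l i) (\<sigma> i) * (1 / fact (l i + k - \<tau> i))"
    have ps: "(\<Sum>i<k. \<sigma> i) = (\<Sum>i<k. i)" using sum.permute[OF p(1), of "\<lambda>i. i"] by (simp add: o_def)
    have "(\<Sum>l\<in>comps k ?S. ?f l) = (\<Sum>l\<in>{l \<in> comps k ?S. \<forall>i<k. \<sigma> i \<le> l i}. ?f l)"
    proof (rule sum.mono_neutral_right)
      show "\<forall>l\<in>comps k ?S - {l \<in> comps k ?S. \<forall>i<k. \<sigma> i \<le> l i}. ?f l = 0"
      proof
        fix l assume "l \<in> comps k ?S - {l \<in> comps k ?S. \<forall>i<k. \<sigma> i \<le> l i}"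
        then obtain i where "i < k" "\<not> \<sigma> i \<le> l i" by auto
        then show "?f l = 0" by (intro prod_zero) (auto simp: invf_def)
      qed
    qed auto
    also have "\<dots> = (\<Sum>\<rho>\<in>comps k r. \<Prod>i<k. 1 / (fact (\<rho> i) * fact (k + \<rho> i + \<sigma> i - \<tau> i)))"
    proof (rule sum.reindex_bij_witness[where i = "\<lambda>\<rho>. \<lambda>i\<in>{..<k}. \<rho> i + \<sigma> i" and j = "\<lambda>l. \<lambda>i\<in>{..<k}. l i - \<sigma> i"])
      fix l assume l: "l \<in> {l \<in> comps k ?S. \<forall>i<k. \<sigma> i \<le> l i}"
      then have l1: "l \<in> extensional {..<k}" "(\<Sum>i<k. l i) = ?S" "\<And>i. i < k \<Longrightarrow> \<sigma> i \<le> l i" by (auto simp: comps_iff)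
      show "(\<lambda>i\<in>{..<k}. (\<lambda>i\<in>{..<k}. l i - \<sigma> i) i + \<sigma> i) = l"
        using l1 by (auto simp: fun_eq_iff extensional_def)
      have "(\<Sum>i<k. l i - \<sigma> i) + (\<Sum>i<k. \<sigma> i) = (\<Sum>i<k. l i)"
        unfolding sum.distrib[symmetric] using l1(3) by (intro sum.cong) auto
      then show "(\<lambda>i\<in>{..<k}. l i - \<sigma> i) \<in> comps k r" using l1(2) ps by (simp add: comps_iff)
      show "(\<Prod>i<k. 1 / (fact ((\<lambda>i\<in>{..<k}. l i - \<sigma> i) i) * fact (k + (\<lambda>i\<in>{..<k}. l i - \<sigma> i) i + \<sigma> i - \<tau> i))) = ?f l"
      proof (intro prod.cong refl)
        fix i assume "i \<in> {..<k}"
        then have i: "i < k" "\<sigma> i \<le> l i" using l1(3) by auto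
        then have "k + (l i - \<sigma> i) + \<sigma> i = l i + k" by simp
        then show "1 / (fact ((\<lambda>i\<in>{..<k}. l i - \<sigma> i) i) * fact (k + (\<lambda>i\<in>{..<k}. l i - \<sigma> i) i + \<sigma> i - \<tau> i)) =
            invf (l i) (\<sigma> i) * (1 / fact (l i + k - \<tau> i) :: complex)"
          using i by (simp add: invf_def add.commute)
      qed
    next
      fix \<rho> assume \<rho>: "\<rho> \<in> comps k r"
      show "(\<lambda>i\<in>{..<k}. (\<lambda>i\<in>{..<k}. \<rho> i + \<sigma> i) i - \<sigma> i) = \<rho>"
        using \<rho> by (auto simp: comps_iff fun_eq_iff extensional_def)
      show "(\<lambda>i\<in>{..<k}. \<rho> i + \<sigma> i) \<in> {l \<in> comps k ?S. \<forall>i<k. \<sigma> i \<le> l i}"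
        using \<rho> ps by (simp add: comps_iff sum.distrib)
    qed
    finally show "(\<Sum>l\<in>comps k ?S. ?f l) = (\<Sum>\<rho>\<in>comps k r. \<Prod>i<k. 1 / (fact (\<rho> i) * fact (k + \<rho> i + \<sigma> i - \<tau> i)))" .
  qed
  finally show ?thesis by (simp add: limval_def)
qed

text \<open>Partitions with more than \<open>k\<close> parts have Schur value 0, the others
  correspond to decreasing tuples. The factor \<open>k!\<close> of \<open>sum_decs\<close> cancels
  that of \<open>sum_phi\<close>.\<close>

lemma partition_sum:
  "barnesG (k + 1) ^ 2 / barnesG (2 * k + 1) * (\<Sum>lam\<in>partitions r. stil (int (2 * k)) lam * schur lam k (\<lambda>_. 1)) = limval k r"
proof -
  let ?G = "barnesG (k + 1) ^ 2 / barnesG (2 * k + 1)"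
  let ?S = "r + (\<Sum>i<k. i)"
  let ?Q = "{lam \<in> partitions r. length lam \<le> k}"
  have fin: "finite (partitions r)"
  proof -
    have "partitions r \<subseteq> {xs. set xs \<subseteq> {..r} \<and> length xs \<le> r}"
    proof (clarify, intro conjI)
      fix lam assume lam: "lam \<in> partitions r"
      then have s: "sum_list lam = r" "\<forall>x\<in>set lam. 0 < x" by (auto simp: partitions_def)
      show "set lam \<subseteq> {..r}" using member_le_sum_list[of _ lam] s by auto
      have "length lam \<le> sum_list lam" using s(2) by (induction lam) auto
      then show "length lam \<le> r" using s by simp
    qed
    then show ?thesis by (rule finite_subset) (simp add: finite_lists_length_le)
  qed
  have "?G * (\<Sum>lam\<in>partitions r. stil (int (2 * k)) lam * schur lam k (\<lambda>_. 1)) =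
     (\<Sum>lam\<in>?Q. ?G * (stil (int (2 * k)) lam * schur lam k (\<lambda>_. 1)))"
    unfolding sum_distrib_left
  proof (rule sum.mono_neutral_right)
    show "\<forall>lam\<in>partitions r - ?Q. ?G * (stil (int (2 * k)) lam * schur lam k (\<lambda>_. 1)) = 0"
    proof
      fix lam assume "lam \<in> partitions r - ?Q"
      then have "schur lam k (\<lambda>_. 1) = 0" by (intro schur_ones_zero) auto
      then show "?G * (stil (int (2 * k)) lam * schur lam k (\<lambda>_. 1)) = 0" by simp
    qed
  qed (use fin in auto)
  also have "\<dots> = (\<Sum>lam\<in>?Q. phi k (\<lambda>i. lshape lam i + k - 1 - i))"
    by (intro sum.cong refl partition_term) auto
  \<comment> \<open>Adding the staircase makes the parts strictly decreasing; in the other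
    direction, \<open>takeWhile\<close> removes the zeros that pad the partition to length
    \<open>k\<close>.\<close>
  also have "\<dots> = (\<Sum>l\<in>decs k ?S. phi k l)"
  proof (rule sum.reindex_bij_witness[where j = "\<lambda>lam. \<lambda>i\<in>{..<k}. lshape lam i + k - 1 - i"
        and i = "\<lambda>l. takeWhile (\<lambda>x. 0 < x) (map (\<lambda>i. l i + Suc i - k) [0..<k])"])
    have idx: "(\<Sum>i<k. k - 1 - i) = (\<Sum>i<k. i)"
      using sum.nat_diff_reindex[of "\<lambda>i. i" k] by simp
    {
      fix lam assume "lam \<in> ?Q"
      then have lam: "lam \<in> partitions r" and len: "length lam \<le> k" by auto
      have pos: "\<forall>x\<in>set lam. 0 < x" and sm: "sum_list lam = r" using lam by (auto simp: partitions_def)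
      have anti: "lshape lam j \<le> lshape lam i" if "i \<le> j" for i j
        using that by (induction j rule: dec_induct) (auto intro: order.trans[OF lshape_mono[OF lam]])
      have "map (\<lambda>i. (\<lambda>i\<in>{..<k}. lshape lam i + k - 1 - i) i + Suc i - k) [0..<k] = map (lshape lam) [0..<k]"
        by (intro map_cong refl) auto
      also have "\<dots> = lam @ replicate (k - length lam) 0"
        by (rule nth_equalityI) (use len in \<open>auto simp: lshape_def nth_append\<close>)
      also have "takeWhile (\<lambda>x. 0 < x) \<dots> = lam"
        using pos by (subst takeWhile_append2) (auto simp: takeWhile_replicate)
      finally show "takeWhile (\<lambda>x. 0 < x) (map (\<lambda>i. (\<lambda>i\<in>{..<k}. lshape lam i + k - 1 - i) i + Suc i - k) [0..<k]) = lam" .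
      have "(\<Sum>i<k. lshape lam i) = (\<Sum>i<length lam. lam ! i)"
        using len by (intro sum.mono_neutral_cong_right) (auto simp: lshape_def)
      also have "\<dots> = r" using sm by (simp add: sum_list_sum_nth atLeast0LessThan)
      finally have s1: "(\<Sum>i<k. lshape lam i) = r" .
      have "(\<Sum>i<k. lshape lam i + k - 1 - i) = (\<Sum>i<k. lshape lam i + (k - 1 - i))"
        by (intro sum.cong refl) auto
      also have "\<dots> = ?S" by (simp only: sum.distrib s1 idx)
      finally have s2: "(\<Sum>i<k. lshape lam i + k - 1 - i) = ?S" .
      have "lshape lam j + k - 1 - j < lshape lam i + k - 1 - i" if "i < j" "j < k" for i j
        using anti[of i j] that by linarith
      then show "(\<lambda>i\<in>{..<k}. lshape lam i + k - 1 - i) \<in> decs k ?S"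
        using s2 by (auto simp: decs_def comps_iff)
      show "phi k (\<lambda>i\<in>{..<k}. lshape lam i + k - 1 - i) = phi k (\<lambda>i. lshape lam i + k - 1 - i)"
        by (rule phi_cong) simp
    }
    {
      fix l assume l: "l \<in> decs k ?S"
      have dec: "l j < l i" if "i < j" "j < k" for i j using l that by (simp add: decs_def)
      have lext: "l \<in> extensional {..<k}" and sl: "(\<Sum>i<k. l i) = ?S" using l by (auto simp: decs_def comps_iff)
      \<comment> \<open>Below \<open>l i\<close> there are \<open>k - 1 - i\<close> further distinct
        naturals; hence subtracting the staircase is not truncated.\<close>
      have ge: "k - 1 - i \<le> l i" if "i < k" for i
        using that
      proof (induction "k - 1 - i" arbitrary: i)
        case (Suc m)
        then have i: "Suc i < k" by simp
        then have "k - 1 - Suc i \<le> l (Suc i)" using Suc.hyps(1)[of "Suc i"] Suc.hyps(2) by simp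
        then show ?case using dec[of i "Suc i"] i by simp
      qed simp
      define L where "L i = l i + Suc i - k" for i
      have Ll: "l i = L i + k - 1 - i" if "i < k" for i using ge[OF that] that by (simp add: L_def)
      have Lm: "L j \<le> L i" if "i \<le> j" "j < k" for i j
        using that
      proof (induction j rule: dec_induct)
        case (step m)
        have "l (Suc m) < l m" using dec[of m "Suc m"] step.prems by simp
        then have "L (Suc m) \<le> L m" by (simp add: L_def)
        then show ?case using step by simp
      qed simp
      let ?xs = "map L [0..<k]"
      let ?lam = "takeWhile (\<lambda>x. 0 < x) ?xs"
      have lsh: "lshape ?lam i = L i" if i: "i < k" for i
      proof (cases "i < length ?lam")
        case True
        then have "?lam ! i = ?xs ! i" by (rule takeWhile_nth)
        then show ?thesis using True i by (simp add: lshape_def)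
      next
        case False
        let ?t = "length ?lam"
        have t: "?t \<le> i" "?t < length ?xs" using False i by auto
        have "\<not> 0 < ?xs ! ?t" by (rule nth_length_takeWhile[OF t(2)])
        then have "L ?t = 0" using t by simp
        then have "L i = 0" using Lm[OF t(1) i] by simp
        then show ?thesis using False by (simp add: lshape_def)
      qed
      have len: "length ?lam \<le> k" using length_takeWhile_le[of "\<lambda>x. 0 < x" ?xs] by simp
      have xs: "map (\<lambda>i. l i + Suc i - k) [0..<k] = ?xs" by (simp add: L_def)
      show "(\<lambda>i\<in>{..<k}. lshape (takeWhile (\<lambda>x. 0 < x) (map (\<lambda>i. l i + Suc i - k) [0..<k])) i + k - 1 - i) = l"
        unfolding xs
      proof (rule ext)
        fix i show "(\<lambda>i\<in>{..<k}. lshape ?lam i + k - 1 - i) i = l i"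
        proof (cases "i < k")
          case True
          then show ?thesis using lsh[OF True] Ll[OF True] by simp
        next
          case False
          then show ?thesis using lext by (simp add: extensional_def)
        qed
      qed
      have "sum_list ?lam = (\<Sum>i<length ?lam. ?lam ! i)" by (simp add: sum_list_sum_nth atLeast0LessThan)
      also have "\<dots> = (\<Sum>i<k. lshape ?lam i)"
        using len by (intro sum.mono_neutral_cong_left) (auto simp: lshape_def)
      also have "\<dots> = (\<Sum>i<k. L i)" using lsh by simp
      also have "\<dots> = r"
      proof -
        have "(\<Sum>i<k. L i) + (\<Sum>i<k. k - 1 - i) = (\<Sum>i<k. l i)"
          unfolding sum.distrib[symmetric] using Ll by (intro sum.cong) auto
        then show ?thesis using sl idx by simp
      qed
      finally have sm: "sum_list ?lam = r" .
      have "sorted_wrt (\<ge>) ?xs"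
        using Lm by (auto simp: sorted_wrt_iff_nth_less)
      then have "sorted_wrt (\<ge>) ?lam"
        by (metis sorted_wrt_append takeWhile_dropWhile_id)
      moreover have "\<forall>x\<in>set ?lam. 0 < x" by (auto dest: set_takeWhileD)
      ultimately show "takeWhile (\<lambda>x. 0 < x) (map (\<lambda>i. l i + Suc i - k) [0..<k]) \<in> ?Q"
        unfolding xs using sm len by (simp add: partitions_def)
    }
  qed
  also have "\<dots> = limval k r"
    using sum_decs[of k ?S] sum_phi[of k r] by simp
  finally show ?thesis .
qed

theorem mainTheorem10:
  fixes k r :: nat
  assumes "1 \<le> r" and "0 < k" and "r \<le> 2 * k"
  shows "convergent (\<lambda>N. MN N k r / of_nat N ^ (k^2 + r)) \<and>
    fps_nth (Abs_fps (\<lambda>n. if 0 < n then Mlim k n * \<i> ^ n / fact n else 0)) r =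
    fps_nth (Abs_fps (\<lambda>n. barnesG (k + 1) ^ 2 / barnesG (2 * k + 1) *
        (\<Sum>lam\<in>partitions n. stil (int (2 * k)) lam * schur lam k (\<lambda>_. 1)))) r"
proof
  note lim = MN_limit[OF assms(3,2)]
  show "convergent (\<lambda>N. MN N k r / of_nat N ^ (k^2 + r))"
    using lim by (rule convergentI)
  have "Mlim k r = (- \<i>) ^ r * (fact r * limval k r)"
    unfolding Mlim_def by (rule limI[OF lim])
  \<comment> \<open>The phase stems from differentiating with respect to the angle and cancels
    against the powers of \<i> in the series; \<open>r!\<close> cancels likewise.\<close>
  then have "Mlim k r * \<i> ^ r / fact r = ((- \<i>) ^ r * \<i> ^ r) * limval k r" by simp
  also have "(- \<i>) ^ r * \<i> ^ r = 1" by (simp add: power_mult_distrib[symmetric])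
  finally show "fps_nth (Abs_fps (\<lambda>n. if 0 < n then Mlim k n * \<i> ^ n / fact n else 0)) r =
    fps_nth (Abs_fps (\<lambda>n. barnesG (k + 1) ^ 2 / barnesG (2 * k + 1) *
        (\<Sum>lam\<in>partitions n. stil (int (2 * k)) lam * schur lam k (\<lambda>_. 1)))) r"
    using assms(1) by (simp only: fps_nth_Abs_fps partition_sum) simp
qed

end
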